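(* Let $q\ge1$ and let $\{\mathbf v^h\}_{h>0}$ be approximate solutions, generated by the shock capturing DG (SC-DG) scheme, of the system $\mathbf u_t+\sum_{k=1}^d \mathbf f^k(\mathbf u)_{x_k}=0$. Assume that there are constants $c,C>0$ independent of $\mathbf v^h$ such that for all $\mathbf w\ne0$ $$0<c\langle\mathbf w,\mathbf w\rangle\le\langle\mathbf w,D(\mathbf v^h)\mathbf w\rangle\le C\langle\mathbf w,\mathbf w\rangle,\qquad 0<c\langle\mathbf w,\mathbf w\rangle\le\langle\mathbf w,\mathbf u_{\mathbf v}(\mathbf v^h(x,t))\mathbf w\rangle\le C\langle\mathbf w,\mathbf w\rangle,$$ and that $\|\mathbf v^h\|_{L_\infty(\Omega\times[0,T])}\le C$ uniformly in $h$. Then, as $h\to0$, the approximate solutions converge (in the sense of Young measures, up to a subsequence) to a measure-valued solution of the system of conservation laws; that is, there are a subsequence and a measurable family of probability measures $\boldsymbol\mu_y\in\mathrm{Prob}(\mathbb R^m)$, $y=(x,t)\in\Omega\times(0,T)$, such that $g(\mathbf v^h)\overset{*}{\rightharpoonup}\langle\boldsymbol\mu_y,g(\boldsymbol\sigma)\rangle_E$ weakly-$*$ in $L_\infty$ for every continuous $g$, and $$\int_0^T\int_\Omega\Big(\big\langle\langle\boldsymbol\mu_y,\mathbf u(\boldsymbol\sigma)\rangle_E,\boldsymbol\varphi_t\big\rangle+\sum_{k=1}^d\big\langle\langle\boldsymbol\mu_y,\mathbf f^k(\boldsymbol\sigma)\rangle_E,\boldsymbol\varphi_{x_k}\big\rangle\Big)dx\,dt=0\qquad\forall\,\boldsymbol\varphi\in\big(C_c^\infty(\Omega\times(0,T))\big)^m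 .$$
   Context: $\langle\boldsymbol\mu_y,g(\boldsymbol\sigma)\rangle_E:=\int_{\mathbb R^m}g(\boldsymbol\sigma)\,d\boldsymbol\mu_y(\boldsymbol\sigma)$, where $\boldsymbol\sigma$ is the generic entropy-variable state. **Conservation law.** $\mathbf u(\cdot,0)=\mathbf u_0$, $\mathbf u:\mathbb R^d\times[0,\infty)\to\mathbb R^m$, $d\in\{1,2,3\}$, with smooth fluxes $\mathbf f^k:\mathbb R^m\to\mathbb R^m$ and compactly supported $\mathbf u_0$, equipped with a strictly convex (sufficiently smooth) entropy $U:\mathbb R^m\to\mathbb R$ and entropy fluxes $F^k$ with $\partial_{\mathbf u}F^k=\partial_{\mathbf u}U\,\partial_{\mathbf u}\mathbf f^k$. The entropy variables are $\mathbf v=(U_{\mathbf u})^T$; $\mathbf u(\mathbf v)$ denotes the inverse map, $\mathbf f^k(\mathbf v)$ abbreviates $\mathbf f^k(\mathbf u(\mathbf v))$, $\mathbf u_{\mathbf v}$ is the (symmetric positive definite) Jacobian of $\mathbf u(\mathbf v)$ and $\mathbf v_{\mathbf u}$ its inverse. $\langle\cdot,\cdot\rangle$ is the Euclidean inner product of $\mathbb R^m$. Exact and approximate solutions are assumed to have compact support inside $\Omega$. **Mesh.** $\Omega\subset\mathbb R^d$ is a bounded domain containing the supports of the solutions on $[0,T]$ (so no boundary conditions enter). $0=t_0<\dots<t_N=T$, $I_n=[t_n,t_{n+1})$, $S_n=\Omega\times I_n$, $d'=d+1$. $\mathcal T_n$ is a subdivision of $S_n$ into disjoint convex cells $\kappa=K\times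 I_n$; $h=\sup_{\kappa,n}h_\kappa<\infty$, with $h_\kappa$ the diameter of $\kappa$, $\rho_\kappa$ its interior (inscribed) diameter, and $h/\rho_\kappa\le\sigma$ for all cells with $\sigma>0$ independent of $h$. $\sum_{\kappa,n}$ is the sum over all $n=0,\dots,N-1$ and all $\kappa\in\mathcal T_n$. $\mathcal V^q=\prod_n\mathcal V^q_n$, $\mathcal V_n^q=\{\mathbf w\in L_2(S_n)^m:\mathbf w|_\kappa\in\mathbb P_q(\kappa)^m\ \forall\kappa\in\mathcal T_n\}$, where $\mathbb P_q$ denotes polynomials of degree at most $q$ ($q$ fixed). Traces: $\mathbf w_{n,\pm}(x)=\mathbf w(x,t_\pm^n)$ (limits at $t_n$ from above/below); $\mathbf w_{K,\pm}(x,t)=\lim_{\epsilon\downarrow0}\mathbf w(x\pm\epsilon\mathbf n,t)$ on $\partial K$ with outward unit normal $\mathbf n$; jumps $[\![\mathbf w]\!]=\mathbf w_+-\mathbf w_-$. **Scheme.** The SC-DG method is: find $\mathbf v^h\in\mathcal V^q$ with $\mathcal B(\mathbf v^h,\mathbf w^h):=\mathcal B_{DG}(\mathbf v^h,\mathbf w^h)+\mathcal B_{SC}(\mathbf v^h,\mathbf w^h)=0$ for all $\mathbf w^h\in\mathcal V^q$, where $\mathbf v^h_{0,-}$ is a given suitable projection (e.g. $L_2$-projection) of $\mathbf v(\mathbf u_0)$, and $$\mathcal B_{DG}(\mathbf v^h,\mathbf w^h)=-\sum_{\kappa,n}\int_{I_n}\int_K\Big(\langle\mathbf u(\mathbf v^h),\mathbf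 w^h_t\rangle+\sum_{k=1}^d\langle\mathbf f^k(\mathbf v^h),\mathbf w^h_{x_k}\rangle\Big)dx\,dt+\sum_{\kappa,n}\int_K\Big(\langle\mathbf u(\mathbf v^h_{n+1,-}),\mathbf w^h_{n+1,-}\rangle-\langle\mathbf u(\mathbf v^h_{n,-}),\mathbf w^h_{n,+}\rangle\Big)dx+\sum_{\kappa,n}\int_{I_n}\int_{\partial K}\langle\hat{\mathbf f}(\mathbf v^h),\mathbf w^h_{K,-}\rangle\,ds\,dt .$$ The numerical flux is consistent and conservative and has the form $\hat{\mathbf f}(\mathbf v^h)=\mathbf f^\star(\mathbf v^h)-\frac12D(\mathbf v^h)(\mathbf v^h_{K,+}-\mathbf v^h_{K,-})$ with entropy conservative flux $\mathbf f^\star(\mathbf v^h)=\int_0^1\sum_k n_k\mathbf f^k(\mathbf v^h_{K,-}+\theta'[\![\mathbf v^h_K]\!])\,d\theta'$ and $D(\mathbf v^h)=D(\mathbf v^h_{K,-},\mathbf v^h_{K,+};\mathbf n)$ a symmetric positive definite matrix. The shock capturing term is $$\mathcal B_{SC}(\mathbf v^h,\mathbf w^h)=\sum_{\kappa,n}\int_{I_n}\int_K\varepsilon_\kappa\Big(\langle\mathbf w^h_t,\tilde{\mathbf u}_{\mathbf v}\mathbf v^h_t\rangle+\sum_{k=1}^d\langle\mathbf w^h_{x_k},\tilde{\mathbf u}_{\mathbf v}\mathbf v^h_{x_k}\rangle\Big)dx\,dt,\qquad \varepsilon_\kappa=\frac{h^{\alpha_1}C_1^{SC}\,\overline{\mathrm{Res}}_\kappa+h^{\alpha_2}C_2^{SC}\,\overline{\mathrm{BRes}}_\kappa}{\overline{\nabla\mathbf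 v}_\kappa+h^\theta},$$ with constants $C_1^{SC},C_2^{SC}>0$, $\alpha_1\in(0,2)$, $\alpha_2>0$, $\theta\ge\max\{\frac{d'}2-\frac{\alpha_1}2,\frac{d'}2-\alpha_2\}$, $\tilde{\mathbf u}_{\mathbf v}=\mathbf u_{\mathbf v}(\tilde{\mathbf v}_\kappa)$, $\tilde{\mathbf v}_\kappa=\frac1{|\kappa|}\int_\kappa\mathbf v^h$, $\mathrm{Res}=\mathbf u(\mathbf v^h)_t+\sum_k\mathbf f^k(\mathbf v^h)_{x_k}$ and $$\overline{\mathrm{Res}}_\kappa^2=\int_{I_n}\int_K\langle\mathrm{Res},\mathbf v_{\mathbf u}(\mathbf v^h)\mathrm{Res}\rangle\,dx\,dt,\quad \overline{\nabla\mathbf v}_\kappa^2=\int_{I_n}\int_K\Big(\langle\mathbf v^h_t,\tilde{\mathbf u}_{\mathbf v}\mathbf v^h_t\rangle+\sum_k\langle\mathbf v^h_{x_k},\tilde{\mathbf u}_{\mathbf v}\mathbf v^h_{x_k}\rangle\Big)dx\,dt,$$ $$\overline{\mathrm{BRes}}_\kappa^2=\int_K|[\![\mathbf u(\mathbf v^h_n)]\!]|^2dx+\int_{I_n}\int_{\partial K}\Big(\big|\mathbf f^\star(\mathbf v^h)-\textstyle\sum_k n_k\mathbf f^k(\mathbf v^h_{K,-})\big|^2+\big|\tfrac12D(\mathbf v^h)[\![\mathbf v^h_K]\!]\big|^2\Big)ds\,dt .$$ *)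

theory Defs
  imports "HOL-Probability.Probability"
begin

primrec Ck :: "nat \<Rightarrow> ('a::real_normed_vector \<Rightarrow> 'b::real_normed_vector) \<Rightarrow> bool" where
  "Ck 0 g \<longleftrightarrow> continuous_on UNIV g"
| "Ck (Suc k) g \<longleftrightarrow> (\<forall>x. g differentiable (at x)) \<and> (\<forall>b. Ck k (\<lambda>x. frechet_derivative g (at x) b))"

definition smooth :: "('a::real_normed_vector \<Rightarrow> 'b::real_normed_vector) \<Rightarrow> bool" where
  "smooth g \<longleftrightarrow> (\<forall>k. Ck k g)"

text \<open>Polynomial maps of total degree at most \<open>q\<close>; the coefficients are vectors, so for
  \<open>'b = real^'m\<close> this is the \<open>m\<close>-fold product of the scalar space.\<close>

definition multi_indices :: "nat \<Rightarrow> ('a::euclidean_space \<Rightarrow> nat) set" where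
  "multi_indices q = {\<alpha>. (\<forall>b. b \<notin> Basis \<longrightarrow> \<alpha> b = 0) \<and> (\<Sum>b\<in>Basis. \<alpha> b) \<le> q}"

definition polys :: "nat \<Rightarrow> ('a::euclidean_space \<Rightarrow> 'b::real_vector) set" where
  "polys q = {p. \<exists>c. \<forall>z. p z = (\<Sum>\<alpha>\<in>multi_indices q. (\<Prod>b\<in>Basis. (z \<bullet> b) ^ \<alpha> b) *\<^sub>R c \<alpha>)}"

definition dt :: "((real^'d) \<times> real \<Rightarrow> 'b::real_normed_vector) \<Rightarrow> (real^'d) \<times> real \<Rightarrow> 'b" where
  "dt w z = vector_derivative (\<lambda>s. w (fst z, s)) (at (snd z))"

definition dx :: "'d \<Rightarrow> ((real^'d) \<times> real \<Rightarrow> 'b::real_normed_vector) \<Rightarrow> (real^'d) \<times> real \<Rightarrow> 'b" where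
  "dx k w z = vector_derivative (\<lambda>s. w (fst z + s *\<^sub>R axis k 1, snd z)) (at 0)"

definition spd :: "real^'n^'n \<Rightarrow> bool" where
  "spd A \<longleftrightarrow> transpose A = A \<and> (\<forall>w. w \<noteq> 0 \<longrightarrow> 0 < w \<bullet> (A *v w))"

text \<open>The \<open>s\<close>-dimensional Hausdorff measure, normalised to agree with Lebesgue measure on \<open>\<real>\<^sup>s\<close>.
  The empty set is singled out because \<^term>\<open>(diameter {}) ^ 0 = 1\<close>; unbounded sets are excluded from
  coverings because \<^const>\<open>diameter\<close> is unspecified on them. The measure lives on the
  Caratheodory-measurable sets, hence is complete.\<close>

definition hausdorff_pre :: "nat \<Rightarrow> real \<Rightarrow> 'a::metric_space set \<Rightarrow> ennreal" where
  "hausdorff_pre s \<delta> A =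
     (INF U \<in> {U :: nat \<Rightarrow> 'a set. A \<subseteq> (\<Union>i. U i) \<and> (\<forall>i. bounded (U i) \<and> diameter (U i) \<le> \<delta>)}.
        \<Sum>i. if U i = {} then 0 else ennreal (unit_ball_vol (real s) * (diameter (U i) / 2) ^ s))"

definition hausdorff_outer :: "nat \<Rightarrow> 'a::metric_space set \<Rightarrow> ennreal" where
  "hausdorff_outer s A = (SUP \<delta>\<in>{0<..}. hausdorff_pre s \<delta> A)"

definition hausdorff_measure :: "nat \<Rightarrow> 'a::metric_space measure" where
  "hausdorff_measure s =
     measure_of UNIV (lambda_system UNIV UNIV (hausdorff_outer s)) (hausdorff_outer s)"

abbreviation surface_measure :: "(real^'d) measure" where
  "surface_measure \<equiv> hausdorff_measure (CARD('d) - 1)"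

text \<open>For open convex \<open>K\<close> the outward unit normal exists at almost every boundary point.\<close>

definition unit_normal :: "(real^'d) set \<Rightarrow> real^'d \<Rightarrow> real^'d" where
  "unit_normal K x = (THE n. norm n = 1 \<and> (\<forall>y\<in>K. n \<bullet> (y - x) \<le> 0))"

text \<open>\<open>entropy_var U u\<close> is the map \<open>u \<mapsto> v = (U\<^sub>u)\<^sup>T\<close>, \<open>state_of U\<close> its inverse \<open>v \<mapsto> u(v)\<close>.\<close>

definition entropy_var :: "(real^'m \<Rightarrow> real) \<Rightarrow> real^'m \<Rightarrow> real^'m" where
  "entropy_var U u = (\<chi> i. frechet_derivative U (at u) (axis i 1))"

definition state_of :: "(real^'m \<Rightarrow> real) \<Rightarrow> real^'m \<Rightarrow> real^'m" where
  "state_of U = inv (entropy_var U)"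

definition flux_v :: "('d \<Rightarrow> real^'m \<Rightarrow> real^'m) \<Rightarrow> (real^'m \<Rightarrow> real) \<Rightarrow> 'd \<Rightarrow> real^'m \<Rightarrow> real^'m" where
  "flux_v f U k v = f k (state_of U v)"

definition u_v :: "(real^'m \<Rightarrow> real) \<Rightarrow> real^'m \<Rightarrow> real^'m^'m" where
  "u_v U v = jacobian (state_of U) (at v)"

definition v_u :: "(real^'m \<Rightarrow> real) \<Rightarrow> real^'m \<Rightarrow> real^'m^'m" where
  "v_u U v = matrix_inv (u_v U v)"

definition strictly_convex :: "('a::real_vector \<Rightarrow> real) \<Rightarrow> bool" where
  "strictly_convex g \<longleftrightarrow>
     (\<forall>a b s. a \<noteq> b \<and> 0 < s \<and> s < 1 \<longrightarrow>
        g ((1 - s) *\<^sub>R a + s *\<^sub>R b) < (1 - s) * g a + s * g b)"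

text \<open>The last line makes \<open>u \<leftrightarrow> v\<close> a global change of variables, so that \<open>u(v)\<close> and its
  symmetric positive definite Jacobian are defined for every \<open>v \<in> \<real>\<^sup>m\<close>.\<close>

definition entropy_pair ::
  "('d \<Rightarrow> real^'m \<Rightarrow> real^'m) \<Rightarrow> (real^'m \<Rightarrow> real) \<Rightarrow> ('d \<Rightarrow> real^'m \<Rightarrow> real) \<Rightarrow> bool" where
  "entropy_pair f U F \<longleftrightarrow>
     strictly_convex U \<and> Ck 2 U \<and>
     (\<forall>k u. F k differentiable (at u)) \<and>
     (\<forall>k u w. frechet_derivative (F k) (at u) w =
        frechet_derivative U (at u) (frechet_derivative (f k) (at u) w)) \<and>
     bij (entropy_var U) \<and> (\<forall>v. state_of U differentiable (at v) \<and> spd (u_v U v))"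

text \<open>\<open>cells M n\<close> is the set of spatial cells \<open>K\<close> such that \<open>K \<times> I\<^sub>n\<close> is a space-time cell.\<close>

record ('d::finite) st_mesh =
  slabs :: nat
  tm :: "nat \<Rightarrow> real"
  cells :: "nat \<Rightarrow> (real^'d) set set"

definition slab :: "'d::finite st_mesh \<Rightarrow> nat \<Rightarrow> real set" where
  "slab M n = {tm M n..<tm M (Suc n)}"

text \<open>Spatial cells are taken open, so the covering is up to cell boundaries.\<close>

definition st_mesh :: "(real^'d) set \<Rightarrow> real \<Rightarrow> 'd::finite st_mesh \<Rightarrow> bool" where
  "st_mesh \<Omega> Tend M \<longleftrightarrow>
     0 < slabs M \<and> tm M 0 = 0 \<and> tm M (slabs M) = Tend \<and>
     (\<forall>n<slabs M. tm M n < tm M (Suc n)) \<and>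
     (\<forall>n<slabs M. finite (cells M n) \<and> disjoint (cells M n) \<and>
        (\<forall>K\<in>cells M n. open K \<and> convex K \<and> K \<noteq> {} \<and> K \<subseteq> \<Omega>) \<and>
        \<Omega> \<subseteq> (\<Union>K\<in>cells M n. closure K))"

definition mesh_size :: "'d::finite st_mesh \<Rightarrow> real" where
  "mesh_size M = Sup {diameter (K \<times> slab M n) | n K. n < slabs M \<and> K \<in> cells M n}"

definition inner_diameter :: "'a::metric_space set \<Rightarrow> real" where
  "inner_diameter S = Sup {2 * r | r z. 0 \<le> r \<and> ball z r \<subseteq> S}"

definition shape_regular :: "real \<Rightarrow> 'd::finite st_mesh \<Rightarrow> bool" where
  "shape_regular \<sigma> M \<longleftrightarrow>
     (\<forall>n<slabs M. \<forall>K\<in>cells M n. mesh_size M \<le> \<sigma> * inner_diameter (K \<times> slab M n))"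

text \<open>Values outside the cells lie on a null set of the space-time slabs and are left free;
  square integrability is automatic, the cells being bounded.\<close>

definition Vq :: "nat \<Rightarrow> 'd::finite st_mesh \<Rightarrow> ((real^'d) \<times> real \<Rightarrow> real^'m) set" where
  "Vq q M = {w. \<forall>n<slabs M. \<forall>K\<in>cells M n. \<exists>p\<in>polys q. \<forall>z\<in>K \<times> slab M n. w z = p z}"

text \<open>Initial traces, and projections of square integrable initial data onto them. The
  \<open>L\<^sub>2\<close>-projection is one instance.\<close>

definition Vq0 :: "nat \<Rightarrow> 'd::finite st_mesh \<Rightarrow> (real^'d \<Rightarrow> real^'m) set" where
  "Vq0 q M = {w. \<forall>K\<in>cells M 0. \<exists>p\<in>polys q. \<forall>x\<in>K. w x = p x}"

definition L2_on :: "(real^'d) set \<Rightarrow> (real^'d \<Rightarrow> real^'m) set" where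
  "L2_on \<Omega> = {w. w \<in> borel_measurable (lebesgue_on \<Omega>) \<and>
                  integrable (lebesgue_on \<Omega>) (\<lambda>x. (norm (w x))\<^sup>2)}"

definition initial_projection ::
  "(real^'d) set \<Rightarrow> nat \<Rightarrow> 'd::finite st_mesh \<Rightarrow> ((real^'d \<Rightarrow> real^'m) \<Rightarrow> real^'d \<Rightarrow> real^'m) \<Rightarrow> bool" where
  "initial_projection \<Omega> q M P \<longleftrightarrow>
     (\<forall>w\<in>L2_on \<Omega>. P w \<in> Vq0 q M) \<and>
     (\<forall>w\<in>Vq0 q M. \<forall>K\<in>cells M 0. \<forall>x\<in>K. P w x = w x)"

definition t_plus :: "((real^'d) \<times> real \<Rightarrow> real^'m) \<Rightarrow> real \<Rightarrow> real^'d \<Rightarrow> real^'m" where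
  "t_plus w s x = Lim (at_right s) (\<lambda>r. w (x, r))"

definition t_minus :: "((real^'d) \<times> real \<Rightarrow> real^'m) \<Rightarrow> real \<Rightarrow> real^'d \<Rightarrow> real^'m" where
  "t_minus w s x = Lim (at_left s) (\<lambda>r. w (x, r))"

text \<open>The trace \<open>v\<^sub>n\<^sub>,\<^sub>-\<close> of the approximate solution, which for \<open>n = 0\<close> is the prescribed initial trace \<open>v0\<close>.\<close>

definition past_trace ::
  "'d::finite st_mesh \<Rightarrow> (real^'d \<Rightarrow> real^'m) \<Rightarrow> ((real^'d) \<times> real \<Rightarrow> real^'m) \<Rightarrow> nat \<Rightarrow> real^'d \<Rightarrow> real^'m" where
  "past_trace M v0 v n x = (if n = 0 then v0 x else t_minus v (tm M n) x)"

definition K_plus :: "(real^'d) set \<Rightarrow> ((real^'d) \<times> real \<Rightarrow> real^'m) \<Rightarrow> (real^'d) \<times> real \<Rightarrow> real^'m" where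
  "K_plus K w z = Lim (at_right 0) (\<lambda>e. w (fst z + e *\<^sub>R unit_normal K (fst z), snd z))"

definition K_minus :: "(real^'d) set \<Rightarrow> ((real^'d) \<times> real \<Rightarrow> real^'m) \<Rightarrow> (real^'d) \<times> real \<Rightarrow> real^'m" where
  "K_minus K w z = Lim (at_right 0) (\<lambda>e. w (fst z - e *\<^sub>R unit_normal K (fst z), snd z))"

definition K_jump :: "(real^'d) set \<Rightarrow> ((real^'d) \<times> real \<Rightarrow> real^'m) \<Rightarrow> (real^'d) \<times> real \<Rightarrow> real^'m" where
  "K_jump K w z = K_plus K w z - K_minus K w z"

definition space_int :: "(real^'d) set \<Rightarrow> (real^'d \<Rightarrow> real) \<Rightarrow> real" where
  "space_int K g = (LINT x|lebesgue_on K. g x)"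

definition cell_int :: "'d::finite st_mesh \<Rightarrow> nat \<Rightarrow> (real^'d) set \<Rightarrow>
    ((real^'d) \<times> real \<Rightarrow> 'b::{banach,second_countable_topology}) \<Rightarrow> 'b" where
  "cell_int M n K g = (LINT z|lebesgue_on (K \<times> slab M n). g z)"

definition face_int :: "'d::finite st_mesh \<Rightarrow> nat \<Rightarrow> (real^'d) set \<Rightarrow> ((real^'d) \<times> real \<Rightarrow> real) \<Rightarrow> real" where
  "face_int M n K g = (LINT t:slab M n|lborel. (LINT x:frontier K|surface_measure. g (x, t)))"

definition f_star :: "('d::finite \<Rightarrow> real^'m \<Rightarrow> real^'m) \<Rightarrow> (real^'m \<Rightarrow> real) \<Rightarrow>
    real^'m \<Rightarrow> real^'m \<Rightarrow> real^'d \<Rightarrow> real^'m" where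
  "f_star f U a b n = integral {0..1} (\<lambda>\<theta>. \<Sum>k\<in>UNIV. (n $ k) *\<^sub>R flux_v f U k (a + \<theta> *\<^sub>R (b - a)))"

definition num_flux :: "('d::finite \<Rightarrow> real^'m \<Rightarrow> real^'m) \<Rightarrow> (real^'m \<Rightarrow> real) \<Rightarrow>
    (real^'m \<Rightarrow> real^'m \<Rightarrow> real^'d \<Rightarrow> real^'m^'m) \<Rightarrow> real^'m \<Rightarrow> real^'m \<Rightarrow> real^'d \<Rightarrow> real^'m" where
  "num_flux f U D a b n = f_star f U a b n - (1/2) *\<^sub>R (D a b n *v (b - a))"

text \<open>\<open>D\<close> takes the interior value, the exterior value and the normal. Borel measurability
  only serves to give a meaning to the boundary integrals.\<close>

definition admissible_flux :: "('d::finite \<Rightarrow> real^'m \<Rightarrow> real^'m) \<Rightarrow> (real^'m \<Rightarrow> real) \<Rightarrow>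
    (real^'m \<Rightarrow> real^'m \<Rightarrow> real^'d \<Rightarrow> real^'m^'m) \<Rightarrow> bool" where
  "admissible_flux f U D \<longleftrightarrow>
     (\<lambda>(a, b, n). D a b n) \<in> borel_measurable borel \<and>
     (\<forall>a b n. norm n = 1 \<longrightarrow> spd (D a b n)) \<and>
     (\<forall>a n. norm n = 1 \<longrightarrow> num_flux f U D a a n = (\<Sum>k\<in>UNIV. (n $ k) *\<^sub>R flux_v f U k a)) \<and>
     (\<forall>a b n. norm n = 1 \<longrightarrow> num_flux f U D a b n = - num_flux f U D b a (- n))"

definition f_star_at where
  "f_star_at f U K v z = f_star f U (K_minus K v z) (K_plus K v z) (unit_normal K (fst z))"

definition f_normal_at where
  "f_normal_at f U K v z = (\<Sum>k\<in>UNIV. (unit_normal K (fst z) $ k) *\<^sub>R flux_v f U k (K_minus K v z))"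

definition D_at where
  "D_at D K v z = D (K_minus K v z) (K_plus K v z) (unit_normal K (fst z))"

definition num_flux_at where
  "num_flux_at f U D K v z = num_flux f U D (K_minus K v z) (K_plus K v z) (unit_normal K (fst z))"

definition B_DG ::
  "('d::finite \<Rightarrow> real^'m \<Rightarrow> real^'m) \<Rightarrow> (real^'m \<Rightarrow> real) \<Rightarrow> (real^'m \<Rightarrow> real^'m \<Rightarrow> real^'d \<Rightarrow> real^'m^'m) \<Rightarrow>
   'd st_mesh \<Rightarrow> (real^'d \<Rightarrow> real^'m) \<Rightarrow> ((real^'d) \<times> real \<Rightarrow> real^'m) \<Rightarrow> ((real^'d) \<times> real \<Rightarrow> real^'m) \<Rightarrow> real" where
  "B_DG f U D M v0 v w =
     - (\<Sum>n<slabs M. \<Sum>K\<in>cells M n. cell_int M n K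
          (\<lambda>z. state_of U (v z) \<bullet> dt w z + (\<Sum>k\<in>UNIV. flux_v f U k (v z) \<bullet> dx k w z)))
     + (\<Sum>n<slabs M. \<Sum>K\<in>cells M n. space_int K
          (\<lambda>x. state_of U (past_trace M v0 v (Suc n) x) \<bullet> t_minus w (tm M (Suc n)) x
             - state_of U (past_trace M v0 v n x) \<bullet> t_plus w (tm M n) x))
     + (\<Sum>n<slabs M. \<Sum>K\<in>cells M n. face_int M n K
          (\<lambda>z. num_flux_at f U D K v z \<bullet> K_minus K w z))"

definition cell_mean :: "'d::finite st_mesh \<Rightarrow> nat \<Rightarrow> (real^'d) set \<Rightarrow> ((real^'d) \<times> real \<Rightarrow> real^'m) \<Rightarrow> real^'m" where
  "cell_mean M n K v = (1 / measure lebesgue (K \<times> slab M n)) *\<^sub>R cell_int M n K v"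

definition u_v_tilde :: "(real^'m \<Rightarrow> real) \<Rightarrow> 'd::finite st_mesh \<Rightarrow> nat \<Rightarrow> (real^'d) set \<Rightarrow>
    ((real^'d) \<times> real \<Rightarrow> real^'m) \<Rightarrow> real^'m^'m" where
  "u_v_tilde U M n K v = u_v U (cell_mean M n K v)"

definition Res :: "('d::finite \<Rightarrow> real^'m \<Rightarrow> real^'m) \<Rightarrow> (real^'m \<Rightarrow> real) \<Rightarrow>
    ((real^'d) \<times> real \<Rightarrow> real^'m) \<Rightarrow> (real^'d) \<times> real \<Rightarrow> real^'m" where
  "Res f U v z = dt (\<lambda>y. state_of U (v y)) z + (\<Sum>k\<in>UNIV. dx k (\<lambda>y. flux_v f U k (v y)) z)"

definition Res_bar where
  "Res_bar f U M n K v = sqrt (cell_int M n K (\<lambda>z. Res f U v z \<bullet> (v_u U (v z) *v Res f U v z)))"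

definition grad_form :: "real^'m^'m \<Rightarrow> ((real^'d) \<times> real \<Rightarrow> real^'m) \<Rightarrow> ((real^'d) \<times> real \<Rightarrow> real^'m) \<Rightarrow>
    (real^'d) \<times> real \<Rightarrow> real" where
  "grad_form A w v z = dt w z \<bullet> (A *v dt v z) + (\<Sum>k\<in>UNIV. dx k w z \<bullet> (A *v dx k v z))"

definition grad_bar where
  "grad_bar U M n K v = sqrt (cell_int M n K (grad_form (u_v_tilde U M n K v) v v))"

definition BRes_bar where
  "BRes_bar f U D M v0 n K v = sqrt (
     space_int K (\<lambda>x. (norm (state_of U (t_plus v (tm M n) x) - state_of U (past_trace M v0 v n x)))\<^sup>2)
     + face_int M n K (\<lambda>z. (norm (f_star_at f U K v z - f_normal_at f U K v z))\<^sup>2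
                           + (norm ((1/2) *\<^sub>R (D_at D K v z *v K_jump K v z)))\<^sup>2))"

definition sc_viscosity where
  "sc_viscosity f U D C1 C2 \<alpha>1 \<alpha>2 \<theta> M v0 n K v =
     (mesh_size M powr \<alpha>1 * C1 * Res_bar f U M n K v
      + mesh_size M powr \<alpha>2 * C2 * BRes_bar f U D M v0 n K v)
     / (grad_bar U M n K v + mesh_size M powr \<theta>)"

definition B_SC where
  "B_SC f U D C1 C2 \<alpha>1 \<alpha>2 \<theta> M v0 v w =
     (\<Sum>n<slabs M. \<Sum>K\<in>cells M n. cell_int M n K
        (\<lambda>z. sc_viscosity f U D C1 C2 \<alpha>1 \<alpha>2 \<theta> M v0 n K v * grad_form (u_v_tilde U M n K v) w v z))"

definition sc_dg_solution where
  "sc_dg_solution f U D C1 C2 \<alpha>1 \<alpha>2 \<theta> q M v0 v \<longleftrightarrow>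
     v \<in> Vq q M \<and>
     (\<forall>w\<in>Vq q M. B_DG f U D M v0 v w + B_SC f U D C1 C2 \<alpha>1 \<alpha>2 \<theta> M v0 v w = 0)"

text \<open>The support is that of the conserved variables \<open>u(v)\<close>; the function is defined on all of
  space, which supplies the exterior traces on \<open>\<partial>\<Omega>\<close>.\<close>

definition compactly_supported_in ::
  "(real^'d) set \<Rightarrow> real \<Rightarrow> (real^'m \<Rightarrow> real) \<Rightarrow> ((real^'d) \<times> real \<Rightarrow> real^'m) \<Rightarrow> bool" where
  "compactly_supported_in \<Omega> Tend U v \<longleftrightarrow>
     (\<exists>Z. compact Z \<and> Z \<subseteq> \<Omega> \<and> (\<forall>x t. x \<notin> Z \<and> t \<in> {0..Tend} \<longrightarrow> state_of U (v (x, t)) = 0))"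

definition L_infinity :: "'a::euclidean_space set \<Rightarrow> ('a \<Rightarrow> real) set" where
  "L_infinity S = {g. g \<in> borel_measurable (lebesgue_on S) \<and> (\<exists>B. AE z in lebesgue_on S. \<bar>g z\<bar> \<le> B)}"

definition weak_star_lim :: "'a::euclidean_space set \<Rightarrow> (nat \<Rightarrow> 'a \<Rightarrow> real) \<Rightarrow> ('a \<Rightarrow> real) \<Rightarrow> bool" where
  "weak_star_lim S gs g \<longleftrightarrow>
     (\<forall>j. gs j \<in> L_infinity S) \<and> g \<in> L_infinity S \<and>
     (\<forall>\<psi>. integrable (lebesgue_on S) \<psi> \<longrightarrow>
        (\<lambda>j. LINT z|lebesgue_on S. gs j z * \<psi> z) \<longlonglongrightarrow> (LINT z|lebesgue_on S. g z * \<psi> z))"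

definition test_function :: "'a::euclidean_space set \<Rightarrow> ('a \<Rightarrow> 'b::real_normed_vector) \<Rightarrow> bool" where
  "test_function S \<phi> \<longleftrightarrow> smooth \<phi> \<and> compact (closure {z. \<phi> z \<noteq> 0}) \<and> closure {z. \<phi> z \<noteq> 0} \<subseteq> S"

definition young_measure :: "'a::euclidean_space set \<Rightarrow> ('a \<Rightarrow> (real^'m) measure) \<Rightarrow> bool" where
  "young_measure S \<mu> \<longleftrightarrow> \<mu> \<in> measurable (lebesgue_on S) (prob_algebra borel)"

definition generates_young_measure ::
  "'a::euclidean_space set \<Rightarrow> (nat \<Rightarrow> 'a \<Rightarrow> real^'m) \<Rightarrow> ('a \<Rightarrow> (real^'m) measure) \<Rightarrow> bool" where
  "generates_young_measure S vs \<mu> \<longleftrightarrow>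
     young_measure S \<mu> \<and>
     (\<forall>g :: real^'m \<Rightarrow> real. continuous_on UNIV g \<longrightarrow>
        (AE y in lebesgue_on S. integrable (\<mu> y) g) \<and>
        weak_star_lim S (\<lambda>j z. g (vs j z)) (\<lambda>y. LINT \<sigma>|\<mu> y. g \<sigma>))"

definition measure_valued_solution ::
  "('d::finite \<Rightarrow> real^'m \<Rightarrow> real^'m) \<Rightarrow> (real^'m \<Rightarrow> real) \<Rightarrow> ((real^'d) \<times> real) set \<Rightarrow>
   ((real^'d) \<times> real \<Rightarrow> (real^'m) measure) \<Rightarrow> bool" where
  "measure_valued_solution f U S \<mu> \<longleftrightarrow>
     young_measure S \<mu> \<and>
     (\<forall>\<phi> :: (real^'d) \<times> real \<Rightarrow> real^'m. test_function S \<phi> \<longrightarrow>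
        (LINT y|lebesgue_on S.
           (LINT \<sigma>|\<mu> y. state_of U \<sigma>) \<bullet> dt \<phi> y
           + (\<Sum>k\<in>UNIV. (LINT \<sigma>|\<mu> y. flux_v f U k \<sigma>) \<bullet> dx k \<phi> y)) = 0)"

end

theory Submission
imports Defs "HOL-Library.Diagonal_Subsequence"
begin

text \<open>Testing the scheme with its own solution, the entropy conservative flux telescopes and the symmetric
dissipation terms remain; so the weighted sums of squared jumps and of the shock capturing term are bounded
uniformly in \<open>h\<close>. A test function is replaced by its values at one point of each cell. By the energy bound
the consistency error and the shock capturing term then tend to 0, and in the limit the equation for the
Young measure follows. Integration by parts on a cell needs the surface measure of the definitions:
the isodiametric inequality identifies Hausdorff and Lebesgue measure on hyperplanes, and a convex
cell whose faces all lie inside \<open>\<Omega>\<close> is a polytope, as its neighbours are convex too; the divergence theorem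
for it is the fundamental theorem of calculus along lines in general position.\<close>

text \<open>The energy test function is \<open>v - vstar\<close>, where \<open>vstar\<close> is the
  entropy variable of the state 0, cut off on the first time slab. The shift makes it vanish outside
  a compact subset of the domain: a cell whose closure leaves the domain contains an open set where
  the solution equals \<open>vstar\<close>, so its polynomial is constant. Such cells may follow a
  curved boundary and need not be polytopes. The cut-off removes the initial trace; the entropy left
  after telescoping is bounded by the uniform bound on the solutions. The energy controls the
  residual through the viscosity, which gives a sum of squares of order
  \<open>h powr (- al1)\<close>. Together with the interpolation error of order \<open>h\<close>
  this yields the rate \<open>h powr (1 - al1 / 2)\<close>, where \<open>al1 < 2\<close> enters; the
  lower bound on \<open>th\<close> keeps the regularisation, summed over all cells, at the same
  order. The jumps give the rate \<open>sqrt h\<close>. Normals and traces are descriptions and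
  limits, specified only almost everywhere on the faces. They are replaced by Borel versions built
  from separating hyperplanes and cell polynomials.\<close>

notation inner (infix "<.>" 70)
notation scaleR (infixr "*R" 75)
notation tendsto (infixr "--->" 55)
notation LIMSEQ (infix "---->" 60)
notation iff (infixr "<->" 25)

section \<open>Hausdorff measure and its Borel sets\<close>

definition hterm :: "nat => 'a::metric_space set => ennreal" where
 "hterm s V = (if V = {} then 0 else ennreal (unit_ball_vol (real s) * (diameter V / 2) ^ s))"

definition hcovers :: "real => 'a::metric_space set => (nat => 'a set) set" where
 "hcovers dl A = {V. A <= (\<Union>i. V i) & (ALL i. bounded (V i) & diameter (V i) <= dl)}"

lemma hausdorff_pre_eq: "hausdorff_pre s dl A = (INF V\<in>hcovers dl A. \<Sum>i. hterm s (V i))"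
 by (simp add: hausdorff_pre_def hcovers_def hterm_def)

lemma hterm_mono:
 assumes "V <= W" "bounded W" shows "hterm s V <= hterm s W"
proof -
 have "diameter V <= diameter W" using assms by (rule diameter_subset)
 moreover have "0 <= diameter V" using assms bounded_subset diameter_ge_0 by blast
 ultimately show ?thesis using assms
  by (auto simp: hterm_def intro!: ennreal_leI mult_left_mono power_mono)
qed

lemma hausdorff_pre_empty: "0 <= dl ==> hausdorff_pre s dl ({} :: 'a::metric_space set) = 0"
proof -
 assume "0 <= dl"
 hence "(%i. {}) : hcovers dl ({} :: 'a set)" by (auto simp: hcovers_def)
 hence "hausdorff_pre s dl ({} :: 'a set) <= (\<Sum>i::nat. hterm s ({} :: 'a set))"
  unfolding hausdorff_pre_eq by (rule INF_lower2) simp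
 thus ?thesis by (simp add: hterm_def)
qed

lemma hausdorff_pre_mono: "A <= B ==> hausdorff_pre s dl A <= hausdorff_pre s dl B"
 unfolding hausdorff_pre_eq by (rule INF_superset_mono) (auto simp: hcovers_def)

lemma hausdorff_pre_antimono: "dl <= dl' ==> hausdorff_pre s dl' A <= hausdorff_pre s dl A"
 unfolding hausdorff_pre_eq by (rule INF_superset_mono) (auto simp: hcovers_def intro: order_trans)

text \<open>Vitali's covering lemmas supply families over a countable index set, while the
  definition asks for a sequence. The remaining indices receive the empty set, which costs
  nothing.\<close>

lemma hausdorff_pre_le_countable:
 assumes "countable I" "A <= (UN i:I. V i)" "!!i. i : I ==> bounded (V i) & diameter (V i) <= dl" "0 <= dl"
 shows "hausdorff_pre s dl A <= (\<integral>\<^sup>+i. hterm s (V i) \<partial>count_space I)"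
proof -
 define W where "W n = (if n : to_nat_on I ` I then V (from_nat_into I n) else {})" for n
 have "W : hcovers dl A"
 proof -
  have "A <= (\<Union>n. W n)"
  proof
   fix x assume "x : A"
   then obtain i where "i : I" "x : V i" using assms by auto
   hence "x : W (to_nat_on I i)" using assms by (auto simp: W_def)
   thus "x : (\<Union>n. W n)" by blast
  qed
  moreover have "bounded (W n) & diameter (W n) <= dl" for n
   using assms by (auto simp: W_def)
  ultimately show ?thesis by (simp add: hcovers_def)
 qed
 hence "hausdorff_pre s dl A <= (\<Sum>n. hterm s (W n))"
  unfolding hausdorff_pre_eq by (rule INF_lower2) simp
 also have "... = (\<integral>\<^sup>+n. hterm s (W n) \<partial>count_space UNIV)"
  by (simp add: nn_integral_count_space_nat)
 also have "... = (\<integral>\<^sup>+n. hterm s (W n) \<partial>count_space (to_nat_on I ` I))"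
  by (rule nn_integral_count_space_eq) (auto simp: W_def hterm_def)
 also have "... = (\<integral>\<^sup>+i. hterm s (W (to_nat_on I i)) \<partial>count_space I)"
  by (rule nn_integral_bij_count_space[symmetric]) (use assms in \<open>auto simp: bij_betw_def\<close>)
 also have "... = (\<integral>\<^sup>+i. hterm s (V i) \<partial>count_space I)"
  by (rule nn_integral_cong) (use assms in \<open>auto simp: W_def\<close>)
 finally show ?thesis .
qed

lemma hausdorff_pre_countably_subadditive:
 assumes "0 <= dl"
 shows "hausdorff_pre s dl (\<Union>n::nat. A n) <= (\<Sum>n. hausdorff_pre s dl (A n))"
proof (cases "ALL n. hausdorff_pre s dl (A n) < \<infinity>")
 case False
 then obtain n where "hausdorff_pre s dl (A n) = \<infinity>" by (auto simp: less_top[symmetric])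
 hence "(\<Sum>n. hausdorff_pre s dl (A n)) = \<infinity>"
  using sum_le_suminf[of "%n. hausdorff_pre s dl (A n)" "{n}"] by (simp add: top_unique)
 thus ?thesis by simp
next
 case True
 show ?thesis
 proof (rule ennreal_le_epsilon)
  fix e :: real assume "0 < e"
  have "EX V:hcovers dl (A n). (\<Sum>i. hterm s (V i)) <= hausdorff_pre s dl (A n) + ennreal (e * (1/2)^Suc n)" for n
  proof -
   have "hausdorff_pre s dl (A n) < hausdorff_pre s dl (A n) + ennreal (e * (1/2)^Suc n)"
    using True[rule_format, of n] `0 < e` by (cases "hausdorff_pre s dl (A n)") (auto simp: ennreal_plus[symmetric] ennreal_less_iff simp del: ennreal_plus)
   thus ?thesis unfolding hausdorff_pre_eq INF_less_iff by (meson less_imp_le)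
  qed
  then obtain V where V: "!!n. V n : hcovers dl (A n)"
   "!!n. (\<Sum>i. hterm s (V n i)) <= hausdorff_pre s dl (A n) + ennreal (e * (1/2)^Suc n)" by metis
  define W where "W k = (case prod_decode k of (m, n) => V m n)" for k
  have "W : hcovers dl (\<Union>n. A n)"
  proof -
   have "(\<Union>n. A n) <= (\<Union>k. W k)"
   proof
    fix x assume "x : (\<Union>n. A n)"
    then obtain m where "x : A m" by blast
    moreover have "A m <= (\<Union>i. V m i)" using V(1) unfolding hcovers_def by blast
    ultimately obtain n where "x : V m n" by blast
    hence "x : W (prod_encode (m, n))" by (simp add: W_def)
    thus "x : (\<Union>k. W k)" by blast
   qed
   thus ?thesis using V(1) by (auto simp: hcovers_def W_def split: prod.split)
  qed
  hence "hausdorff_pre s dl (\<Union>n. A n) <= (\<Sum>k. hterm s (W k))"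
   unfolding hausdorff_pre_eq by (rule INF_lower2) simp
  also have "... = (\<Sum>m. \<Sum>n. hterm s (V m n))"
   using suminf_ennreal_2dimen[of "%m. (\<Sum>n. hterm s (V m n))" "%(m,n). hterm s (V m n)"]
   by (simp add: o_def W_def case_prod_unfold)
  also have "... <= (\<Sum>m. hausdorff_pre s dl (A m) + ennreal (e * (1/2)^Suc m))"
   by (intro suminf_le V) auto
  also have "... = (\<Sum>m. hausdorff_pre s dl (A m)) + (\<Sum>m. ennreal (e * (1/2)^Suc m))"
   by (rule suminf_add[symmetric]) auto
  also have "(\<Sum>m. ennreal (e * (1/2)^Suc m)) = ennreal e"
  proof (rule suminf_ennreal_eq)
   show "(%m. e * (1/2)^Suc m) sums e" using sums_mult[OF power_half_series, of e] by simp
  qed (use `0 < e` in simp)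
  finally show "hausdorff_pre s dl (\<Union>n. A n) <= (\<Sum>n. hausdorff_pre s dl (A n)) + ennreal e" .
 qed
qed

lemma hausdorff_pre_le_outer: "0 < dl ==> hausdorff_pre s dl A <= hausdorff_outer s A"
 unfolding hausdorff_outer_def by (rule SUP_upper) simp

lemma hausdorff_outer_subadditive: "hausdorff_outer s (\<Union>i::nat. A i) <= (\<Sum>i. hausdorff_outer s (A i))"
 unfolding hausdorff_outer_def[of s "\<Union>i. A i"]
 by (intro SUP_least order_trans[OF hausdorff_pre_countably_subadditive suminf_le] hausdorff_pre_le_outer) auto

lemma outer_measure_space_hausdorff: "outer_measure_space UNIV (hausdorff_outer s :: 'a::metric_space set => ennreal)"
 unfolding outer_measure_space_def
proof (intro conjI)
 show "positive UNIV (hausdorff_outer s :: 'a set => ennreal)"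
  by (auto simp: positive_def hausdorff_outer_def hausdorff_pre_empty)
 show "increasing UNIV (hausdorff_outer s :: 'a set => ennreal)"
  by (auto simp: increasing_def hausdorff_outer_def intro!: SUP_mono' hausdorff_pre_mono)
qed (simp add: countably_subadditive_def hausdorff_outer_subadditive)

text \<open>A set of diameter at most \<open>dl\<close> cannot meet both \<open>A\<close> and
  \<open>B\<close>, so a cover of the union splits into a cover of \<open>A\<close> and a cover of
  \<open>B\<close>, and no member is counted twice.\<close>

lemma hausdorff_pre_metric:
 assumes "!!a b. a : A ==> b : B ==> dl < dist a b"
 shows "hausdorff_pre s dl A + hausdorff_pre s dl B <= hausdorff_pre s dl (A Un B)"
 unfolding hausdorff_pre_eq[of s dl "A Un B"]
proof (rule INF_greatest)
 fix V assume V: "V : hcovers dl (A Un B)"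
 define VA where "VA i = (if V i Int A = {} then {} else V i)" for i
 define VB where "VB i = (if V i Int B = {} then {} else V i)" for i
 have Vb: "bounded (V i)" "diameter (V i) <= dl" "A Un B <= (\<Union>i. V i) & i = i" for i
  using V by (auto simp: hcovers_def)
 have d0: "0 <= dl" using Vb[of 0] diameter_ge_0[of "V 0"] by linarith
 have cA: "A <= (\<Union>i. VA i)" and cB: "B <= (\<Union>i. VB i)"
  using Vb(3)[of 0] unfolding VA_def VB_def by (simp_all add: subset_iff) (metis IntI empty_iff)+
 hence "VA : hcovers dl A" "VB : hcovers dl B"
  using Vb(1,2) d0 by (simp_all add: hcovers_def VA_def VB_def)
 hence "hausdorff_pre s dl A + hausdorff_pre s dl B <= (\<Sum>i. hterm s (VA i)) + (\<Sum>i. hterm s (VB i))"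
  unfolding hausdorff_pre_eq by (intro add_mono INF_lower)
 also have "... = (\<Sum>i. hterm s (VA i) + hterm s (VB i))"
  by (rule suminf_add) auto
 also have "... <= (\<Sum>i. hterm s (V i))"
 proof (intro suminf_le)
  fix i
  have "V i Int A = {} | V i Int B = {}"
  proof (rule ccontr)
   assume "~ ?thesis"
   then obtain a b where "a : V i" "a : A" "b : V i" "b : B" by blast
   moreover have "bounded (V i)" "diameter (V i) <= dl" using V by (auto simp: hcovers_def)
   ultimately show False using assms[of a b] diameter_bounded_bound[of "V i" a b] by linarith
  qed
  thus "hterm s (VA i) + hterm s (VB i) <= hterm s (V i)"
   by (auto simp: VA_def VB_def hterm_def)
 qed auto
 finally show "hausdorff_pre s dl A + hausdorff_pre s dl B <= (\<Sum>i. hterm s (V i))" .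
qed

lemma hausdorff_outer_metric:
 assumes "0 < r" "!!a b. a : A ==> b : B ==> r <= dist a b"
 shows "hausdorff_outer s A + hausdorff_outer s B <= hausdorff_outer s (A Un B)"
proof -
 have *: "hausdorff_pre s dl1 A + hausdorff_pre s dl2 B <= hausdorff_outer s (A Un B)"
  if "0 < dl1" "0 < dl2" for dl1 dl2
 proof -
  define dl where "dl = min (min dl1 dl2) (r / 2)"
  have "hausdorff_pre s dl1 A + hausdorff_pre s dl2 B <= hausdorff_pre s dl A + hausdorff_pre s dl B"
   by (intro add_mono hausdorff_pre_antimono) (auto simp: dl_def)
  also have "... <= hausdorff_pre s dl (A Un B)"
  proof (rule hausdorff_pre_metric)
   fix a b assume "a : A" "b : B"
   from assms(2)[OF this] show "dl < dist a b" using assms(1) by (auto simp: dl_def min_def)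
  qed
  also have "... <= hausdorff_outer s (A Un B)"
   by (rule hausdorff_pre_le_outer) (use that assms in \<open>auto simp: dl_def\<close>)
  finally show ?thesis .
 qed
 have "hausdorff_outer s A + hausdorff_outer s B
  = (SUP dl1\<in>{0<..}. SUP dl2\<in>{0<..}. hausdorff_pre s dl1 A + hausdorff_pre s dl2 B)"
  unfolding hausdorff_outer_def
  by (subst ennreal_SUP_add_left[symmetric]; (subst ennreal_SUP_add_right[symmetric])?; simp)
 also have "... <= hausdorff_outer s (A Un B)"
  by (intro SUP_least *) auto
 finally show ?thesis .
qed

lemma suminf_tail_tendsto_0:
 fixes f :: "nat => ennreal"
 assumes "(\<Sum>i. f i) < \<infinity>"
 shows "(%k. \<Sum>i. f (i + k)) ----> 0"
proof -
 obtain g where g: "!!i. f i = ennreal (g i)" "!!i. 0 <= g i"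
 proof -
  have "f i < \<infinity>" for i
   using sum_le_suminf[of f "{i}"] assms by (auto simp: top_unique less_top[symmetric])
  thus ?thesis using that[of "%i. enn2real (f i)"] by (simp add: less_top[symmetric])
 qed
 have s: "summable g" using assms g summable_suminf_not_top[of g] by (auto simp: less_top[symmetric])
 have "(%k. \<Sum>i. g (i + k)) ----> 0" using s by (rule suminf_exist_split2)
 moreover have "(\<Sum>i. f (i + k)) = ennreal (\<Sum>i. g (i + k))" for k
  using g s by (auto intro!: suminf_ennreal2 simp: summable_iff_shift)
 ultimately show ?thesis by (simp add: tendsto_ennrealI[where x=0, simplified])
qed

text \<open>Caratheodory's criterion: the parts of \<open>A\<close> at distance between \<open>1/(k+2)\<close> and \<open>1/(k+1)\<close> from \<open>F\<close>
 are, taken alternately, pairwise at positive distance, so their outer measures are summable.\<close>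

lemma closed_in_lambda_system:
 fixes mu :: "'a::metric_space set => ennreal"
 assumes om: "outer_measure_space UNIV mu"
  and metric: "!!r A B. 0 < r ==> (!!a b. a : A ==> b : B ==> r <= dist a b) ==> mu A + mu B <= mu (A Un B)"
  and csub: "!!A. mu (\<Union>i::nat. A i) <= (\<Sum>i. mu (A i))" and F: "closed F"
 shows "F : lambda_system UNIV UNIV mu"
proof -
 have mono: "mu A <= mu B" if "A <= B" for A B
  using om that by (auto simp: outer_measure_space_def increasing_def)
 have zero: "mu {} = 0" using om by (auto simp: outer_measure_space_def positive_def)
 have sub2: "mu (A Un B) <= mu A + mu B" for A B
 proof -
  have "mu (\<Union>i. binaryset A B i) <= (\<Sum>i. mu (binaryset A B i))" by (rule csub)
  also have "... = mu A + mu B" using suminf_binaryset_eq[of mu A B] zero by simp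
  finally show ?thesis by (simp add: UN_binaryset_eq)
 qed
 show ?thesis
 proof (cases "F = {}")
  case True thus ?thesis by (simp add: lambda_system_def zero)
 next
  case False
  define f where "f x = infdist x F" for x
  have fpos: "x : F <-> f x = 0" for x
   using F False by (simp add: f_def in_closed_iff_infdist_zero)
  have f0: "0 <= f x" for x by (simp add: f_def infdist_nonneg)
  have flip: "f x <= f y + dist x y" for x y unfolding f_def by (rule infdist_triangle)
  have "mu (A Int F) + mu (A - F) <= mu A" if fin: "mu A < \<infinity>" for A
  proof -
   define B where "B k = {x:A. 1 / real (Suc k) <= f x}" for k
   define R where "R k = {x:A. 1 / real (Suc (Suc k)) <= f x & f x <= 1 / real (Suc k)}" for k
   have part: "(\<Sum>i<n. mu (R (2 * i + e))) <= mu (\<Union>i<n. R (2 * i + e))" for n e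
   proof (induction n)
    case 0 thus ?case by simp
   next
    case (Suc n)
    have "mu (\<Union>i<n. R (2 * i + e)) + mu (R (2 * n + e)) <= mu ((\<Union>i<n. R (2 * i + e)) Un R (2 * n + e))"
    \<comment> \<open>For \<open>n = 0\<close> the union is empty. The case distinction also keeps
      the denominator \<open>2 * n + e\<close> in the gap below positive.\<close>
    proof (cases "n = 0")
     case True thus ?thesis by (simp add: zero)
    next
     case False
     show ?thesis
     proof (rule metric)
      show "0 < 1 / real (2 * n + e) - 1 / real (Suc (2 * n + e))" using False by (simp add: frac_less2)
      fix a b assume "a : (\<Union>i<n. R (2 * i + e))" "b : R (2 * n + e)"
      then obtain i where i: "i < n" "1 / real (Suc (Suc (2 * i + e))) <= f a" "f b <= 1 / real (Suc (2 * n + e))"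
       by (auto simp: R_def)
      have "1 / real (2 * n + e) <= 1 / real (Suc (Suc (2 * i + e)))"
       using i by (intro frac_le) auto
      thus "1 / real (2 * n + e) - 1 / real (Suc (2 * n + e)) <= dist a b"
       using i flip[of a b] by linarith
     qed
    qed
    also have "(\<Union>i<n. R (2 * i + e)) Un R (2 * n + e) = (\<Union>i<Suc n. R (2 * i + e))"
     by (auto simp: lessThan_Suc)
    finally have "mu (\<Union>i<n. R (2 * i + e)) + mu (R (2 * n + e)) <= mu (\<Union>i<Suc n. R (2 * i + e))" .
    with add_right_mono[OF Suc, of "mu (R (2 * n + e))"] show ?case
     unfolding sum.lessThan_Suc by (rule order_trans)
   qed
   have par: "(\<Sum>i<n. mu (R (2 * i + e))) <= mu A" for n e
    by (rule order_trans[OF part mono]) (auto simp: R_def)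
   have "(\<Sum>k<n. mu (R k)) <= mu A + mu A" for n
   proof -
    have eq: "(\<Sum>k<2*n. mu (R k)) = (\<Sum>i<n. mu (R (2 * i + 0))) + (\<Sum>i<n. mu (R (2 * i + 1)))" for n
     by (induction n) (simp_all add: algebra_simps)
    have "(\<Sum>k<n. mu (R k)) <= (\<Sum>k<2*n. mu (R k))" by (rule sum_mono2) auto
    also have "... <= mu A + mu A" unfolding eq by (intro add_mono par)
    finally show ?thesis .
   qed
   hence "(\<Sum>k. mu (R k)) <= mu A + mu A"
    by (simp add: suminf_eq_SUP SUP_least)
   hence tail: "(%k. \<Sum>i. mu (R (i + k))) ----> 0"
    using fin by (intro suminf_tail_tendsto_0) (auto simp: ennreal_add_less_top intro: le_less_trans)
   have cover: "A - F <= B k Un (\<Union>i. R (i + k))" for k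
   proof
    fix x assume x: "x : A - F"
    hence fx: "0 < f x" using fpos[of x] f0[of x] by auto
    show "x : B k Un (\<Union>i. R (i + k))"
    proof (cases "1 / real (Suc k) <= f x")
     case True thus ?thesis using x by (auto simp: B_def)
    next
     case False
     \<comment> \<open>The shell containing \<open>x\<close> is read off the integer part of
       \<open>1 / f x\<close>; \<open>k < l\<close> places it in the tail.\<close>
     define l where "l = nat \<lfloor>1 / f x\<rfloor>"
     have l: "real l <= 1 / f x" "1 / f x < real (Suc l)" using fx by (simp_all add: l_def) linarith
     have "real (Suc k) < 1 / f x" using False fx by (simp add: field_simps)
     hence "k < l" using l(2) by linarith
     moreover from this l have "1 / real (Suc l) <= f x" "f x <= 1 / real l" using fx by (simp_all add: field_simps)
     ultimately have "x : R ((l - Suc k) + k)" using x by (simp add: R_def)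
     thus ?thesis by blast
    qed
   qed
   have bound: "mu (A Int F) + mu (A - F) <= mu A + (\<Sum>i. mu (R (i + k)))" for k
   proof -
    have "mu (A - F) <= mu (B k) + (\<Sum>i. mu (R (i + k)))"
     by (rule order_trans[OF mono[OF cover[of k]] order_trans[OF sub2 add_left_mono[OF csub]]])
    hence "mu (A Int F) + mu (A - F) <= (mu (A Int F) + mu (B k)) + (\<Sum>i. mu (R (i + k)))"
     by (simp add: add.assoc add_left_mono)
    also have "mu (A Int F) + mu (B k) <= mu (A Int F Un B k)"
    proof (rule metric)
     show "0 < 1 / real (Suc k)" by simp
     fix a b assume "a : A Int F" "b : B k"
     thus "1 / real (Suc k) <= dist a b"
      using flip[of b a] fpos[of a] by (auto simp: B_def dist_commute)
    qed
    also have "... <= mu A" by (rule mono) (auto simp: B_def)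
    finally show ?thesis by (simp add: add_right_mono)
   qed
   have "(%k. mu A + (\<Sum>i. mu (R (i + k)))) ----> mu A + 0"
    by (intro tendsto_add tendsto_const tail)
   thus ?thesis
    using LIMSEQ_le_const[of _ "mu A + 0" "mu (A Int F) + mu (A - F)"] bound by auto
  qed
  hence le: "mu (A Int F) + mu (A - F) <= mu A" for A
   by (cases "mu A < \<infinity>") (auto simp: less_top[symmetric])
  have "mu (F Int x) + mu ((UNIV - F) Int x) = mu x" for x
  proof (rule antisym)
   show "mu (F Int x) + mu ((UNIV - F) Int x) <= mu x" using le[of x] by (simp add: Int_commute Diff_eq)
   show "mu x <= mu (F Int x) + mu ((UNIV - F) Int x)"
    by (rule order_trans[OF mono sub2]) auto
  qed
  thus ?thesis by (simp add: lambda_system_def)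
 qed
qed

lemma
 fixes A :: "'a::metric_space set"
 shows space_hausdorff_measure [simp]: "space (hausdorff_measure s :: 'a measure) = UNIV"
  and sets_hausdorff_measure: "sets (hausdorff_measure s :: 'a measure) = lambda_system UNIV UNIV (hausdorff_outer s)"
  and emeasure_hausdorff_lambda: "A : lambda_system UNIV UNIV (hausdorff_outer s) ==>
     emeasure (hausdorff_measure s) A = hausdorff_outer s A"
proof -
 interpret sigma_algebra UNIV "UNIV :: 'a set set" using sigma_algebra_Pow[of UNIV] by simp
 have "measure_space UNIV (lambda_system UNIV UNIV (hausdorff_outer s :: 'a set => ennreal)) (hausdorff_outer s)"
  by (rule caratheodory_lemma[OF outer_measure_space_hausdorff])
 hence ms: "sigma_algebra UNIV (lambda_system UNIV UNIV (hausdorff_outer s :: 'a set => ennreal))"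
  "positive (lambda_system UNIV UNIV (hausdorff_outer s :: 'a set => ennreal)) (hausdorff_outer s)"
  "countably_additive (lambda_system UNIV UNIV (hausdorff_outer s :: 'a set => ennreal)) (hausdorff_outer s)"
  by (auto simp: measure_space_def)
 show "space (hausdorff_measure s :: 'a measure) = UNIV"
  by (simp add: hausdorff_measure_def)
 show "sets (hausdorff_measure s :: 'a measure) = lambda_system UNIV UNIV (hausdorff_outer s)"
  using sigma_algebra.sets_measure_of_eq[OF ms(1)] by (simp add: hausdorff_measure_def)
 show "A : lambda_system UNIV UNIV (hausdorff_outer s) ==>
     emeasure (hausdorff_measure s) A = hausdorff_outer s A"
  unfolding hausdorff_measure_def using ms by (intro emeasure_measure_of_sigma)
qed

lemma borel_subset_hausdorff:
 fixes A :: "'a::metric_space set"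
 assumes "A : sets borel"
 shows "A : sets (hausdorff_measure s)"
proof -
 have "closed F ==> F : sets (hausdorff_measure s)" for F :: "'a set"
  unfolding sets_hausdorff_measure
  using outer_measure_space_hausdorff hausdorff_outer_metric hausdorff_outer_subadditive by (rule closed_in_lambda_system)
 hence "Collect closed <= sets (hausdorff_measure s :: 'a measure)" by blast
 from sets.sigma_sets_subset[OF this] have "sets (borel :: 'a measure) <= sets (hausdorff_measure s)"
  by (simp add: borel_eq_closed)
 thus ?thesis using assms by blast
qed

lemma emeasure_hausdorff_measure: "A : sets borel ==> emeasure (hausdorff_measure s) A = hausdorff_outer s A"
 using borel_subset_hausdorff emeasure_hausdorff_lambda sets_hausdorff_measure by blast

section \<open>Integration along lines, Steiner symmetrisation and the isodiametric
  inequality\<close>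

lemma nn_integral_lborel_shift:
 fixes h :: "'a::euclidean_space => ennreal"
 assumes "h : borel_measurable borel"
 shows "(\<integral>\<^sup>+x. h (x + c) \<partial>lborel) = (\<integral>\<^sup>+x. h x \<partial>lborel)"
proof -
 have "(\<integral>\<^sup>+x. h x \<partial>lborel) = (\<integral>\<^sup>+x. h x \<partial>distr lborel borel ((+) c))"
  by (simp add: lborel_distr_plus)
 also have "... = (\<integral>\<^sup>+x. h (c + x) \<partial>lborel)"
  using assms by (subst nn_integral_distr) auto
 finally show ?thesis by (simp add: add.commute)
qed

text \<open>Fubini along a direction without a choice of coordinates. Every line parallel to
  \<open>e\<close> meets \<open>T\<close> in parameter length one, so base points in
  \<open>T\<close> give each line total weight one; the proof is Tonelli together with translation
  invariance.\<close>

lemma nn_integral_lines: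
 fixes e :: "'a::euclidean_space"
 assumes T[measurable]: "T : sets borel"
  and one: "!!x. emeasure lborel {s::real. x - s *R e : T} = 1"
  and h[measurable]: "h : borel_measurable borel"
 shows "(\<integral>\<^sup>+x. h x \<partial>lborel) = (\<integral>\<^sup>+x. (\<integral>\<^sup>+s. h (x + s *R e) \<partial>lborel) * indicator T x \<partial>lborel)"
proof -
 have "(\<integral>\<^sup>+x. (\<integral>\<^sup>+s. h (x + s *R e) \<partial>lborel) * indicator T x \<partial>lborel)
   = (\<integral>\<^sup>+x. (\<integral>\<^sup>+s. h (x + s *R e) * indicator T x \<partial>lborel) \<partial>lborel)"
  by (intro nn_integral_cong nn_integral_multc[symmetric]) auto
 also have "... = (\<integral>\<^sup>+s. (\<integral>\<^sup>+x. h (x + s *R e) * indicator T x \<partial>lborel) \<partial>lborel)"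
  by (rule lborel_pair.Fubini'[symmetric]) measurable
 also have "... = (\<integral>\<^sup>+s. (\<integral>\<^sup>+x. h x * indicator T (x - s *R e) \<partial>lborel) \<partial>lborel)"
 proof (rule nn_integral_cong)
  fix s :: real
  show "(\<integral>\<^sup>+x. h (x + s *R e) * indicator T x \<partial>lborel) = (\<integral>\<^sup>+x. h x * indicator T (x - s *R e) \<partial>lborel)"
   using nn_integral_lborel_shift[of "%x. h x * indicator T (x - s *R e)" "s *R e"] by simp
 qed
 also have "... = (\<integral>\<^sup>+x. (\<integral>\<^sup>+s. h x * indicator T (x - s *R e) \<partial>lborel) \<partial>lborel)"
  by (rule lborel_pair.Fubini') measurable
 also have "... = (\<integral>\<^sup>+x. h x \<partial>lborel)"
 proof (rule nn_integral_cong)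
  fix x
  have "(\<integral>\<^sup>+s. h x * indicator T (x - s *R e) \<partial>lborel) = h x * (\<integral>\<^sup>+s. indicator {s. x - s *R e : T} s \<partial>lborel)"
   by (subst nn_integral_cmult[symmetric]) (auto simp: indicator_def)
  also have "... = h x" using one[of x] by (subst nn_integral_indicator) auto
  finally show "(\<integral>\<^sup>+s. h x * indicator T (x - s *R e) \<partial>lborel) = h x" .
 qed
 finally show ?thesis by simp
qed

lemma emeasure_slab_line:
 fixes n e :: "'a::euclidean_space"
 assumes "n <.> e ~= 0"
 shows "emeasure lborel {s::real. x - s *R e : {y. b < n <.> y & n <.> y < b + \<bar>n <.> e\<bar>}} = 1"
proof -
 define m where "m = n <.> e"
 have "{s. x - s *R e : {y. b < n <.> y & n <.> y < b + \<bar>n <.> e\<bar>}} =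
   (if 0 < m then {(n <.> x - b) / m - 1<..<(n <.> x - b) / m} else {(n <.> x - b) / m<..<(n <.> x - b) / m + 1})"
  using assms by (auto simp: m_def[symmetric] inner_diff_right field_simps split: if_splits)
 thus ?thesis by (simp split: if_splits)
qed

lemma slab_borel [measurable]: "{y::'a::euclidean_space. b < n <.> y & n <.> y < c} : sets borel"
 by measurable

definition line_length :: "'a::euclidean_space set => 'a => 'a => ennreal" where
 "line_length S e x = (\<integral>\<^sup>+s. indicator S (x + s *R e) \<partial>lborel)"

text \<open>For a unit vector \<open>e\<close> this is the Steiner symmetral: on every line in
  direction \<open>e\<close> the slice of \<open>S\<close> is replaced by the open interval of the
  same length, centred on the hyperplane through the origin orthogonal to \<open>e\<close>.\<close>

definition steiner :: "'a::euclidean_space set => 'a => 'a set" where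
 "steiner S e = {x. ennreal (2 * \<bar>e <.> x\<bar>) < line_length S e x}"

lemma line_length_measurable [measurable]:
 assumes [measurable]: "S : sets borel"
 shows "line_length S e : borel_measurable borel"
 unfolding line_length_def by measurable

lemma steiner_measurable [measurable]:
 assumes [measurable]: "S : sets borel"
 shows "steiner S e : sets borel"
 unfolding steiner_def by measurable

lemma line_length_shift:
 assumes [measurable]: "S : sets borel"
 shows "line_length S e (x + r *R e) = line_length S e x"
proof -
 have "line_length S e (x + r *R e) = (\<integral>\<^sup>+s. indicator S (x + (s + r) *R e) \<partial>lborel)"
  by (simp add: line_length_def algebra_simps)
 also have "... = line_length S e x"
  unfolding line_length_def
  by (intro nn_integral_lborel_shift[of "%s. indicator S (x + s *R e)" r]) measurable
 finally show ?thesis .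
qed

lemma line_length_eq: "S : sets borel ==> line_length S e x = emeasure lborel {s::real. x + s *R e : S}"
proof -
 assume [measurable]: "S : sets borel"
 have "line_length S e x = (\<integral>\<^sup>+s. indicator {s. x + s *R e : S} s \<partial>lborel)"
  unfolding line_length_def by (intro nn_integral_cong) (auto simp: indicator_def)
 thus ?thesis by simp
qed

lemma emeasure_real_le_diam:
 fixes A :: "real set"
 assumes "!!s t. s : A ==> t : A ==> t - s <= d" "0 <= d"
 shows "emeasure lborel A <= ennreal d"
proof (cases "A = {}")
 case False
 then obtain a where a: "a : A" by blast
 have bb: "bdd_below A" by (rule bdd_belowI[of _ "a - d"]) (use assms(1) a in force)
 have "A <= {Inf A..Inf A + d}"
 proof
  fix t assume t: "t : A"
  have "t - d <= Inf A" by (rule cInf_greatest) (use False assms(1) t in force)+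
  thus "t : {Inf A..Inf A + d}" using cInf_lower[OF t bb] by auto
 qed
 hence "emeasure lborel A <= emeasure lborel {Inf A..Inf A + d}" by (rule emeasure_mono) simp
 thus ?thesis using assms by simp
qed simp

text \<open>Cavalieri's principle: the symmetral has slices of the same length, and the diameter
  bound \<open>D\<close> makes these lengths finite.\<close>

lemma emeasure_steiner:
 fixes e :: "'a::euclidean_space"
 assumes S[measurable]: "S : sets borel" and e: "norm e = 1"
  and D: "!!x y. x : S ==> y : S ==> dist x y <= D"
 shows "emeasure lborel (steiner S e) = emeasure lborel S"
proof -
 define T where "T = {y. 0 < e <.> y & e <.> y < 0 + \<bar>e <.> e\<bar>}"
 have ee: "e <.> e = 1" using e by (simp add: norm_eq_1)
 have T: "T : sets borel" "!!x. emeasure lborel {s::real. x - s *R e : T} = 1"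
  unfolding T_def using emeasure_slab_line[of e e _ 0] ee by auto
 have "line_length (steiner S e) e x = line_length S e x" for x
 proof -
  have "line_length S e x <= ennreal (max D 0)"
   unfolding line_length_eq[OF S]
  proof (rule emeasure_real_le_diam)
   fix s t assume "s : {s. x + s *R e : S}" "t : {s. x + s *R e : S}"
   hence "dist (x + s *R e) (x + t *R e) <= D" by (intro D) simp_all
   moreover have "dist (x + s *R e) (x + t *R e) = \<bar>s - t\<bar>"
    using norm_scaleR[of "s - t" e] unfolding e by (simp add: dist_norm scaleR_diff_left)
   ultimately have "\<bar>s - t\<bar> <= D" by (simp only:)
   thus "t - s <= max D 0" by auto
  qed simp
  then obtain l where l: "line_length S e x = ennreal l" "0 <= l"
   by (cases "line_length S e x") (auto simp: top_unique)
  have "{s. x + s *R e : steiner S e} = {s. 2 * \<bar>e <.> x + s\<bar> < l}"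
   using l by (auto simp: steiner_def line_length_shift inner_add_right ee ennreal_less_iff)
  also have "... = {- l / 2 - e <.> x<..<l / 2 - e <.> x}" by (auto simp: abs_if field_simps)
  finally have "emeasure lborel {s. x + s *R e : steiner S e} = ennreal l" using l by simp
  thus ?thesis using l by (simp add: line_length_eq)
 qed
 hence "(\<integral>\<^sup>+x. indicator (steiner S e) x \<partial>lborel) = (\<integral>\<^sup>+x. indicator S x \<partial>lborel)"
  using nn_integral_lines[OF T, of "indicator (steiner S e)"] nn_integral_lines[OF T, of "indicator S"]
  by (simp add: line_length_def)
 thus ?thesis by simp
qed

text \<open>The lines through \<open>x\<close> and \<open>y\<close> carry points of \<open>S\<close>
  that are more than \<open>2 * \<bar>e <.> x\<bar>\<close> and
  \<open>2 * \<bar>e <.> y\<bar>\<close> apart. Joining the upper point of each line to the lower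
  point of the other gives two pairs, and in one of them the difference along \<open>e\<close> is at
  least that of \<open>x\<close> and \<open>y\<close>, while the orthogonal component
  \<open>p\<close> is the same.\<close>

lemma dist_steiner:
 fixes e :: "'a::euclidean_space"
 assumes S: "S : sets borel" and e: "norm e = 1"
  and D: "!!x y. x : S ==> y : S ==> dist x y <= D"
  and xy: "x : steiner S e" "y : steiner S e"
 shows "dist x y <= D"
proof -
 have ee: "e <.> e = 1" using e by (simp add: norm_eq_1)
 have far: "EX s t. z + s *R e : S & z + t *R e : S & 2 * \<bar>e <.> z\<bar> < t - s" if "z : steiner S e" for z
 proof (rule ccontr)
  assume "~ ?thesis"
  hence "emeasure lborel {s. z + s *R e : S} <= ennreal (2 * \<bar>e <.> z\<bar>)"
   by (intro emeasure_real_le_diam) (auto simp: not_less)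
  thus False using that S by (simp add: steiner_def line_length_eq not_le[symmetric])
 qed
 obtain s1 t1 where 1: "x + s1 *R e : S" "x + t1 *R e : S" "2 * \<bar>e <.> x\<bar> < t1 - s1" using far xy by blast
 obtain s2 t2 where 2: "y + s2 *R e : S" "y + t2 *R e : S" "2 * \<bar>e <.> y\<bar> < t2 - s2" using far xy by blast
 define p where "p = (x - y) - (e <.> (x - y)) *R e"
 have pe: "p <.> e = 0" unfolding p_def inner_diff_left inner_scaleR_left ee
  by (simp add: inner_commute inner_diff_right)
 have nrm: "(dist (x + s *R e) (y + t *R e))^2 = p <.> p + (e <.> (x - y) + (s - t))^2" for s t
 proof -
  have "(x + s *R e) - (y + t *R e) = p + (e <.> (x - y) + (s - t)) *R e"
   by (simp add: p_def algebra_simps)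
  hence "(dist (x + s *R e) (y + t *R e))^2
    = (p + (e <.> (x - y) + (s - t)) *R e) <.> (p + (e <.> (x - y) + (s - t)) *R e)"
   by (simp add: dist_norm power2_norm_eq_inner)
  also have "... = p <.> p + (e <.> (x - y) + (s - t))^2"
   using pe ee by (simp add: inner_add_left inner_add_right inner_commute[of e p] power2_eq_square
    del: inner_diff_right inner_diff_left)
  finally show ?thesis .
 qed
 have D0: "0 <= D" using D[OF 1(1) 1(1)] by simp
 have le: "p <.> p + (e <.> (x - y) + (s - t))^2 <= D^2" if "x + s *R e : S" "y + t *R e : S" for s t
  using D[OF that] unfolding nrm[symmetric] by (intro power_mono) auto
 define r where "r = sqrt (D^2 - p <.> p)"
 have bd: "\<bar>e <.> (x - y) + (s - t)\<bar> <= r" if "x + s *R e : S" "y + t *R e : S" for s t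
  unfolding r_def by (rule real_le_rsqrt) (use le[OF that] in simp)
 have "\<bar>e <.> (x - y)\<bar> <= r"
  using bd[OF 1(2) 2(1)] bd[OF 1(1) 2(2)] 1(3) 2(3) by (simp add: inner_diff_right abs_le_iff) argo
 hence "(e <.> (x - y))^2 <= r^2" using power_mono[of "\<bar>e <.> (x - y)\<bar>" r 2] by simp
 also have "r^2 = D^2 - p <.> p"
 proof -
  have "p <.> p <= D^2" using le[OF 1(1) 2(1)] zero_le_power2[of "e <.> (x - y) + (s1 - s2)"] by linarith
  thus ?thesis unfolding r_def by (intro real_sqrt_pow2) simp
 qed
 finally have "(dist x y)^2 <= D^2" using nrm[of 0 0] by simp
 thus ?thesis using D0 by (rule power2_le_imp_le)
qed

definition mirror :: "'a::real_inner => 'a => 'a" where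
 "mirror b x = x - (2 * (x <.> b)) *R b"

text \<open>A symmetry in a direction orthogonal to \<open>e\<close> survives symmetrisation along
  \<open>e\<close>, so the coordinate directions can be treated one after the other.\<close>

lemma steiner_mirror:
 fixes e :: "'a::euclidean_space"
 assumes S: "S : sets borel" and "b <.> e = 0" "norm b = 1" and sym: "!!x. x : S ==> mirror b x : S"
  and x: "x : steiner S e"
 shows "mirror b x : steiner S e"
proof -
 have bb: "b <.> b = 1" using assms by (simp add: norm_eq_1)
 have inv: "mirror b (mirror b y) = y" for y by (simp add: mirror_def inner_diff_left bb)
 have "mirror b x + s *R e : S <-> x + s *R e : S" for s
 proof -
  have "mirror b x + s *R e = mirror b (x + s *R e)"
   using assms by (simp add: mirror_def inner_add_left inner_commute[of e b])
  thus ?thesis using sym inv by metis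
 qed
 hence "line_length S e (mirror b x) = line_length S e x" using S by (simp add: line_length_eq)
 moreover have "e <.> mirror b x = e <.> x" using assms by (simp add: mirror_def inner_diff_right inner_commute[of e b])
 ultimately show ?thesis using x by (simp add: steiner_def)
qed

lemma steiner_mirror_self:
 fixes e :: "'a::euclidean_space"
 assumes S: "S : sets borel" and "norm e = 1" and x: "x : steiner S e"
 shows "mirror e x : steiner S e"
proof -
 have ee: "e <.> e = 1" using assms by (simp add: norm_eq_1)
 have "line_length S e (mirror e x) = line_length S e x"
  using line_length_shift[OF S, of e x "- (2 * (x <.> e))"] by (simp add: mirror_def)
 moreover have "e <.> mirror e x = - (e <.> x)" using ee by (simp add: mirror_def inner_diff_right inner_commute)
 ultimately show ?thesis using x by (simp add: steiner_def)
qed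

lemma iterated_steiner:
 fixes S :: "'a::euclidean_space set"
 assumes "B <= Basis" and S: "S : sets borel" and D: "!!x y. x : S ==> y : S ==> dist x y <= D"
 shows "EX S' :: 'a set. S' : sets borel & emeasure lborel S' = emeasure lborel S & (ALL x:S'. ALL y:S'. dist x y <= D)
  & (ALL b:B. ALL x:S'. mirror b x : S')"
 using finite_subset[OF assms(1) finite_Basis] assms(1)
proof (induction B rule: finite_induct)
 case empty
 show ?case by (rule exI[of _ S]) (use S D in auto)
next
 case (insert e B)
 have "B <= Basis" using insert.prems by blast
 from insert.IH[OF this] obtain S' where S'0: "S' : sets borel" "emeasure lborel S' = emeasure lborel S"
  "ALL x:S'. ALL y:S'. dist x y <= D" "ALL b:B. ALL x:S'. mirror b x : S'"
  by metis
 have S': "S' : sets borel" "emeasure lborel S' = emeasure lborel S"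
  "!!x y. x : S' ==> y : S' ==> dist x y <= D" "!!b x. b : B ==> x : S' ==> mirror b x : S'"
  using S'0 by blast+
 have e: "norm e = 1" using insert by auto
 show ?case
 proof (intro exI[of _ "steiner S' e"] conjI ballI)
  show "steiner S' e : sets borel" using S' by measurable
  show "emeasure lborel (steiner S' e) = emeasure lborel S" using emeasure_steiner[OF S'(1) e S'(3)] S' by simp
  fix x assume x: "x : steiner S' e"
  show "dist x y <= D" if "y : steiner S' e" for y using dist_steiner[OF S'(1) e S'(3) x that] .
  fix b assume b: "b : insert e B"
  show "mirror b x : steiner S' e"
  proof (cases "b = e")
   case True thus ?thesis using steiner_mirror_self[OF S'(1) e x] by simp
  next
   case False
   hence "b <.> e = 0" "norm b = 1" using b insert by (auto intro: inner_not_same_Basis)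
   thus ?thesis using steiner_mirror[OF S'(1) _ _ S'(4) x, of b] b False by auto
  qed
 qed
qed

text \<open>After symmetrisation in every coordinate direction the set is invariant under all
  coordinate reflections, hence under the map from \<open>x\<close> to \<open>- x\<close>. These two
  points are \<open>2 * norm x\<close> apart, so the set lies in the ball of radius
  \<open>D / 2\<close>.\<close>

lemma isodiametric:
 fixes S :: "'a::euclidean_space set"
 assumes S: "S : sets borel" and D: "!!x y. x : S ==> y : S ==> dist x y <= D" and "0 <= D"
 shows "emeasure lborel S <= ennreal (unit_ball_vol (real DIM('a)) * (D / 2) ^ DIM('a))"
proof -
 obtain S' :: "'a set" where S'0: "S' : sets borel" "emeasure lborel S' = emeasure lborel S"
  "ALL x:S'. ALL y:S'. dist x y <= D" "ALL b:Basis. ALL x:S'. mirror b x : S'"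
  using iterated_steiner[OF order_refl S D] by metis
 have S': "S' : sets borel" "emeasure lborel S' = emeasure lborel S"
  "!!x y. x : S' ==> y : S' ==> dist x y <= D" "!!b x. b : Basis ==> x : S' ==> mirror b x : S'"
  using S'0 by blast+
 have part: "x - (SUM b:B. (2 * (x <.> b)) *R b) : S'" if "B <= Basis" "x : S'" for x B
  using finite_subset[OF that(1) finite_Basis] that(1)
 proof (induction B rule: finite_induct)
  case empty thus ?case using that by simp
 next
  case (insert b B)
  have b: "b : Basis" "B <= Basis" "b ~: B" using insert by auto
  have "(SUM c:B. (2 * (x <.> c)) *R c) <.> b = (SUM c:B. 0)"
   unfolding inner_sum_left using b by (intro sum.cong) (auto simp: inner_Basis subset_iff)
  hence "mirror b (x - (SUM c:B. (2 * (x <.> c)) *R c)) = x - (SUM c:insert b B. (2 * (x <.> c)) *R c)"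
   using insert by (simp add: mirror_def inner_diff_left algebra_simps)
  thus ?case using S'(4)[OF b(1) insert.IH[OF b(2)]] by simp
 qed
 have "S' <= cball 0 (D / 2)"
 proof
  fix x assume x: "x : S'"
  have "(SUM b:Basis. (2 * (x <.> b)) *R b) = 2 *R x"
   using euclidean_representation[of "2 *R x"] by simp
  hence "x - 2 *R x : S'" using part[OF order_refl x] by simp
  hence "dist x (- x) <= D" using S'(3)[OF x, of "- x"] by (simp add: scaleR_2)
  thus "x : cball 0 (D / 2)" by (simp add: dist_norm scaleR_2[symmetric])
 qed
 hence "emeasure lborel S' <= emeasure lborel (cball (0::'a) (D / 2))" by (rule emeasure_mono) simp
 thus ?thesis using S' assms by (simp add: emeasure_cball)
qed

text \<open>The members of a cover need not be measurable; their closures are, and have the same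
  diameter.\<close>

lemma emeasure_closure_le_hterm:
 fixes V :: "'a::euclidean_space set"
 assumes "bounded V"
 shows "emeasure lborel (closure V) <= hterm DIM('a) V"
proof (cases "V = {}")
 case False
 have "emeasure lborel (closure V) <= ennreal (unit_ball_vol (real DIM('a)) * (diameter V / 2) ^ DIM('a))"
 proof (rule isodiametric)
  fix x y assume "x : closure V" "y : closure V"
  thus "dist x y <= diameter V"
   using diameter_bounded_bound[of "closure V"] assms diameter_closure[OF assms] by auto
 qed (use assms diameter_ge_0 in auto)
 thus ?thesis using False by (simp add: hterm_def)
qed (simp add: hterm_def)

lemma emeasure_le_hausdorff_pre:
 fixes A :: "'a::euclidean_space set"
 assumes "A : sets borel"
 shows "emeasure lborel A <= hausdorff_pre DIM('a) dl A"
 unfolding hausdorff_pre_eq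
proof (rule INF_greatest)
 fix V assume "V : hcovers dl A"
 hence V: "A <= (\<Union>i. V i)" "!!i. bounded (V i)" by (auto simp: hcovers_def)
 have "A <= (\<Union>i. closure (V i))" using V(1) closure_subset by blast
 hence "emeasure lborel A <= emeasure lborel (\<Union>i. closure (V i))" by (rule emeasure_mono) simp
 also have "... <= (\<Sum>i. emeasure lborel (closure (V i)))"
  by (rule emeasure_subadditive_countably) auto
 also have "... <= (\<Sum>i. hterm DIM('a) (V i))"
  by (intro suminf_le emeasure_closure_le_hterm V(2)) auto
 finally show "emeasure lborel A <= (\<Sum>i. hterm DIM('a) (V i))" .
qed

lemma hterm_cball:
 fixes a :: "'a::euclidean_space"
 assumes "0 <= r"
 shows "hterm DIM('a) (cball a r) = emeasure lborel (cball a r)"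
 using assms by (simp add: hterm_def emeasure_cball)

lemma hausdorff_pre_Un:
 assumes "0 <= dl"
 shows "hausdorff_pre s dl (A Un B) <= hausdorff_pre s dl A + hausdorff_pre s dl B"
proof -
 have "hausdorff_pre s dl (\<Union>i. binaryset A B i) <= (\<Sum>i. hausdorff_pre s dl (binaryset A B i))"
  using assms by (rule hausdorff_pre_countably_subadditive)
 also have "... = hausdorff_pre s dl A + hausdorff_pre s dl B"
  using suminf_binaryset_eq[of "hausdorff_pre s dl" A B] by (simp add: hausdorff_pre_empty[OF assms])
 finally show ?thesis by (simp add: UN_binaryset_eq)
qed

text \<open>The null set lies in an open set of small measure. Disjoint balls in that open set,
  enlarged five times, cover the null set, at the price of the factor \<open>5 ^ DIM('a)\<close>
  that \<open>e'\<close> absorbs.\<close>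

lemma hausdorff_pre_null:
 fixes N :: "'a::euclidean_space set"
 assumes N: "N : null_sets lborel" and "0 < dl"
 shows "hausdorff_pre DIM('a) dl N = 0"
proof -
 have "hausdorff_pre DIM('a) dl N <= 0 + ennreal e" if e: "0 < e" for e
 proof -
  define e' where "e' = e / 5 ^ DIM('a)"
  have "0 < e'" using e by (simp add: e'_def)
  moreover have "N : sets borel" using N by auto
  ultimately obtain V where V: "open V" "N <= V" "emeasure lborel (V - N) < ennreal e'"
   using outer_regular_lborel by metis
  have "emeasure lborel V <= emeasure lborel N + emeasure lborel (V - N)"
   using emeasure_subadditive[of N lborel "V - N"] V N by (auto simp: Un_absorb1)
  hence Ve: "emeasure lborel V <= ennreal e'" using V(3) N by (auto simp: null_sets_def)
  \<comment> \<open>Radii of at most \<open>dl / 10\<close> leave the enlarged balls with diameter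
    at most \<open>dl\<close>.\<close>
  have "EX r. 0 < r & r <= dl / 10 & cball x r <= V" if x: "x : N" for x
  proof -
   obtain r where "0 < r" "cball x r <= V" using V x open_contains_cball by blast
   thus ?thesis using `0 < dl` by (intro exI[of _ "min r (dl / 10)"]) auto
  qed
  then obtain r where r: "!!x. x : N ==> 0 < r x & r x <= dl / 10" "!!x. x : N ==> cball x (r x) <= V"
   by metis
  obtain C where C: "countable C" "C <= N" "pairwise (%i j. disjnt (cball i (r i)) (cball j (r j))) C"
   "N <= (UN i:C. cball i (5 * r i))"
  proof (rule Vitali_covering_lemma_cballs[where S=N and K=N and a="%x. x" and r=r and B="dl / 10"])
   show "N <= (UN i:N. cball i (r i))" using r(1) by force
  qed (use r that in auto)
  have "hausdorff_pre DIM('a) dl N <= (\<integral>\<^sup>+x. hterm DIM('a) (cball x (5 * r x)) \<partial>count_space C)"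
  proof (rule hausdorff_pre_le_countable[OF C(1,4)])
   fix x assume "x : C"
   thus "bounded (cball x (5 * r x)) & diameter (cball x (5 * r x)) <= dl"
    using r(1)[of x] C(2) by auto
  qed (use `0 < dl` in simp)
  also have "... = (\<integral>\<^sup>+x. ennreal (5 ^ DIM('a)) * emeasure lborel (cball x (r x)) \<partial>count_space C)"
  proof (rule nn_integral_cong)
   fix x assume "x : space (count_space C)"
   hence "0 < r x" using r(1)[of x] C(2) by auto
   thus "hterm DIM('a) (cball x (5 * r x)) = ennreal (5 ^ DIM('a)) * emeasure lborel (cball x (r x))"
    by (simp add: hterm_cball emeasure_cball power_mult_distrib ennreal_mult[symmetric] mult_ac)
  qed
  also have "... = ennreal (5 ^ DIM('a)) * (\<integral>\<^sup>+x. emeasure lborel (cball x (r x)) \<partial>count_space C)"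
   by (rule nn_integral_cmult) simp
  also have "(\<integral>\<^sup>+x. emeasure lborel (cball x (r x)) \<partial>count_space C) = emeasure lborel (UN x:C. cball x (r x))"
   using C(1,3) by (intro emeasure_UN_countable[symmetric]) (auto simp: disjoint_family_on_def pairwise_def disjnt_def)
  also have "... <= emeasure lborel V"
   using r(2) C(2) V(1) by (intro emeasure_mono) auto
  also have "... <= ennreal e'" by (rule Ve)
  also have "ennreal (5 ^ DIM('a)) * ennreal e' = ennreal e"
   using e by (simp add: e'_def ennreal_mult[symmetric])
  finally show ?thesis by (simp add: mult_left_mono)
 qed
 hence "hausdorff_pre DIM('a) dl N <= 0" by (rule ennreal_le_epsilon)
 thus ?thesis by simp
qed

text \<open>Vitali's theorem fills \<open>G\<close> with small disjoint balls up to a null set, and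
  for a ball the summand of the premeasure is exactly its Lebesgue measure.\<close>

lemma hausdorff_pre_open_le:
 fixes G :: "'a::euclidean_space set"
 assumes "open G" and dl: "0 < dl"
 shows "hausdorff_pre DIM('a) dl G <= emeasure lborel G"
proof -
 define K where "K = {(x, r). 0 < r & r <= dl / 2 & cball x r <= G}"
 obtain C where C: "countable C" "C <= K" "pairwise (%i j. disjnt (cball (fst i) (snd i)) (cball (fst j) (snd j))) C"
  "negligible (G - (UN i:C. cball (fst i) (snd i)))"
 proof (rule Vitali_covering_theorem_cballs[of K snd G fst])
  show "0 < snd i" if "i : K" for i using that by (auto simp: K_def)
  fix x d assume x: "x : G" and d: "(0::real) < d"
  obtain r where r: "0 < r" "cball x r <= G" using assms x open_contains_cball by blast
  hence "(x, min r (min (dl / 2) (d / 2))) : K" using dl d by (auto simp: K_def)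
  thus "EX i. i : K & x : cball (fst i) (snd i) & snd i < d"
   by (rule_tac x="(x, min r (min (dl / 2) (d / 2)))" in exI) (use r dl d in \<open>auto simp: min_def\<close>)
 qed (use that in blast)
 define W where "W = (UN i:C. cball (fst i) (snd i))"
 have [measurable]: "W : sets borel" unfolding W_def using C(1) by (intro sets.countable_UN') auto
 have WG: "W <= G"
 proof -
  have "cball (fst i) (snd i) <= G" if "i : C" for i using subsetD[OF C(2) that] by (simp add: K_def case_prod_beta)
  thus ?thesis unfolding W_def by blast
 qed
 have "G - W : null_sets lborel"
  using C(4) assms by (auto simp: W_def[symmetric] negligible_iff_null_sets null_sets_def null_sets_completion_iff)
 hence 0: "hausdorff_pre DIM('a) dl (G - W) = 0" using dl by (rule hausdorff_pre_null)
 have "hausdorff_pre DIM('a) dl W <= (\<integral>\<^sup>+i. hterm DIM('a) (cball (fst i) (snd i)) \<partial>count_space C)"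
 proof (rule hausdorff_pre_le_countable[OF C(1)])
  fix i assume "i : C"
  thus "bounded (cball (fst i) (snd i)) & diameter (cball (fst i) (snd i)) <= dl"
   using C(2) by (auto simp: K_def)
 qed (use dl in \<open>auto simp: W_def\<close>)
 also have "... = (\<integral>\<^sup>+i. emeasure lborel (cball (fst i) (snd i)) \<partial>count_space C)"
  by (intro nn_integral_cong hterm_cball) (use C(2) in \<open>auto simp: K_def\<close>)
 also have "... = emeasure lborel W"
  unfolding W_def using C(1,3)
  by (intro emeasure_UN_countable[symmetric]) (auto simp: disjoint_family_on_def pairwise_def disjnt_def)
 also have "... <= emeasure lborel G" using WG assms by (intro emeasure_mono) auto
 finally have "hausdorff_pre DIM('a) dl W <= emeasure lborel G" .
 moreover have "hausdorff_pre DIM('a) dl G <= hausdorff_pre DIM('a) dl W + hausdorff_pre DIM('a) dl (G - W)"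
  using hausdorff_pre_Un[of dl "DIM('a)" W "G - W"] WG dl by (simp add: Un_absorb1)
 ultimately show ?thesis using 0 by simp
qed

theorem hausdorff_outer_eq_lborel:
 fixes A :: "'a::euclidean_space set"
 assumes A: "A : sets borel"
 shows "hausdorff_outer DIM('a) A = emeasure lborel A"
proof (rule antisym)
 show "emeasure lborel A <= hausdorff_outer DIM('a) A"
  using emeasure_le_hausdorff_pre[OF A, of 1] hausdorff_pre_le_outer[of 1 "DIM('a)" A] by simp
 show "hausdorff_outer DIM('a) A <= emeasure lborel A"
  unfolding hausdorff_outer_def
 proof (rule SUP_least)
  fix dl :: real assume dl: "dl : {0<..}"
  show "hausdorff_pre DIM('a) dl A <= emeasure lborel A"
  proof (rule ennreal_le_epsilon)
   fix e :: real assume "0 < e"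
   then obtain V where V: "open V" "A <= V" "emeasure lborel (V - A) < ennreal e"
    using outer_regular_lborel[OF A] by metis
   have "hausdorff_pre DIM('a) dl A <= hausdorff_pre DIM('a) dl V" by (rule hausdorff_pre_mono[OF V(2)])
   also have "... <= emeasure lborel V" using V(1) dl by (intro hausdorff_pre_open_le) auto
   also have "... <= emeasure lborel A + emeasure lborel (V - A)"
    using emeasure_subadditive[of A lborel "V - A"] V A by (auto simp: Un_absorb1)
   also have "... <= emeasure lborel A + ennreal e" using V(3) by (intro add_left_mono) simp
   finally show "hausdorff_pre DIM('a) dl A <= emeasure lborel A + ennreal e" .
  qed
 qed
qed

lemma
 fixes j :: "'a::metric_space => 'b::metric_space"
 assumes j: "!!x y. dist (j x) (j y) = dist x y"
 shows diameter_isometry: "diameter (j ` V) = diameter V"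
  and bounded_isometry: "bounded (j ` V) <-> bounded V"
proof -
 show "diameter (j ` V) = diameter V"
  unfolding diameter_def by (auto simp: j image_image case_prod_unfold intro!: arg_cong[where f=Sup])
   (force simp: image_iff j)+
 show "bounded (j ` V) <-> bounded V"
  unfolding bounded_two_points by (auto simp: j)
qed

text \<open>\<open>j\<close> need not be onto, since hyperplanes will be embedded in a space of
  higher dimension. A cover of the image is therefore pulled back by preimages, whose images under
  \<open>j\<close> are subsets of the covering sets.\<close>

lemma hausdorff_outer_isometry:
 fixes j :: "'a::metric_space => 'b::metric_space"
 assumes j: "!!x y. dist (j x) (j y) = dist x y"
 shows "hausdorff_outer s (j ` A) = hausdorff_outer s A"
proof -
 have ht: "hterm s (j ` V) = hterm s V" for V by (simp add: hterm_def diameter_isometry[OF j])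
 have "hausdorff_pre s dl (j ` A) = hausdorff_pre s dl A" for dl
 proof (rule antisym)
  show "hausdorff_pre s dl (j ` A) <= hausdorff_pre s dl A"
   unfolding hausdorff_pre_eq[of s dl A]
  proof (rule INF_greatest)
   fix V assume V: "V : hcovers dl A"
   have "j ` A <= (\<Union>i. j ` V i)" using V unfolding hcovers_def by blast
   hence "(%i. j ` V i) : hcovers dl (j ` A)"
    using V by (simp add: hcovers_def diameter_isometry[OF j] bounded_isometry[OF j])
   hence "hausdorff_pre s dl (j ` A) <= (\<Sum>i. hterm s (j ` V i))"
    unfolding hausdorff_pre_eq by (rule INF_lower2) simp
   thus "hausdorff_pre s dl (j ` A) <= (\<Sum>i. hterm s (V i))" by (simp add: ht)
  qed
  show "hausdorff_pre s dl A <= hausdorff_pre s dl (j ` A)"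
   unfolding hausdorff_pre_eq[of s dl "j ` A"]
  proof (rule INF_greatest)
   fix V assume V: "V : hcovers dl (j ` A)"
   have sub: "j ` (j -` V i) <= V i" for i by auto
   have Vb: "bounded (V i)" "diameter (V i) <= dl" for i using V by (auto simp: hcovers_def)
   have "diameter (j ` (j -` V i)) <= dl" for i
    using diameter_subset[OF sub Vb(1), of i] Vb(2)[of i] by linarith
   hence "diameter (j -` V i) <= dl" for i by (simp only: diameter_isometry[OF j])
   moreover have "bounded (j -` V i)" for i
    using bounded_subset[OF Vb(1) sub, of i] by (simp only: bounded_isometry[OF j])
   moreover have "A <= (\<Union>i. j -` V i)" using V unfolding hcovers_def by blast
   ultimately have "(%i. j -` V i) : hcovers dl A" by (simp add: hcovers_def)
   hence "hausdorff_pre s dl A <= (\<Sum>i. hterm s (j -` V i))"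
    unfolding hausdorff_pre_eq by (rule INF_lower2) simp
   also have "... <= (\<Sum>i. hterm s (V i))"
   proof (intro suminf_le)
    show "hterm s (j -` V i) <= hterm s (V i)" for i
     using hterm_mono[OF sub Vb(1), of s i] by (simp only: ht)
   qed auto
   finally show "hausdorff_pre s dl A <= (\<Sum>i. hterm s (V i))" .
  qed
 qed
 thus ?thesis by (simp add: hausdorff_outer_def)
qed

text \<open>In space dimension one the faces are points. With exponent 0 every nonempty covering set
  costs exactly one.\<close>

lemma hausdorff_outer_0_singleton: "hausdorff_outer 0 {p} = 1"
proof -
 have "hausdorff_pre 0 dl {p} = 1" if "0 < dl" for dl
 proof (rule antisym)
  have "(%i. if i = 0 then {p} else {}) : hcovers dl {p}" using that by (auto simp: hcovers_def)
  hence "hausdorff_pre 0 dl {p} <= (\<Sum>i::nat. hterm 0 (if i = 0 then {p} else {}))"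
   unfolding hausdorff_pre_eq by (rule INF_lower2) simp
  also have "... = (SUM i:{0::nat}. hterm 0 (if i = 0 then {p} else {}))"
   by (rule suminf_finite) (auto simp: hterm_def)
  finally show "hausdorff_pre 0 dl {p} <= 1" by (simp add: hterm_def)
  show "1 <= hausdorff_pre 0 dl {p}" unfolding hausdorff_pre_eq
  proof (rule INF_greatest)
   fix V assume "V : hcovers dl {p}"
   then obtain i where i: "p : V i" by (auto simp: hcovers_def)
   have "1 = hterm 0 (V i)" using i by (auto simp: hterm_def)
   also have "... <= (\<Sum>i. hterm 0 (V i))"
    using sum_le_suminf[of "%i. hterm 0 (V i)" "{i}"] by simp
   finally show "1 <= (\<Sum>i. hterm 0 (V i))" .
  qed
 qed
 thus ?thesis by (simp add: hausdorff_outer_def)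
qed

lemma inner_of_linear_isometry:
 fixes T :: "'a::real_inner => 'b::real_inner"
 assumes "linear T" "!!x. norm (T x) = norm x"
 shows "T x <.> T y = x <.> y"
proof -
 have "T x <.> T y = ((norm (T x + T y))^2 - (norm (T x))^2 - (norm (T y))^2) / 2"
  by (rule dot_norm)
 also have "... = ((norm (x + y))^2 - (norm x)^2 - (norm y)^2) / 2"
  using assms by (simp add: linear_add[symmetric])
 finally show ?thesis by (simp add: dot_norm)
qed

text \<open>Lebesgue measure is the Hausdorff measure of full dimension, hence invariant under isometries.\<close>

lemma linear_isometry_to_cart:
 fixes w :: "'a::euclidean_space" and n :: "real^'d"
 assumes dim: "DIM('a) = CARD('d)" and "norm w = 1" "norm n = 1"
 obtains T :: "'a => real^'d" where "linear T" "!!x y. T x <.> T y = x <.> y" "!!x. norm (T x) = norm x"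
  "surj T" "T w = n" "T : borel_measurable borel"
  "!!A. A : sets borel ==> emeasure lborel (T -` A) = emeasure lborel A"
proof -
 have "DIM('a) = DIM(real^'d)" using dim by simp
 then obtain f :: "'a => real^'d" and g where f: "linear f" "linear g" "!!x. norm (f x) = norm x"
  "!!x. f (g x) = x" "!!x. g (f x) = x"
  by (rule isomorphisms_UNIV_UNIV) blast
 obtain Q where Q: "orthogonal_transformation Q" "Q (f w) = n"
  using orthogonal_transformation_exists[of "f w" n] assms f(3) by auto
 define T where "T = Q \<circ> f"
 have lin: "linear T" unfolding T_def using f(1) Q(1) by (intro linear_compose) (auto simp: orthogonal_transformation_linear)
 have nrm: "norm (T x) = norm x" for x
  using f(3) orthogonal_transformation_norm[OF Q(1)] by (simp add: T_def)
 have "surj f" using f(4) by (metis surjI)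
 hence surj: "surj T" unfolding T_def using orthogonal_transformation_surj[OF Q(1)] by (rule comp_surj)
 have cont: "continuous_on UNIV T" using lin by (simp add: linear_continuous_on linear_conv_bounded_linear)
 hence meas: "T : borel_measurable borel" by (rule borel_measurable_continuous_onI)
 have "emeasure lborel (T -` A) = emeasure lborel A" if "A : sets borel" for A
 proof -
  have B: "T -` A : sets borel" using measurable_sets[OF meas that] by simp
  have d: "dist (T x) (T y) = dist x y" for x y
   using nrm[of "x - y"] lin by (simp add: dist_norm linear_diff)
  have "emeasure lborel A = hausdorff_outer DIM(real^'d) (T ` (T -` A))"
   using hausdorff_outer_eq_lborel[OF that] surj by (simp add: surj_image_vimage_eq)
  also have "... = hausdorff_outer DIM('a) (T -` A)"
   using dim by (simp only: hausdorff_outer_isometry[OF d]) simp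
  also have "... = emeasure lborel (T -` A)" by (rule hausdorff_outer_eq_lborel[OF B])
  finally show ?thesis by simp
 qed
 thus ?thesis
  using that[OF lin inner_of_linear_isometry[OF lin nrm] nrm surj _ meas] Q(2) by (simp add: T_def)
qed

section \<open>Surface measure on hyperplanes\<close>

text \<open>Projection along \<open>e\<close> onto the hyperplane with normal \<open>n\<close> and
  offset \<open>b\<close>, for \<open>e\<close> transversal to it.\<close>

definition plane_proj :: "'a::real_inner => real => 'a => 'a => 'a" where
 "plane_proj n b e x = x + ((b - n <.> x) / (n <.> e)) *R e"

text \<open>The right prism of height one over \<open>A\<close> expresses a surface measure as a
  volume of the ambient space, so that no chart of the hyperplane has to be carried along.\<close>

abbreviation "prism n b A == {x. b < n <.> x & n <.> x < b + 1 & plane_proj n b n x : A}"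

text \<open>The type \<open>'e\<close> is a model of the hyperplane: an isometry of
  \<open>'e \<times> real\<close> with the whole space sends the last unit vector to
  \<open>n\<close> and turns the product of a subset of \<open>'e\<close> with an interval of length
  one into the prism. \<open>surface_hyperplane\<close> instantiates \<open>'e\<close> for
  dimensions two and three.\<close>

lemma surface_hyperplane_via:
 fixes n :: "real^'d" and b :: real and A :: "(real^'d) set"
 assumes dim: "DIM('e::euclidean_space) + 1 = CARD('d)" and n: "norm n = 1"
  and A: "A : sets borel" "A <= {x. n <.> x = b}"
 shows "emeasure surface_measure A = emeasure lborel (prism n b A)"
proof -
 have "DIM('e \<times> real) = CARD('d)" using dim by simp
 then obtain T :: "'e \<times> real => real^'d" where T: "linear T" "!!x y. T x <.> T y = x <.> y" "!!x. norm (T x) = norm x"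
  "surj T" "T (0, 1) = n" and [measurable]: "T : borel_measurable borel"
  and Te: "!!A. A : sets borel ==> emeasure lborel (T -` A) = emeasure lborel A"
  by (rule linear_isometry_to_cart[where w = "(0, 1)" and n = n]) (use n in \<open>auto simp: norm_Pair\<close>)
 define j where "j y = T (y, b)" for y
 have nT: "n <.> T (y, s) = s" for y s using T(2)[of "(0, 1)" "(y, s)"] T(5) by (simp add: inner_Pair)
 have [measurable]: "j : borel_measurable borel"
  unfolding j_def by (rule measurable_compose[of "%y. (y, b)" borel borel T]) (auto intro: borel_measurable_continuous_onI continuous_intros)
 have "T x - T y = T (x - y)" for x y using T(1) by (simp add: linear_diff)
 hence jd: "dist (j x) (j y) = dist x y" for x y
  using T(3)[of "(x, b) - (y, b)"] by (simp add: j_def dist_norm norm_Pair)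
 have [measurable]: "A : sets borel" by fact
 have B: "j -` A : sets borel" using measurable_sets[of j borel borel A] A by simp
 have AB: "A = j ` (j -` A)"
 proof -
  have "x : range j" if "x : A" for x
  proof -
   obtain y s where x: "x = T (y, s)" using T(4) by (metis surj_def surj_pair)
   have "s = b" using A(2) that nT[of y s] x by auto
   thus ?thesis using x by (auto simp: j_def)
  qed
  thus ?thesis by (auto simp: image_vimage_eq)
 qed
 have s: "CARD('d) - 1 = DIM('e)" using dim by simp
 have "emeasure surface_measure A = hausdorff_outer DIM('e) (j ` (j -` A))"
  using emeasure_hausdorff_measure[OF A(1)] AB s by simp
 also have "... = emeasure lborel (j -` A)"
  by (simp only: hausdorff_outer_isometry[OF jd] hausdorff_outer_eq_lborel[OF B])
 also have "... = emeasure (lborel \<Otimes>\<^sub>M lborel) ((j -` A) \<times> {b<..<b + 1})"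
  using B by (subst lborel.emeasure_pair_measure_Times) auto
 also have "... = emeasure lborel ((j -` A) \<times> {b<..<b + 1})" by (simp add: lborel_prod)
 also have "(j -` A) \<times> {b<..<b + 1} = T -` (prism n b A)"
 proof -
  have nn: "n <.> n = 1" using n by (simp add: norm_eq_1)
  have "plane_proj n b n (T (y, s)) = j y" for y s
  proof -
   have "plane_proj n b n (T (y, s)) = T (y, s) + (b - s) *R T (0, 1)"
    by (simp add: plane_proj_def nn nT T(5))
   also have "... = T ((y, s) + (b - s) *R (0, 1))" using T(1) by (simp only: linear_add linear_cmul)
   finally show ?thesis by (simp add: j_def)
  qed
  thus ?thesis by (auto simp: nT)
 qed
 also have "emeasure lborel ... = emeasure lborel (prism n b A)"
  by (rule Te) (unfold plane_proj_def, measurable)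
 finally show ?thesis .
qed

text \<open>In dimension one the hyperplane is a single point, which no Euclidean space of positive
  dimension models; both sides are 1 unless \<open>A\<close> is empty.\<close>

lemma surface_hyperplane_dim1:
 fixes n :: "real^'d" and b :: real and A :: "(real^'d) set"
 assumes dim: "CARD('d) = 1" and n: "norm n = 1" and A: "A : sets borel" "A <= {x. n <.> x = b}"
 shows "emeasure surface_measure A = emeasure lborel (prism n b A)"
proof -
 have "DIM(real) = CARD('d)" using dim by simp
 then obtain T :: "real => real^'d" where T: "linear T" "!!x y. T x <.> T y = x <.> y" "!!x. norm (T x) = norm x"
  "surj T" "T 1 = n" and [measurable]: "T : borel_measurable borel"
  and Te: "!!A. A : sets borel ==> emeasure lborel (T -` A) = emeasure lborel A"
  by (rule linear_isometry_to_cart[where w = 1 and n = n]) (use n in auto)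
 have nT: "n <.> T s = s" for s using T(2)[of 1 s] T(5) by simp
 have nn: "n <.> n = 1" using n by (simp add: norm_eq_1)
 have Ts: "T s = s *R n" for s using linear_cmul[OF T(1), of s 1] T(5) by simp
 have pt: "x = b *R n" if "n <.> x = b" for x
  using T(4) nT Ts that by (metis surjD)
 have pp: "plane_proj n b n x = b *R n" for x
  by (rule pt) (simp add: plane_proj_def inner_add_right nn)
 show ?thesis
 proof (cases "A = {}")
  case False
  hence Ab: "A = {b *R n}" using A(2) pt by blast
  have "emeasure lborel {x. b < n <.> x & n <.> x < b + 1} = emeasure lborel (T -` {x. b < n <.> x & n <.> x < b + 1})"
   by (rule Te[symmetric]) measurable
  also have "T -` {x. b < n <.> x & n <.> x < b + 1} = {b<..<b+1}" by (auto simp: nT)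
  finally have "emeasure lborel {x. b < n <.> x & n <.> x < b + 1} = 1" by simp
  moreover have "emeasure surface_measure A = 1"
   using emeasure_hausdorff_measure[OF A(1)] dim by (simp add: Ab hausdorff_outer_0_singleton)
  ultimately show ?thesis by (simp add: pp Ab)
 qed simp
qed

lemma surface_hyperplane:
 fixes n :: "real^'d" and b :: real and A :: "(real^'d) set"
 assumes dim: "CARD('d) : {1, 2, 3}" and n: "norm n = 1" and A: "A : sets borel" "A <= {x. n <.> x = b}"
 shows "emeasure surface_measure A = emeasure lborel (prism n b A)"
proof -
 consider "CARD('d) = 1" | "CARD('d) = 2" | "CARD('d) = 3" using dim by auto
 thus ?thesis
 proof cases
  case 1 thus ?thesis using surface_hyperplane_dim1[OF _ n A] by simp
 next
  case 2 thus ?thesis using surface_hyperplane_via[where 'e=real, OF _ n A] by simp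
 next
  case 3 thus ?thesis using surface_hyperplane_via[where 'e="real \<times> real", OF _ n A] by simp
 qed
qed

text \<open>A slab whose width along the line direction is one meets every line in a segment of parameter length one,
 so the shear below can be undone by a translation on each line parallel to \<open>w\<close>.\<close>

lemma nn_integral_shear:
 fixes n w :: "'a::euclidean_space"
 assumes [measurable]: "h : borel_measurable borel" and nw: "n <.> w = 0"
 shows "(\<integral>\<^sup>+x. h (x + (n <.> x - b) *R w) \<partial>lborel) = (\<integral>\<^sup>+x. h x \<partial>lborel)"
proof (cases "w = 0")
 case False
 define T where "T = {y. 0 < w <.> y & w <.> y < 0 + \<bar>w <.> w\<bar>}"
 have T: "T : sets borel" "!!x. emeasure lborel {s::real. x - s *R w : T} = 1"
  unfolding T_def using emeasure_slab_line[of w w _ 0] False by auto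
 have "(\<integral>\<^sup>+s. h (x + s *R w + (n <.> (x + s *R w) - b) *R w) \<partial>lborel) = (\<integral>\<^sup>+s. h (x + s *R w) \<partial>lborel)" for x
 proof -
  have "(\<integral>\<^sup>+s. h (x + s *R w + (n <.> (x + s *R w) - b) *R w) \<partial>lborel)
    = (\<integral>\<^sup>+s. h (x + (s + (n <.> x - b)) *R w) \<partial>lborel)"
   using nw by (simp add: inner_add_right algebra_simps)
  also have "... = (\<integral>\<^sup>+s. h (x + s *R w) \<partial>lborel)"
   by (rule nn_integral_lborel_shift[of "%s. h (x + s *R w)"]) measurable
  finally show ?thesis .
 qed
 thus ?thesis
  using nn_integral_lines[OF T, of "%x. h (x + (n <.> x - b) *R w)"] nn_integral_lines[OF T, of h] by simp
qed simp

lemma plane_proj_line: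
 assumes "n <.> e ~= 0"
 shows "plane_proj n b e (x + s *R e) = plane_proj n b e x" and "n <.> plane_proj n b e x = b"
 using assms by (simp_all add: plane_proj_def inner_add_right field_simps scaleR_add_left[symmetric] del: scaleR_add_left)

lemma plane_proj_measurable [measurable]:
 "plane_proj n b (e::'a::euclidean_space) : borel_measurable borel"
 unfolding plane_proj_def by measurable

text \<open>Three volumes are compared: the part of \<open>T\<close> projecting into
  \<open>A\<close>, the slanted prism over \<open>A\<close> with edge \<open>e\<close>, and the
  right prism of height \<open>n <.> e\<close>. The first two have the same length on each line
  along \<open>e\<close> when averaged over \<open>T\<close>, a shear relates the last two, and the
  right prism scales with its height.\<close>

lemma surface_oblique_pos:
 fixes n e :: "real^'d" and b :: real and A :: "(real^'d) set"
 assumes dim: "CARD('d) : {1, 2, 3}" and n: "norm n = 1" and pos: "0 < n <.> e"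
  and T[measurable]: "T : sets borel" and T1: "!!x. emeasure lborel {s::real. x - s *R e : T} = 1"
  and A[measurable]: "A : sets borel" and AH: "A <= {x. n <.> x = b}"
 shows "emeasure lborel {x : T. plane_proj n b e x : A} = ennreal (n <.> e) * emeasure surface_measure A"
proof -
 define m where "m = n <.> e"
 have m: "0 < m" using pos by (simp add: m_def)
 have nn: "n <.> n = 1" using n by (simp add: norm_eq_1)
 define S where "S = {x. b < n <.> x & n <.> x < b + m & plane_proj n b e x : A}"
 define S' where "S' = {x. b < n <.> x & n <.> x < b + m & plane_proj n b n x : A}"
 have [measurable]: "S : sets borel" "S' : sets borel" unfolding S_def S'_def by measurable
 have 1: "emeasure lborel {s::real. b < n <.> (x + s *R e) & n <.> (x + s *R e) < b + m} = 1" for x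
 proof -
  have "{s::real. b < n <.> (x + s *R e) & n <.> (x + s *R e) < b + m} = {(b - n <.> x) / m<..<(b - n <.> x) / m + 1}"
   using m by (auto simp: inner_add_right m_def[symmetric] field_simps)
  thus ?thesis by simp
 qed
 have "emeasure lborel S = (\<integral>\<^sup>+x. indicator S x \<partial>lborel)" by simp
 also have "... = (\<integral>\<^sup>+x. (\<integral>\<^sup>+s. indicator S (x + s *R e) \<partial>lborel) * indicator T x \<partial>lborel)"
  by (rule nn_integral_lines[OF T T1]) measurable
 also have "... = (\<integral>\<^sup>+x. indicator {x : T. plane_proj n b e x : A} x \<partial>lborel)"
 proof (rule nn_integral_cong)
  fix x
  have "(\<integral>\<^sup>+s. indicator S (x + s *R e) \<partial>lborel)
   = (\<integral>\<^sup>+s. indicator {s. b < n <.> (x + s *R e) & n <.> (x + s *R e) < b + m} s * indicator A (plane_proj n b e x) \<partial>lborel)"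
   using pos by (intro nn_integral_cong) (auto simp: S_def indicator_def plane_proj_line)
  also have "... = indicator A (plane_proj n b e x)"
   using 1[of x] by (subst nn_integral_multc) auto
  finally show "(\<integral>\<^sup>+s. indicator S (x + s *R e) \<partial>lborel) * indicator T x = indicator {x : T. plane_proj n b e x : A} x"
   by (simp split: split_indicator)
 qed
 also have "... = emeasure lborel {x : T. plane_proj n b e x : A}" by simp
 finally have i: "emeasure lborel {x : T. plane_proj n b e x : A} = emeasure lborel S" ..
 \<comment> \<open>\<open>w\<close> is tangential, and the shear by \<open>w\<close> sends the
   rescaled edge \<open>(1 / m) *R e\<close> of the slanted prism to the normal
   \<open>n\<close>.\<close>
 define w where "w = n - (1 / m) *R e"
 have nw: "n <.> w = 0" using m by (simp add: w_def inner_diff_right nn m_def)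
 have "indicator S x = (indicator S' (x + (n <.> x - b) *R w) :: ennreal)" for x
 proof -
  have "n <.> (x + (n <.> x - b) *R w) = n <.> x" by (simp add: inner_add_right nw)
  moreover have "plane_proj n b n (x + (n <.> x - b) *R w) = plane_proj n b e x"
   using m by (simp add: plane_proj_def inner_add_right nw nn m_def[symmetric] w_def algebra_simps diff_divide_distrib)
  ultimately show ?thesis by (simp add: S_def S'_def indicator_def)
 qed
 hence "(\<integral>\<^sup>+x. indicator S x \<partial>lborel) = (\<integral>\<^sup>+x. indicator S' x \<partial>lborel)"
  using nn_integral_shear[of "indicator S'" n w b] nw by simp
 hence ii: "emeasure lborel S = emeasure lborel S'" by simp
 define Tn where "Tn = {y. b < n <.> y & n <.> y < b + \<bar>n <.> n\<bar>}"
 have Tn: "Tn : sets borel" "!!x. emeasure lborel {s::real. x - s *R n : Tn} = 1"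
  unfolding Tn_def using emeasure_slab_line[of n n _ b] nn by auto
 have "emeasure lborel S' = (\<integral>\<^sup>+x. indicator S' x \<partial>lborel)" by simp
 also have "... = (\<integral>\<^sup>+x. (\<integral>\<^sup>+s. indicator S' (x + s *R n) \<partial>lborel) * indicator Tn x \<partial>lborel)"
  by (rule nn_integral_lines[OF Tn]) measurable
 also have "... = (\<integral>\<^sup>+x. ennreal m * indicator (prism n b A) x \<partial>lborel)"
 proof (rule nn_integral_cong)
  fix x
  have "(\<integral>\<^sup>+s. indicator S' (x + s *R n) \<partial>lborel)
   = (\<integral>\<^sup>+s. indicator {b - n <.> x<..<b - n <.> x + m} s * indicator A (plane_proj n b n x) \<partial>lborel)"
   using nn by (intro nn_integral_cong) (auto simp: S'_def indicator_def plane_proj_line inner_add_right)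
  also have "... = ennreal m * indicator A (plane_proj n b n x)"
   using m by (subst nn_integral_multc) auto
  finally show "(\<integral>\<^sup>+s. indicator S' (x + s *R n) \<partial>lborel) * indicator Tn x
    = ennreal m * indicator (prism n b A) x"
   by (simp add: Tn_def nn split: split_indicator)
 qed
 also have "... = ennreal m * emeasure lborel (prism n b A)"
  by (subst nn_integral_cmult_indicator) auto
 also have "... = ennreal m * emeasure surface_measure A"
  using surface_hyperplane[OF dim n A AH] by simp
 finally show ?thesis using i ii by (simp add: m_def)
qed

lemma surface_oblique:
 fixes n e :: "real^'d" and b :: real and A :: "(real^'d) set"
 assumes dim: "CARD('d) : {1, 2, 3}" and n: "norm n = 1" and ne: "n <.> e ~= 0"
  and T: "T : sets borel" and T1: "!!x. emeasure lborel {s::real. x - s *R e : T} = 1"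
  and A: "A : sets borel" "A <= {x. n <.> x = b}"
 shows "emeasure lborel {x : T. plane_proj n b e x : A} = ennreal \<bar>n <.> e\<bar> * emeasure surface_measure A"
proof (cases "0 < n <.> e")
 case True thus ?thesis using surface_oblique_pos[OF dim n True T T1 A] by simp
next
 case False
 hence neg: "0 < (- n) <.> e" using ne by simp
 have "(- b - (- n) <.> x) / ((- n) <.> e) = (b - n <.> x) / (n <.> e)" for x
  using ne by (simp add: field_simps)
 hence pp: "plane_proj n b e x = plane_proj (- n) (- b) e x" for x
  by (simp only: plane_proj_def)
 have "emeasure lborel {x : T. plane_proj (- n) (- b) e x : A} = ennreal ((- n) <.> e) * emeasure surface_measure A"
  by (rule surface_oblique_pos[OF dim _ neg T T1 A(1)]) (use n A(2) in auto)
 thus ?thesis using neg by (simp only: pp) simp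
qed

text \<open>Completeness makes the integrands on faces measurable: traces and normals are specified
  only almost everywhere, and agreement almost everywhere with a Borel function is then
  enough.\<close>

lemma complete_measure_hausdorff: "complete_measure (hausdorff_measure s :: 'a::metric_space measure)"
proof
 fix A B :: "'a set" assume "B <= A" "A : null_sets (hausdorff_measure s)"
 hence A: "hausdorff_outer s A = 0" "A : lambda_system UNIV UNIV (hausdorff_outer s)"
  using emeasure_hausdorff_lambda[of A s] by (auto simp: null_sets_def sets_hausdorff_measure)
 have mono: "hausdorff_outer s X <= hausdorff_outer s Y" if "X <= Y" for X Y :: "'a set"
  using outer_measure_space_hausdorff[of s, where 'a='a] that by (auto simp: outer_measure_space_def increasing_def)
 have "hausdorff_outer s (B Int X) + hausdorff_outer s ((UNIV - B) Int X) = hausdorff_outer s X" for X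
 proof (rule antisym)
  have "hausdorff_outer s (B Int X) = 0" using mono[of "B Int X" A] `B <= A` A(1) by auto
  thus "hausdorff_outer s (B Int X) + hausdorff_outer s ((UNIV - B) Int X) <= hausdorff_outer s X"
   by (simp add: mono)
  have "hausdorff_outer s X = hausdorff_outer s (A Int X) + hausdorff_outer s ((UNIV - A) Int X)"
   using A(2) by (simp add: lambda_system_def)
  also have "hausdorff_outer s (A Int X) = 0" using mono[of "A Int X" A] A(1) by auto
  also have "0 + hausdorff_outer s ((UNIV - A) Int X) <= hausdorff_outer s (B Int X) + hausdorff_outer s ((UNIV - B) Int X)"
  proof -
   have "(UNIV - A) Int X <= (UNIV - B) Int X" using `B <= A` by blast
   from mono[OF this] show ?thesis by (simp add: add_increasing)
  qed
  finally show "hausdorff_outer s X <= hausdorff_outer s (B Int X) + hausdorff_outer s ((UNIV - B) Int X)" .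
 qed
 thus "B : sets (hausdorff_measure s)" by (simp add: sets_hausdorff_measure lambda_system_def)
qed

lemma (in complete_measure) borel_measurable_AE_eq:
 fixes f g :: "'a => 'b::topological_space"
 assumes g: "g : borel_measurable M" and eq: "AE x in M. f x = g x"
 shows "f : borel_measurable M"
proof (rule borel_measurableI)
 fix S :: "'b set" assume "open S"
 have "AE x in M. x : g -` S Int space M <-> x : f -` S Int space M" using eq by eventually_elim auto
 moreover have "g -` S Int space M : sets M" using g `open S` by (intro measurable_sets[OF g]) auto
 ultimately show "f -` S Int space M : sets M" by (rule in_sets_AE) auto
qed

lemma hausdorff_measurable:
 assumes "g : borel_measurable borel"
 shows "g : borel_measurable (hausdorff_measure s)"
proof (rule measurableI)
 fix A :: "'b set" assume "A : sets borel"
 hence "g -` A : sets borel" using measurable_sets[OF assms] by simp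
 thus "g -` A Int space (hausdorff_measure s) : sets (hausdorff_measure s)"
  using borel_subset_hausdorff by simp
qed simp

text \<open>Surface measure concentrated on \<open>S\<close>, with the Borel sets in place of the
  larger Caratheodory algebra, so that products with Lebesgue measure in time can be formed for
  Borel functions.\<close>

definition surf_on :: "(real^'d) set => (real^'d) measure" where
 "surf_on S = distr (density surface_measure (indicator S)) borel (%x. x)"

lemma space_surf_on [simp]: "space (surf_on S) = UNIV"
 and sets_surf_on [simp, measurable_cong]: "sets (surf_on S) = sets borel"
 by (simp_all add: surf_on_def)

lemma surf_on_ident:
 shows "(%x. x) : measurable (density surface_measure (indicator S)) (borel :: (real^'d) measure)"
  and "(%x. x) : measurable surface_measure (borel :: (real^'d) measure)"
 using hausdorff_measurable[of "%x. x"] by simp_all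

lemma indicator_hausdorff [measurable]:
 "S : sets borel ==> indicator S : borel_measurable (hausdorff_measure s)"
 by (intro hausdorff_measurable) simp

lemma emeasure_surf_on:
 assumes "S : sets borel" "A : sets borel"
 shows "emeasure (surf_on S) A = emeasure surface_measure (A Int S)"
proof -
 have "emeasure (surf_on S) A = emeasure (density surface_measure (indicator S)) A"
  unfolding surf_on_def using assms surf_on_ident(1)[of S] by (subst emeasure_distr) auto
 also have "... = (\<integral>\<^sup>+x. indicator S x * indicator A x \<partial>surface_measure)"
  using assms borel_subset_hausdorff by (subst emeasure_density) auto
 also have "... = (\<integral>\<^sup>+x. indicator (A Int S) x \<partial>surface_measure)"
  by (intro nn_integral_cong) (auto split: split_indicator)
 also have "... = emeasure surface_measure (A Int S)"
  using assms borel_subset_hausdorff[of "A Int S"] by (subst nn_integral_indicator) auto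
 finally show ?thesis .
qed

lemma surface_integral_eq:
 fixes g g' :: "real^'d => 'b::{banach, second_countable_topology}"
 assumes S: "S : sets borel" and g': "g' : borel_measurable borel"
  and eq: "AE x in surface_measure. x : S --> g x = g' x"
 shows "(LINT x:S|surface_measure. g x) = (LINT x|surf_on S. g' x)"
proof -
 interpret complete_measure "surface_measure :: (real^'d) measure" by (rule complete_measure_hausdorff)
 have m: "(%x. indicator S x *R g' x) : borel_measurable surface_measure"
  using S g' by (intro hausdorff_measurable borel_measurable_scaleR) auto
 have eq': "AE x in surface_measure. indicator S x *R g x = indicator S x *R g' x"
  using eq by eventually_elim (auto split: split_indicator)
 have "(LINT x:S|surface_measure. g x) = (LINT x|surface_measure. indicator S x *R g' x)"
  unfolding set_lebesgue_integral_def by (rule integral_cong_AE[OF borel_measurable_AE_eq[OF m eq'] m eq'])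
 also have "... = (LINT x|density surface_measure (%x. ennreal (indicator S x)). g' x)"
  using S g' by (subst integral_density) (auto intro!: hausdorff_measurable)
 also have "... = (LINT x|surf_on S. g' x)"
  unfolding surf_on_def using g' surf_on_ident(1)[of S] by (subst integral_distr) (auto simp: ennreal_indicator)
 finally show ?thesis .
qed

lemma AE_surf_on:
 fixes P :: "real^'d => bool"
 assumes "S : sets borel" "{x. P x} : sets borel" "AE x in surface_measure. x : S --> P x"
 shows "AE x in surf_on S. P x"
proof -
 have "AE x in density surface_measure (indicator S). P x"
  using assms(1,3) by (subst AE_density) (auto elim!: eventually_mono split: split_indicator_asm)
 thus ?thesis unfolding surf_on_def using assms(2) surf_on_ident(1)[of S] by (subst AE_distr_iff) auto
qed

text \<open>Two unit normals with offsets describe the same hyperplane only up to a common sign.\<close>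

lemma hyperplane_pair_nondegenerate:
 fixes n n' :: "'a::euclidean_space"
 assumes "norm n = 1" "norm n' = 1" "(n, b) ~= (n', b')" "~ (n' = - n & b' = - b)"
 shows "n' - r *R n ~= 0 | b' - r * b ~= 0"
proof (rule ccontr)
 assume "~ ?thesis"
 hence eq: "n' = r *R n" "b' = r * b" by auto
 hence "\<bar>r\<bar> = 1" using assms(1,2) by simp
 hence "r = 1 | r = - 1" by linarith
 thus False using eq assms(3,4) by auto
qed

text \<open>Inserting the projection leaves one affine equation for \<open>x\<close>, which is
  nondegenerate because the two hyperplanes differ.\<close>

lemma negligible_plane_proj:
 fixes n n' :: "'a::euclidean_space"
 assumes "norm n = 1" "norm n' = 1" "(n, b) ~= (n', b')" "~ (n' = - n & b' = - b)" "n <.> e ~= 0"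
 shows "negligible {x. n' <.> plane_proj n b e x = b'}"
proof -
 define r where "r = (n' <.> e) / (n <.> e)"
 have "n' <.> plane_proj n b e x - b' = (n' - r *R n) <.> x - (b' - r * b)" for x
  by (simp add: plane_proj_def r_def inner_add_right inner_diff_left algebra_simps diff_divide_distrib)
 hence "{x. n' <.> plane_proj n b e x = b'} = {x. (n' - r *R n) <.> x = b' - r * b}"
  by (metis (no_types, opaque_lifting) right_minus_eq)
 thus ?thesis using hyperplane_pair_nondegenerate[OF assms(1-4), of r] by (simp add: negligible_hyperplane)
qed

lemma hyperplane_borel [measurable]: "{x::'a::euclidean_space. n <.> x = b} : sets borel"
 by (intro borel_closed closed_hyperplane)

lemma surface_hyperplane_inter_null:
 fixes n n' :: "real^'d"
 assumes dim: "CARD('d) : {1, 2, 3}"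
  and n: "norm n = 1" "norm n' = 1" "(n, b) ~= (n', b')" "~ (n' = - n & b' = - b)"
 shows "{x. n <.> x = b} Int {x. n' <.> x = b'} : null_sets surface_measure"
proof -
 define A where "A = {x. n <.> x = b} Int {x. n' <.> x = b'}"
 have A[measurable]: "A : sets borel" unfolding A_def by measurable
 have ne: "n <.> n ~= 0" using n by (simp add: norm_eq_1)
 have "{x. n' <.> plane_proj n b n x = b'} : null_sets lborel"
  using negligible_plane_proj[OF n ne]
  by (auto simp: negligible_iff_null_sets null_sets_def null_sets_completion_iff)
 hence "prism n b A : null_sets lborel"
  by (rule null_sets_subset) (measurable, auto simp: A_def)
 hence "emeasure surface_measure A = 0"
  using surface_hyperplane[OF dim n(1) A, of b] by (auto simp: A_def null_sets_def)
 thus ?thesis using borel_subset_hausdorff[OF A] by (auto simp: A_def[symmetric] null_sets_def)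
qed

lemma surface_hyperplane_bounded_finite:
 fixes n :: "real^'d"
 assumes dim: "CARD('d) : {1, 2, 3}" and n: "norm n = 1"
  and A: "A : sets borel" "A <= {x. n <.> x = b}" "bounded A"
 shows "emeasure surface_measure A < \<infinity>"
proof -
 obtain R where R: "!!x. x : A ==> norm x <= R" using A(3) by (auto simp: bounded_iff)
 have "prism n b A <= cball 0 (R + 1)"
 proof
  fix x assume x: "x : prism n b A"
  have nn: "n <.> n = 1" using n by (simp add: norm_eq_1)
  have "x = plane_proj n b n x + (n <.> x - b) *R n" by (simp add: plane_proj_def nn algebra_simps)
  hence "norm x <= norm (plane_proj n b n x) + norm ((n <.> x - b) *R n)" by (metis norm_triangle_ineq)
  also have "... <= R + 1" using x R[of "plane_proj n b n x"] n by auto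
  finally show "x : cball 0 (R + 1)" by simp
 qed
 hence "emeasure lborel (prism n b A) <= emeasure lborel (cball (0::real^'d) (R + 1))"
  by (rule emeasure_mono) simp
 also have "... < \<infinity>" using emeasure_lborel_cball_finite by simp
 finally show ?thesis using surface_hyperplane[OF dim n A(1,2)] by simp
qed

text \<open>The projection along \<open>e\<close> of a transversal slab carries Lebesgue measure to surface measure, up to
 the cosine of the angle between \<open>e\<close> and the normal.\<close>

lemma integral_plane_proj:
 fixes n e :: "real^'d" and g :: "real^'d => real"
 assumes dim: "CARD('d) : {1, 2, 3}" and n: "norm n = 1" and ne: "n <.> e ~= 0"
  and T[measurable]: "T : sets borel" and T1: "!!x. emeasure lborel {s::real. x - s *R e : T} = 1"
  and g[measurable]: "g : borel_measurable borel"
 shows "(LINT x|density lborel (indicator T). g (plane_proj n b e x)) = \<bar>n <.> e\<bar> * (LINT x|surf_on {x. n <.> x = b}. g x)"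
  and "integrable (surf_on {x. n <.> x = b}) g ==> integrable (density lborel (indicator T)) (%x. g (plane_proj n b e x))"
proof -
 define H where "H = {x. n <.> x = b}"
 have [measurable]: "H : sets borel" unfolding H_def by measurable
 have eq: "distr (density lborel (indicator T)) borel (plane_proj n b e) = density (surf_on H) (%x. ennreal \<bar>n <.> e\<bar>)"
 proof (rule measure_eqI)
  fix A assume "A : sets (distr (density lborel (indicator T)) borel (plane_proj n b e))"
  hence A[measurable]: "A : sets borel" by simp
  have "emeasure (distr (density lborel (indicator T)) borel (plane_proj n b e)) A
    = emeasure (density lborel (indicator T)) {x. plane_proj n b e x : A}"
   by (subst emeasure_distr) (auto simp: vimage_def)
  also have "... = (\<integral>\<^sup>+x. indicator {x : T. plane_proj n b e x : A Int H} x \<partial>lborel)"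
   by (subst emeasure_density, simp, simp, intro nn_integral_cong)
     (auto simp: H_def plane_proj_line(2)[OF ne] split: split_indicator)
  also have "... = emeasure lborel {x : T. plane_proj n b e x : A Int H}" by simp
  also have "... = ennreal \<bar>n <.> e\<bar> * emeasure surface_measure (A Int H)"
   by (rule surface_oblique[OF dim n ne T T1]) (auto simp: H_def)
  also have "... = emeasure (density (surf_on H) (%x. ennreal \<bar>n <.> e\<bar>)) A"
   by (subst emeasure_density) (auto simp: emeasure_surf_on nn_integral_cmult_indicator)
  finally show "emeasure (distr (density lborel (indicator T)) borel (plane_proj n b e)) A
   = emeasure (density (surf_on H) (%x. ennreal \<bar>n <.> e\<bar>)) A" .
 qed simp
 have "(LINT x|density lborel (indicator T). g (plane_proj n b e x)) = (LINT x|density (surf_on H) (%x. ennreal \<bar>n <.> e\<bar>). g x)"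
  unfolding eq[symmetric] by (subst integral_distr) auto
 also have "... = \<bar>n <.> e\<bar> * (LINT x|surf_on H. g x)" by (subst integral_density) auto
 finally show "(LINT x|density lborel (indicator T). g (plane_proj n b e x)) = \<bar>n <.> e\<bar> * (LINT x|surf_on {x. n <.> x = b}. g x)"
  by (simp add: H_def)
 assume "integrable (surf_on {x. n <.> x = b}) g"
 hence "integrable (density (surf_on H) (%x. ennreal \<bar>n <.> e\<bar>)) g"
  by (subst integrable_density) (auto simp: H_def)
 thus "integrable (density lborel (indicator T)) (%x. g (plane_proj n b e x))"
  unfolding eq[symmetric] by (subst (asm) integrable_distr_eq) auto
qed

lemma integral_lines:
 fixes e :: "'a::euclidean_space" and h :: "'a => real"
 assumes T[measurable]: "T : sets borel" and T1: "!!x. emeasure lborel {s::real. x - s *R e : T} = 1"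
  and h: "integrable lborel h"
 shows "(LINT x|lborel. h x) = (LINT x|density lborel (indicator T). LINT s|lborel. h (x + s *R e))"
proof -
 define M where "M = density lborel (indicator T :: 'a => ennreal)"
 have [measurable_cong]: "sets M = sets borel" by (simp add: M_def)
 have "sigma_finite_measure M" unfolding M_def
  by (subst sigma_finite_measure.sigma_finite_iff_density_finite[OF sigma_finite_lborel])
   (auto intro!: AE_I2 split: split_indicator)
 then interpret M: sigma_finite_measure M .
 interpret P: pair_sigma_finite M "lborel :: real measure" ..
 have [measurable]: "h : borel_measurable borel" using h by auto
 have [measurable]: "(%(x, s::real). x + s *R e) : measurable (M \<Otimes>\<^sub>M lborel) borel" by measurable
 have eq: "distr (M \<Otimes>\<^sub>M lborel) borel (%(x, s::real). x + s *R e) = lborel"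
 proof (rule measure_eqI)
  fix A assume "A : sets (distr (M \<Otimes>\<^sub>M lborel) borel (%(x, s::real). x + s *R e))"
  hence A[measurable]: "A : sets borel" by simp
  have "emeasure (distr (M \<Otimes>\<^sub>M lborel) borel (%(x, s::real). x + s *R e)) A
    = (\<integral>\<^sup>+z. indicator A z \<partial>distr (M \<Otimes>\<^sub>M lborel) borel (%(x, s::real). x + s *R e))" by simp
  also have "... = (\<integral>\<^sup>+z. indicator A (fst z + snd z *R e) \<partial>(M \<Otimes>\<^sub>M lborel))"
   by (subst nn_integral_distr) (auto simp: case_prod_beta)
  also have "... = (\<integral>\<^sup>+x. (\<integral>\<^sup>+s. indicator A (x + s *R e) \<partial>lborel) \<partial>M)"
   by (subst lborel.nn_integral_fst[symmetric]) auto
  also have "... = (\<integral>\<^sup>+x. (\<integral>\<^sup>+s. indicator A (x + s *R e) \<partial>lborel) * indicator T x \<partial>lborel)"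
   unfolding M_def by (subst nn_integral_density) (auto simp: mult.commute)
  also have "... = (\<integral>\<^sup>+x. indicator A x \<partial>lborel)"
   by (rule nn_integral_lines[OF T T1, symmetric]) measurable
  finally show "emeasure (distr (M \<Otimes>\<^sub>M lborel) borel (%(x, s::real). x + s *R e)) A = emeasure lborel A" by simp
 qed simp
 have "(LINT x|lborel. h x) = (\<integral>z. h (fst z + snd z *R e) \<partial>(M \<Otimes>\<^sub>M lborel))"
  by (subst eq[symmetric], subst integral_distr) (auto simp: case_prod_beta)
 also have "... = (LINT x|M. LINT s|lborel. h (x + s *R e))"
 proof -
  have "integrable (M \<Otimes>\<^sub>M lborel) (%z. h (fst z + snd z *R e))"
   using h by (subst (asm) eq[symmetric], subst (asm) integrable_distr_eq) (auto simp: case_prod_beta)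
  thus ?thesis by (subst P.integral_fst'[symmetric]) auto
 qed
 finally show ?thesis by (simp add: M_def)
qed

lemma negligible_null_sets: "negligible S ==> S : sets borel ==> S : null_sets lborel"
 by (simp add: negligible_iff_null_sets null_sets_def)

text \<open>Since \<open>K\<close> contains half a ball at \<open>x\<close>, a competing normal
  \<open>m\<close> is nonpositive on all directions that point strictly inwards. Applied to the
  tangential part of \<open>m\<close>, tilted inwards by an arbitrarily small \<open>e\<close>, this
  forces the tangential part to vanish.\<close>

lemma unit_normal_eq:
 assumes "norm n = 1" "n <.> x = b" "K <= {y. n <.> y < b}" "0 < r" "ball x r Int {y. n <.> y < b} <= K"
 shows "unit_normal K x = n"
 unfolding unit_normal_def
proof (rule the_equality)
 show "norm n = 1 & (ALL y:K. n <.> (y - x) <= 0)"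
  using assms(1-3) by (auto simp: inner_diff_right)
 fix m assume m: "norm m = 1 & (ALL y:K. m <.> (y - x) <= 0)"
 have nn: "n <.> n = 1" and mm: "m <.> m = 1" using assms(1) m by (auto simp: norm_eq_1)
 have key: "m <.> d <= 0" if d: "n <.> d < 0" for d
 proof -
  have "d ~= 0" using d by auto
  define t where "t = r / (2 * norm d)"
  have t: "0 < t" "t * norm d < r" using `d ~= 0` assms(4) by (auto simp: t_def)
  have "x + t *R d : ball x r Int {y. n <.> y < b}"
   using t d assms(2) by (auto simp: dist_norm inner_add_right mult_pos_neg)
  hence "x + t *R d : K" using assms(5) by blast
  hence "t * (m <.> d) <= 0" using m by force
  thus ?thesis using t by (simp add: mult_le_0_iff)
 qed
 have "m <.> (m - (m <.> n) *R n) <= e" if "0 < e" for e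
 proof -
  have "m <.> ((m - (m <.> n) *R n) - e *R n) <= 0"
   using that by (intro key) (simp add: inner_diff_right nn inner_commute)
  hence "m <.> (m - (m <.> n) *R n) <= e * (m <.> n)" by (simp add: inner_diff_right)
  also have "... <= e * 1"
   using that norm_cauchy_schwarz[of m n] m assms(1) by (intro mult_left_mono) auto
  finally show ?thesis by simp
 qed
 hence "m <.> (m - (m <.> n) *R n) <= 0" by (rule field_le_epsilon[where y=0, simplified])
 hence sq: "1 <= (m <.> n)^2" by (simp add: inner_diff_right mm power2_eq_square)
 have "0 <= m <.> n" using key[of "- n"] nn by simp
 with sq have "1 <= m <.> n" by (simp add: power2_eq_square) (smt (verit) mult_le_one mult_less_cancel_right1)
 moreover have "(norm (m - n))^2 = 2 - 2 * (m <.> n)"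
  by (simp add: power2_norm_eq_inner inner_diff_left inner_diff_right nn mm inner_commute)
 ultimately have "(norm (m - n))^2 <= 0" by simp
 thus "m = n" by simp
qed

section \<open>Divergence theorem on a polytope\<close>

text \<open>\<open>I\<close> may list redundant half-spaces, whose hyperplanes touch
  \<open>K\<close> in an edge or miss it. Only the inequalities and the covering of the frontier are
  asked for, which is what separation from the neighbouring cells supplies.\<close>

locale polytope_cell =
 fixes K :: "(real^'d) set" and I :: "((real^'d) \<times> real) set"
 assumes dim: "CARD('d) : {1, 2, 3}"
  and K: "open K" "convex K" "bounded K" "K ~= {}"
  and finI: "finite I"
  and normals: "!!n b. (n, b) : I ==> norm n = 1"
  and sides: "!!n b x. (n, b) : I ==> x : K ==> n <.> x < b"
  and frontier_sub: "!!x. x : frontier K ==> EX (n, b):I. n <.> x = b"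
begin

text \<open>The relatively open face. Strictness in the other constraints excludes the edges, so
  that facets are disjoint and \<open>K\<close> is half a ball near each of their points.\<close>

definition facet :: "(real^'d) \<times> real => (real^'d) set" where
 "facet i = {x. fst i <.> x = snd i & (ALL j:I - {i}. fst j <.> x < snd j)}"

text \<open>A point that satisfies all inequalities but lies outside \<open>K\<close> is joined to a
  point of \<open>K\<close> by a segment that crosses the frontier, where some inequality would have
  to be an equality.\<close>

lemma K_eq: "K = {x. ALL (n, b):I. n <.> x < b}"
proof
 show "K <= {x. ALL (n, b):I. n <.> x < b}" using sides by auto
 show "{x. ALL (n, b):I. n <.> x < b} <= K"
 proof (rule ccontr)
  assume "~ ?thesis"
  then obtain y where y: "!!n b. (n, b) : I ==> n <.> y < b" "y ~: K" by blast
  obtain z where z: "z : K" using K by auto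
  have "closed_segment z y Int frontier K ~= {}"
   using y z by (intro connected_Int_frontier) auto
  then obtain w where w: "w : closed_segment z y" "w : frontier K" by blast
  then obtain n b where nb: "(n, b) : I" "n <.> w = b" using frontier_sub by blast
  obtain t where t: "0 <= t" "t <= 1" "w = (1 - t) *R z + t *R y"
   using w by (auto simp: in_segment)
  have "(1 - t) * (n <.> z) + t * (n <.> y) < b"
   using convex_bound_lt[of "n <.> z" b "n <.> y" "1 - t" t] t sides[OF nb(1) z] y(1)[OF nb(1)] by simp
  thus False using nb(2) t(3) by (simp add: inner_add_right)
 qed
qed

lemma closure_le: "x : closure K ==> (n, b) : I ==> n <.> x <= b"
proof -
 assume x: "x : closure K" and i: "(n, b) : I"
 have "closure K <= {x. n <.> x <= b}"
  using sides[OF i] by (intro closure_minimal closed_halfspace_le) (auto intro: less_imp_le)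
 thus ?thesis using x by auto
qed

lemma facet_half_ball:
 assumes i: "i : I" and x: "x : facet i"
 shows "EX r>0. ball x r Int {y. fst i <.> y < snd i} <= K"
proof -
 have "open (INT j:I - {i}. {y. fst j <.> y < snd j})" using finI by (intro open_INT) (auto simp: open_halfspace_lt)
 moreover have "x : (INT j:I - {i}. {y. fst j <.> y < snd j})" using x by (auto simp: facet_def)
 ultimately obtain r where r: "0 < r" "ball x r <= (INT j:I - {i}. {y. fst j <.> y < snd j})"
  using open_contains_ball by blast
 have "ball x r Int {y. fst i <.> y < snd i} <= K"
 proof
  fix y assume y: "y : ball x r Int {y. fst i <.> y < snd i}"
  have "fst j <.> y < snd j" if "j : I" for j
   using y r(2) that by (cases "j = i") auto
  thus "y : K" unfolding K_eq by auto
 qed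
 thus ?thesis using r(1) by blast
qed

lemma facet_frontier:
 assumes i: "i : I" and x: "x : facet i"
 shows "x : frontier K"
proof -
 obtain n b where nb: "i = (n, b)" by fastforce
 obtain r where r: "0 < r" "ball x r Int {y. n <.> y < b} <= K" using facet_half_ball[OF i x] nb by auto
 have n1: "norm n = 1" "n <.> n = 1" using normals i nb by (auto simp: norm_eq_1[symmetric])
 have xb: "n <.> x = b" using x nb by (simp add: facet_def)
 have "x ~: K" using sides[of n b x] i nb xb by auto
 moreover have "x : closure K"
  unfolding closure_approachable
 proof (intro allI impI)
  fix e :: real assume "0 < e"
  define d where "d = min e r / 2"
  have d: "0 < d" "d < e" "d < r" using `0 < e` r by (auto simp: d_def min_def)
  have "x - d *R n : K" using r(2) d xb n1 by (intro subsetD[OF r(2)]) (auto simp: dist_norm inner_diff_right)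
  moreover have "dist (x - d *R n) x < e" using d n1 by (simp add: dist_norm)
  ultimately show "EX y:K. dist y x < e" by blast
 qed
 ultimately show ?thesis using K(1) by (simp add: frontier_def interior_open)
qed

lemma facet_normal: "i : I ==> x : facet i ==> unit_normal K x = fst i"
proof -
 assume i: "i : I" and x: "x : facet i"
 obtain r where r: "0 < r" "ball x r Int {y. fst i <.> y < snd i} <= K" using facet_half_ball[OF i x] by auto
 show ?thesis
  by (rule unit_normal_eq[OF _ _ _ r(1) r(2)])
    (use i x normals[of "fst i" "snd i"] sides[of "fst i" "snd i"] in \<open>auto simp: facet_def\<close>)
qed

lemma distinct_planes:
 assumes "(n, b) : I" "(n', b') : I"
 shows "~ (n' = - n & b' = - b)"
proof
 assume "n' = - n & b' = - b"
 hence "- n <.> z < - b" if "z : K" for z using sides[OF assms(2) that] by simp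
 thus False using sides[OF assms(1)] K(4) by force
qed

definition bad :: "(real^'d) set" where
 "bad = (UN i:I. UN j:I - {i}. {x. fst i <.> x = snd i} Int {x. fst j <.> x = snd j})"

lemma bad_null: "bad : null_sets surface_measure"
 unfolding bad_def
proof (intro null_sets_UN' countable_finite)
 fix i j assume "i : I" "j : I - {i}"
 thus "{x. fst i <.> x = snd i} Int {x. fst j <.> x = snd j} : null_sets surface_measure"
  using normals[of "fst i" "snd i"] normals[of "fst j" "snd j"] distinct_planes[of "fst i" "snd i" "fst j" "snd j"]
  by (intro surface_hyperplane_inter_null[OF dim]) (auto simp: prod_eq_iff)
qed (use finI in auto)

lemma frontier_cases: "x : frontier K ==> x ~: bad ==> EX i:I. x : facet i"
proof -
 assume x: "x : frontier K" "x ~: bad"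
 then obtain n b where i: "(n, b) : I" "n <.> x = b" using frontier_sub by blast
 have xc: "x : closure K" using x by (simp add: frontier_def)
 have "fst j <.> x < snd j" if j: "j : I - {(n, b)}" for j
  using x(2) i j closure_le[OF xc, of "fst j" "snd j"] by (force simp: bad_def)
 hence "x : facet (n, b)" using i by (auto simp: facet_def)
 thus ?thesis using i by blast
qed

lemma facets_disjoint: "i : I ==> j : I ==> i ~= j ==> x : facet i ==> x ~: facet j"
 by (force simp: facet_def)

lemma facet_borel [measurable]: "facet i : sets borel"
 using finI by (simp add: facet_def open_halfspace_lt)

lemma surface_frontier_finite: "emeasure surface_measure (frontier K) < \<infinity>"
proof -
 have "frontier K <= (UN i:I. {x. fst i <.> x = snd i} Int frontier K)" using frontier_sub by fastforce
 hence "emeasure surface_measure (frontier K) <= emeasure surface_measure (UN i:I. {x. fst i <.> x = snd i} Int frontier K)"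
  using finI by (intro emeasure_mono borel_subset_hausdorff sets.finite_UN) auto
 also have "... <= (SUM i:I. emeasure surface_measure ({x. fst i <.> x = snd i} Int frontier K))"
  using finI by (intro emeasure_subadditive_finite image_subsetI borel_subset_hausdorff) auto
 also have "... < \<infinity>"
  unfolding infinity_ennreal_def ennreal_sum_less_top[OF finI]
 proof
  fix i assume i: "i : I"
  have "bounded ({x. fst i <.> x = snd i} Int frontier K)"
   by (rule bounded_subset[OF bounded_closure[OF K(3)]]) (auto simp: frontier_def)
  hence "emeasure surface_measure ({x. fst i <.> x = snd i} Int frontier K) < \<infinity>"
   using i normals[of "fst i" "snd i"]
   by (intro surface_hyperplane_bounded_finite[OF dim, where n="fst i" and b="snd i"]) auto
  thus "emeasure surface_measure ({x. fst i <.> x = snd i} Int frontier K) < top" by simp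
 qed
 finally show ?thesis .
qed

lemma integral_facets:
 fixes g :: "real^'d => real"
 assumes g: "continuous_on UNIV g"
 shows "(LINT x:frontier K|surface_measure. (unit_normal K x <.> e) * g x)
    = (SUM i:I. (fst i <.> e) * (LINT x|surf_on {x. fst i <.> x = snd i}. indicator (facet i) x * g x))"
  and "i : I ==> integrable (surf_on {x. fst i <.> x = snd i}) (%x. indicator (facet i) x * g x)"
proof -
 have [measurable]: "g : borel_measurable borel" using g by (rule borel_measurable_continuous_onI)
 have "bounded (g ` closure K)"
  using K(3) g by (intro compact_imp_bounded compact_continuous_image) (auto intro: continuous_on_subset)
 then obtain B where B: "!!x. x : closure K ==> \<bar>g x\<bar> <= B" by (auto simp: bounded_iff)
 have FK: "frontier K : sets borel" by simp
 define S where "S = surf_on (frontier K)"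
 have [measurable_cong]: "sets S = sets borel" by (simp add: S_def)
 have "emeasure S (space S) < \<infinity>"
  using surface_frontier_finite by (simp add: S_def emeasure_surf_on)
 then interpret S: finite_measure S by (intro finite_measureI) auto
 have sub: "facet i <= frontier K" if "i : I" for i using facet_frontier[OF that] by auto
 have intS: "integrable S (%x. indicator (facet i) x * g x)" if "i : I" for i
 proof (rule S.integrable_const_bound[where B="\<bar>B\<bar>"])
  have "norm (indicator (facet i) x * g x) <= \<bar>B\<bar>" for x
   using sub[OF that] B[of x] by (auto simp: frontier_def split: split_indicator)
  thus "AE x in S. norm (indicator (facet i) x * g x) <= \<bar>B\<bar>" by simp
 qed simp
 have eqm: "density (surf_on {x. fst i <.> x = snd i}) (indicator (facet i)) = density S (indicator (facet i))" if "i : I" for i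
 proof (rule measure_eqI)
  fix A assume "A : sets (density (surf_on {x. fst i <.> x = snd i}) (indicator (facet i)))"
  hence A[measurable]: "A : sets borel" by simp
  have "facet i Int A Int {x. fst i <.> x = snd i} = facet i Int A Int frontier K"
   using sub[OF that] by (auto simp: facet_def)
  hence "emeasure (surf_on {x. fst i <.> x = snd i}) (facet i Int A) = emeasure S (facet i Int A)"
   by (simp add: S_def emeasure_surf_on)
  thus "emeasure (density (surf_on {x. fst i <.> x = snd i}) (indicator (facet i))) A
    = emeasure (density S (indicator (facet i))) A"
   by (simp add: emeasure_restricted)
 qed (simp add: S_def)
 have tr: "integrable (surf_on {x. fst i <.> x = snd i}) (%x. indicator (facet i) x * g x) <-> integrable S (%x. indicator (facet i) x * g x)"
  "(LINT x|surf_on {x. fst i <.> x = snd i}. indicator (facet i) x * g x) = (LINT x|S. indicator (facet i) x * g x)" if "i : I" for i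
 proof -
  have d: "integrable (density M (%x. ennreal (indicator (facet i) x))) g <-> integrable M (%x. indicator (facet i) x * g x)"
   "(LINT x|density M (%x. ennreal (indicator (facet i) x)). g x) = (LINT x|M. indicator (facet i) x * g x)"
   if [measurable_cong]: "sets M = sets borel" for M :: "(real^'d) measure"
   by (subst integrable_density integral_density; simp)+
  show "integrable (surf_on {x. fst i <.> x = snd i}) (%x. indicator (facet i) x * g x) <-> integrable S (%x. indicator (facet i) x * g x)"
  "(LINT x|surf_on {x. fst i <.> x = snd i}. indicator (facet i) x * g x) = (LINT x|S. indicator (facet i) x * g x)"
   using d[of S] d[of "surf_on {x. fst i <.> x = snd i}"] eqm[OF that] by (simp_all add: ennreal_indicator S_def)
 qed
 show "i : I ==> integrable (surf_on {x. fst i <.> x = snd i}) (%x. indicator (facet i) x * g x)"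
  using tr intS by simp
 have "(LINT x:frontier K|surface_measure. (unit_normal K x <.> e) * g x)
   = (LINT x|S. (SUM i:I. (fst i <.> e) * (indicator (facet i) x * g x)))"
  unfolding S_def
 proof (rule surface_integral_eq[OF FK])
  have "AE x in surface_measure. x ~: bad" using bad_null by (rule AE_not_in)
  thus "AE x in surface_measure. x : frontier K -->
    (unit_normal K x <.> e) * g x = (SUM i:I. (fst i <.> e) * (indicator (facet i) x * g x))"
  proof eventually_elim
   case (elim x)
   show ?case
   proof
    assume "x : frontier K"
    then obtain i where i: "i : I" "x : facet i" using frontier_cases elim by blast
    have "(SUM j:I. (fst j <.> e) * (indicator (facet j) x * g x)) = (SUM j:I. if j = i then (fst i <.> e) * g x else 0)"
     using i facets_disjoint[OF i(1)] by (intro sum.cong) (auto split: split_indicator)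
    thus "(unit_normal K x <.> e) * g x = (SUM i:I. (fst i <.> e) * (indicator (facet i) x * g x))"
     using i finI by (simp add: facet_normal)
   qed
  qed
 qed measurable
 also have "... = (SUM i:I. LINT x|S. (fst i <.> e) * (indicator (facet i) x * g x))"
  by (rule Bochner_Integration.integral_sum) (intro integrable_mult_right intS)
 also have "... = (SUM i:I. (fst i <.> e) * (LINT x|surf_on {x. fst i <.> x = snd i}. indicator (facet i) x * g x))"
  by (intro sum.cong) (simp_all add: tr)
 finally show "(LINT x:frontier K|surface_measure. (unit_normal K x <.> e) * g x)
    = (SUM i:I. (fst i <.> e) * (LINT x|surf_on {x. fst i <.> x = snd i}. indicator (facet i) x * g x))" .
qed

definition line_param :: "real^'d => real^'d => (real^'d) \<times> real => real" where
 "line_param e x i = (snd i - fst i <.> x) / (fst i <.> e)"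

lemma plane_proj_minus: "plane_proj n b (- e) x = plane_proj n b e x"
 by (simp add: plane_proj_def)

lemma plane_proj_line_param: "plane_proj (fst i) (snd i) e x = x + line_param e x i *R e"
 by (simp add: plane_proj_def line_param_def)

text \<open>Base points of the lines in direction \<open>e\<close> that pass through the
  intersection of two of the hyperplanes.\<close>

definition line_bad :: "real^'d => (real^'d) set" where
 "line_bad e = (UN i:{i:I. fst i <.> e ~= 0}. UN j:I - {i}. {x. fst j <.> plane_proj (fst i) (snd i) e x = snd j})"

lemma line_bad_null: "line_bad e : null_sets lborel"
 unfolding line_bad_def
proof (intro null_sets_UN' countable_finite)
 fix i j assume "i : {i:I. fst i <.> e ~= 0}" "j : I - {i}"
 hence "negligible {x. fst j <.> plane_proj (fst i) (snd i) e x = snd j}"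
  using normals[of "fst i" "snd i"] normals[of "fst j" "snd j"] distinct_planes[of "fst i" "snd i" "fst j" "snd j"]
  by (intro negligible_plane_proj) (auto simp: prod_eq_iff)
 moreover have "{x. fst j <.> plane_proj (fst i) (snd i) e x = snd j} : sets borel" by measurable
 ultimately show "{x. fst j <.> plane_proj (fst i) (snd i) e x = snd j} : null_sets lborel"
  by (rule negligible_null_sets)
qed (use finI in auto)

text \<open>A line in general position that meets \<open>K\<close> leaves it through exactly one facet; reversing the
 direction, it also enters through exactly one.\<close>

lemma line_exit:
 assumes x: "x ~: line_bad e" and s0: "x + s0 *R e : K" and e: "e ~= 0"
 obtains p where "p : I" "0 < fst p <.> e" "s0 < line_param e x p"
  "!!s. s0 <= s ==> x + s *R e : K <-> s < line_param e x p"
  "!!i. i : I ==> 0 < fst i <.> e ==> plane_proj (fst i) (snd i) e x : facet i <-> i = p"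
proof -
 define t where "t = line_param e x"
 have inK: "x + s *R e : K <-> (ALL i:I. fst i <.> x + s * (fst i <.> e) < snd i)" for s
  unfolding K_eq by (auto simp: inner_add_right)
 have tP: "fst i <.> x + s * (fst i <.> e) < snd i <-> s < t i" if "0 < fst i <.> e" for i s
  using that by (auto simp: t_def line_param_def field_simps)
 \<comment> \<open>Constraints that the direction \<open>e\<close> does not approach hold at
   \<open>s0\<close> and stay satisfied for all later parameters.\<close>
 have tN: "fst i <.> x + s * (fst i <.> e) < snd i" if "~ 0 < fst i <.> e" "i : I" "s0 <= s" for i s
  using s0[unfolded inK, rule_format, OF that(2)] mult_right_mono_neg[OF that(3), of "fst i <.> e"] that(1) by simp
 have "EX i:I. 0 < fst i <.> e"
 proof (rule ccontr)
  assume "~ ?thesis"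
  hence inK': "x + s *R e : K" if "s0 <= s" for s using tN that unfolding inK by blast
  obtain R where R: "!!y. y : K ==> norm y <= R" using K(3) by (auto simp: bounded_iff)
  define s where "s = max s0 ((R + norm x) / norm e + 1)"
  have "(R + norm x) / norm e < s" by (simp add: s_def)
  hence "R + norm x < s * norm e" using e by (simp add: pos_divide_less_eq)
  also have "... <= norm (s *R e)" by (simp add: mult_right_mono)
  also have "... <= norm (x + s *R e) + norm x" using norm_triangle_ineq4[of "x + s *R e" x] by simp
  finally show False using R[OF inK'[of s]] by (simp add: s_def)
 qed
 hence P: "finite {i:I. 0 < fst i <.> e}" "{i:I. 0 < fst i <.> e} ~= {}" using finI by auto
 \<comment> \<open>The exit constraint is the first hyperplane reached among those that the line
   approaches; general position makes it unique.\<close>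
 define p where "p = arg_min_on t {i:I. 0 < fst i <.> e}"
 have p: "p : I" "0 < fst p <.> e" "!!i. i : I ==> 0 < fst i <.> e ==> t p <= t i"
  using arg_min_if_finite(1)[OF P, of t] arg_min_least[OF P, of _ t] by (simp_all add: p_def)
 have pr: "fst j <.> plane_proj (fst i) (snd i) e x = fst j <.> x + t i * (fst j <.> e)" for i j
  by (simp add: plane_proj_line_param t_def inner_add_right)
 have s0p: "s0 < t p" using s0 p(1) unfolding inK tP[OF p(2), symmetric] by blast
 show thesis
 proof (rule that[OF p(1,2)])
  show "s0 < line_param e x p" using s0p by (simp add: t_def)
  fix s assume s: "s0 <= s"
  show "x + s *R e : K <-> s < line_param e x p"
   unfolding inK t_def[symmetric] using p tP tN[OF _ _ s] by (meson less_le_trans)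
 next
  fix i assume i: "i : I" "0 < fst i <.> e"
  have on: "fst j <.> x + t j * (fst j <.> e) = snd j" if "0 < fst j <.> e" for j using that by (simp add: t_def line_param_def)
  show "plane_proj (fst i) (snd i) e x : facet i <-> i = p"
  proof
   assume "plane_proj (fst i) (snd i) e x : facet i"
   thus "i = p" using p(1) p(3)[OF i] tP[OF p(2), of "t i"] by (force simp: facet_def pr)
  next
   assume ip: "i = p"
   have "fst j <.> x + t p * (fst j <.> e) < snd j" if j: "j : I - {p}" for j
   proof (cases "0 < fst j <.> e")
    case True
    have "fst j <.> plane_proj (fst p) (snd p) e x ~= snd j" using x j p(1,2) by (force simp: line_bad_def)
    hence "t p ~= t j" using on[of j] True by (auto simp: pr)
    thus ?thesis using tP[OF True] p(3)[of j] j True by fastforce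
   qed (use tN[of j "t p"] j s0p in auto)
   thus "plane_proj (fst i) (snd i) e x : facet i" using on p(2) by (simp add: facet_def pr ip)
  qed
 qed
qed

lemma facet_line_meets:
 assumes i: "i : I" "fst i <.> e ~= 0" and f: "plane_proj (fst i) (snd i) e x : facet i"
 shows "EX s. x + s *R e : K"
proof -
 define y where "y = plane_proj (fst i) (snd i) e x"
 obtain r where r: "0 < r" "ball y r Int {y. fst i <.> y < snd i} <= K" using facet_half_ball[OF i(1)] f by (auto simp: y_def)
 have e: "e ~= 0" using i(2) by auto
 \<comment> \<open>A step of half the radius, against the sign of \<open>fst i <.> e\<close>, leads
   from the facet into the half ball inside \<open>K\<close>.\<close>
 define d where "d = - sgn (fst i <.> e) * r / (2 * norm e)"
 have "\<bar>d\<bar> * norm e < r" using r(1) e i(2) by (simp add: d_def abs_mult abs_sgn_eq)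
 moreover have "d * (fst i <.> e) < 0"
 proof -
  have "d * (fst i <.> e) = - \<bar>fst i <.> e\<bar> * r / (2 * norm e)"
   by (simp add: d_def abs_sgn mult_ac)
  thus ?thesis using r(1) e i(2) by (simp add: divide_neg_pos mult_pos_pos)
 qed
 moreover have "fst i <.> y = snd i" using f by (simp add: y_def facet_def)
 ultimately have "y + d *R e : K" by (intro subsetD[OF r(2)]) (simp add: dist_norm inner_add_right)
 hence "x + (line_param e x i + d) *R e : K" by (simp add: y_def plane_proj_line_param scaleR_add_left add.assoc)
 thus ?thesis by blast
qed

text \<open>In general position a line that meets \<open>K\<close> does so in an interval whose two
  ends are its only crossings lying on facets; the sign tells exit from entry. A line that misses
  \<open>K\<close> meets no facet, by \<open>facet_line_meets\<close>.\<close>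

lemma line_FTC:
 fixes g :: "real^'d => real"
 assumes der: "!!x. (g has_derivative g' x) (at x)" and cont: "continuous_on UNIV (%x. g' x e)"
  and e: "e ~= 0" and x: "x ~: line_bad e"
 shows "(LINT s|lborel. indicator K (x + s *R e) * g' (x + s *R e) e)
  = (SUM i:I. sgn (fst i <.> e) * (indicator (facet i) (plane_proj (fst i) (snd i) e x) * g (plane_proj (fst i) (snd i) e x)))"
proof (cases "EX s. x + s *R e : K")
 case False
 have "(SUM i:I. sgn (fst i <.> e) * (indicator (facet i) (plane_proj (fst i) (snd i) e x) * g (plane_proj (fst i) (snd i) e x))) = 0"
 proof (intro sum.neutral ballI)
  fix i assume "i : I"
  thus "sgn (fst i <.> e) * (indicator (facet i) (plane_proj (fst i) (snd i) e x) * g (plane_proj (fst i) (snd i) e x)) = 0"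
   using False facet_line_meets[of i e x] by (cases "fst i <.> e = 0") (auto split: split_indicator)
 qed
 thus ?thesis using False by simp
next
 case True
 have lc: "continuous_on UNIV (%s. g' (x + s *R e) e)"
  by (rule continuous_on_compose2[OF cont]) (auto intro!: continuous_intros)
 from True obtain s0 where s0: "x + s0 *R e : K" by blast
 define a where "a = line_param e x"
 from line_exit[OF x s0 e] obtain p where p: "p : I" "0 < fst p <.> e" "s0 < a p"
  "!!s. s0 <= s ==> x + s *R e : K <-> s < a p"
  "!!i. i : I ==> 0 < fst i <.> e ==> plane_proj (fst i) (snd i) e x : facet i <-> i = p"
  unfolding a_def by blast
 have "x ~: line_bad (- e)" "x + (- s0) *R (- e) : K" "- e ~= 0" using x s0 e by (simp_all add: line_bad_def plane_proj_minus)
 from line_exit[OF this] obtain m where m0: "m : I" "0 < fst m <.> (- e)" "- s0 < line_param (- e) x m"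
  "!!s. - s0 <= s ==> x + s *R (- e) : K <-> s < line_param (- e) x m"
  "!!i. i : I ==> 0 < fst i <.> (- e) ==> plane_proj (fst i) (snd i) (- e) x : facet i <-> i = m" by blast
 have am: "line_param (- e) x m = - a m" by (simp add: a_def line_param_def)
 have m4: "x + s *R e : K <-> a m < s" if "s <= s0" for s using m0(4)[of "- s"] that by (simp add: am)
 have m: "m : I" "fst m <.> e < 0" "a m < s0"
  "!!i. i : I ==> fst i <.> e < 0 ==> plane_proj (fst i) (snd i) e x : facet i <-> i = m"
  using m0(1-3,5) by (simp_all add: plane_proj_minus am)
 have inK: "x + s *R e : K <-> a m < s & s < a p" for s using m(3) m4[of s] p(3) p(4)[of s] by (cases "s <= s0") auto
 have "(SUM i:I. sgn (fst i <.> e) * (indicator (facet i) (plane_proj (fst i) (snd i) e x) * g (plane_proj (fst i) (snd i) e x)))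
   = (SUM i:I. (if i = p then g (x + a p *R e) else 0) + (if i = m then - g (x + a m *R e) else 0))"
 proof (rule sum.cong)
  fix i assume i: "i : I"
  show "sgn (fst i <.> e) * (indicator (facet i) (plane_proj (fst i) (snd i) e x) * g (plane_proj (fst i) (snd i) e x))
   = (if i = p then g (x + a p *R e) else 0) + (if i = m then - g (x + a m *R e) else 0)"
   using p(2) p(5)[OF i] m(2) m(4)[OF i]
   by (cases "fst i <.> e" "0 :: real" rule: linorder_cases) (auto simp: plane_proj_line_param a_def split: split_indicator)
 qed simp
 also have "... = g (x + a p *R e) - g (x + a m *R e)"
  using finI p(1) m(1) by (simp add: sum.distrib)
 also have "... = (LINT s|lborel. g' (x + s *R e) e * indicator {a m..a p} s)"
 proof (rule integral_FTC_Icc_real[symmetric])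
  show "a m <= a p" using p(3) m(3) by simp
  show "DERIV (%s. g (x + s *R e)) s :> g' (x + s *R e) e" for s
  proof -
   have lin: "linear (g' (x + s *R e))" using der has_derivative_linear by blast
   have "((%s. x + s *R e) has_derivative (%h. h *R e)) (at s)"
    by (auto intro!: derivative_eq_intros)
   from has_derivative_compose[OF this der] show ?thesis
    by (simp add: has_field_derivative_def linear_cmul[OF lin] mult_commute_abs)
  qed
  show "isCont (%s. g' (x + s *R e) e) s" for s
   using lc by (simp add: continuous_on_eq_continuous_at)
 qed
 also have "... = (LINT s|lborel. indicator K (x + s *R e) * g' (x + s *R e) e)"
 proof (rule integral_cong_AE)
  have [measurable]: "(%s. g' (x + s *R e) e) : borel_measurable borel"
   using lc by (rule borel_measurable_continuous_onI)
  have [measurable]: "K : sets borel" using K(1) by simp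
  show "(%s. g' (x + s *R e) e * indicator {a m..a p} s) : borel_measurable lborel"
   "(%s. indicator K (x + s *R e) * g' (x + s *R e) e) : borel_measurable lborel" by measurable
  have "AE s in lborel. s ~= a m" "AE s in lborel. s ~= a p" by (rule AE_lborel_singleton)+
  thus "AE s in lborel. g' (x + s *R e) e * indicator {a m..a p} s = indicator K (x + s *R e) * g' (x + s *R e) e"
   by eventually_elim (auto simp: inK split: split_indicator)
 qed
 finally show ?thesis by simp
qed

theorem divergence:
 fixes g :: "real^'d => real"
 assumes der: "!!x. (g has_derivative g' x) (at x)" and cont: "continuous_on UNIV (%x. g' x e)"
  and e: "e ~= 0"
 shows "(LBINT x:K. g' x e) = (LINT x:frontier K|surface_measure. (unit_normal K x <.> e) * g x)"
proof -
 define T where "T = {y. 0 < e <.> y & e <.> y < 0 + \<bar>e <.> e\<bar>}"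
 have T: "T : sets borel" "!!x. emeasure lborel {s::real. x - s *R e : T} = 1"
  unfolding T_def using emeasure_slab_line[of e e _ 0] e by auto
 note [measurable] = T(1)
 have [measurable]: "K : sets borel" using K(1) by simp
 have gc: "continuous_on UNIV g" using der has_derivative_continuous_on[of UNIV g g'] by auto
 have [measurable]: "g : borel_measurable borel" "(%x. g' x e) : borel_measurable borel"
  using gc cont by (auto intro: borel_measurable_continuous_onI)
 define h where "h x = indicator K x * g' x e" for x
 have hm[measurable]: "h : borel_measurable borel" unfolding h_def by measurable
 have h: "integrable lborel h"
 proof -
  have "integrable lborel (%x. indicator (closure K) x *R (g' x e))"
   using K(3) continuous_on_subset[OF cont] by (intro borel_integrable_compact) auto
  hence "integrable lborel (%x. indicator K x *R (indicator (closure K) x *R (g' x e)))"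
   by (rule integrable_mult_indicator[rotated]) simp
  moreover have "indicator K x *R (indicator (closure K) x *R (g' x e)) = h x" for x
   using closure_subset[of K] by (auto simp: h_def split: split_indicator)
  ultimately show ?thesis by (simp only:)
 qed
 define M where "M = density lborel (indicator T :: real^'d => ennreal)"
 have [measurable_cong]: "sets M = sets borel" by (simp add: M_def)
 define G where "G i x = indicator (facet i) (plane_proj (fst i) (snd i) e x) * g (plane_proj (fst i) (snd i) e x)" for i x
 have [measurable]: "G i : borel_measurable borel" for i unfolding G_def by measurable
 have AE_M: "AE x in M. x ~: line_bad e"
  unfolding M_def using AE_not_in[OF line_bad_null[of e]] by (subst AE_density) auto
 have intG: "fst i <.> e ~= 0 ==> integrable M (G i)"
  "fst i <.> e ~= 0 ==> (LINT x|M. G i x) = \<bar>fst i <.> e\<bar> * (LINT x|surf_on {x. fst i <.> x = snd i}. indicator (facet i) x * g x)"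
  if i: "i : I" for i
  unfolding G_def M_def
  using integral_plane_proj[OF dim _ _ T, of "fst i" "%x. indicator (facet i) x * g x" "snd i"]
   normals[of "fst i" "snd i"] i integral_facets(2)[OF gc i] by auto
 have "(LBINT x:K. g' x e) = (LINT x|lborel. h x)"
  by (simp add: set_lebesgue_integral_def h_def)
 also have "... = (LINT x|M. LINT s|lborel. h (x + s *R e))"
  unfolding M_def by (rule integral_lines[OF T h])
 also have "... = (LINT x|M. (SUM i:I. sgn (fst i <.> e) * G i x))"
 proof (rule integral_cong_AE)
  show "AE x in M. (LINT s|lborel. h (x + s *R e)) = (SUM i:I. sgn (fst i <.> e) * G i x)"
   using AE_M
  proof eventually_elim
   case (elim x)
   show ?case using line_FTC[OF der cont e elim] by (simp add: h_def G_def)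
  qed
 qed measurable
 also have "... = (SUM i:I. LINT x|M. sgn (fst i <.> e) * G i x)"
 proof (rule Bochner_Integration.integral_sum)
  fix i assume "i : I"
  thus "integrable M (%x. sgn (fst i <.> e) * G i x)"
   using intG(1) by (cases "fst i <.> e = 0") auto
 qed
 also have "... = (SUM i:I. (fst i <.> e) * (LINT x|surf_on {x. fst i <.> x = snd i}. indicator (facet i) x * g x))"
 proof (rule sum.cong)
  fix i assume i: "i : I"
  show "(LINT x|M. sgn (fst i <.> e) * G i x) = (fst i <.> e) * (LINT x|surf_on {x. fst i <.> x = snd i}. indicator (facet i) x * g x)"
  proof (cases "fst i <.> e = 0")
   case False
   \<comment> \<open>The sign of \<open>fst i <.> e\<close> comes from entering or leaving, its
     modulus from projecting the facet along \<open>e\<close>; the product is the normal component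
     in the surface integral.\<close>
   thus ?thesis using intG(2)[OF i False] by (simp add: mult.assoc[symmetric] sgn_mult_abs)
  qed simp
 qed simp
 also have "... = (LINT x:frontier K|surface_measure. (unit_normal K x <.> e) * g x)"
  by (rule integral_facets(1)[OF gc, symmetric])
 finally show ?thesis .
qed

end

section \<open>Weak-* compactness and Young measures\<close>

lemma diagonal_convergent:
 fixes a :: "nat => nat => real"
 assumes "!!n. bounded (range (a n))"
 obtains r :: "nat => nat" where "strict_mono r" "!!n. convergent (%j. a n (r j))"
proof -
 interpret subseqs "%n s. convergent (%j. a n (s j))"
 proof
  fix n and s :: "nat => nat"
  have "bounded (range (%j. a n (s j)))" by (rule bounded_subset[OF assms[of n]]) auto
  then obtain l r where "strict_mono r" "((%j. a n (s j)) \<circ> r) ----> l"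
   using bounded_imp_convergent_subsequence by blast
  thus "EX r'. strict_mono r' & convergent (%j. a n ((s \<circ> r') j))"
   by (auto simp: o_def convergent_def)
 qed
 have "convergent (%j. a n (diagseq j))" for n
 proof -
  have "convergent (%j. a n ((diagseq \<circ> (+) (Suc n)) j))"
  proof (rule diagseq_holds)
   fix r s :: "nat => nat" and n assume r: "strict_mono r" and "convergent (%j. a n (s j))"
   then obtain l where "(%j. a n (s j)) ----> l" by (auto simp: convergent_def)
   from LIMSEQ_subseq_LIMSEQ[OF this r] show "convergent (%j. a n ((s \<circ> r) j))"
    by (auto simp: o_def convergent_def)
  qed
  hence "convergent (%j. a n (diagseq (j + Suc n)))" by (simp add: o_def add.commute)
  thus ?thesis by (subst (asm) convergent_ignore_initial_segment)
 qed
 thus ?thesis using that subseq_diagseq by blast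
qed

text \<open>Weak-* sequential compactness: convergence on a generating \<open>\<pi>\<close>-system propagates to all Borel
 sets, and the limiting set function has a density by Radon-Nikodym.\<close>

context
 fixes M :: "'a::euclidean_space measure" and h :: "nat => 'a => real" and G :: "'a set set"
 assumes fin: "finite_measure M" and space_M: "space M = UNIV" and sets_M: "sets M = sigma_sets UNIV G"
  and h_meas: "!!j. h j : borel_measurable M" and h01: "!!j x. 0 <= h j x & h j x <= 1"
  and G: "Int_stable G" "UNIV : G"
  and G_conv: "!!A. A : G ==> convergent (%j. LINT x|M. indicator A x * h j x)"
begin

interpretation finite_measure M by (rule fin)

lemma int_h: "A : sets M ==> integrable M (%x. indicator A x * h j x)"
 using h_meas h01 by (intro integrable_const_bound[where B=1]) (auto split: split_indicator)

lemma int_h_bounds: "A : sets M ==> 0 <= (LINT x|M. indicator A x * h j x) & (LINT x|M. indicator A x * h j x) <= measure M A"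
proof
 assume A: "A : sets M"
 show "0 <= (LINT x|M. indicator A x * h j x)" using h01 by (intro Bochner_Integration.integral_nonneg) auto
 have "(LINT x|M. indicator A x * h j x) <= (LINT x|M. indicator A x)"
  using h01 A by (intro Bochner_Integration.integral_mono int_h) (auto split: split_indicator simp: less_top[symmetric])
 thus "(LINT x|M. indicator A x * h j x) <= measure M A" using A space_M by simp
qed

definition limset :: "'a set => real" where
 "limset A = lim (%j. LINT x|M. indicator A x * h j x)"

text \<open>Sum and limit may be exchanged because \<open>measure M (A i)\<close> is summable and
  dominates the terms uniformly in \<open>j\<close>.\<close>

lemma union_limit:
 fixes A :: "nat => 'a set"
 assumes dA: "disjoint_family A" and mA: "!!i. A i : sets M"
  and conv: "!!i. (%j. LINT x|M. indicator (A i) x * h j x) ----> L i"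
 shows "(%j. LINT x|M. indicator (\<Union>i. A i) x * h j x) ----> (\<Sum>i. L i)"
proof -
 have sm: "summable (%i. measure M (A i))"
  using finite_measure_UNION[of A] mA dA sums_summable by blast
 have "(LINT x|M. indicator (\<Union>i. A i) x * h j x) = (\<Sum>i. LINT x|M. indicator (A i) x * h j x)" for j
 proof -
  have pt: "(%i. indicator (A i) x * h j x) sums (indicator (\<Union>i. A i) x * h j x)" for x
   by (intro sums_mult2 indicator_sums) (use dA in \<open>auto simp: disjoint_family_on_def\<close>)
  have "(LINT x|M. (\<Sum>i. indicator (A i) x * h j x)) = (\<Sum>i. LINT x|M. indicator (A i) x * h j x)"
  proof (rule integral_suminf)
   show "AE x in M. summable (%i. norm (indicator (A i) x * h j x))"
    using sums_summable[OF pt] h01 by (auto simp: abs_mult)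
   show "summable (%i. LINT x|M. norm (indicator (A i) x * h j x))"
    by (rule summable_comparison_test[OF _ sm]) (use int_h_bounds[OF mA] h01 in \<open>auto simp: abs_mult\<close>)
  qed (use int_h mA in auto)
  thus ?thesis using pt by (simp add: sums_iff)
 qed
 moreover have "\<forall>\<^sub>F (k, n) in at_top \<times>\<^sub>F sequentially. norm (LINT x|M. indicator (A k) x * h n x) <= measure M (A k)"
  using int_h_bounds[OF mA] by (intro always_eventually) auto
 ultimately show ?thesis using tannerys_theorem[OF conv _ sm] by simp
qed

lemma all_convergent: "A : sets M ==> (%j. LINT x|M. indicator A x * h j x) ----> limset A"
proof -
 assume "A : sets M"
 hence A: "A : sigma_sets UNIV G" by (simp add: sets_M)
 have "G <= Pow UNIV" by simp
 from G(1) this A have "convergent (%j. LINT x|M. indicator A x * h j x)"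
 proof (induction rule: sigma_sets_induct_disjoint)
  case (compl A)
  have "(LINT x|M. indicator (UNIV - A) x * h j x) = (LINT x|M. indicator UNIV x * h j x) - (LINT x|M. indicator A x * h j x)" for j
   using Bochner_Integration.integral_diff[OF int_h[of UNIV j] int_h[of A j]] compl(1) sets.top[of M] space_M
   by (simp add: sets_M indicator_compl left_diff_distrib Compl_eq_Diff_UNIV[symmetric])
  thus ?case using compl G_conv[OF G(2)] by (simp only: convergent_diff)
 next
  case (union A)
  from union(3) have "(%j. LINT x|M. indicator (A i) x * h j x) ----> lim (%j. LINT x|M. indicator (A i) x * h j x)" for i
   by (simp add: convergent_LIMSEQ_iff)
  from union_limit[OF union(1) _ this] union(2) show ?case by (auto simp: convergent_def sets_M)
 qed (simp_all add: G_conv convergent_const)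
 thus ?thesis by (simp add: limset_def convergent_LIMSEQ_iff)
qed

lemma limset_bounds: "A : sets M ==> 0 <= limset A & limset A <= measure M A"
 using LIMSEQ_le_const[OF all_convergent, of A 0] LIMSEQ_le_const2[OF all_convergent, of A "measure M A"]
  int_h_bounds[of A] by auto

lemma limset_density:
 obtains H where "H : borel_measurable M" "!!x. 0 <= H x & H x <= 1" "!!A. A : sets M ==> (LINT x|M. indicator A x * H x) = limset A"
proof -
 define N where "N = measure_of UNIV (sets M) (%A. ennreal (limset A))"
 have ca: "countably_additive (sets M) (%A. ennreal (limset A))"
 proof (rule countably_additiveI)
  fix A :: "nat => 'a set" assume A: "range A <= sets M" "disjoint_family A" "(\<Union>i. A i) : sets M"
  have "limset (\<Union>i. A i) = (\<Sum>i. limset (A i))"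
   by (rule LIMSEQ_unique[OF all_convergent union_limit]) (use A all_convergent in auto)
  moreover have "summable (%i. limset (A i))"
   by (rule summable_comparison_test[of _ "%i. measure M (A i)"])
    (use limset_bounds A finite_measure_UNION[of A] sums_summable in auto)
  ultimately show "(\<Sum>i. ennreal (limset (A i))) = ennreal (limset (\<Union>i. A i))"
   using limset_bounds A(1) by (subst suminf_ennreal2) auto
 qed
 have pos: "positive (sets M) (%A. ennreal (limset A))"
  using limset_bounds[of "{}"] by (auto simp: positive_def)
 have sN: "sets N = sets M" using sets.sigma_sets_eq[of M] space_M sets.space_closed[of M] by (simp add: N_def)
 have eN: "emeasure N A = ennreal (limset A)" if "A : sets M" for A
  unfolding N_def using sets.sigma_algebra_axioms[of M] space_M pos ca that
  by (intro emeasure_measure_of_sigma) auto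
 have ac: "absolutely_continuous M N"
  using limset_bounds eN sN unfolding absolutely_continuous_def
  by (auto simp: null_sets_def measure_def) (metis enn2real_0 ennreal_0 order_antisym)
 have "finite_measure N" by (rule finite_measureI) (use eN[OF sets.top] sets_eq_imp_space_eq[OF sN] in simp)
 then obtain D where D[measurable]: "D : borel_measurable M" and RN: "AE x in M. RN_deriv M N x = ennreal (D x)" and D0: "!!x. 0 <= D x"
  using real_RN_deriv[OF _ ac sN] by blast
 have nn: "(\<integral>\<^sup>+x. ennreal (indicator A x * D x) \<partial>M) = ennreal (limset A)" if A: "A : sets M" for A
 proof -
  have "(\<integral>\<^sup>+x. ennreal (indicator A x * D x) \<partial>M) = (\<integral>\<^sup>+x. RN_deriv M N x * indicator A x \<partial>M)"
   by (rule nn_integral_cong_AE) (use RN in \<open>eventually_elim, auto split: split_indicator\<close>)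
  thus ?thesis using eN[OF A] density_RN_deriv[OF ac sN] A by (metis emeasure_density borel_measurable_RN_deriv)
 qed
 have int: "integrable M (%x. indicator A x * D x)" "(LINT x|M. indicator A x * D x) = limset A" if A: "A : sets M" for A
  using A D0 nn[OF A] limset_bounds[OF A] by (auto intro!: integrableI_nonneg simp: integral_eq_nn_integral)
 \<comment> \<open>The averages of \<open>D\<close> over sets of positive measure lie between 0 and
   1, hence so does \<open>D\<close> almost everywhere; clipping then makes the bounds hold
   everywhere.\<close>
 have "AE x in M. D x : {0..1}"
 proof (rule averaging_theorem)
  show "integrable M D" using int(1)[of UNIV] sets.top[of M] space_M by simp
  show "(1 / measure M A) *R set_lebesgue_integral M A D : {0..1}" if "A : sets M" "0 < measure M A" for A
   using that int(2)[of A] limset_bounds[of A] by (simp add: set_lebesgue_integral_def)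
 qed simp
 hence eq: "AE x in M. max 0 (min 1 (D x)) = D x" by eventually_elim auto
 show thesis
 proof (rule that[of "%x. max 0 (min 1 (D x))"])
  fix A assume A: "A : sets M"
  show "(LINT x|M. indicator A x * max 0 (min 1 (D x))) = limset A"
   unfolding int(2)[OF A, symmetric]
   by (rule integral_cong_AE) (use A eq in \<open>auto elim!: eventually_mono\<close>)
 qed auto
qed

lemma weak_density:
 "EX H. H : borel_measurable M & (ALL x. 0 <= H x & H x <= 1) &
   (ALL psi. integrable M psi --> (%j. LINT x|M. h j x * psi x) ----> (LINT x|M. H x * psi x))"
proof -
 obtain H where Hm: "H : borel_measurable M" and H01: "!!x. 0 <= H x & H x <= 1"
  and int_ind: "!!A. A : sets M ==> (LINT x|M. indicator A x * H x) = limset A"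
  using limset_density by blast
 have bm: "integrable M (%x. k x * u x)" if "k : borel_measurable M" "!!x. 0 <= k x & k x <= 1" "integrable M u"
  for k u :: "'a => real"
  using that by (intro Bochner_Integration.integrable_bound[OF that(3)]) (auto simp: abs_mult intro!: mult_left_le_one_le)
 have "(%j. LINT x|M. h j x * psi x) ----> (LINT x|M. H x * psi x)" if "integrable M psi" for psi
  using that
 proof (induction rule: integrable_induct)
  case (base A c)
  have "(%j. (LINT x|M. indicator A x * h j x) * c) ----> (LINT x|M. indicator A x * H x) * c"
   using all_convergent[OF base(1)] int_ind[OF base(1)] by (intro tendsto_mult_right) auto
  moreover have "(LINT x|M. indicator A x * k x) * c = (LINT x|M. k x * (indicator A x *R c))" for k :: "'a => real"
   by (subst integral_mult_left_zero[symmetric]) (auto simp: mult_ac)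
  ultimately show ?case by simp
 next
  case (add f g)
  show ?case
   using tendsto_add[OF add(3,4)] bm[OF h_meas h01] bm[OF Hm H01] add(1,2)
   by (simp add: distrib_left)
 next
  \<comment> \<open>Replacing \<open>f\<close> by \<open>s i\<close> costs at most their L1
    distance, uniformly in \<open>j\<close>, because the weights lie between 0 and 1. This
    uniformity allows the two limits to be exchanged.\<close>
  case (lim f s)
  have "(%i. LINT x|M. \<bar>s i x - f x\<bar>) ----> (LINT x|M. 0)"
  proof (rule integral_dominated_convergence[where w="%x. 3 * \<bar>f x\<bar>"])
   show "AE x in M. (%i. \<bar>s i x - f x\<bar>) ----> 0"
    using lim(2) by (intro AE_I2 tendsto_rabs_zero) (auto intro!: tendsto_eq_intros)
   show "AE x in M. norm \<bar>s i x - f x\<bar> <= 3 * \<bar>f x\<bar>" for i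
    using lim(3)[of _ i] by (intro AE_I2) (smt (verit) real_norm_def)
  qed (use lim(1,4) in auto)
  hence c: "(%i. LINT x|M. \<bar>s i x - f x\<bar>) ----> 0" by simp
  have close: "\<bar>(LINT x|M. k x * s i x) - (LINT x|M. k x * f x)\<bar> <= (LINT x|M. \<bar>s i x - f x\<bar>)"
   if k: "k : borel_measurable M" "!!x. 0 <= k x & k x <= 1" for k :: "'a => real" and i
  proof -
   have "norm (LINT x|M. k x * s i x - k x * f x) <= (LINT x|M. \<bar>s i x - f x\<bar>)"
   proof (rule Bochner_Integration.integral_norm_bound_integral)
    show "norm (k x * s i x - k x * f x) <= \<bar>s i x - f x\<bar>" for x
     using k(2)[of x] by (simp add: right_diff_distrib[symmetric] abs_mult mult_left_le_one_le)
   qed (use bm[OF k] lim(1,4) in auto)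
   thus ?thesis using bm[OF k] lim(1,4) by simp
  qed
  show ?case
  proof (rule swap_uniform_limit'[where S=UNIV and F=sequentially])
   show "\<forall>\<^sub>F i in sequentially. (%j. LINT x|M. h j x * s i x) ----> (LINT x|M. H x * s i x)" using lim(5) by simp
   show "(%i. LINT x|M. H x * s i x) ----> (LINT x|M. H x * f x)"
    by (rule metric_tendsto_imp_tendsto[OF c]) (use close[OF Hm H01] in \<open>auto simp: dist_real_def intro!: always_eventually order_trans[OF _ abs_ge_self]\<close>)
   show "uniform_limit UNIV (%i j. LINT x|M. h j x * s i x) (%j. LINT x|M. h j x * f x) sequentially"
   proof (rule uniform_limitI)
    fix e :: real assume "0 < e"
    from order_tendstoD(2)[OF c this]
    show "\<forall>\<^sub>F i in sequentially. ALL j:UNIV. dist (LINT x|M. h j x * s i x) (LINT x|M. h j x * f x) < e"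
     by eventually_elim (use close[OF h_meas h01] in \<open>auto simp: dist_real_def intro: le_less_trans\<close>)
   qed
  qed auto
 qed
 thus ?thesis using Hm H01 by blast
qed

end

text \<open>The diagonal argument needs countably many test sets, and the induction over disjoint
  unions a family that is stable under intersection and contains the whole space: finite
  intersections from a countable base.\<close>

lemma countable_borel_generator:
 "EX G :: 'a::second_countable_topology set set. countable G & Int_stable G & sets borel = sigma_sets UNIV G & UNIV : G"
proof -
 obtain B :: "'a set set" where B: "countable B" "topological_basis B" using ex_countable_basis by blast
 define G where "G = Inter ` {F. finite F & F <= B}"
 have "countable G" unfolding G_def using countable_Collect_finite_subset[OF B(1)] by (rule countable_image)
 moreover have "Int_stable G"
 proof (rule Int_stableI)
  fix X Y assume "X : G" "Y : G"
  then obtain F F' where "X = \<Inter>F" "Y = \<Inter>F'" "finite F" "finite F'" "F <= B" "F' <= B"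
   unfolding G_def by blast
  thus "X Int Y : G" unfolding G_def by (intro image_eqI[of _ _ "F Un F'"]) auto
 qed
 moreover have "UNIV : G" unfolding G_def by (intro image_eqI[of _ _ "{}"]) auto
 moreover have "sets (borel :: 'a measure) = sigma_sets UNIV G"
 proof (rule antisym)
  have "X : G" if "X : B" for X unfolding G_def using that by (intro image_eqI[of _ _ "{X}"]) auto
  hence "sigma_sets UNIV B <= sigma_sets UNIV G" by (intro sigma_sets_mono') auto
  thus "sets (borel :: 'a measure) <= sigma_sets UNIV G" by (subst borel_eq_countable_basis[OF B]) simp
  have "open X" if "X : G" for X using that topological_basis_open[OF B(2)] by (auto simp: G_def intro!: open_Inter)
  hence "G <= sets borel" by auto
  thus "sigma_sets UNIV G <= sets borel" using sets.sigma_sets_subset[of G borel] by simp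
 qed
 ultimately show ?thesis by blast
qed

definition unit_measure :: "real measure" where
 "unit_measure = restrict_space lborel {0<..<1}"

lemma space_unit_measure [simp]: "space unit_measure = {0<..<1}"
 by (simp add: unit_measure_def space_restrict_space)

lemma prob_space_unit_measure: "prob_space unit_measure"
 by (rule prob_spaceI) (simp add: unit_measure_def emeasure_restrict_space space_restrict_space)

lemma measurable_unit_measure: "h : borel_measurable borel ==> h : borel_measurable unit_measure"
 unfolding unit_measure_def by (intro measurable_restrict_space1) simp

lemma unit_measure_atMost:
 assumes "0 <= a" "a <= 1"
 shows "(LINT wo|unit_measure. indicator {..a} wo) = (a::real)"
proof -
 have "(LINT wo|unit_measure. indicator {..a} wo :: real) = measure unit_measure ({..a} Int {0<..<1})"
  by simp
 also have "... = measure lborel ({..a} Int {0<..<1})"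
  unfolding unit_measure_def by (rule measure_restrict_space) auto
 also have "{..a} Int {0<..<1} = (if a < 1 then {0<..a} else {0<..<1})" using assms by auto
 finally show ?thesis using assms by auto
qed

text \<open>The limits \<open>a q\<close> at rational levels need not be right continuous in
  \<open>q\<close> and so may differ from the distribution function of \<open>mu\<close>. Being
  squeezed between its values at smaller levels and at \<open>q\<close> is enough at points of
  continuity.\<close>

lemma weak_conv_sandwich:
 assumes nu: "!!j. real_distribution (nu j)" "real_distribution mu"
  and lim: "!!q. q : \<rat> ==> (%j. cdf (nu j) q) ----> a q"
  and a: "!!q. q : \<rat> ==> a q <= cdf mu q" "!!p q. q : \<rat> ==> p < q ==> cdf mu p <= a q"
 shows "weak_conv_m nu mu"
 unfolding weak_conv_m_def weak_conv_def
proof (intro allI impI order_tendstoI)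
 have mono: "cdf (nu j) p <= cdf (nu j) q" if "p <= q" for j p q
  using finite_borel_measure.cdf_nondecreasing[OF real_distribution.finite_borel_measure_M[OF nu(1)] that] .
 fix x assume "isCont (cdf mu) x"
 hence c: "cdf mu \<midarrow>x\<rightarrow> cdf mu x" by (simp add: isCont_def)
 {
  fix b assume "b < cdf mu x"
  from order_tendstoD(1)[OF c this] obtain d where d: "0 < d" "!!y. y ~= x ==> \<bar>y - x\<bar> < d ==> b < cdf mu y"
   by (auto simp: eventually_at dist_real_def)
  obtain q where q: "q : \<rat>" "x - d / 2 < q" "q < x" using Rats_dense_in_real[of "x - d / 2" x] d(1) by auto
  have "b < cdf mu (x - d / 2)" using d by auto
  from order_tendstoD(1)[OF lim[OF q(1)] less_le_trans[OF this a(2)[OF q(1,2)]]]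
  show "\<forall>\<^sub>F j in sequentially. b < cdf (nu j) x"
   by eventually_elim (rule less_le_trans[OF _ mono], use q(3) in auto)
 next
  fix b assume "cdf mu x < b"
  from order_tendstoD(2)[OF c this] obtain d where d: "0 < d" "!!y. y ~= x ==> \<bar>y - x\<bar> < d ==> cdf mu y < b"
   by (auto simp: eventually_at dist_real_def)
  obtain q where q: "q : \<rat>" "x < q" "q < x + d" using Rats_dense_in_real[of x "x + d"] d(1) by auto
  have "cdf mu q < b" using d q by auto
  from order_tendstoD(2)[OF lim[OF q(1)] le_less_trans[OF a(1)[OF q(1)] this]]
  show "\<forall>\<^sub>F j in sequentially. cdf (nu j) x < b"
   by eventually_elim (rule le_less_trans[OF mono], use q(2) in auto)
 }
qed

text \<open>Young measures of \<open>[0,1]\<close>-valued sequences: the weak-* limits of the indicators of \<open>w j <= q\<close> are the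
 distribution functions; \<open>X z\<close> is the corresponding quantile function.\<close>

theorem scalar_young_measure:
 fixes M :: "'a::euclidean_space measure" and w :: "nat => 'a => real"
 assumes fin: "finite_measure M" and sets_M: "sets M = sets borel"
  and w_meas[measurable]: "!!j. w j : borel_measurable M" and w01: "!!j x. 0 <= w j x & w j x <= 1"
 obtains r :: "nat => nat" and X :: "'a => real => real"
 where "strict_mono r" "(%z. X (fst z) (snd z)) : borel_measurable (M \<Otimes>\<^sub>M unit_measure)" "!!z wo. 0 <= X z wo & X z wo <= 1"
  "!!g psi :: _ => real. continuous_on UNIV g ==> integrable M psi ==>
    (%j. LINT z|M. g (w (r j) z) * psi z) ----> (LINT z|M. (LINT wo|unit_measure. g (X z wo)) * psi z)"
proof -
 interpret finite_measure M by (rule fin)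
 have space_M: "space M = UNIV" using sets_eq_imp_space_eq[OF sets_M] by simp
 obtain G :: "'a set set" where G: "countable G" "Int_stable G" "sets borel = sigma_sets UNIV G" "UNIV : G"
  using countable_borel_generator by blast
 have sG: "sets M = sigma_sets UNIV G" using sets_M G(3) by simp
 define h where "h j q x = indicat_real {..q} (w j x)" for j and q :: real and x
 have hm[measurable]: "h j q : borel_measurable M" for j q unfolding h_def by measurable
 have h01: "0 <= h j q x & h j q x <= 1" for j q x by (simp add: h_def)
 define P where "P = G \<times> (\<rat> :: real set)"
 have P: "countable P" "P ~= {}" unfolding P_def using G(1,4) countable_rat by auto
 define a where "a n j = (LINT x|M. indicator (fst (from_nat_into P n)) x * h j (snd (from_nat_into P n)) x)" for n j
 have "norm (a n j) <= (LINT x|M. 1)" for n j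
  unfolding a_def
 proof (rule Bochner_Integration.integral_norm_bound_integral)
  have "A : sets M" if "A : G" for A using that sG by auto
  hence "fst (from_nat_into P n) : sets M" using from_nat_into[OF P(2), of n] by (auto simp: P_def)
  thus "integrable M (%x. indicator (fst (from_nat_into P n)) x * h j (snd (from_nat_into P n)) x)"
   using h01 by (intro integrable_const_bound[where B=1]) (auto split: split_indicator)
 qed (use h01 in \<open>auto split: split_indicator\<close>)
 then obtain r where r: "strict_mono r" "!!n. convergent (%j. a n (r j))"
  using diagonal_convergent[of a] by (metis boundedI rangeE)
 have conv: "convergent (%j. LINT x|M. indicator A x * h (r j) q x)" if "A : G" "q : \<rat>" for A q
 proof -
  have "(A, q) : P" using that by (simp add: P_def)
  then obtain n where "from_nat_into P n = (A, q)" using from_nat_into_surj[OF P(1)] by blast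
  thus ?thesis using r(2)[of n] by (simp add: a_def)
 qed
 \<comment> \<open>For levels outside [0,1) the weak limits are chosen to be exactly 0 or 1 at every
   point, so that the comparison with the law of the quantile function below has no exceptional set
   at these levels.\<close>
 have "EX F. F : borel_measurable M & (ALL x. 0 <= F x & F x <= 1) & (q < 0 --> F = (%_. 0)) & (1 <= q --> F = (%_. 1)) &
   (ALL psi. integrable M psi --> (%j. LINT x|M. h (r j) q x * psi x) ----> (LINT x|M. F x * psi x))" if q: "q : \<rat>" for q
 proof -
  consider "q < 0" | "1 <= q" | "0 <= q" "q < 1" by linarith
  thus ?thesis
  proof cases
   case 1
   hence "h j q x = 0" for j x using w01[of j x] by (auto simp: h_def)
   thus ?thesis using 1 by (intro exI[of _ "%_. 0"]) simp
  next
   case 2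
   hence "h j q x = 1" for j x using w01[of j x] by (auto simp: h_def)
   thus ?thesis using 2 by (intro exI[of _ "%_. 1"]) simp
  next
   case 3
   moreover obtain H where "H : borel_measurable M" "ALL x. 0 <= H x & H x <= 1"
    "ALL psi. integrable M psi --> (%j. LINT x|M. h (r j) q x * psi x) ----> (LINT x|M. H x * psi x)"
    using weak_density[of M G "%j. h (r j) q", OF fin space_M sG hm h01 G(2,4) conv[OF _ q]] by blast
   ultimately show ?thesis by (intro exI[of _ H]) simp
  qed
 qed
 from bchoice[OF ballI, OF this] obtain F where F0: "ALL q:\<rat>. F q : borel_measurable M & (ALL x. 0 <= F q x & F q x <= 1) & (q < 0 --> F q = (%_. 0)) &
   (1 <= q --> F q = (%_. 1)) & (ALL psi. integrable M psi --> (%j. LINT x|M. h (r j) q x * psi x) ----> (LINT x|M. F q x * psi x))" ..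
 have F: "!!q. q : \<rat> ==> F q : borel_measurable M" "!!q x. q : \<rat> ==> 0 <= F q x & F q x <= 1"
  "!!q x. q : \<rat> ==> q < 0 ==> F q x = 0" "!!q x. q : \<rat> ==> 1 <= q ==> F q x = 1"
  "!!q psi. q : \<rat> ==> integrable M psi ==> (%j. LINT x|M. h (r j) q x * psi x) ----> (LINT x|M. F q x * psi x)"
  using F0 by auto
 have intm: "integrable M (%x. k x * psi x)" if "k : borel_measurable M" "!!x. \<bar>k x\<bar> <= B" "integrable M psi"
  for k psi :: "'a => real" and B
 proof (rule Bochner_Integration.integrable_bound[of M "%x. B * psi x"])
  have "\<bar>k x\<bar> <= \<bar>B\<bar>" for x using that(2)[of x] by linarith
  thus "AE x in M. norm (k x * psi x) <= norm (B * psi x)" by (simp add: abs_mult mult_right_mono)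
 qed (use that in auto)
 have intF: "integrable M (%x. F q x * psi x)" if "q : \<rat>" "integrable M psi" for q psi
  using F(1,2)[OF that(1)] that(2) by (intro intm[where B=1]) auto
 have mono: "AE x in M. F p x <= F q x" if "p : \<rat>" "q : \<rat>" "p <= q" for p q
 proof -
  have i1: "integrable M (%x. F q x - F p x)" using intF[of _ "%_. 1"] that by simp
  have "AE x in M. 0 <= F q x - F p x"
  proof (rule density_nonneg[OF i1])
   fix A assume A: "A : sets M"
   hence iA: "integrable M (indicat_real A)" by (simp add: less_top[symmetric])
   have "(LINT x|M. F p x * indicator A x) <= (LINT x|M. F q x * indicator A x)"
   proof (rule LIMSEQ_le[OF F(5)[OF that(1) iA] F(5)[OF that(2) iA]], intro exI allI impI)
    fix n
    show "(LINT x|M. h (r n) p x * indicator A x) <= (LINT x|M. h (r n) q x * indicator A x)"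
     using that(3) by (intro Bochner_Integration.integral_mono intm[where B=1] hm iA)
      (auto simp: h_def split: split_indicator)
   qed
   thus "0 <= (LINT x:A|M. F q x - F p x)"
    using intF[OF _ iA] that by (simp add: set_lebesgue_integral_def right_diff_distrib mult.commute)
  qed
  thus ?thesis by eventually_elim simp
 qed
 have AE_good: "AE x in M. ALL p:\<rat>. ALL q:\<rat>. p <= q --> F p x <= F q x"
  using mono by (auto simp: AE_ball_countable countable_rat)
 \<comment> \<open>The generalised inverse of the distribution function, over rational levels so
   that its measurability involves countably many conditions only. The element 1 keeps the set of
   the infimum nonempty.\<close>
 define X where "X z wo = Inf (insert 1 {q:\<rat>. 0 <= q & q <= 1 & wo <= F q z})" for z wo
 have bdd: "bdd_below (insert (1::real) {q:\<rat>. 0 <= q & q <= 1 & wo <= F q z})" for z wo by (rule bdd_belowI[of _ 0]) auto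
 have X_less: "X z wo < c <-> 1 < c | (EX q:\<rat> Int {0..1}. q < c & wo <= F q z)" for z wo c
  unfolding X_def by (subst cInf_less_iff[OF _ bdd]) auto
 have X01: "0 <= X z wo & X z wo <= 1" for z wo
  unfolding X_def by (intro conjI cInf_greatest cInf_lower bdd) auto
 have Xm: "(%z. X (fst z) (snd z)) : borel_measurable (M \<Otimes>\<^sub>M borel)"
 proof (rule borel_measurable_iff_less[THEN iffD2], rule allI)
  fix c :: real
  have "(UN q:{q : \<rat> Int {0..1}. q < c}. {z : space (M \<Otimes>\<^sub>M borel). snd z <= F q (fst z)}) : sets (M \<Otimes>\<^sub>M borel)"
  proof (rule sets.countable_UN''[OF countable_subset[OF _ countable_rat]], safe)
   fix q :: real assume "q : \<rat>"
   hence [measurable]: "F q : borel_measurable M" using F(1) by auto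
   show "{z : space (M \<Otimes>\<^sub>M borel). snd z <= F q (fst z)} : sets (M \<Otimes>\<^sub>M borel)" by measurable
  qed
  moreover have "{z : space (M \<Otimes>\<^sub>M borel). X (fst z) (snd z) < c} = (if 1 < c then space (M \<Otimes>\<^sub>M borel) else
    (UN q:{q : \<rat> Int {0..1}. q < c}. {z : space (M \<Otimes>\<^sub>M borel). snd z <= F q (fst z)}))"
   by (auto simp: X_less)
  ultimately show "{z : space (M \<Otimes>\<^sub>M borel). X (fst z) (snd z) < c} : sets (M \<Otimes>\<^sub>M borel)" by simp
 qed
 interpret U: prob_space unit_measure by (rule prob_space_unit_measure)
 have Xm': "(%z. X (fst z) (snd z)) : borel_measurable (M \<Otimes>\<^sub>M unit_measure)"
 proof -
  have "(%z. z) : measurable (M \<Otimes>\<^sub>M unit_measure) (M \<Otimes>\<^sub>M borel)"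
   using measurable_unit_measure[of "%x. x"] by (intro measurable_pair) (auto simp: o_def)
  thus ?thesis using Xm by (rule measurable_compose)
 qed
 have Xz: "X z : borel_measurable unit_measure" for z
  using measurable_compose[OF measurable_Pair1'[of z M unit_measure] Xm'] space_M by simp
 have kX: "integrable unit_measure (%wo. k (X z wo))" "(%z. LINT wo|unit_measure. k (X z wo)) : borel_measurable M"
  "\<bar>LINT wo|unit_measure. k (X z wo)\<bar> <= b" if k: "k : borel_measurable borel" "!!x. \<bar>k x\<bar> <= b" for k :: "real => real" and b z
 proof -
  show i: "integrable unit_measure (%wo. k (X z wo))"
   by (rule U.integrable_const_bound[where B=b]) (use k measurable_compose[OF Xz k(1)] in auto)
  show "(%z. LINT wo|unit_measure. k (X z wo)) : borel_measurable M"
   using measurable_compose[OF Xm' k(1)] by (intro U.borel_measurable_lebesgue_integral) (simp add: case_prod_beta)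
  show "\<bar>LINT wo|unit_measure. k (X z wo)\<bar> <= b"
   using Bochner_Integration.integral_norm_bound_integral[OF i, of "%_. b"] k(2) U.prob_space by simp
 qed
 define C where "C z q = (LINT wo|unit_measure. indicat_real {..q} (X z wo))" for z and q :: real
 \<comment> \<open>As \<open>F q z\<close> need not be right continuous in \<open>q\<close>, it
   agrees with the distribution function \<open>C\<close> of the quantile function only up to an
   arbitrarily small shift of the level.\<close>
 have C: "F q z <= C z q" "!!p. p < q ==> (ALL p:\<rat>. ALL q:\<rat>. p <= q --> F p z <= F q z) ==> C z p <= F q z" if q: "q : \<rat>" for q z
 proof -
  have iX: "integrable unit_measure (%wo. indicator {..p} (X z wo) :: real)" for p by (rule kX(1)[of _ 1]) auto
  have iF: "integrable unit_measure (indicator {..F q z} :: real => real)"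
   by (rule U.integrable_const_bound[where B=1]) (auto intro: measurable_unit_measure)
  have F_eq: "F q z = (LINT wo|unit_measure. indicator {..F q z} wo)" using unit_measure_atMost[of "F q z"] F(2)[OF q] by simp
  have "X z wo <= q" if wo: "wo : {0<..<1::real}" "wo <= F q z" for wo
  proof -
   have "0 <= q" using F(3)[OF q, of z] wo by fastforce
   thus ?thesis using X01[of z wo] q wo by (cases "q <= 1") (auto simp: X_def intro!: cInf_lower bdd)
  qed
  thus "F q z <= C z q"
   unfolding C_def by (subst F_eq, intro Bochner_Integration.integral_mono iX iF) (auto split: split_indicator)
  fix p assume p: "p < q" and good: "ALL p:\<rat>. ALL q:\<rat>. p <= q --> F p z <= F q z"
  have "wo <= F q z" if wo: "wo : {0<..<1::real}" "X z wo <= p" for wo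
  proof -
   have "X z wo < q" using wo p by simp
   thus ?thesis using F(4)[OF q, of z] wo(1) good q by (fastforce simp: X_less)
  qed
  thus "C z p <= F q z"
   unfolding C_def by (subst F_eq, intro Bochner_Integration.integral_mono iX iF) (auto split: split_indicator)
 qed
 \<comment> \<open>A nonnegative weight \<open>psi\<close> of integral one is a probability density.
   Both sides become expectations of \<open>g\<close> under laws on the real line, and convergence
   of distribution functions applies.\<close>
 have pos: "(%j. LINT z|M. g (w (r j) z) * psi z) ----> (LINT z|M. (LINT wo|unit_measure. g (X z wo)) * psi z)"
  if g: "continuous_on UNIV g" and B: "!!x. \<bar>g x\<bar> <= B" and psi: "integrable M psi" "!!z. 0 <= psi z" "(LINT z|M. psi z) = 1" for g psi :: "_ => real" and B
 proof -
  have [measurable]: "psi : borel_measurable M" "g : borel_measurable borel"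
   using psi g by (auto intro: borel_measurable_continuous_onI)
  define D where "D = density M (%z. ennreal (psi z))"
  interpret D: prob_space D
   using psi sets.top[of M] by (intro prob_spaceI) (simp add: D_def emeasure_density nn_integral_eq_integral space_M)
  have [measurable_cong]: "sets D = sets M" by (simp add: D_def)
  interpret DU: pair_prob_space D unit_measure by unfold_locales
  have [measurable]: "(%z. X (fst z) (snd z)) : borel_measurable (D \<Otimes>\<^sub>M unit_measure)" using Xm' by measurable
  define nu where "nu j = distr D borel (w (r j))" for j
  define mu where "mu = distr (D \<Otimes>\<^sub>M unit_measure) borel (%z. X (fst z) (snd z))"
  have mu: "integral\<^sup>L mu k = (LINT z|M. (LINT wo|unit_measure. k (X z wo)) * psi z)"
   if k[measurable]: "k : borel_measurable borel" "!!x. \<bar>k x\<bar> <= b" for k :: "real => real" and b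
  proof -
   have "integrable (D \<Otimes>\<^sub>M unit_measure) (%z. k (X (fst z) (snd z)))"
    by (rule DU.P.integrable_const_bound[where B=b]) (use k(2) in \<open>auto, measurable\<close>)
   hence "integral\<^sup>L mu k = (LINT z|D. LINT wo|unit_measure. k (X z wo))"
    unfolding mu_def by (subst integral_distr) (auto simp: DU.integral_fst'[symmetric] case_prod_beta)
   thus ?thesis using kX(2)[OF k] psi(2) by (simp add: D_def integral_density mult.commute)
  qed
  have nu: "integral\<^sup>L (nu j) k = (LINT z|M. k (w (r j) z) * psi z)" if "k : borel_measurable borel" for k :: "real => real" and j
   using that psi(2) by (simp add: nu_def D_def integral_distr integral_density mult.commute)
  have rd: "real_distribution (nu j)" "real_distribution mu" for j
   unfolding nu_def mu_def by (intro D.real_distribution_distr DU.P.real_distribution_distr; measurable)+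
  have cdf_int: "cdf N q = integral\<^sup>L N (indicator {..q})" if "real_distribution N" for N q
   using that real_distribution.space_eq_univ[OF that] by (simp add: cdf_def)
  have cdf: "cdf mu q = (LINT z|M. C z q * psi z)" for q
   unfolding cdf_int[OF rd(2)] C_def by (rule mu[of _ 1]) auto
  have Cm: "integrable M (%z. C z q * psi z)" for q
   unfolding C_def by (intro intm[where B=1] kX(2,3) psi(1)) auto
  have "weak_conv_m nu mu"
  proof (rule weak_conv_sandwich[OF rd])
   fix q :: real assume q: "q : \<rat>"
   have "cdf (nu j) q = (LINT z|M. h (r j) q z * psi z)" for j
    unfolding cdf_int[OF rd(1)] h_def by (rule nu) simp
   thus "(%j. cdf (nu j) q) ----> (LINT z|M. F q z * psi z)" using F(5)[OF q psi(1)] by simp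
   show "(LINT z|M. F q z * psi z) <= cdf mu q"
    unfolding cdf using C(1)[OF q] psi(2) by (intro Bochner_Integration.integral_mono intF q psi(1) Cm mult_right_mono) auto
   fix p assume p: "p < q"
   show "cdf mu p <= (LINT z|M. F q z * psi z)"
    unfolding cdf
    by (intro integral_mono_AE intF q psi(1) Cm)
     (use AE_good in \<open>eventually_elim, auto intro!: mult_right_mono C(2)[OF q p] psi(2)\<close>)
  qed
  hence "(%j. integral\<^sup>L (nu j) g) ----> integral\<^sup>L mu g"
   using g B by (intro weak_conv_imp_integral_bdd_continuous_conv[OF rd, where B=B]) (auto simp: continuous_on_eq_continuous_at)
  thus ?thesis using nu[of g] mu[of g B] B by simp
 qed
 have main: "(%j. LINT z|M. g (w (r j) z) * psi z) ----> (LINT z|M. (LINT wo|unit_measure. g (X z wo)) * psi z)"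
  if g0: "continuous_on UNIV g" and psi: "integrable M psi" for g psi :: "_ => real"
 proof -
  \<comment> \<open>All values involved lie in [0,1], so composing \<open>g\<close> with clipping
    changes nothing there and makes it bounded.\<close>
  define k where "k x = g (max 0 (min 1 x))" for x
  have k: "continuous_on UNIV k" unfolding k_def by (intro continuous_on_compose2[OF g0] continuous_intros) auto
  have km: "k : borel_measurable borel" by (rule borel_measurable_continuous_onI[OF k])
  have gk: "g (w j z) = k (w j z)" "g (X z wo) = k (X z wo)" for j z wo using w01 X01 by (simp_all add: k_def)
  have "bounded (g ` {0..1})" using g0 by (intro compact_imp_bounded compact_continuous_image) (auto intro: continuous_on_subset)
  then obtain B where "ALL x:{0..1}. \<bar>g x\<bar> <= B" by (auto simp: bounded_iff)
  hence B: "\<bar>k x\<bar> <= B" for x by (simp add: k_def)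
  have half: "(%j. LINT z|M. k (w (r j) z) * phi z) ----> (LINT z|M. (LINT wo|unit_measure. k (X z wo)) * phi z)"
   if phi: "integrable M phi" "!!z. 0 <= phi z" for phi :: "'a => real"
  proof (cases "(LINT z|M. phi z) = 0")
   case True
   hence "AE z in M. phi z = 0" using integral_nonneg_eq_0_iff_AE[OF phi(1)] phi(2) by simp
   hence "(LINT z|M. f z * phi z) = 0" for f by (intro integral_eq_zero_AE) (auto elim: eventually_mono)
   thus ?thesis by simp
  next
   case False
   hence "0 < (LINT z|M. phi z)" using Bochner_Integration.integral_nonneg[of M phi] phi(2) by (simp add: less_le)
   thus ?thesis
    using tendsto_mult_left[OF pos[OF k B, of "%z. phi z / (LINT z|M. phi z)"], of "LINT z|M. phi z"] phi by simp
  qed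
  have i: "integrable M (%z. max 0 (psi z))" "integrable M (%z. max 0 (- psi z))" using psi by auto
  have split: "(LINT z|M. f z * max 0 (psi z)) - (LINT z|M. f z * max 0 (- psi z)) = (LINT z|M. f z * psi z)"
   if f: "f : borel_measurable M" "!!z. \<bar>f z\<bar> <= B" for f
  proof -
   have "(LINT z|M. f z * psi z) = (LINT z|M. f z * max 0 (psi z) - f z * max 0 (- psi z))"
    by (rule Bochner_Integration.integral_cong) (auto simp: max_def)
   thus ?thesis using intm[OF f i(1)] intm[OF f i(2)] by simp
  qed
  have "(%j. LINT z|M. k (w (r j) z) * psi z) ----> (LINT z|M. (LINT wo|unit_measure. k (X z wo)) * psi z)"
   using tendsto_diff[OF half[OF i(1)] half[OF i(2)]] split[OF kX(2)[OF km B] kX(3)[OF km B]]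
    split[OF measurable_compose[OF w_meas km] B] by simp
  thus ?thesis by (simp add: gk)
 qed
 show thesis by (rule that[OF r(1) Xm' X01 main])
qed

text \<open>The usual coding by points of the Cantor set. With the digits 0 and 2 only, codes that
  differ early are separated by a gap, so that the digits depend continuously on the code.\<close>

definition ternary :: "(nat => bool) => real" where
 "ternary a = (\<Sum>j. 2 * of_bool (a j) * (1/3) ^ Suc j)"

lemma ternary_summable: "summable (%j. 2 * of_bool (a j) * (1/3::real) ^ Suc j)"
 by (rule summable_comparison_test'[where N=0 and g="%j. (1/3::real) ^ j"]) (auto simp: summable_geometric)

lemma ternary_bounds: "0 <= ternary a & ternary a <= 1"
proof
 show "0 <= ternary a" unfolding ternary_def by (intro suminf_nonneg ternary_summable) auto
 have "ternary a <= ternary (%_. True)"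
  unfolding ternary_def by (intro suminf_le ternary_summable) auto
 also have "... = 1" using sums_unique[OF sums_mult[OF geometric_sums[of "1/3::real"], of "2/3"]] by (simp add: ternary_def)
 finally show "ternary a <= 1" .
qed

lemma ternary_Suc: "3 * ternary a = 2 * of_bool (a 0) + ternary (%j. a (Suc j))"
 using suminf_split_head[OF ternary_summable[of a]] suminf_mult[OF ternary_summable[of "%j. a (Suc j)"], of "1/3"]
 by (simp add: ternary_def mult_ac)

text \<open>The digits after the first contribute at most 1/3, so codes with different first digits
  are at least 1/3 apart. If the first digits agree, they are split off and the distance is
  multiplied by three.\<close>

lemma ternary_code_injective: "\<bar>ternary a - ternary b\<bar> < (1/3) ^ k ==> i < k ==> a i = b i"
proof (induction k arbitrary: a b i)
 case (Suc k)
 let ?a = "%j. a (Suc j)" and ?b = "%j. b (Suc j)"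
 have "\<bar>3 * ternary a - 3 * ternary b\<bar> < (1/3) ^ k" using Suc.prems(1) by (simp add: abs_if split: if_splits)
 moreover have "(1/3::real) ^ k <= 1" by (rule power_le_one) auto
 ultimately have "a 0 = b 0" "\<bar>ternary ?a - ternary ?b\<bar> < (1/3) ^ k"
  using ternary_Suc[of a] ternary_Suc[of b] ternary_bounds[of ?a] ternary_bounds[of ?b] by (auto simp: of_bool_def split: if_splits)
 with Suc.IH[of ?a ?b] Suc.prems(2) show ?case by (cases i) auto
qed simp

text \<open>The ball is a continuous image of a set of reals, with a Borel section: \<open>kap\<close> records, as ternary digits,
 on which side of each of countably many hyperplanes a point lies. This reduces Young measures of
 vector-valued sequences to the scalar case.\<close>

lemma continuous_decoding:
 obtains kap :: "'b::euclidean_space => real" and dl :: "real => 'b"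
 where "kap : borel_measurable borel" "!!x. 0 <= kap x & kap x <= 1" "continuous_on UNIV dl"
  "!!x. norm x <= C ==> dl (kap x) = x"
proof -
 define P where "P = (Basis :: 'b set) \<times> (\<rat> :: real set)"
 have P: "countable P" "P ~= {}"
  unfolding P_def using countable_SIGMA[OF countable_finite[OF finite_Basis] countable_rat] nonempty_Basis by auto
 define t where "t = from_nat_into P"
 define bit where "bit x i <-> x <.> fst (t i) <= snd (t i)" for x :: 'b and i
 define kap where "kap x = ternary (bit x)" for x
 have [measurable]: "(%x. of_bool (bit x j) :: real) : borel_measurable borel" for j
  unfolding bit_def by measurable
 have kapm: "kap : borel_measurable borel" unfolding kap_def ternary_def by measurable
 \<comment> \<open>Uniform continuity of the inverse. The pairs at distance at least
   \<open>e\<close> form a compact set, and finitely many of the hyperplanes suffice to separate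
   each of them strictly; agreement in the corresponding digits therefore forces distance less than
   \<open>e\<close>.\<close>
 have uc: "EX k. ALL x y. norm x <= C --> norm y <= C --> \<bar>kap x - kap y\<bar> < (1/3) ^ k --> dist x y < e" if e: "0 < e" for e
 proof -
  define U where "U i = {z. (fst z <.> fst (t i) < snd (t i) & snd (t i) < snd z <.> fst (t i)) | (snd z <.> fst (t i) < snd (t i) & snd (t i) < fst z <.> fst (t i))}" for i
  define E where "E = (cball 0 C \<times> cball 0 C) Int {z::'b \<times> 'b. e <= dist (fst z) (snd z)}"
  have o: "open (U i)" for i unfolding U_def
   by (intro open_Collect_disj open_Collect_conj open_Collect_less continuous_intros)
  have c: "compact E" unfolding E_def
   by (intro compact_Int_closed compact_Times closed_Collect_le continuous_intros) auto
  have cover: "E <= (UN i:UNIV. U i)"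
  proof
   fix z :: "'b \<times> 'b" assume "z : E"
   hence "fst z ~= snd z" using e by (auto simp: E_def)
   then obtain b where b: "b : Basis" "fst z <.> b ~= snd z <.> b" by (metis euclidean_eqI)
   hence "min (fst z <.> b) (snd z <.> b) < max (fst z <.> b) (snd z <.> b)" by (simp add: min_def max_def)
   from Rats_dense_in_real[OF this] obtain q where q: "q : \<rat>" "min (fst z <.> b) (snd z <.> b) < q" "q < max (fst z <.> b) (snd z <.> b)" by blast
   obtain i where "t i = (b, q)"
    using from_nat_into_surj[OF P(1), of "(b, q)"] b q by (auto simp: P_def t_def)
   thus "z : (UN i:UNIV. U i)" using q by (intro UN_I[of i]) (auto simp: U_def)
  qed
  obtain J where J: "finite J" "E <= (UN i:J. U i)" by (rule compactE_image[OF c o cover]) auto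
  then obtain k where k: "ALL i:J. i < k" by (auto simp: finite_nat_set_iff_bounded)
  have "dist x y < e" if "norm x <= C" "norm y <= C" "\<bar>kap x - kap y\<bar> < (1/3) ^ k" for x y
  proof (rule ccontr)
   assume "~ dist x y < e"
   hence "(x, y) : (UN i:J. U i)" using that by (intro subsetD[OF J(2)]) (auto simp: E_def)
   then obtain i where "i : J" "bit x i ~= bit y i" by (fastforce simp: U_def bit_def)
   thus False using ternary_code_injective[OF that(3)[unfolded kap_def], of i] k by auto
  qed
  thus ?thesis by blast
 qed
 have inj: "x = y" if "norm x <= C" "norm y <= C" "kap x = kap y" for x y
 proof (rule ccontr)
  assume "x ~= y"
  then obtain k where "ALL x' y'. norm x' <= C --> norm y' <= C --> \<bar>kap x' - kap y'\<bar> < (1/3) ^ k --> dist x' y' < dist x y"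
   using uc[of "dist x y"] by auto
  from this[rule_format, OF that(1,2)] that(3) show False by simp
 qed
 define D where "D = kap ` {x. norm x <= C}"
 define dl0 where "dl0 = the_inv_into {x. norm x <= C} kap"
 have dl0: "dl0 (kap x) = x" if "norm x <= C" for x
  unfolding dl0_def using that inj by (intro the_inv_into_f_f) (auto simp: inj_on_def)
 have "uniformly_continuous_on D dl0"
  unfolding uniformly_continuous_on_def
 proof (intro allI impI)
  fix e :: real assume "0 < e"
  then obtain k where k: "!!x y. norm x <= C ==> norm y <= C ==> \<bar>kap x - kap y\<bar> < (1/3) ^ k ==> dist x y < e"
   using uc by blast
  show "EX d>0. ALL x:D. ALL x':D. dist x' x < d --> dist (dl0 x') (dl0 x) < e"
   by (rule exI[of _ "(1/3) ^ k"]) (use k dl0 in \<open>auto simp: D_def dist_real_def\<close>)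
 qed
 \<comment> \<open>The range of \<open>kap\<close> on the ball need not be closed. Uniform
   continuity extends the inverse to the closure, and Tietze's theorem extends it to the whole
   line.\<close>
 then obtain dl1 where dl1: "uniformly_continuous_on (closure D) dl1" "!!x. x : D ==> dl0 x = dl1 x"
  by (rule uniformly_continuous_on_extension_on_closure) blast
 obtain dl where dl: "continuous_on UNIV dl" "!!x. x : closure D ==> dl x = dl1 x"
  using Tietze_unbounded[of "closure D" dl1 UNIV] uniformly_continuous_imp_continuous[OF dl1(1)] by auto
 have "dl (kap x) = x" if "norm x <= C" for x
  using dl0[OF that] dl(2)[of "kap x"] dl1(2)[of "kap x"] closure_subset[of D] that by (auto simp: D_def)
 thus thesis using that[OF kapm _ dl(1)] ternary_bounds by (simp add: kap_def)
qed

lemma lebesgue_on_integral_eq: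
 fixes F F' :: "'a::euclidean_space => real"
 assumes S: "S : sets borel" and F': "F' : borel_measurable borel" and F: "F : borel_measurable (lebesgue_on S)"
  and eq: "AE z in lebesgue_on S. F z = F' z"
 shows "(LINT z|lebesgue_on S. F z) = (LINT z|density lborel (indicator S). F' z)"
  and "integrable (lebesgue_on S) F <-> integrable (density lborel (indicator S)) F'"
proof -
 have S': "S Int space lebesgue : sets lebesgue" using S by simp
 have F'm: "F' : borel_measurable (lebesgue_on S)"
  using F' S by (intro measurable_restrict_space1 measurable_completion) simp
 have m: "(%z. indicator S z *R F' z) : borel_measurable lborel" using F' S by auto
 have "(LINT z|lebesgue_on S. F z) = (LINT z|lebesgue_on S. F' z)" by (rule integral_cong_AE[OF F F'm eq])
 also have "... = (LINT z|lebesgue. indicator S z *R F' z)" by (rule integral_restrict_space[OF S'])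
 also have "... = (LINT z|lborel. indicator S z *R F' z)" by (rule integral_completion[OF m])
 also have "... = (LINT z|density lborel (indicator S). F' z)"
  using F' S integral_density[of F' lborel "indicat_real S"] by (simp add: ennreal_indicator)
 finally show "(LINT z|lebesgue_on S. F z) = (LINT z|density lborel (indicator S). F' z)" .
 have "integrable (lebesgue_on S) F <-> integrable (lebesgue_on S) F'" by (rule integrable_cong_AE[OF F F'm eq])
 also have "... <-> integrable lebesgue (%z. indicator S z *R F' z)" by (rule integrable_restrict_space[OF S'])
 also have "... <-> integrable lborel (%z. indicator S z *R F' z)" by (rule integrable_completion[OF m])
 also have "... <-> integrable (density lborel (indicator S)) F'"
  using F' S integrable_density[of F' lborel "indicat_real S"] by (simp add: ennreal_indicator)
 finally show "integrable (lebesgue_on S) F <-> integrable (density lborel (indicator S)) F'" .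
qed

lemma lebesgue_on_borel_version:
 fixes F :: "'a::euclidean_space => 'b::euclidean_space"
 assumes S: "S : sets borel" and F: "F : borel_measurable (lebesgue_on S)"
 obtains F' where "F' : borel_measurable borel" "AE z in lebesgue_on S. F z = F' z"
proof -
 have "(%z. indicator S z *R F z) : borel_measurable lebesgue"
  using F S by (subst (asm) borel_measurable_restrict_space_iff) auto
 hence "(%z. (indicator S z *R F z) <.> b) : borel_measurable lebesgue" for b
  by (rule borel_measurable_inner) simp
 hence "ALL b. EX g:borel_measurable lborel. AE z in lborel. (indicator S z *R F z) <.> b = g z"
  using completion_ex_borel_measurable_real by blast
 then obtain g where g: "!!b. g b : borel_measurable lborel" "!!b. AE z in lborel. (indicator S z *R F z) <.> b = g b z"
  by metis
 define F' where "F' z = (SUM b:Basis. g b z *R b)" for z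
 have [measurable]: "g b : borel_measurable borel" for b using g(1)[of b] by simp
 have "F' : borel_measurable borel" unfolding F'_def by measurable
 moreover have "AE z in lebesgue_on S. F z = F' z"
 proof -
  have "AE z in lborel. ALL b:Basis. (indicator S z *R F z) <.> b = g b z"
   using g(2) by (simp add: AE_finite_all)
  hence "AE z in lborel. indicator S z *R F z = F' z"
   by eventually_elim (simp add: F'_def euclidean_eq_iff[where 'a='b])
  hence "AE z in lebesgue. indicator S z *R F z = F' z" by (rule AE_completion)
  hence "AE z in lebesgue. z : S --> F z = F' z" by eventually_elim auto
  thus ?thesis using S by (subst AE_restrict_space_iff) auto
 qed
 ultimately show thesis by (rule that)
qed

text \<open>The vector sequence is coded by \<open>kap\<close>, treated as a scalar sequence and
  decoded by \<open>dl\<close>; the Young measure at \<open>z\<close> is the law of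
  \<open>dl (X z wo)\<close>. A test function \<open>g\<close> enters as
  \<open>g \<circ> dl\<close>, which is continuous although \<open>kap\<close> is only
  Borel.\<close>

theorem young_measure_exists:
 fixes v :: "nat => 'a::euclidean_space => real^'m"
 assumes S: "S : sets borel" "emeasure lborel S < \<infinity>"
  and v: "!!j. v j : borel_measurable (lebesgue_on S)"
  and bound: "!!j. AE z in lebesgue_on S. norm (v j z) <= C"
 obtains r :: "nat => nat" and mu where "strict_mono r" "generates_young_measure S (%j. v (r j)) mu"
proof -
 define R where "R = max C 0"
 obtain kap :: "real^'m => real" and dl where kap[measurable]: "kap : borel_measurable borel"
  and kap01: "!!x. 0 <= kap x & kap x <= 1" and dl: "continuous_on UNIV dl" "!!x. norm x <= R ==> dl (kap x) = x"
  by (rule continuous_decoding[where C=R]) blast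
 have [measurable]: "dl : borel_measurable borel" using dl(1) by (rule borel_measurable_continuous_onI)
 have "EX v'. v' : borel_measurable borel & (ALL z. norm (v' z) <= R) & (AE z in lebesgue_on S. v j z = v' z)" for j
 proof -
  obtain v'' where v''[measurable]: "v'' : borel_measurable borel" and ae: "AE z in lebesgue_on S. v j z = v'' z"
   using lebesgue_on_borel_version[OF S(1) v[of j]] .
  have "(%z. if norm (v'' z) <= R then v'' z else 0) : borel_measurable borel" by measurable
  moreover have "ALL z. norm (if norm (v'' z) <= R then v'' z else 0) <= R" by (simp add: R_def)
  moreover have "AE z in lebesgue_on S. v j z = (if norm (v'' z) <= R then v'' z else 0)"
   using ae bound[of j] by eventually_elim (auto simp: R_def)
  ultimately show ?thesis by blast
 qed
 then obtain v' where v'[measurable]: "!!j. v' j : borel_measurable borel" and v'R: "!!j z. norm (v' j z) <= R"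
  and v'ae: "!!j. AE z in lebesgue_on S. v j z = v' j z" by metis
 define M where "M = density lborel (indicator S :: 'a => ennreal)"
 have sM[measurable_cong]: "sets M = sets borel" by (simp add: M_def)
 have spM: "space M = UNIV" by (simp add: M_def)
 have finM: "finite_measure M"
  by (rule finite_measureI) (use S in \<open>simp add: M_def emeasure_density\<close>)
 obtain r :: "nat => nat" and X where r: "strict_mono r" and X[measurable]: "(%z. X (fst z) (snd z)) : borel_measurable (M \<Otimes>\<^sub>M unit_measure)"
  and X01: "!!z wo. 0 <= X z wo & X z wo <= 1"
  and lim: "!!g psi :: _ => real. continuous_on UNIV g ==> integrable M psi ==>
    (%j. LINT z|M. g (kap (v' (r j) z)) * psi z) ----> (LINT z|M. (LINT wo|unit_measure. g (X z wo)) * psi z)"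
  by (rule scalar_young_measure[OF finM sM, of "%j z. kap (v' j z)"]) (use kap01 in \<open>auto simp: measurable_cong_sets[OF sM refl]\<close>)
 interpret U: prob_space unit_measure by (rule prob_space_unit_measure)
 define V where "V z wo = dl (X z wo)" for z wo
 define mu where "mu z = distr unit_measure borel (V z)" for z
 have Vm: "(%(z, wo). V z wo) : borel_measurable (M \<Otimes>\<^sub>M unit_measure)"
  unfolding V_def case_prod_beta by measurable
 have Vz: "V z : borel_measurable unit_measure" for z
  using measurable_compose[OF measurable_Pair1'[of z M unit_measure] Vm] spM by simp
 have "compact (dl ` {0..1})" using dl(1) by (intro compact_continuous_image) (auto intro: continuous_on_subset)
 then obtain R' where "ALL x:dl ` {0..1}. norm x <= R'" using compact_imp_bounded bounded_iff by metis
 hence R': "!!s. s : {0..1} ==> norm (dl s) <= R'" by blast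
 have VR: "norm (V z wo) <= R'" for z wo using R' X01 by (simp add: V_def)
 have probm: "prob_space (mu z)" for z unfolding mu_def by (rule U.prob_space_distr[OF Vz])
 have ym: "young_measure S mu"
 proof -
  have "mu : measurable M (subprob_algebra borel)"
   unfolding mu_def using Vm
   by (intro measurable_distr2) (auto simp: space_subprob_algebra U.subprob_space_axioms)
  hence "mu : measurable M (prob_algebra borel)"
   unfolding prob_algebra_def using probm by (intro measurable_restrict_space2) auto
  hence "mu : measurable borel (prob_algebra borel)" by (simp add: measurable_cong_sets[OF sM refl])
  hence "mu : measurable lebesgue (prob_algebra borel)"
   by (intro measurable_completion) (simp add: measurable_cong_sets[OF sets_lborel refl])
  thus ?thesis unfolding young_measure_def by (rule measurable_restrict_space1)
 qed
 have main: "(AE y in lebesgue_on S. integrable (mu y) g) &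
    weak_star_lim S (%j z. g (v (r j) z)) (%y. LINT sg|mu y. g sg)" if g: "continuous_on UNIV g" for g :: "real^'m => real"
 proof
  have gm[measurable]: "g : borel_measurable borel" using g by (rule borel_measurable_continuous_onI)
  have "compact (g ` cball 0 (max R R'))" using g by (intro compact_continuous_image) (auto intro: continuous_on_subset)
  then obtain B where "ALL x:g ` cball 0 (max R R'). norm x <= B" using compact_imp_bounded bounded_iff by metis
  hence B: "!!x. norm x <= max R R' ==> \<bar>g x\<bar> <= B" by simp
  have gV: "integrable unit_measure (%wo. g (V z wo))" for z
   using B VR Vz by (intro U.integrable_const_bound[where B=B]) (auto simp: le_max_iff_disj)
  show "AE y in lebesgue_on S. integrable (mu y) g"
   unfolding mu_def using gV Vz by (simp add: integrable_distr_eq)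
  have H: "(LINT sg|mu z. g sg) = (LINT wo|unit_measure. g (V z wo))" for z
   unfolding mu_def using Vz by (subst integral_distr) auto
  have Hm: "(%z. LINT sg|mu z. g sg) : borel_measurable borel"
  proof -
   have "(%(z, wo). g (V z wo)) : borel_measurable (M \<Otimes>\<^sub>M unit_measure)" using Vm by (simp add: case_prod_beta)
   from U.borel_measurable_lebesgue_integral[OF this] show ?thesis
    by (simp add: H measurable_cong_sets[OF sM refl])
  qed
  have leb: "h : borel_measurable borel ==> h : borel_measurable (lebesgue_on S)" for h :: "'a => real"
   by (intro measurable_restrict_space1 measurable_completion) simp
  have HB: "\<bar>LINT sg|mu z. g sg\<bar> <= B" for z
  proof -
   have "norm (LINT wo|unit_measure. g (V z wo)) <= (LINT wo|unit_measure. B)"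
    using gV[of z] B VR by (intro Bochner_Integration.integral_norm_bound_integral) (auto simp: le_max_iff_disj)
   thus ?thesis by (simp add: H U.prob_space[simplified])
  qed
  show "weak_star_lim S (%j z. g (v (r j) z)) (%y. LINT sg|mu y. g sg)"
   unfolding weak_star_lim_def
  proof (intro conjI allI impI)
   have gv: "(%z. g (v j z)) : borel_measurable (lebesgue_on S)" for j
    using v[of j] gm by (rule measurable_compose)
   show "(%z. g (v (r j) z)) : L_infinity S" for j
    unfolding L_infinity_def
   proof (intro CollectI conjI gv exI[of _ B])
    show "AE z in lebesgue_on S. \<bar>g (v (r j) z)\<bar> <= B"
     using v'ae[of "r j"] by eventually_elim (use B v'R in \<open>simp add: le_max_iff_disj\<close>)
   qed
   show "(%y. LINT sg|mu y. g sg) : L_infinity S"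
    unfolding L_infinity_def using leb[OF Hm] HB by auto
   fix psi :: "'a => real" assume psi: "integrable (lebesgue_on S) psi"
   hence psim: "psi : borel_measurable (lebesgue_on S)" by auto
   obtain psi' where psi'[measurable]: "psi' : borel_measurable borel" and psiae: "AE z in lebesgue_on S. psi z = psi' z"
    using lebesgue_on_borel_version[OF S(1) psim] .
   have psi'i: "integrable M psi'" unfolding M_def
    using lebesgue_on_integral_eq(2)[OF S(1) psi' psim psiae] psi by blast
   have "(%j. LINT z|M. (g \<circ> dl) (kap (v' (r j) z)) * psi' z) ----> (LINT z|M. (LINT wo|unit_measure. (g \<circ> dl) (X z wo)) * psi' z)"
    using g dl(1) by (intro lim psi'i continuous_on_compose) (auto intro: continuous_on_subset)
   moreover have "(LINT z|lebesgue_on S. g (v (r j) z) * psi z) = (LINT z|M. (g \<circ> dl) (kap (v' (r j) z)) * psi' z)" for j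
    unfolding M_def
   proof (rule lebesgue_on_integral_eq(1)[OF S(1)])
    show "(%z. g (v (r j) z) * psi z) : borel_measurable (lebesgue_on S)" using gv psim by measurable
    show "AE z in lebesgue_on S. g (v (r j) z) * psi z = (g \<circ> dl) (kap (v' (r j) z)) * psi' z"
     using v'ae[of "r j"] psiae by eventually_elim (simp add: dl(2)[OF v'R])
   qed (simp add: o_def)
   moreover have "(LINT z|lebesgue_on S. (LINT sg|mu z. g sg) * psi z) = (LINT z|M. (LINT wo|unit_measure. (g \<circ> dl) (X z wo)) * psi' z)"
    unfolding M_def
   proof (rule lebesgue_on_integral_eq(1)[OF S(1)])
    show "(%z. (LINT sg|mu z. g sg) * psi z) : borel_measurable (lebesgue_on S)"
     using leb[OF Hm] psim by measurable
    show "AE z in lebesgue_on S. (LINT sg|mu z. g sg) * psi z = (LINT wo|unit_measure. (g \<circ> dl) (X z wo)) * psi' z"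
     using psiae by eventually_elim (simp add: H V_def)
    show "(%z. (LINT wo|unit_measure. (g \<circ> dl) (X z wo)) * psi' z) : borel_measurable borel"
     using Hm by (simp add: H V_def)
   qed
   ultimately show "(%j. LINT z|lebesgue_on S. g (v (r j) z) * psi z) ----> (LINT z|lebesgue_on S. (LINT sg|mu z. g sg) * psi z)"
    by simp
  qed
 qed
 show thesis
  by (rule that[OF r, of mu]) (use ym main in \<open>simp add: generates_young_measure_def\<close>)
qed

section \<open>Continuously differentiable maps\<close>

text \<open>The derivative is kept as an explicit argument because integration by parts mentions it.
  Continuity is asked direction by direction; in finite dimension this gives joint continuity, by
  \<open>has_C1_joint\<close>.\<close>

definition has_C1 :: "('a::euclidean_space => 'b::euclidean_space) => ('a => 'a => 'b) => bool" where
 "has_C1 g g' <-> (ALL x. (g has_derivative g' x) (at x)) & (ALL h. continuous_on UNIV (%x. g' x h))"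

lemma has_C1D:
 assumes "has_C1 g g'"
 shows "(g has_derivative g' x) (at x)" "continuous_on S (%x. g' x h)" "linear (g' x)" "continuous_on S g"
proof -
 show d: "(g has_derivative g' x) (at x)" for x using assms by (simp add: has_C1_def)
 have "continuous_on UNIV (%x. g' x h)" using assms by (simp add: has_C1_def)
 thus "continuous_on S (%x. g' x h)" by (rule continuous_on_subset) simp
 show "linear (g' x)" using d has_derivative_linear by blast
 show "continuous_on S g"
  using has_derivative_continuous[OF d] by (intro continuous_at_imp_continuous_on) auto
qed

lemma has_C1_Ck: "Ck (Suc 0) g ==> has_C1 g (%x. frechet_derivative g (at x))"
 by (auto simp: has_C1_def frechet_derivative_works[symmetric])

lemma linear_expand: "linear T ==> T h = (SUM i:Basis. (h <.> i) *R T i)" for T :: "'a::euclidean_space => 'b::real_vector"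
proof -
 assume T: "linear T"
 have "T h = T (SUM i:Basis. (h <.> i) *R i)" by (simp add: euclidean_representation)
 also have "... = (SUM i:Basis. (h <.> i) *R T i)" using T by (simp add: linear_sum linear_cmul o_def)
 finally show ?thesis .
qed

lemma has_C1_joint:
 assumes "has_C1 g g'" "continuous_on S a" "continuous_on S b"
 shows "continuous_on S (%z. g' (a z) (b z))"
proof -
 have eq: "g' (a z) (b z) = (SUM i:Basis. (b z <.> i) *R g' (a z) i)" for z
  using linear_expand[OF has_C1D(3)[OF assms(1)]] .
 have "continuous_on S (%z. g' (a z) i)" for i
  by (rule continuous_on_compose2[OF has_C1D(2)[OF assms(1), of UNIV] assms(2)]) simp
 thus ?thesis unfolding eq by (intro continuous_intros assms)
qed

lemma has_C1_compose:
 assumes "has_C1 f f'" "has_C1 g g'"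
 shows "has_C1 (%x. f (g x)) (%x h. f' (g x) (g' x h))"
 unfolding has_C1_def
proof (intro conjI allI)
 show "((%x. f (g x)) has_derivative (%h. f' (g x) (g' x h))) (at x)" for x
  by (rule has_derivative_compose[OF has_C1D(1)[OF assms(2)] has_C1D(1)[OF assms(1)]])
 show "continuous_on UNIV (%x. f' (g x) (g' x h))" for h
  by (rule has_C1_joint[OF assms(1)]) (use assms(2) in \<open>auto intro: has_C1D\<close>)
qed

lemma has_C1_const: "has_C1 (%x. c) (%x h. 0)"
 by (auto simp: has_C1_def)

lemma has_C1_linear: "bounded_linear g ==> has_C1 g (%x. g)"
 by (auto simp: has_C1_def intro: bounded_linear_imp_has_derivative)

lemma has_C1_diff: "has_C1 f f' ==> has_C1 g g' ==> has_C1 (%x. f x - g x) (%x h. f' x h - g' x h)"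
 by (auto simp: has_C1_def intro!: has_derivative_diff continuous_intros)

lemma has_C1_sum: "(!!i. i : I ==> has_C1 (f i) (f' i)) ==> has_C1 (%x. SUM i:I. f i x) (%x h. SUM i:I. f' i x h)"
 by (auto simp: has_C1_def intro!: has_derivative_sum continuous_intros)

lemma has_C1_inner:
 assumes "has_C1 f f'" "has_C1 g g'"
 shows "has_C1 (%x. f x <.> g x) (%x h. f x <.> g' x h + f' x h <.> g x)"
 using assms has_C1D(4)[OF assms(1), of UNIV] has_C1D(4)[OF assms(2), of UNIV]
 by (auto simp: has_C1_def intro!: has_derivative_inner continuous_intros)

lemma has_C1_scaleR:
 assumes "has_C1 f f'" "has_C1 g g'"
 shows "has_C1 (%x. f x *R g x) (%x h. f x *R g' x h + f' x h *R g x)"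
 using assms has_C1D(4)[OF assms(1), of UNIV] has_C1D(4)[OF assms(2), of UNIV]
 by (auto simp: has_C1_def intro!: has_derivative_scaleR continuous_intros)

lemma has_C1_prod:
 fixes f :: "'i => 'a::euclidean_space => real"
 assumes "finite I" "!!i. i : I ==> EX f'. has_C1 (f i) f'"
 shows "EX g'. has_C1 (%x. PROD i:I. f i x) g'"
 using assms
proof (induction I rule: finite_induct)
 case empty thus ?case using has_C1_const[of "1::real"] by auto
next
 case (insert i I)
 obtain f' where "has_C1 (f i) f'" using insert.prems by blast
 moreover obtain g' where "has_C1 (%x. PROD i:I. f i x) g'" using insert.IH insert.prems by blast
 ultimately have "has_C1 (%x. f i x *R (PROD i:I. f i x)) (%x h. f i x *R g' x h + f' x h *R (PROD i:I. f i x))"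
  by (rule has_C1_scaleR)
 thus ?case using insert.hyps by auto
qed

lemma has_C1_power:
 fixes f :: "'a::euclidean_space => real"
 shows "has_C1 f f' ==> EX g'. has_C1 (%x. f x ^ n) g'"
 using has_C1_prod[of "{..<n}" "%_. f"] by auto

lemma has_C1_polys:
 fixes p :: "'a::euclidean_space => 'b::euclidean_space"
 assumes "p : polys q"
 obtains p' where "has_C1 p p'"
proof -
 obtain c where c: "p = (%z. SUM al:multi_indices q. (PROD b:Basis. (z <.> b) ^ al b) *R c al)"
  using assms by (auto simp: polys_def)
 have "EX g'. has_C1 (%z. (PROD b:Basis. (z <.> b) ^ al b) *R c al) g'" for al :: "'a => nat"
 proof -
  have "EX g'. has_C1 (%z::'a. (z <.> b) ^ al b) g'" for b
   by (rule has_C1_power[OF has_C1_linear]) (rule bounded_linear_inner_left)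
  then obtain g' where "has_C1 (%z::'a. PROD b:Basis. (z <.> b) ^ al b) g'"
   using has_C1_prod[of "Basis :: 'a set" "%b z. (z <.> b) ^ al b"] by auto
  from has_C1_scaleR[OF this has_C1_const] show ?thesis by blast
 qed
 then obtain G where "!!al. has_C1 (%z. (PROD b:Basis. (z <.> b) ^ al b) *R c al) (G al)" by metis
 hence "has_C1 p (%x h. SUM al:multi_indices q. G al x h)" unfolding c by (rule has_C1_sum)
 thus ?thesis by (rule that)
qed

lemma smooth_has_C1: "smooth g ==> has_C1 g (%x. frechet_derivative g (at x))"
 by (rule has_C1_Ck) (simp only: smooth_def)

lemma has_C1_Lipschitz:
 assumes g: "has_C1 g g'" and S: "convex S" and B: "!!x h. x : S ==> norm (g' x h) <= B * norm h"
  and xy: "x : S" "y : S"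
 shows "norm (g x - g y) <= B * norm (x - y)"
proof (rule differentiable_bound[OF S _ _ xy])
 show "(g has_derivative g' z) (at z within S)" for z
  using has_C1D(1)[OF g] by (rule has_derivative_at_withinI)
 show "onorm (g' z) <= B" if "z : S" for z
 proof (rule onorm_le)
  show "norm (g' z h) <= B * norm h" for h using B that by blast
 qed
qed

lemma has_C1_bound_compact:
 assumes g: "has_C1 g g'" and S: "compact S"
 shows "EX B>=0. ALL x:S. ALL h. norm (g' x h) <= B * norm h"
proof -
 have "EX B. ALL x:S. norm (g' x i) <= B" for i
  using compact_imp_bounded[OF compact_continuous_image[OF has_C1D(2)[OF g] S]] by (auto simp: bounded_iff)
 then obtain B where B: "!!i x. x : S ==> norm (g' x i) <= B i" by metis
 have "norm (g' x h) <= (SUM i:Basis. \<bar>B i\<bar>) * norm h" if "x : S" for x h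
 proof -
  have "norm (g' x h) <= (SUM i:Basis. norm ((h <.> i) *R g' x i))"
   unfolding linear_expand[OF has_C1D(3)[OF g], of x h] by (rule norm_sum)
  also have "... <= (SUM i:Basis. norm h * \<bar>B i\<bar>)"
   using B[OF that] Basis_le_norm[of _ h]
   by (intro sum_mono) (auto intro!: mult_mono order_trans[OF B[OF that]])
  also have "... = (SUM i:Basis. \<bar>B i\<bar>) * norm h" by (simp add: sum_distrib_right[symmetric] sum_distrib_left[symmetric] mult.commute)
  finally show ?thesis .
 qed
 thus ?thesis by (intro exI[of _ "SUM i:Basis. \<bar>B i\<bar>"]) (auto intro: sum_nonneg)
qed

section \<open>Entropy variables, potentials and the entropy conservative flux\<close>

locale entropy_system =
 fixes f :: "'d::finite => real^'m => real^'m" and U :: "real^'m => real" and F :: "'d => real^'m => real"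
 assumes fluxes: "!!k. smooth (f k)" and entropy: "entropy_pair f U F"
begin

abbreviation "u == state_of U"
abbreviation "fl == flux_v f U"
text \<open>The value of the entropy variables wherever the conserved state vanishes, hence outside
  the supports.\<close>

abbreviation "vstar == entropy_var U 0"

text \<open>The Hessian of \<open>U\<close>, as derivative of the map from \<open>u\<close> to
  \<open>v\<close>. At \<open>u v\<close> it is the inverse of \<open>u_v U v\<close>, so bounds for
  the latter are obtained by inverting bounds for the Hessian.\<close>

definition hess :: "real^'m => real^'m => real^'m" where
 "hess x h = (SUM i:UNIV. frechet_derivative (%y. frechet_derivative U (at y) (axis i 1)) (at x) h *R axis i 1)"

lemma C2_U: "U differentiable (at x)" "Ck (Suc 0) (%x. frechet_derivative U (at x) b)"
 using entropy by (auto simp: entropy_pair_def numeral_2_eq_2)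

lemma has_C1_entropy_var: "has_C1 (entropy_var U) hess"
proof -
 have "entropy_var U = (%y. SUM i:UNIV. frechet_derivative U (at y) (axis i 1) *R axis i 1)"
  by (auto simp: entropy_var_def fun_eq_iff vec_eq_iff axis_def if_distrib cong: if_cong)
 moreover have "has_C1 (%y. SUM i:UNIV. frechet_derivative U (at y) (axis i 1) *R axis i (1::real)) hess"
  unfolding hess_def using has_C1_scaleR[OF has_C1_Ck[OF C2_U(2)] has_C1_const]
  by (intro has_C1_sum) (auto simp del: Ck.simps)
 ultimately show ?thesis by simp
qed

lemma dU: "frechet_derivative U (at x) h = entropy_var U x <.> h"
proof -
 have lin: "linear (frechet_derivative U (at x))"
  using C2_U(1) by (simp add: linear_frechet_derivative)
 have "frechet_derivative U (at x) h = frechet_derivative U (at x) (SUM i:UNIV. (h $ i) *R axis i 1)"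
  using basis_expansion[of h] by (simp add: scalar_mult_eq_scaleR)
 also have "... = (SUM i:UNIV. h $ i * frechet_derivative U (at x) (axis i 1))"
  by (simp add: linear_sum[OF lin] linear_cmul[OF lin] o_def)
 also have "... = entropy_var U x <.> h"
  by (simp add: entropy_var_def inner_vec_def mult.commute)
 finally show ?thesis .
qed

lemma bij: "bij (entropy_var U)" using entropy by (simp add: entropy_pair_def)

lemma u_inv [simp]: "entropy_var U (u v) = v" "u (entropy_var U x) = x"
 using bij by (simp_all add: state_of_def bij_is_surj surj_f_inv_f bij_is_inj)

lemma u_deriv: "(u has_derivative (%h. u_v U v *v h)) (at v)"
 using entropy jacobian_works[of u "at v"] by (simp add: entropy_pair_def u_v_def)

lemma u_v_pos: "w ~= 0 ==> 0 < w <.> (u_v U v *v w)"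
 using entropy by (simp add: entropy_pair_def spd_def)

lemma hess_u_v: "hess (u v) (u_v U v *v h) = h"
proof -
 have "((%v. entropy_var U (u v)) has_derivative (%h. hess (u v) (u_v U v *v h))) (at v)"
  by (rule has_derivative_compose[OF u_deriv has_C1D(1)[OF has_C1_entropy_var]])
 hence "((%v. v) has_derivative (%h. hess (u v) (u_v U v *v h))) (at v)" by simp
 from has_derivative_unique[OF this has_derivative_ident] show ?thesis by metis
qed

lemma u_v_hess: "u_v U v *v hess (u v) h = h"
proof -
 have "((%x. u (entropy_var U x)) has_derivative (%h. u_v U v *v hess (u v) h)) (at (u v))"
  by (rule has_derivative_compose[OF has_C1D(1)[OF has_C1_entropy_var]]) (simp add: u_deriv)
 hence "((%x. x) has_derivative (%h. u_v U v *v hess (u v) h)) (at (u v))" by simp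
 from has_derivative_unique[OF this has_derivative_ident] show ?thesis by metis
qed

lemma hess_pos: "w ~= 0 ==> 0 < w <.> hess (u v) w"
proof -
 assume "w ~= 0"
 define y where "y = hess (u v) w"
 have w: "w = u_v U v *v y" by (simp add: y_def u_v_hess)
 hence "y ~= 0" using `w ~= 0` by auto
 hence "0 < y <.> (u_v U v *v y)" by (rule u_v_pos)
 thus ?thesis unfolding w[symmetric] by (simp add: y_def inner_commute)
qed

lemma v_u_eq: "v_u U v *v r = hess (u v) r"
proof -
 have lin: "linear (hess (u v))" using has_C1D(3)[OF has_C1_entropy_var] .
 have "u_v U v ** matrix (hess (u v)) = mat 1"
  unfolding matrix_eq by (simp add: matrix_vector_mul_assoc[symmetric] fun_cong[OF matrix_vector_mul(2)[OF lin]] u_v_hess)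
 moreover from this have "matrix (hess (u v)) ** u_v U v = mat 1" using matrix_left_right_inverse by blast
 ultimately have "EX B. u_v U v ** B = mat 1 & B ** u_v U v = mat 1" by blast
 from someI_ex[OF this] have "u_v U v ** v_u U v = mat 1" unfolding v_u_def matrix_inv_def by blast
 hence "u_v U v *v (v_u U v *v r) = r" by (simp add: matrix_vector_mul_assoc)
 hence "hess (u v) (u_v U v *v (v_u U v *v r)) = hess (u v) r" by simp
 thus ?thesis by (simp only: hess_u_v)
qed

lemma u_cont: "continuous_on S u"
 using has_derivative_continuous[OF u_deriv] by (intro continuous_at_imp_continuous_on) auto

text \<open>Positivity is made uniform by compactness of the ball times the unit sphere. The whole
  ball is treated because the estimates also use cell means and the segments between two
  traces.\<close>

lemma hess_bounds:
 "EX c0>0. EX C0>0. ALL v:cball 0 R. ALL w. c0 * (w <.> w) <= w <.> hess (u v) w & norm (hess (u v) w) <= C0 * norm w"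
proof -
 have lin: "linear (hess (u v))" for v using has_C1D(3)[OF has_C1_entropy_var] .
 obtain B where B: "0 <= B" "!!v w. v : cball 0 R ==> norm (hess (u v) w) <= B * norm w"
  using has_C1_bound_compact[OF has_C1_entropy_var compact_continuous_image[OF u_cont compact_cball[of 0 R]]] by blast
 \<comment> \<open>The modulus keeps the set nonempty for negative \<open>R\<close>, where the claim
   itself is void.\<close>
 define K where "K = cball (0::real^'m) \<bar>R\<bar> \<times> sphere (0::real^'m) 1"
 have K: "compact K" unfolding K_def by (intro compact_Times) auto
 obtain e :: "real^'m" where e: "e : Basis" using nonempty_Basis by blast
 hence "(0, e) : K" by (simp add: K_def)
 moreover have "continuous_on K (%z. snd z <.> hess (u (fst z)) (snd z))"
  by (intro continuous_intros has_C1_joint[OF has_C1_entropy_var] continuous_on_compose2[OF u_cont[of UNIV]]) auto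
 ultimately obtain z0 where z0: "z0 : K" "!!z. z : K ==> snd z0 <.> hess (u (fst z0)) (snd z0) <= snd z <.> hess (u (fst z)) (snd z)"
  using continuous_attains_inf[OF K] by blast
 define c0 where "c0 = snd z0 <.> hess (u (fst z0)) (snd z0)"
 have "snd z0 ~= 0" using z0(1) by (auto simp: K_def)
 hence "0 < c0" unfolding c0_def by (rule hess_pos)
 moreover have "c0 * (w <.> w) <= w <.> hess (u v) w" if v: "v : cball 0 R" for v w
 proof (cases "w = 0")
  case False
  define y where "y = w /\<^sub>R norm w"
  have w: "w = norm w *R y" using False by (simp add: y_def)
  have "c0 <= y <.> hess (u v) y" using z0(2)[of "(v, y)"] v False by (simp add: c0_def K_def y_def)
  moreover have "hess (u v) w = norm w *R hess (u v) y" by (subst w) (simp add: linear_cmul[OF lin])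
  hence "w <.> hess (u v) w = (w <.> w) * (y <.> hess (u v) y)"
   by (subst (1) w) (simp add: dot_square_norm power2_eq_square)
  ultimately show ?thesis using mult_left_mono[of c0 "y <.> hess (u v) y" "w <.> w"] by (simp add: mult.commute)
 qed simp
 moreover have "norm (hess (u v) w) <= (B + 1) * norm w" if "v : cball 0 R" for v w
  using B(2)[OF that, of w] norm_ge_zero[of w] unfolding distrib_right by linarith
 ultimately show ?thesis using B(1) by (intro exI[of _ c0] exI[of _ "B + 1"] conjI) auto
qed

lemma u_v_bounds:
 "EX c1>0. EX L>0. ALL v:cball 0 R. ALL w. c1 * (w <.> w) <= w <.> (u_v U v *v w) & norm (u_v U v *v w) <= L * norm w
   & c1 * (w <.> w) <= w <.> (v_u U v *v w)"
proof -
 obtain c0 C0 where c: "0 < c0" "0 < C0"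
  "!!v w. v : cball 0 R ==> c0 * (w <.> w) <= w <.> hess (u v) w"
  "!!v w. v : cball 0 R ==> norm (hess (u v) w) <= C0 * norm w"
  using hess_bounds[of R] by metis
 \<comment> \<open>With \<open>y = u_v U v *v w\<close>, so that \<open>w\<close> is the Hessian
   applied to \<open>y\<close>, the Hessian bounds read \<open>c0 * (y <.> y) <= y <.> w\<close> and
   \<open>norm w <= C0 * norm y\<close>. The first gives the factor \<open>1 / c0\<close>, both
   together give \<open>c0 / C0^2\<close>.\<close>
 have *: "min c0 (c0 / C0^2) * (w <.> w) <= w <.> (u_v U v *v w) & norm (u_v U v *v w) <= 1 / c0 * norm w
   & min c0 (c0 / C0^2) * (w <.> w) <= w <.> (v_u U v *v w)" if v: "v : cball 0 R" for v w
 proof (intro conjI)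
  define y where "y = u_v U v *v w"
  have w: "w = hess (u v) y" by (simp add: y_def hess_u_v)
  have yy: "c0 * (y <.> y) <= y <.> w" using c(3)[OF v, of y] w by simp
  have "c0 * (norm y * norm y) <= norm y * norm w"
   using yy norm_cauchy_schwarz[of y w] by (simp add: dot_square_norm power2_eq_square)
  hence "c0 * norm y <= norm w" by (cases "y = 0") (auto simp: mult.left_commute)
  thus "norm (u_v U v *v w) <= 1 / c0 * norm w" using c(1) by (simp add: y_def field_simps)
  have "norm w <= C0 * norm y" using c(4)[OF v, of y] w by simp
  hence "(norm w)^2 <= (C0 * norm y)^2" by (intro power_mono) auto
  hence "c0 / C0^2 * (w <.> w) <= c0 * (y <.> y)"
   using c(1,2) by (simp add: dot_square_norm power_mult_distrib field_simps)
  hence "c0 / C0^2 * (w <.> w) <= w <.> y" using yy by (simp add: inner_commute)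
  moreover have "min c0 (c0 / C0^2) * (w <.> w) <= c0 / C0^2 * (w <.> w)" by (intro mult_right_mono) auto
  ultimately show "min c0 (c0 / C0^2) * (w <.> w) <= w <.> (u_v U v *v w)" by (simp add: y_def)
  have "min c0 (c0 / C0^2) * (w <.> w) <= c0 * (w <.> w)" by (intro mult_right_mono) auto
  thus "min c0 (c0 / C0^2) * (w <.> w) <= w <.> (v_u U v *v w)"
   using c(3)[OF v, of w] by (simp add: v_u_eq)
 qed
 show ?thesis
  by (rule exI[of _ "min c0 (c0 / C0^2)"], rule conjI, use c in simp, rule exI[of _ "1 / c0"]) (use c * in auto)
qed

text \<open>The entropy pair provides differentiability of \<open>u\<close>; continuity of the
  derivative follows from the inverse relation. The difference \<open>u_v U v *v h - w0\<close> is
  \<open>u_v U v\<close> applied to \<open>h - hess (u v) w0\<close>, where \<open>u_v\<close> is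
  locally bounded and the argument tends to 0.\<close>

lemma has_C1_u: "has_C1 u (%v h. u_v U v *v h)"
 unfolding has_C1_def
proof (intro conjI allI)
 fix h
 have "isCont (%v. u_v U v *v h) v0" for v0
 proof -
  obtain L where L: "0 < L" "!!v w. v : cball 0 (norm v0 + 1) ==> norm (u_v U v *v w) <= L * norm w"
   using u_v_bounds[of "norm v0 + 1"] by metis
  define w0 where "w0 = u_v U v0 *v h"
  have "continuous_on UNIV (%v. h - hess (u v) w0)"
   by (intro continuous_intros has_C1_joint[OF has_C1_entropy_var] u_cont)
  hence "isCont (%v. h - hess (u v) w0) v0" by (simp add: continuous_on_eq_continuous_at)
  hence "((%v. h - hess (u v) w0) ---> h - hess (u v0) w0) (at v0)" by (simp add: isCont_def)
  hence t: "((%v. L * norm (h - hess (u v) w0)) ---> 0) (at v0)"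
   by (auto simp: w0_def hess_u_v intro!: tendsto_mult_right_zero tendsto_norm_zero)
  have "((%v. u_v U v *v h - w0) ---> 0) (at v0)"
  proof (rule Lim_null_comparison[OF _ t])
   have "eventually (%v. v : ball v0 1) (at v0)" by (rule eventually_at_in_open') auto
   thus "eventually (%v. norm (u_v U v *v h - w0) <= L * norm (h - hess (u v) w0)) (at v0)"
   proof eventually_elim
    case (elim v)
    hence "v : cball 0 (norm v0 + 1)" using norm_triangle_ineq2[of v v0] by (auto simp: dist_norm norm_minus_commute)
    from L(2)[OF this, of "h - hess (u v) w0"] show ?case
     by (simp add: matrix_vector_mult_diff_distrib u_v_hess)
   qed
  qed
  thus ?thesis unfolding isCont_def w0_def using LIM_zero_iff by blast
 qed
 thus "continuous_on UNIV (%v. u_v U v *v h)" by (simp add: continuous_on_eq_continuous_at)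
qed (rule u_deriv)

definition flux' :: "'d => real^'m => real^'m => real^'m" where
 "flux' k v h = frechet_derivative (f k) (at (u v)) (u_v U v *v h)"

lemma has_C1_flux: "has_C1 (fl k) (flux' k)"
 unfolding flux'_def using has_C1_compose[OF smooth_has_C1[OF fluxes[of k]] has_C1_u]
 by (simp add: flux_v_def[abs_def])

text \<open>Entropy potential of the flux, with \<open>potential0\<close> as its counterpart in
  time. By compatibility of the entropy pair the gradients in the entropy variables are the flux and
  the state, which turns the volume terms of the scheme tested with its solution into exact
  divergences.\<close>

definition potential :: "'d => real^'m => real" where
 "potential k v = fl k v <.> v - F k (u v)"

definition potential0 :: "real^'m => real" where
 "potential0 v = u v <.> v - U (u v)"

lemma has_C1_legendre:
 assumes g: "has_C1 g g'" and \<Phi>: "!!v. (\<Phi> has_derivative (%h. g' v h <.> v)) (at v)"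
 shows "has_C1 (%v. g v <.> v - \<Phi> v) (%v h. g v <.> h)"
 unfolding has_C1_def
proof (intro conjI allI)
 show "continuous_on UNIV (%v. g v <.> h)" for h by (intro continuous_intros has_C1D(4)[OF g])
 show "((%v. g v <.> v - \<Phi> v) has_derivative (%h. g v <.> h)) (at v)" for v
  using has_derivative_diff[OF has_derivative_inner[OF has_C1D(1)[OF g] has_derivative_ident] \<Phi>[of v]] by simp
qed

lemma has_C1_potential: "has_C1 (potential k) (%v h. fl k v <.> h)"
proof -
 have "frechet_derivative (F k) (at (u v)) = (%w. v <.> frechet_derivative (f k) (at (u v)) w)" for v
  using entropy by (simp add: entropy_pair_def dU fun_eq_iff)
 hence F: "(F k has_derivative (%w. v <.> frechet_derivative (f k) (at (u v)) w)) (at (u v))" for v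
  using entropy by (metis entropy_pair_def frechet_derivative_works)
 show ?thesis unfolding potential_def[abs_def]
  by (rule has_C1_legendre[OF has_C1_flux]) (use has_derivative_compose[OF u_deriv F] in \<open>simp add: flux'_def inner_commute\<close>)
qed

lemma has_C1_potential0: "has_C1 potential0 (%v h. u v <.> h)"
proof -
 have "(U has_derivative (%h. v <.> h)) (at (u v))" for v
  using C2_U(1)[of "u v"] dU[of "u v"] by (metis (no_types, lifting) ext frechet_derivative_works u_inv(1))
 from has_derivative_compose[OF u_deriv this] show ?thesis unfolding potential0_def[abs_def]
  by (intro has_C1_legendre[OF has_C1_u]) (simp add: inner_commute)
qed

text \<open>Strong convexity of \<open>potential0\<close>, whose gradient is \<open>u\<close> and
  whose Hessian is \<open>u_v\<close>, by Taylor expansion of second order on the segment from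
  \<open>a\<close> to \<open>b\<close>. It yields the dissipation of the jumps in time.\<close>

lemma bregman:
 assumes c1: "!!v w. v : cball 0 R ==> c1 * (w <.> w) <= w <.> (u_v U v *v w)"
  and ab: "a : cball 0 R" "b : cball 0 R"
 shows "c1 / 2 * (norm (b - a))^2 <= potential0 b - potential0 a - u a <.> (b - a)"
proof -
 define d where "d = b - a"
 define gam where "gam s = a + s *R d" for s
 have gamin: "gam s : cball 0 R" if "0 <= s" "s <= 1" for s
 proof -
  have "gam s = (1 - s) *R a + s *R b" by (simp add: gam_def d_def algebra_simps)
  moreover have "(1 - s) *R a + s *R b : cball 0 R" by (rule convexD_alt[OF convex_cball ab that])
  ultimately show ?thesis by (simp only:)
 qed
 have gamd: "(gam has_derivative (%h. h *R d)) (at s)" for s unfolding gam_def by (auto intro!: derivative_eq_intros)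
 have ud: "DERIV (%s. u (gam s) <.> d) s :> (u_v U (gam s) *v d) <.> d" for s
  using has_derivative_inner_left[OF has_derivative_compose[OF gamd u_deriv], of d s]
  by (simp add: has_field_derivative_def matrix_vector_mult_scaleR mult_commute_abs)
 have pd: "DERIV (%s. potential0 (gam s)) s :> u (gam s) <.> d" for s
  using has_derivative_compose[OF gamd has_C1D(1)[OF has_C1_potential0], of s]
  by (simp add: has_field_derivative_def mult_commute_abs)
 define \<Delta> where "\<Delta> m = (if m = 0 then (%s. potential0 (gam s)) else if m = 1 then (%s. u (gam s) <.> d) else (%s. (u_v U (gam s) *v d) <.> d))" for m :: nat
 have "EX t>0. t < 1 & potential0 (gam 1) = (\<Sum>m<2. \<Delta> m 0 / fact m * 1 ^ m) + \<Delta> 2 t / fact 2 * 1 ^ 2"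
  by (rule Maclaurin) (use ud pd in \<open>auto simp: \<Delta>_def less_2_cases_iff\<close>)
 then obtain t where t: "0 < t" "t < 1" "potential0 (gam 1) = potential0 (gam 0) + u (gam 0) <.> d + (u_v U (gam t) *v d) <.> d / 2"
  by (auto simp: \<Delta>_def numeral_2_eq_2)
 thus ?thesis
  using c1[OF gamin, of t d] by (simp add: gam_def d_def power2_norm_eq_inner inner_commute)
qed

lemma f_star_integrable: "(%th. SUM k:UNIV. (n $ k) *R fl k (a + th *R (b - a))) integrable_on {0..1::real}"
 by (intro integrable_continuous_interval continuous_intros continuous_on_compose2[OF has_C1D(4)[OF has_C1_flux, of UNIV]]) auto

text \<open>Tadmor's condition for entropy conservation: tested with \<open>b - a\<close>, the flux
  integrated over the segment is the derivative of the potentials along it.\<close>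

lemma f_star_potential: "f_star f U a b n <.> (b - a) = (SUM k:UNIV. (n $ k) * (potential k b - potential k a))"
proof -
 define gam where "gam s = a + s *R (b - a)" for s :: real
 have gamd: "(gam has_derivative (%h. h *R (b - a))) (at s within S)" for s S
  unfolding gam_def by (auto intro!: derivative_eq_intros)
 have "((%s. SUM k:UNIV. (n $ k) * (fl k (gam s) <.> (b - a))) has_integral
   (SUM k:UNIV. (n $ k) * potential k (gam 1)) - (SUM k:UNIV. (n $ k) * potential k (gam 0))) {0..1}"
 proof (rule fundamental_theorem_of_calculus)
  fix s :: real
  have "((%s. potential k (gam s)) has_vector_derivative (fl k (gam s) <.> (b - a))) (at s within {0..1})" for k
   using has_derivative_compose[OF gamd[of s "{0..1}"] has_C1D(1)[OF has_C1_potential[of k]]]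
   by (simp add: has_vector_derivative_def)
  thus "((%s. SUM k:UNIV. (n $ k) * potential k (gam s)) has_vector_derivative
    (SUM k:UNIV. (n $ k) * (fl k (gam s) <.> (b - a)))) (at s within {0..1})"
   by (intro has_vector_derivative_sum has_vector_derivative_mult_right)
 qed simp
 hence 1: "integral {0..1} (%s. SUM k:UNIV. (n $ k) * (fl k (gam s) <.> (b - a)))
   = (SUM k:UNIV. (n $ k) * (potential k b - potential k a))"
  by (auto simp: gam_def right_diff_distrib sum_subtractf dest: integral_unique)
 have "f_star f U a b n <.> (b - a) = integral {0..1} ((%w. w <.> (b - a)) \<circ> (%th. SUM k:UNIV. (n $ k) *R fl k (a + th *R (b - a))))"
  unfolding f_star_def by (rule integral_linear[OF f_star_integrable bounded_linear_inner_left, symmetric])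
 also have "... = (SUM k:UNIV. (n $ k) * (potential k b - potential k a))"
  using 1 by (simp add: o_def inner_sum_left gam_def)
 finally show ?thesis .
qed

lemma f_star_continuous: "continuous_on UNIV (%z. f_star f U (fst z) (fst (snd z)) (snd (snd z)))"
 unfolding f_star_def cbox_interval[symmetric]
 by (rule integral_continuous_on_param)
   (auto simp: case_prod_beta intro!: continuous_intros continuous_on_compose2[OF has_C1D(4)[OF has_C1_flux, of UNIV]])

lemma f_star_close:
 assumes L: "!!k a b. a : cball 0 R ==> b : cball 0 R ==> norm (fl k a - fl k b) <= L * norm (a - b)"
  and "0 <= L" and n: "norm n = 1" and ab: "a : cball 0 R" "b : cball 0 R"
 shows "norm (f_star f U a b n - (SUM k:UNIV. (n $ k) *R fl k a)) <= real CARD('d) * L * norm (b - a)"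
proof -
 have eq: "f_star f U a b n - (SUM k:UNIV. (n $ k) *R fl k a) =
   integral {0..1} (%th::real. (SUM k:UNIV. (n $ k) *R fl k (a + th *R (b - a))) - (SUM k:UNIV. (n $ k) *R fl k a))"
  unfolding f_star_def by (subst Henstock_Kurzweil_Integration.integral_diff) (auto intro: f_star_integrable)
 have "norm (integral {0..1} (%th::real. (SUM k:UNIV. (n $ k) *R fl k (a + th *R (b - a))) - (SUM k:UNIV. (n $ k) *R fl k a)))
   <= real CARD('d) * L * norm (b - a) * (1 - 0)"
 proof (rule integral_bound)
  show "continuous_on {0..1} (%th::real. (SUM k:UNIV. (n $ k) *R fl k (a + th *R (b - a))) - (SUM k:UNIV. (n $ k) *R fl k a))"
   by (intro continuous_intros continuous_on_compose2[OF has_C1D(4)[OF has_C1_flux, of UNIV]]) auto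
  fix th :: real assume th: "th : {0..1}"
  have "a + th *R (b - a) = (1 - th) *R a + th *R b" by (simp add: algebra_simps)
  hence g: "a + th *R (b - a) : cball 0 R" using convexD_alt[OF convex_cball ab, of th] th by simp
  have "norm ((SUM k:UNIV. (n $ k) *R fl k (a + th *R (b - a))) - (SUM k:UNIV. (n $ k) *R fl k a))
    = norm (SUM k:UNIV. (n $ k) *R (fl k (a + th *R (b - a)) - fl k a))"
   by (simp add: sum_subtractf scaleR_diff_right)
  also have "... <= (SUM k:(UNIV::'d set). L * norm (b - a))"
  proof (rule sum_norm_le)
   fix k :: 'd
   have "norm (fl k (a + th *R (b - a)) - fl k a) <= L * (th * norm (b - a))"
    using L[OF g ab(1), of k] th by simp
   also have "... <= L * norm (b - a)" using th assms(2) by (intro mult_left_mono) (auto intro: mult_left_le_one_le)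
   finally have 1: "norm (fl k (a + th *R (b - a)) - fl k a) <= L * norm (b - a)" .
   have "\<bar>n $ k\<bar> <= 1" using component_le_norm_cart[of n k] n by simp
   hence "\<bar>n $ k\<bar> * norm (fl k (a + th *R (b - a)) - fl k a) <= 1 * (L * norm (b - a))"
    using 1 by (intro mult_mono) auto
   thus "norm ((n $ k) *R (fl k (a + th *R (b - a)) - fl k a)) <= L * norm (b - a)" by simp
  qed
  also have "... = real CARD('d) * L * norm (b - a)" by simp
  finally show "norm ((SUM k:UNIV. (n $ k) *R fl k (a + th *R (b - a))) - (SUM k:UNIV. (n $ k) *R fl k a))
   <= real CARD('d) * L * norm (b - a)" .
 qed simp
 thus ?thesis unfolding eq by simp
qed

end

text \<open>For a positive definite symmetric matrix the form bounds the norm. Instead of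
  diagonalising, the nonnegative form is evaluated at \<open>C *R w - A *v w\<close>.\<close>

lemma spd_norm_le:
 assumes A: "spd A" and C: "!!w. w <.> (A *v w) <= C * (w <.> w)" and "0 <= C"
 shows "norm (A *v w) <= C * norm w"
proof -
 have sym: "x <.> (A *v y) = (A *v x) <.> y" for x y
  using A dot_lmul_matrix[of x A y] transpose_matrix_vector[of A x] by (simp add: spd_def)
 have pos: "0 <= x <.> (A *v x)" for x using A by (cases "x = 0") (auto simp: spd_def less_imp_le)
 define y where "y = A *v w"
 have "0 <= (C *R w - y) <.> (A *v (C *R w - y))" by (rule pos)
 also have "... = C^2 * (w <.> y) - 2 * C * (y <.> y) + y <.> (A *v y)"
  by (simp add: matrix_vector_mult_diff_distrib matrix_vector_mult_scaleR inner_diff_left inner_diff_right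
    sym[of w y] y_def[symmetric] power2_eq_square inner_commute algebra_simps)
 also have "... <= C^2 * (w <.> y) - 2 * C * (y <.> y) + C * (y <.> y)" using C[of y] by simp
 finally have "C * (y <.> y) <= C * (C * (w <.> y))" by (simp add: power2_eq_square algebra_simps)
 hence le: "C = 0 | y <.> y <= C * (w <.> y)" using assms(3) by (auto simp: mult_le_cancel_left)
 show ?thesis
 proof (cases "C = 0")
  case True
  hence "w = 0" using C[of w] A by (auto simp: spd_def not_le)
  thus ?thesis by simp
 next
  case False
  hence "norm y * norm y <= C * (norm w * norm y)"
   using le norm_cauchy_schwarz[of w y] assms(3)
   by (simp add: dot_square_norm power2_eq_square) (meson mult_left_mono order_trans)
  thus ?thesis by (cases "y = 0") (auto simp: y_def[symmetric] mult.assoc[symmetric] assms(3))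
 qed
qed

section \<open>Neighbouring cells in one time slab\<close>

lemma open_halfspace_strict:
 fixes a :: "'a::euclidean_space"
 assumes "open K" "a ~= 0" "!!x. x : K ==> a <.> x <= b" "x : K"
 shows "a <.> x < b"
proof -
 have "K <= interior {x. a <.> x <= b}" using assms by (intro interior_maximal) auto
 thus ?thesis using assms by auto
qed

lemma separate_open_convex:
 fixes K K' :: "'a::euclidean_space set"
 assumes "open K" "convex K" "K ~= {}" "open K'" "convex K'" "K' ~= {}" "K Int K' = {}"
 shows "EX n b. norm n = 1 & (ALL x:K. n <.> x < b) & (ALL x:K'. b < n <.> x)"
proof -
 obtain a b where ab: "a ~= 0" "!!x. x : K ==> a <.> x <= b" "!!x. x : K' ==> b <= a <.> x"
  using separating_hyperplane_sets[OF assms(2,5,3,6,7)] by blast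
 have 1: "a <.> x < b" if "x : K" for x by (rule open_halfspace_strict[OF assms(1) ab(1,2) that])
 have 2: "b < a <.> x" if "x : K'" for x
  using open_halfspace_strict[OF assms(4), of "- a" "- b" x] ab that by auto
 have n: "0 < norm a" using ab by simp
 show ?thesis
 proof (intro exI conjI ballI)
  show "norm (a /\<^sub>R norm a) = 1" using n by simp
  show "(a /\<^sub>R norm a) <.> x < b / norm a" if "x : K" for x using 1[OF that] n by (simp add: divide_simps)
  show "b / norm a < (a /\<^sub>R norm a) <.> x" if "x : K'" for x using 2[OF that] n by (simp add: divide_simps)
 qed
qed

locale cell_partition =
 fixes Om :: "(real^'d) set" and \<C> :: "(real^'d) set set"
 assumes dim: "CARD('d) : {1, 2, 3}"
  and Om: "open Om" "bounded Om"
  and fin: "finite \<C>" and disj: "disjoint \<C>"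
  and cell: "!!K. K : \<C> ==> open K & convex K & K ~= {} & K <= Om"
  and cover: "Om <= (UN K:\<C>. closure K)"
begin

definition sep :: "(real^'d) set => (real^'d) set => (real^'d) \<times> real" where
 "sep K K' = (SOME i. norm (fst i) = 1 & (ALL x:K. fst i <.> x < snd i) & (ALL x:K'. snd i < fst i <.> x))"

lemma sep:
 assumes "K : \<C>" "K' : \<C>" "K ~= K'"
 shows "norm (fst (sep K K')) = 1" "x : K ==> fst (sep K K') <.> x < snd (sep K K')"
  "x : K' ==> snd (sep K K') < fst (sep K K') <.> x"
proof -
 have "K Int K' = {}" using disj assms by (auto simp: disjoint_def)
 hence "EX i. norm (fst i) = 1 & (ALL x:K. fst i <.> x < snd i) & (ALL x:K'. snd i < fst i <.> x)"
  using separate_open_convex[of K K'] cell[OF assms(1)] cell[OF assms(2)] by auto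
 from someI_ex[OF this] show "norm (fst (sep K K')) = 1" "x : K ==> fst (sep K K') <.> x < snd (sep K K')"
  "x : K' ==> snd (sep K K') < fst (sep K K') <.> x"
  unfolding sep_def by auto
qed

lemma sep_closure:
 assumes "K : \<C>" "K' : \<C>" "K ~= K'"
 shows "x : closure K ==> fst (sep K K') <.> x <= snd (sep K K')"
  "x : closure K' ==> snd (sep K K') <= fst (sep K K') <.> x"
proof -
 have "closure K <= {x. fst (sep K K') <.> x <= snd (sep K K')}"
  using sep(2)[OF assms] by (intro closure_minimal closed_halfspace_le) (auto intro: less_imp_le)
 moreover have "closure K' <= {x. fst (sep K K') <.> x >= snd (sep K K')}"
  using sep(3)[OF assms] by (intro closure_minimal closed_halfspace_ge) (auto intro: less_imp_le)
 ultimately show "x : closure K ==> fst (sep K K') <.> x <= snd (sep K K')"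
  "x : closure K' ==> snd (sep K K') <= fst (sep K K') <.> x" by auto
qed

definition nodes :: "(real^'d) set" where
 "nodes = (UN K:\<C>. UN K':\<C> - {K}. UN L:\<C> - {K, K'}. closure K Int closure K' Int closure L)"

lemma nodes_closed: "closed nodes"
 unfolding nodes_def using fin by (intro closed_UN closed_Int) auto

text \<open>The three hyperplanes separating three cells pairwise cannot all coincide.\<close>

lemma nodes_null: "nodes : null_sets surface_measure"
 unfolding nodes_def
proof (intro null_sets_UN' countable_finite)
 fix K1 K2 K3 assume K: "K1 : \<C>" "K2 : \<C> - {K1}" "K3 : \<C> - {K1, K2}"
 define T where "T = closure K1 Int closure K2 Int closure K3"
 obtain n12 b12 n13 b13 n23 b23 where s: "sep K1 K2 = (n12, b12)" "sep K1 K3 = (n13, b13)" "sep K2 K3 = (n23, b23)"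
  by fastforce
 have neq: "K1 : \<C>" "K2 : \<C>" "K3 : \<C>" "K1 ~= K2" "K1 ~= K3" "K2 ~= K3" using K by blast+
 note s12 = sep[OF neq(1,2,4), unfolded s fst_conv snd_conv] sep_closure[OF neq(1,2,4), unfolded s fst_conv snd_conv]
 note s13 = sep[OF neq(1,3,5), unfolded s fst_conv snd_conv] sep_closure[OF neq(1,3,5), unfolded s fst_conv snd_conv]
 note s23 = sep[OF neq(2,3,6), unfolded s fst_conv snd_conv] sep_closure[OF neq(2,3,6), unfolded s fst_conv snd_conv]
 obtain x1 x2 x3 where x: "x1 : K1" "x2 : K2" "x3 : K3" using K cell by blast
 have on: "n12 <.> y = b12" "n13 <.> y = b13" "n23 <.> y = b23" if "y : T" for y
  using that s12(4,5)[of y] s13(4,5)[of y] s23(4,5)[of y] by (auto simp: T_def)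
 have ord: "n12 <.> x1 < b12" "b12 < n12 <.> x2" "n13 <.> x1 < b13" "b13 < n13 <.> x3" "n23 <.> x2 < b23" "b23 < n23 <.> x3"
  using x s12(2,3) s13(2,3) s23(2,3) by auto
 have nrm: "norm n12 = 1" "norm n13 = 1" "norm n23 = 1" using s12(1) s13(1) s23(1) by auto
 have "EX S:null_sets surface_measure. T <= S"
 proof (cases "(n12, b12) = (n13, b13)")
  case True
  have "{x. n12 <.> x = b12} Int {x. n23 <.> x = b23} : null_sets surface_measure"
   using True ord nrm by (intro surface_hyperplane_inter_null[OF dim]) auto
  moreover have "T <= {x. n12 <.> x = b12} Int {x. n23 <.> x = b23}" using on by auto
  ultimately show ?thesis by (rule bexI[rotated])
 next
  case False
  have "{x. n12 <.> x = b12} Int {x. n13 <.> x = b13} : null_sets surface_measure"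
   using False ord nrm by (intro surface_hyperplane_inter_null[OF dim]) auto
  moreover have "T <= {x. n12 <.> x = b12} Int {x. n13 <.> x = b13}" using on by auto
  ultimately show ?thesis by (rule bexI[rotated])
 qed
 moreover have "T : sets surface_measure" unfolding T_def by (intro borel_subset_hausdorff) auto
 ultimately have "T : null_sets surface_measure" using null_sets_subset by blast
 thus "closure K1 Int closure K2 Int closure K3 : null_sets surface_measure" by (simp add: T_def)
qed (use fin in auto)

text \<open>A regular point of the common face of two cells: no third cell comes near, and one
  hyperplane divides a small ball between the two. There both traces and opposite normals exist, and
  by \<open>facing_exists\<close> all frontier points in \<open>Om\<close> off the null set
  \<open>nodes\<close> are of this kind.\<close>

definition facing :: "(real^'d) set => (real^'d) set => real^'d => bool" where
 "facing K K' x <-> K : \<C> & K' : \<C> & K ~= K' & x : frontier K & x : frontier K' &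
   (ALL L:\<C>. x : closure L --> L = K | L = K') &
   (EX n r. norm n = 1 & 0 < r & K <= {y. n <.> y < n <.> x} & K' <= {y. n <.> x < n <.> y} &
    ball x r Int {y. n <.> y < n <.> x} <= K & ball x r Int {y. n <.> x < n <.> y} <= K')"

lemma facing_sym: "facing K K' x ==> facing K' K x"
proof -
 assume f: "facing K K' x"
 obtain n r where n: "norm n = 1" "0 < r" "K <= {y. n <.> y < n <.> x}" "K' <= {y. n <.> x < n <.> y}"
   "ball x r Int {y. n <.> y < n <.> x} <= K" "ball x r Int {y. n <.> x < n <.> y} <= K'"
  using f unfolding facing_def by blast
 have "norm (- n) = 1 & 0 < r & K' <= {y. - n <.> y < - n <.> x} & K <= {y. - n <.> x < - n <.> y} &
   ball x r Int {y. - n <.> y < - n <.> x} <= K' & ball x r Int {y. - n <.> x < - n <.> y} <= K"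
  using n by simp
 thus ?thesis using f unfolding facing_def by metis
qed

text \<open>The closures cover only up to boundaries, so \<open>S\<close> is first placed in the
  closure of \<open>K\<close>; convexity then gives back \<open>K\<close> as the interior of its
  closure.\<close>

lemma open_subset_cells:
 assumes "open S" "S <= Om" "K : \<C>" "!!L. L : \<C> ==> L ~= K ==> S Int closure L = {}"
 shows "S <= K"
proof -
 have "S <= closure K" using assms cover by blast
 hence "S <= interior (closure K)" using assms by (intro interior_maximal) auto
 also have "interior (closure K) = K" using convex_interior_closure[of K] cell[OF assms(3)] by (simp add: interior_open)
 finally show ?thesis .
qed

lemma isolating_ball:
 assumes "x : Om"
 shows "EX r>0. ball x r <= Om & (ALL L:\<C>. x ~: closure L --> ball x r Int closure L = {})"
proof -
 have "open (Om - (UN L:{L:\<C>. x ~: closure L}. closure L))" using Om fin by (intro open_Diff closed_UN) auto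
 then obtain r where "0 < r" "ball x r <= Om - (UN L:{L:\<C>. x ~: closure L}. closure L)"
  using assms open_contains_ball by (smt (verit) DiffI UN_iff mem_Collect_eq)
 thus ?thesis by (intro exI[of _ r]) blast
qed

lemma frontier_other_cell:
 assumes "K : \<C>" "x : frontier K" "x : Om"
 shows "EX K':\<C> - {K}. x : closure K'"
proof (rule ccontr)
 assume "~ ?thesis"
 hence no: "!!L. L : \<C> ==> L ~= K ==> x ~: closure L" by blast
 obtain r where r: "0 < r" "ball x r <= Om" "!!L. L : \<C> ==> x ~: closure L ==> ball x r Int closure L = {}"
  using isolating_ball[OF assms(3)] by metis
 have "ball x r <= K" by (rule open_subset_cells) (use r no assms(1) in auto)
 hence "x : K" using r(1) by auto
 thus False using assms(2) cell[OF assms(1)] by (simp add: frontier_def interior_open)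
qed

text \<open>The covering brings a second cell to \<open>x\<close>, and off the nodes there is no
  third. In a small ball the two sides of the separating hyperplane then belong to these two
  cells.\<close>

lemma facing_exists:
 assumes K: "K : \<C>" and x: "x : frontier K" "x : Om" "x ~: nodes"
 shows "EX K'. facing K K' x"
proof -
 obtain K' where K': "K' : \<C>" "K' ~= K" "x : closure K'" using frontier_other_cell[OF K x(1,2)] by auto
 have xK: "x : closure K" using x(1) by (simp add: frontier_def)
 have two: "L = K | L = K'" if "L : \<C>" "x : closure L" for L
 proof (rule ccontr)
  assume "~ ?thesis"
  hence "L : \<C> - {K, K'}" "K' : \<C> - {K}" "x : closure K Int closure K' Int closure L"
   using that K K' xK by auto
  thus False using x(3) K unfolding nodes_def by blast
 qed
 have nK': "x ~: K'"
 proof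
  assume "x : K'"
  hence "K' Int K ~= {}" using xK cell[OF K'(1)] open_Int_closure_eq_empty by blast
  thus False using disj K K' by (auto simp: disjoint_def)
 qed
 define n where "n = fst (sep K K')"
 have b: "n <.> x = snd (sep K K')" unfolding n_def using sep_closure[OF K K'(1) K'(2)[symmetric], of x] xK K'(3) by simp
 obtain r where r: "0 < r" "ball x r <= Om" "!!L. L : \<C> ==> x ~: closure L ==> ball x r Int closure L = {}"
  using isolating_ball[OF x(2)] by metis
 have "ball x r Int {y. n <.> y < n <.> x} <= K"
 proof (rule open_subset_cells)
  show "open (ball x r Int {y. n <.> y < n <.> x})" by (intro open_Int open_ball open_halfspace_lt)
  fix L assume L: "L : \<C>" "L ~= K"
  show "ball x r Int {y. n <.> y < n <.> x} Int closure L = {}"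
  proof (cases "L = K'")
   case True
   thus ?thesis using sep_closure(2)[OF K K'(1) K'(2)[symmetric]] b by (force simp: n_def)
  next
   case False
   thus ?thesis using two L r(3) by blast
  qed
 qed (use r K in auto)
 moreover have "ball x r Int {y. n <.> x < n <.> y} <= K'"
 proof (rule open_subset_cells)
  show "open (ball x r Int {y. n <.> x < n <.> y})" by (intro open_Int open_ball open_halfspace_gt)
  fix L assume L: "L : \<C>" "L ~= K'"
  show "ball x r Int {y. n <.> x < n <.> y} Int closure L = {}"
  proof (cases "L = K")
   case True
   thus ?thesis using sep_closure(1)[OF K K'(1) K'(2)[symmetric]] b by (force simp: n_def)
  next
   case False
   thus ?thesis using two L r(3) by blast
  qed
 qed (use r K' in auto)
 moreover have "K <= {y. n <.> y < n <.> x}" "K' <= {y. n <.> x < n <.> y}" "norm n = 1"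
  unfolding b using sep[OF K K'(1) K'(2)[symmetric]] by (auto simp: n_def)
 moreover have "x : frontier K'" using K' nK' cell[OF K'(1)] by (simp add: frontier_def interior_open)
 ultimately have "facing K K' x"
  unfolding facing_def using K K' x(1) two r(1) by metis
 thus ?thesis by blast
qed

lemma facing_normal:
 assumes "facing K K' x"
 obtains n r where "norm n = 1" "0 < r" "unit_normal K x = n" "unit_normal K' x = - n"
  "!!e. 0 < e ==> e < r ==> x - e *R n : K" "!!e. 0 < e ==> e < r ==> x + e *R n : K'"
proof -
 obtain n r where n: "norm n = 1" "0 < r" "K <= {y. n <.> y < n <.> x}" "K' <= {y. n <.> x < n <.> y}"
   "ball x r Int {y. n <.> y < n <.> x} <= K" "ball x r Int {y. n <.> x < n <.> y} <= K'"
  using assms unfolding facing_def by blast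
 have nn: "n <.> n = 1" using n by (simp add: norm_eq_1)
 show ?thesis
 proof (rule that[OF n(1,2)])
  show "unit_normal K x = n" by (rule unit_normal_eq[OF n(1) refl n(3,2,5)])
  show "unit_normal K' x = - n" by (rule unit_normal_eq[OF _ refl, of _ _ _ r]) (use n in auto)
  show "x - e *R n : K" if "0 < e" "e < r" for e
   using that n(1) nn by (intro subsetD[OF n(5)]) (auto simp: dist_norm inner_diff_right)
  show "x + e *R n : K'" if "0 < e" "e < r" for e
   using that n(1) nn by (intro subsetD[OF n(6)]) (auto simp: dist_norm inner_add_right)
 qed
qed

text \<open>Away from the nodes, the value at \<open>x\<close> of the function attached to the cell opposite to \<open>K\<close>.\<close>

definition across :: "((real^'d) set => 'b::real_vector) => (real^'d) set => real^'d => 'b" where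
 "across g K x = (SUM L:\<C> - {K}. indicator (closure L) x *R g L)"

lemma across_facing: "facing K K' x ==> across g K x = g K'"
proof -
 assume f: "facing K K' x"
 have "across g K x = (SUM L:{K'}. indicat_real (closure L) x *R g L)"
  unfolding across_def using f fin
  by (intro sum.mono_neutral_right) (auto simp: facing_def indicator_def)
 moreover have "x : closure K'" using f by (simp add: facing_def frontier_def)
 ultimately show ?thesis by simp
qed

text \<open>A Borel version of the unit normal, read off the separating hyperplanes;
  \<open>unit_normal\<close> itself is a description without evident measurability.\<close>

definition normal :: "(real^'d) set => real^'d => real^'d" where
 "normal K x = across (%L. fst (sep K L)) K x"

text \<open>The hyperplane chosen by \<open>sep\<close> passes through \<open>x\<close>. The half
  ball on its \<open>K\<close> side avoids the opposite cell and is open, so it lies in the interior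
  of the closure of \<open>K\<close>, and \<open>unit_normal_eq\<close> applies to this
  hyperplane.\<close>

lemma normal_facing: "facing K K' x ==> normal K x = unit_normal K x"
proof -
 assume f: "facing K K' x"
 hence C: "K : \<C>" "K' : \<C>" "K ~= K'" by (auto simp: facing_def)
 obtain n r where n: "norm n = 1" "0 < r" "K <= {y. n <.> y < n <.> x}" "ball x r Int {y. n <.> y < n <.> x} <= K"
   "ball x r Int {y. n <.> x < n <.> y} <= K'"
  using f unfolding facing_def by blast
 define m b where "m = fst (sep K K')" "b = snd (sep K K')"
 have mx: "m <.> x = b" using sep_closure[OF C, of x] f by (auto simp: m_b_def facing_def frontier_def)
 have "ball x r Int {y. m <.> y < b} <= closure K"
 proof
  fix y assume y: "y : ball x r Int {y. m <.> y < b}"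
  have "y ~: K'" using sep(3)[OF C] y by (force simp: m_b_def)
  hence "n <.> y <= n <.> x" using n(5) y by force
  have "open (ball x r Int {y. m <.> y < b})" by (intro open_Int open_ball open_halfspace_lt)
  moreover have "ball x r Int {y. m <.> y < b} <= {y. n <.> y <= n <.> x}"
   using n(5) sep(3)[OF C] by (force simp: m_b_def)
  ultimately have "n <.> y < n <.> x" using open_halfspace_strict[of _ n "n <.> x" y] y n(1) by fastforce
  thus "y : closure K" using n(4) y closure_subset by blast
 qed
 hence "ball x r Int {y. m <.> y < b} <= interior (closure K)"
  by (intro interior_maximal open_Int open_ball open_halfspace_lt)
 also have "interior (closure K) = K" using convex_interior_closure[of K] cell[OF C(1)] by (simp add: interior_open)
 finally have "unit_normal K x = m"
  by (intro unit_normal_eq[OF _ mx _ n(2)]) (use sep[OF C] in \<open>auto simp: m_b_def\<close>)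
 thus ?thesis unfolding normal_def across_facing[OF f] by (simp add: m_b_def)
qed

text \<open>For these cells every frontier point is shared with another cell, which makes them
  polytopes. The remaining cells may end on the boundary of \<open>Om\<close>, of which no
  regularity is assumed.\<close>

definition inner_cells :: "(real^'d) set set" where
 "inner_cells = {K:\<C>. closure K <= Om}"

lemma inner_cells: "K : inner_cells ==> K : \<C>" "K : inner_cells ==> closure K <= Om"
  "K : inner_cells ==> frontier K <= Om" "finite inner_cells"
 using fin by (auto simp: inner_cells_def frontier_def)

lemma cell_bounded: "K : \<C> ==> bounded K" using cell Om bounded_subset by blast

lemma inner_polytope: "K : inner_cells ==> polytope_cell K ((%K'. sep K K') ` (\<C> - {K}))"
proof
 assume K: "K : inner_cells"
 hence KC: "K : \<C>" by (rule inner_cells)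
 show "CARD('d) : {1, 2, 3}" by (rule dim)
 show "open K" "convex K" "K ~= {}" using cell[OF KC] by auto
 show "bounded K" by (rule cell_bounded[OF KC])
 show "finite ((%K'. sep K K') ` (\<C> - {K}))" using fin by simp
 show "norm n = 1" if "(n, b) : (%K'. sep K K') ` (\<C> - {K})" for n b
  using that sep(1)[OF KC] by (smt (verit) DiffE fst_conv imageE singletonI)
 show "n <.> x < b" if nb: "(n, b) : (%K'. sep K K') ` (\<C> - {K})" and x: "x : K" for n b x
 proof -
  obtain K' where "(n, b) = sep K K'" "K' : \<C>" "K ~= K'" using nb by auto
  thus ?thesis using sep(2)[OF KC, of K' x] x by (metis fst_conv snd_conv)
 qed
 fix x assume x: "x : frontier K"
 then obtain K' where K': "K' : \<C> - {K}" "x : closure K'"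
  using frontier_other_cell[OF KC x] inner_cells(3)[OF K] by blast
 hence "fst (sep K K') <.> x = snd (sep K K')"
  using sep_closure[OF KC, of K' x] x by (auto simp: frontier_def intro: antisym)
 thus "EX (n, b):(%K'. sep K K') ` (\<C> - {K}). n <.> x = b"
  using K'(1) by (auto simp: case_prod_beta)
qed

definition skeleton :: "(real^'d) set" where
 "skeleton = (UN K:inner_cells. frontier K)"

lemma skeleton_closed: "closed skeleton" unfolding skeleton_def using inner_cells by (intro closed_UN) auto

lemma skeleton_finite: "emeasure surface_measure skeleton < \<infinity>"
proof -
 have "emeasure surface_measure skeleton <= (SUM K:inner_cells. emeasure surface_measure (frontier K))"
  unfolding skeleton_def using inner_cells(4)
  by (intro emeasure_subadditive_finite image_subsetI borel_subset_hausdorff) auto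
 also have "... < \<infinity>"
  unfolding infinity_ennreal_def ennreal_sum_less_top[OF inner_cells(4)]
  using polytope_cell.surface_frontier_finite[OF inner_polytope] by auto
 finally show ?thesis .
qed

lemma uncovered_null: "negligible (Om - \<Union>\<C>)"
proof -
 have "Om - \<Union>\<C> <= (UN K:\<C>. frontier K)"
 proof
  fix x assume x: "x : Om - \<Union>\<C>"
  then obtain K where "K : \<C>" "x : closure K" using cover by blast
  thus "x : (UN K:\<C>. frontier K)" using x cell by (auto simp: frontier_def interior_open)
 qed
 moreover have "negligible (UN K:\<C>. frontier K)"
  using fin cell by (intro negligible_Union) (auto intro!: negligible_convex_frontier)
 ultimately show ?thesis by (rule negligible_subset[rotated])
qed

end

section \<open>Integration by parts on space-time cells\<close>

lemma set_integrable_continuous: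
 fixes g :: "'a::euclidean_space => 'b::{banach, second_countable_topology}"
 assumes "continuous_on UNIV g" "bounded S" "S : sets borel"
 shows "set_integrable lborel S g"
proof -
 have "integrable lborel (%x. indicator (closure S) x *R g x)"
  using assms continuous_on_subset[OF assms(1)] by (intro borel_integrable_compact) auto
 hence "integrable lborel (%x. indicator S x *R (indicator (closure S) x *R g x))"
  by (rule integrable_mult_indicator[rotated]) (use assms(3) in simp)
 moreover have "indicator S x *R (indicator (closure S) x *R g x) = indicator S x *R g x" for x
  using closure_subset[of S] by (auto split: split_indicator)
 ultimately show ?thesis unfolding set_integrable_def by (simp only:)
qed

lemma times_borel:
 "A : sets borel ==> B : sets borel ==> A \<times> B : sets (borel :: ('a::second_countable_topology \<times> 'b::second_countable_topology) measure)"
 unfolding borel_prod[symmetric] by (rule pair_measureI)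

lemma set_integral_times:
 fixes g :: "'a::euclidean_space \<times> real => real"
 assumes g: "continuous_on UNIV g" and K: "bounded K" "K : sets borel" and I: "bounded I" "I : sets borel"
 shows "(LBINT z:K \<times> I. g z) = (LBINT x:K. LBINT t:I. g (x, t))"
  and "(LBINT z:K \<times> I. g z) = (LBINT t:I. LBINT x:K. g (x, t))"
proof -
 note [measurable] = K(2) I(2)
 have "set_integrable lborel (K \<times> I) g"
  using K I by (intro set_integrable_continuous[OF g] bounded_Times times_borel) auto
 hence int: "integrable (lborel \<Otimes>\<^sub>M lborel) (%(x, t). indicator K x * (indicator I t * g (x, t)))"
  unfolding set_integrable_def lborel_prod[symmetric] by (simp add: case_prod_beta' indicator_times mult.assoc)
 have eq: "(LBINT z:K \<times> I. g z) = integral\<^sup>L (lborel \<Otimes>\<^sub>M lborel) (%(x, t). indicator K x * (indicator I t * g (x, t)))"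
  unfolding set_lebesgue_integral_def lborel_prod[symmetric] by (simp add: case_prod_beta' indicator_times mult.assoc)
 show "(LBINT z:K \<times> I. g z) = (LBINT x:K. LBINT t:I. g (x, t))"
  unfolding eq using lborel_pair.integral_fst'[OF int] by (simp add: set_lebesgue_integral_def)
 have sw: "(LBINT t:I. LBINT x:K. g (x, t)) = (LINT t|lborel. LINT x|lborel. indicator K x * (indicator I t * g (x, t)))"
  unfolding set_lebesgue_integral_def
  by (intro Bochner_Integration.integral_cong refl) (auto split: split_indicator)
 show "(LBINT z:K \<times> I. g z) = (LBINT t:I. LBINT x:K. g (x, t))"
  unfolding eq sw using lborel_pair.integral_snd[OF int] by simp
qed

lemma set_integral_FTC:
 fixes A :: "'a::euclidean_space \<times> real => real"
 assumes A: "has_C1 A A'" and ab: "a <= b"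
 shows "(LBINT t:{a..<b}. A' (x, t) (0, 1)) = A (x, b) - A (x, a)"
proof -
 have c: "continuous_on UNIV (%t. A' (x, t) (0, 1))"
  by (rule continuous_on_compose2[OF has_C1D(2)[OF A, of UNIV]]) (auto intro!: continuous_intros)
 have [measurable]: "(%t. A' (x, t) (0, 1)) : borel_measurable borel" using c by (rule borel_measurable_continuous_onI)
 have "(LBINT t:{a..<b}. A' (x, t) (0, 1)) = (LINT t|lborel. A' (x, t) (0, 1) * indicator {a..b} t)"
  unfolding set_lebesgue_integral_def
 proof (rule integral_cong_AE)
  have "AE t in lborel. t ~= b" by (rule AE_lborel_singleton)
  thus "AE t in lborel. indicator {a..<b} t *R A' (x, t) (0, 1) = A' (x, t) (0, 1) * indicator {a..b} t"
   by eventually_elim (auto split: split_indicator)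
 qed measurable
 also have "... = A (x, b) - A (x, a)"
 proof (rule integral_FTC_Icc_real[OF ab])
  show "isCont (%t. A' (x, t) (0, 1)) t" for t using c by (simp add: continuous_on_eq_continuous_at)
  show "DERIV (%t. A (x, t)) t :> A' (x, t) (0, 1)" for t
  proof -
   have lin: "linear (A' (x, t))" by (rule has_C1D(3)[OF A])
   have "((%t. (x, t)) has_derivative (%h. (0, h))) (at t)" by (auto intro!: derivative_eq_intros)
   from has_derivative_compose[OF this has_C1D(1)[OF A]]
   have "((%t. A (x, t)) has_derivative (%h. A' (x, t) (0, h))) (at t)" .
   moreover have "A' (x, t) (0, h) = A' (x, t) (0, 1) * h" for h
    using linear_cmul[OF lin, of h "(0, 1)"] by simp
   hence "(%h. A' (x, t) (0, h)) = (*) (A' (x, t) (0, 1))" by (intro ext)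
   ultimately show ?thesis unfolding has_field_derivative_def by (simp only:)
  qed
 qed
 finally show ?thesis .
qed

lemma AE_snd_neq: "AE z in (lborel :: ('a::euclidean_space \<times> real) measure). snd z ~= t"
proof -
 have "negligible {z::'a \<times> real. (0, 1) <.> z = t}" by (intro negligible_hyperplane) (simp add: zero_prod_def)
 from AE_not_in[OF negligible_null_sets[OF this borel_closed[OF closed_hyperplane]]] show ?thesis by (simp add: inner_prod_def)
qed

abbreviation side :: "(real^'d) set => (real^'d) \<times> real => real" where
 "side K z == indicator (frontier K) (fst z)"

locale slab_cells = cell_partition Om \<C> for Om :: "(real^'d) set" and \<C> +
 fixes a b :: real
 assumes ab: "a < b"
begin

abbreviation "slab_measure == density lborel (indicator {a..<b} :: real => ennreal)"

text \<open>One finite measure carries the lateral faces of all inner cells of the slab, so that the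
  contributions of two cells with a common face can be compared at almost every point.\<close>

definition face_measure :: "((real^'d) \<times> real) measure" where
 "face_measure = distr (slab_measure \<Otimes>\<^sub>M surf_on skeleton) borel (%(t, x). (x, t))"

lemma sets_face_measure [simp, measurable_cong]: "sets face_measure = sets borel"
 by (simp add: face_measure_def)

lemma space_face_measure [simp]: "space face_measure = UNIV"
 by (simp add: face_measure_def)

lemma skeleton_borel [measurable]: "skeleton : sets borel" using skeleton_closed by simp

sublocale surf: finite_measure "surf_on skeleton"
 by standard (use skeleton_finite in \<open>simp add: emeasure_surf_on[OF skeleton_borel]\<close>)
sublocale slab: finite_measure slab_measure by standard (use ab in \<open>simp add: emeasure_density\<close>)
sublocale face: pair_sigma_finite slab_measure "surf_on skeleton" ..

lemma swap_measurable: "(%(t, x). (x, t)) : borel_measurable (slab_measure \<Otimes>\<^sub>M surf_on skeleton)"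
proof -
 have [measurable_cong]: "sets (surf_on skeleton) = sets (borel :: (real^'d) measure)" by simp
 show ?thesis unfolding borel_prod[symmetric] by measurable
qed

lemma finite_face_measure: "finite_measure face_measure"
 unfolding face_measure_def
 by (intro finite_measure.finite_measure_distr finite_measure_pair_measure swap_measurable surf.finite_measure_axioms slab.finite_measure_axioms)

lemma AE_face:
 assumes P: "!!t. t : {a..<b} ==> AE x in surface_measure. x : skeleton --> P (x, t)"
  and m: "{z. P z} : sets borel"
 shows "AE z in face_measure. P z"
proof -
 have "AE x in surf_on skeleton. P (x, t)" if t: "t : {a..<b}" for t
 proof (rule AE_surf_on[OF skeleton_borel _ P[OF t]])
  have "(%x. (x, t)) : measurable borel (borel :: ((real^'d) \<times> real) measure)"
   unfolding borel_prod[symmetric] by measurable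
  from measurable_sets[OF this m] show "{x. P (x, t)} : sets borel" by (simp add: vimage_def)
 qed
 hence "AE t in slab_measure. AE x in surf_on skeleton. P (case (t, x) of (t, x) => (x, t))"
  by (subst AE_density) (auto split: split_indicator)
 moreover have "{z : space (slab_measure \<Otimes>\<^sub>M surf_on skeleton). P (case z of (t, x) => (x, t))} : sets (slab_measure \<Otimes>\<^sub>M surf_on skeleton)"
  using measurable_sets[OF swap_measurable m] by (simp add: vimage_def Int_def conj_commute)
 ultimately show ?thesis
  unfolding face_measure_def using m by (subst AE_distr_iff[OF swap_measurable]) (auto intro: face.AE_pair_measure)
qed

lemma AE_face_point: "AE z in face_measure. fst z : skeleton & fst z ~: nodes & snd z : {a..<b}"
proof (rule AE_face)
 fix t assume "t : {a..<b}"
 have "AE x in surface_measure. x ~: nodes" by (rule AE_not_in[OF nodes_null])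
 thus "AE x in surface_measure. x : skeleton --> fst (x, t) : skeleton & fst (x, t) ~: nodes & snd (x, t) : {a..<b}"
  by eventually_elim (use `t : {a..<b}` in auto)
next
 have "{z::(real^'d) \<times> real. fst z : skeleton & fst z ~: nodes & snd z : {a..<b}} = (skeleton - nodes) \<times> {a..<b}" by auto
 moreover have "(skeleton - nodes) \<times> {a..<b} : sets borel"
  using nodes_closed unfolding borel_prod[symmetric] by (intro pair_measureI) auto
 ultimately show "{z::(real^'d) \<times> real. fst z : skeleton & fst z ~: nodes & snd z : {a..<b}} : sets borel" by simp
qed

lemma AE_face_facing:
 "AE z in face_measure. snd z : {a..<b} & fst z ~: nodes &
   (ALL K:\<C>. fst z : frontier K --> (EX K'. facing K K' (fst z)))"
 using AE_face_point
proof eventually_elim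
 case (elim z)
 hence "fst z : Om" unfolding skeleton_def using inner_cells(3) by blast
 thus ?case using elim facing_exists by blast
qed

lemma indicator_frontier_measurable [measurable]:
 "(%z::(real^'d) \<times> real. side K z :: real) : borel_measurable borel"
proof -
 have "(%x. indicator (frontier K) x :: real) : borel_measurable borel" by simp
 moreover have "(fst :: (real^'d) \<times> real => real^'d) : measurable borel borel"
  unfolding borel_prod[symmetric] by (rule measurable_fst)
 ultimately show ?thesis by (rule measurable_compose[rotated])
qed

lemma integrable_face:
 assumes g: "g : borel_measurable borel" and B: "AE z in face_measure. fst z : frontier K --> \<bar>g z\<bar> <= B"
 shows "integrable face_measure (%z. side K z * g z :: real)"
proof (rule finite_measure.integrable_const_bound[OF finite_face_measure, where B="max B 0"])
 show "AE z in face_measure. norm (side K z * g z) <= max B 0"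
  using B by eventually_elim (auto split: split_indicator)
 note [measurable] = g
 show "(%z. side K z * g z) : borel_measurable face_measure" by measurable
qed

text \<open>The traces in the scheme are limits without evident joint measurability in space and
  time. Agreement with a Borel function almost everywhere on each time slice lets the iterated
  integral be written with \<open>face_measure\<close>.\<close>

lemma face_integral_eq:
 assumes K: "K : inner_cells" and g'[measurable]: "g' : borel_measurable borel"
  and int: "integrable face_measure (%z. side K z * g' z :: real)"
  and eq: "!!t. t : {a..<b} ==> AE x in surface_measure. x : frontier K --> g (x, t) = g' (x, t)"
 shows "(LBINT t:{a..<b}. (LINT x:frontier K|surface_measure. g (x, t)))
   = (LINT z|face_measure. side K z * g' z)"
proof -
 have sub: "frontier K <= skeleton" using K by (auto simp: skeleton_def)
 have m: "(%x. indicator (frontier K) x * g' (x, t)) : borel_measurable borel" for t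
 proof -
  have "(%x. (x, t)) : measurable borel (borel :: ((real^'d) \<times> real) measure)"
   unfolding borel_prod[symmetric] by measurable
  note [measurable] = measurable_compose[OF this g']
  show ?thesis by measurable
 qed
 have inner: "(LINT x:frontier K|surface_measure. g (x, t)) = (LINT x|surf_on skeleton. indicator (frontier K) x * g' (x, t))"
  if t: "t : {a..<b}" for t
 proof -
  have "(LINT x:frontier K|surface_measure. g (x, t)) = (LINT x:skeleton|surface_measure. indicator (frontier K) x * g (x, t))"
   unfolding set_lebesgue_integral_def using sub
   by (intro Bochner_Integration.integral_cong refl) (auto split: split_indicator)
  also have "... = (LINT x|surf_on skeleton. indicator (frontier K) x * g' (x, t))"
  proof (rule surface_integral_eq[OF skeleton_borel m])
   show "AE x in surface_measure. x : skeleton --> indicator (frontier K) x * g (x, t) = indicator (frontier K) x * g' (x, t)"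
    using eq[OF t] by eventually_elim (auto split: split_indicator)
  qed
  finally show ?thesis .
 qed
 define h where "h = (%(t, x). indicator (frontier K) x * g' (x, t))"
 have hm: "h : borel_measurable (slab_measure \<Otimes>\<^sub>M surf_on skeleton)" "integrable (slab_measure \<Otimes>\<^sub>M surf_on skeleton) h"
  "(LINT z|face_measure. side K z * g' z) = integral\<^sup>L (slab_measure \<Otimes>\<^sub>M surf_on skeleton) h"
  using measurable_compose[OF swap_measurable, of "%z. side K z * g' z" borel] int
   integrable_distr[OF swap_measurable, of "%z. side K z * g' z"]
  by (auto simp: h_def case_prod_beta' face_measure_def integral_distr swap_measurable)
 have "(LINT z|face_measure. side K z * g' z) = (LINT t|slab_measure. LINT x|surf_on skeleton. h (t, x))"
  unfolding hm(3) using face.integral_fst'[OF hm(2)] by simp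
 also have "... = (LINT t|lborel. indicator {a..<b} t *R (LINT x|surf_on skeleton. h (t, x)))"
  using surf.borel_measurable_lebesgue_integral[of "%t x. h (t, x)" slab_measure] hm(1)
  by (subst integral_density[symmetric]) (auto simp: ennreal_indicator)
 also have "... = (LBINT t:{a..<b}. (LINT x:frontier K|surface_measure. g (x, t)))"
  unfolding set_lebesgue_integral_def using inner
  by (intro Bochner_Integration.integral_cong refl) (auto simp: set_lebesgue_integral_def h_def split: split_indicator)
 finally show ?thesis by simp
qed

lemma facing_sum:
 assumes "facing K K' x"
 shows "(SUM L:inner_cells. indicator (frontier L) x * G L)
  = (if K : inner_cells then G K else 0) + (if K' : inner_cells then G K' else 0 :: real)"
proof -
 have "(SUM L:inner_cells. indicator (frontier L) x * G L) = (SUM L:inner_cells. (if L = K then G K else 0) + (if L = K' then G K' else 0))"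
  using assms inner_cells(1) by (intro sum.cong) (auto simp: facing_def frontier_def split: split_indicator)
 thus ?thesis using inner_cells(4) by (simp add: sum.distrib)
qed

lemma pair_integral:
 assumes int: "!!K. K : inner_cells ==> integrable face_measure (%z. side K z * G K z :: real)"
 shows "(SUM K:inner_cells. LINT z|face_measure. side K z * G K z)
   = (LINT z|face_measure. (SUM K:inner_cells. side K z * G K z))"
 using int by (subst Bochner_Integration.integral_sum) auto

text \<open>At almost every point of the skeleton the sum over cells has at most the two terms of a
  facing pair; the second term is absent when the opposite cell is not an inner one.\<close>

lemma pair_integral_nonneg:
 assumes int: "!!K. K : inner_cells ==> integrable face_measure (%z. side K z * G K z :: real)"
  and nn: "AE z in face_measure. ALL K K'. facing K K' (fst z) --> K : inner_cells -->
   0 <= G K z + (if K' : inner_cells then G K' z else 0)"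
 shows "0 <= (SUM K:inner_cells. LINT z|face_measure. side K z * G K z)"
proof -
 have "0 <= (LINT z|face_measure. (SUM K:inner_cells. side K z * G K z))"
 proof (rule integral_nonneg_AE)
 show "AE z in face_measure. 0 <= (SUM K:inner_cells. side K z * G K z)"
  using AE_face_point nn
 proof eventually_elim
  case (elim z)
  then obtain K where K: "K : inner_cells" "fst z : frontier K" unfolding skeleton_def by blast
  then obtain K' where "facing K K' (fst z)" using elim(1) facing_exists inner_cells by blast
  thus ?case using elim(2) K(1) by (simp add: facing_sum)
 qed
 qed
 thus ?thesis by (simp only: pair_integral[OF int])
qed

lemma normal_borel [measurable]: "normal K : borel_measurable borel"
 unfolding normal_def across_def by measurable

lemma AE_normal: "K : \<C> ==> AE z in face_measure. fst z : frontier K --> norm (normal K (fst z)) = 1"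
 using AE_face_facing
proof eventually_elim
 case (elim z)
 show ?case
 proof
  assume "fst z : frontier K"
  then obtain K' where f: "facing K K' (fst z)" using elim by blast
  show "norm (normal K (fst z)) = 1" using facing_normal[OF f] normal_facing[OF f] by metis
 qed
qed

lemma surface_facing:
 "K : inner_cells ==> AE x in surface_measure. x : frontier K --> (EX K'. facing K K' x)"
 using AE_not_in[OF nodes_null] by eventually_elim (use facing_exists inner_cells in blast)

text \<open>The space-time divergence theorem: the fundamental theorem in time, and
  \<open>divergence\<close> on each time slice with the normal replaced by its Borel
  version.\<close>

lemma cell_divergence:
 assumes cell_in: "K : inner_cells" and A: "has_C1 A A'" and B: "!!k. has_C1 (B k) (B' k)"
 shows "(LBINT z:K \<times> {a..<b}. A' z (0, 1) + (SUM k:UNIV. B' k z (axis k 1, 0)))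
  = (LBINT x:K. A (x, b) - A (x, a))
   + (LINT z|face_measure. side K z * (SUM k:UNIV. normal K (fst z) $ k * B k z))" (is "?lhs = _")
  and "integrable face_measure (%z. side K z * (SUM k:UNIV. normal K (fst z) $ k * B k z))"
proof -
 interpret polytope_cell K "(%K'. sep K K') ` (\<C> - {K})" by (rule inner_polytope[OF cell_in])
 have Kb: "bounded K" "K : sets borel" using inner_cells(1)[OF cell_in] cell cell_bounded by auto
 have I: "bounded {a..<b}" "{a..<b} : sets borel" by auto
 have Bm[measurable]: "B k : borel_measurable borel" for k
  using has_C1D(4)[OF B] by (intro borel_measurable_continuous_onI)
 have nm[measurable]: "(%z::(real^'d) \<times> real. normal K (fst z) $ k) : borel_measurable borel" for k
 proof -
  have "(%z::(real^'d) \<times> real. normal K (fst z)) : borel_measurable borel" unfolding borel_prod[symmetric] by measurable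
  hence "(%z::(real^'d) \<times> real. normal K (fst z) <.> axis k 1) : borel_measurable borel" by measurable
  thus ?thesis by (simp add: inner_axis)
 qed
 have intk: "integrable face_measure (%z. side K z * (normal K (fst z) $ k * B k z))" for k
 proof -
  have "compact (closure K \<times> {a..b})" using Kb by (intro compact_Times) auto
  hence "bounded (B k ` (closure K \<times> {a..b}))"
   by (intro compact_imp_bounded compact_continuous_image has_C1D(4)[OF B])
  then obtain R where R: "!!z. z : closure K \<times> {a..b} ==> \<bar>B k z\<bar> <= R" by (auto simp: bounded_iff)
  have "AE z in face_measure. fst z : frontier K --> \<bar>normal K (fst z) $ k * B k z\<bar> <= R"
   using AE_normal[OF inner_cells(1)[OF cell_in]] AE_face_point
  proof eventually_elim
   case (elim z)
   show ?case
   proof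
    assume f: "fst z : frontier K"
    hence "\<bar>B k z\<bar> <= R" using elim by (intro R) (auto simp: mem_Times_iff frontier_def)
    moreover have "\<bar>normal K (fst z) $ k\<bar> <= 1" using elim f component_le_norm_cart[of "normal K (fst z)" k] by simp
    ultimately show "\<bar>normal K (fst z) $ k * B k z\<bar> <= R"
     using mult_mono[of "\<bar>normal K (fst z) $ k\<bar>" 1 "\<bar>B k z\<bar>" R] by (simp add: abs_mult)
   qed
  qed
  thus ?thesis by (intro integrable_face) measurable
 qed
 show "integrable face_measure (%z. side K z * (SUM k:UNIV. normal K (fst z) $ k * B k z))"
  unfolding sum_distrib_left using intk by (intro Bochner_Integration.integrable_sum) auto
 have cA: "continuous_on UNIV (%z. A' z (0, 1))" and cB: "continuous_on UNIV (%z. B' k z (axis k 1, 0))" for k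
  using has_C1D(2)[OF A] has_C1D(2)[OF B] by auto
 have si: "set_integrable lborel (K \<times> {a..<b}) g" if "continuous_on UNIV g" for g :: "(real^'d) \<times> real => real"
  by (rule set_integrable_continuous[OF that]) (use Kb I in \<open>auto intro: bounded_Times times_borel\<close>)
 have side: "(LBINT z:K \<times> {a..<b}. B' k z (axis k 1, 0)) = (LINT z|face_measure. side K z * (normal K (fst z) $ k * B k z))" for k
 proof -
  have c: "continuous_on UNIV (%x. B' k (x, t) (axis k 1, 0))" for t
   by (rule continuous_on_compose2[OF cB]) (auto intro!: continuous_intros)
  have d: "((%x. B k (x, t)) has_derivative (%h. B' k (x, t) (h, 0))) (at x)" for x t
  proof -
   have "((%x. (x, t)) has_derivative (%h. (h, 0))) (at x)" by (auto intro!: derivative_eq_intros)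
   from has_derivative_compose[OF this has_C1D(1)[OF B]] show ?thesis .
  qed
  have "(LBINT z:K \<times> {a..<b}. B' k z (axis k 1, 0)) = (LBINT t:{a..<b}. LBINT x:K. B' k (x, t) (axis k 1, 0))"
   by (rule set_integral_times(2)[OF cB Kb I])
  also have "... = (LBINT t:{a..<b}. LINT x:frontier K|surface_measure. (unit_normal K x <.> axis k 1) * B k (x, t))"
   using divergence[OF d c] by simp
  also have "... = (LINT z|face_measure. side K z * (normal K (fst z) $ k * B k z))"
  proof (rule face_integral_eq[OF cell_in _ intk, where g="%z. (unit_normal K (fst z) <.> axis k 1) * B k z", unfolded fst_conv])
   fix t assume "t : {a..<b}"
   show "AE x in surface_measure. x : frontier K --> (unit_normal K x <.> axis k 1) * B k (x, t) = normal K x $ k * B k (x, t)"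
    using surface_facing[OF cell_in] by eventually_elim (auto simp: normal_facing inner_axis)
  qed measurable
  finally show ?thesis .
 qed
 have "?lhs = (LBINT z:K \<times> {a..<b}. A' z (0, 1)) + (LBINT z:K \<times> {a..<b}. (SUM k:UNIV. B' k z (axis k 1, 0)))"
  by (intro set_integral_add si cA continuous_intros cB)
 also have "(LBINT z:K \<times> {a..<b}. (SUM k:UNIV. B' k z (axis k 1, 0))) = (SUM k:UNIV. LBINT z:K \<times> {a..<b}. B' k z (axis k 1, 0))"
  using si[OF cB] unfolding set_lebesgue_integral_def set_integrable_def
  by (subst Bochner_Integration.integral_sum[symmetric]) (auto simp: sum_distrib_left)
 also have "(LBINT z:K \<times> {a..<b}. A' z (0, 1)) = (LBINT x:K. A (x, b) - A (x, a))"
  unfolding set_integral_times(1)[OF cA Kb I] using ab by (simp add: set_integral_FTC[OF A])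
 also have "(SUM k:UNIV. LBINT z:K \<times> {a..<b}. B' k z (axis k 1, 0))
  = (SUM k:UNIV. LINT z|face_measure. side K z * (normal K (fst z) $ k * B k z))"
  by (simp only: side)
 also have "(SUM k:UNIV. LINT z|face_measure. side K z * (normal K (fst z) $ k * B k z))
   = (LINT z|face_measure. side K z * (SUM k:UNIV. normal K (fst z) $ k * B k z))"
  unfolding sum_distrib_left using intk by (subst Bochner_Integration.integral_sum) auto
 finally show "?lhs = (LBINT x:K. A (x, b) - A (x, a))
   + (LINT z|face_measure. side K z * (SUM k:UNIV. normal K (fst z) $ k * B k z))" .
qed

text \<open>The outward flux of \<open>x - z\<close> through the frontier is \<open>d |K|\<close>, and its normal component is at least \<open>rho\<close>.\<close>

lemma frontier_mass:
 assumes K: "K : inner_cells" and r: "0 < rho" "ball z rho <= K"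
 shows "rho * (LINT w|face_measure. side K w) <= (b - a) * (real CARD('d) * measure lborel K)"
proof -
 define B where "B k w = fst w $ k - z $ k" for k and w :: "(real^'d) \<times> real"
 have B: "has_C1 (B k) (%_ h. fst h $ k - 0)" for k
  unfolding B_def
  by (intro has_C1_diff has_C1_linear has_C1_const bounded_linear_compose[OF bounded_linear_vec_nth bounded_linear_fst])
 have KC: "K : \<C>" using K by (rule inner_cells)
 have Kb: "bounded K" "K : sets borel" using cell_bounded[OF KC] cell[OF KC] by auto
 have "(LBINT w:K \<times> {a..<b}. (0::real) + (SUM k:UNIV. fst (axis k 1 :: real^'d, 0::real) $ k - 0))
   = (LBINT x:K. (0::real) - 0) + (LINT w|face_measure. side K w * (SUM k:UNIV. normal K (fst w) $ k * B k w))"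
  by (rule cell_divergence(1)[OF K has_C1_const[of "0::real"] B])
 hence "(LBINT w:K \<times> {a..<b}. real CARD('d)) = (LINT w|face_measure. side K w * (SUM k:UNIV. normal K (fst w) $ k * B k w))"
  by simp
 moreover have "(LBINT w:K \<times> {a..<b}. real CARD('d)) = (LBINT x:K. LBINT t:{a..<b}. real CARD('d))"
  by (rule set_integral_times(1)) (use Kb in auto)
 moreover have "(LBINT t:{a..<b}. real CARD('d)) = (b - a) * real CARD('d)" using ab by (subst set_integral_const) auto
 moreover have "(LBINT x:K. (b - a) * real CARD('d)) = (b - a) * (real CARD('d) * measure lborel K)"
  using Kb emeasure_bounded_finite[of K] by (subst set_integral_const) auto
 ultimately have eq: "(b - a) * (real CARD('d) * measure lborel K) = (LINT w|face_measure. side K w * (SUM k:UNIV. normal K (fst w) $ k * B k w))"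
  by simp
 have "rho * (LINT w|face_measure. side K w) = (LINT w|face_measure. side K w * rho)"
  by (simp add: mult.commute)
 also have "... <= (LINT w|face_measure. side K w * (SUM k:UNIV. normal K (fst w) $ k * B k w))"
 proof (rule integral_mono_AE)
  show "integrable face_measure (%w. side K w * rho)" by (rule integrable_face[of _ _ rho]) (use r in auto)
  show "integrable face_measure (%w. side K w * (SUM k:UNIV. normal K (fst w) $ k * B k w))"
   by (rule cell_divergence(2)[OF K has_C1_const[of "0::real"] B])
  show "AE w in face_measure. side K w * rho <= side K w * (SUM k:UNIV. normal K (fst w) $ k * B k w)"
   using AE_face_facing
  proof eventually_elim
   case (elim w)
   have "rho <= (SUM k:UNIV. normal K (fst w) $ k * B k w)" if f: "fst w : frontier K"
   proof -
    obtain K' where f: "facing K K' (fst w)" using elim f KC by blast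
    obtain n where n: "norm n = 1" "K <= {y. n <.> y < n <.> fst w}" "n = normal K (fst w)"
    proof -
     obtain n r where "norm n = 1" "K <= {y. n <.> y < n <.> fst w}" "0 < r" "ball (fst w) r Int {y. n <.> y < n <.> fst w} <= K"
      using f unfolding facing_def by blast
     thus ?thesis using that unit_normal_eq[of n "fst w" _ K r] normal_facing[OF f] by metis
    qed
    have eqs: "(SUM k:UNIV. normal K (fst w) $ k * B k w) = n <.> (fst w - z)"
     by (simp add: n(3) B_def inner_vec_def)
    have nn: "n <.> n = 1" using n(1) by (simp add: norm_eq_1)
    show ?thesis
    proof (rule field_le_epsilon)
     fix e :: real assume e: "0 < e"
     have s: "0 <= max 0 (rho - e)" "max 0 (rho - e) < rho" using e r by auto
     have "z + max 0 (rho - e) *R n : ball z rho" using s n(1) by (simp add: dist_norm)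
     hence "n <.> (z + max 0 (rho - e) *R n) < n <.> fst w" using r n(2) by blast
     thus "rho <= (SUM k:UNIV. normal K (fst w) $ k * B k w) + e"
      unfolding eqs by (simp add: inner_add_right inner_diff_right nn)
    qed
   qed
   thus ?case by (auto split: split_indicator)
  qed
 qed
 finally show ?thesis unfolding eq .
qed

end

context cell_partition
begin

lemma AE_covered: "AE x in lborel. x : Om --> x : \<Union>\<C>"
proof -
 have "open (\<Union>\<C>)" using cell by auto
 hence "Om - \<Union>\<C> : null_sets lborel" by (intro negligible_null_sets[OF uncovered_null]) (use Om(1) in auto)
 from AE_not_in[OF this] show ?thesis by eventually_elim auto
qed

lemma sum_cell_integrals:
 fixes g :: "real^'d => real"
 assumes "set_integrable lborel Om g"
 shows "(SUM K:\<C>. LBINT x:K. g x) = (LBINT x:Om. g x)"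
proof -
 have si: "set_integrable lborel K g" if "K : \<C>" for K
  by (rule set_integrable_subset[OF assms]) (use cell[OF that] in auto)
 have "(LBINT x:\<Union>\<C>. g x) = (LBINT x:(UN K:\<C>. K). g x)" by simp
 also have "... = (SUM K:\<C>. LBINT x:K. g x)"
 proof (rule set_integral_finite_Union[OF fin _ si])
  show "disjoint_family_on (%K. K) \<C>" using disj by (auto simp: disjoint_def disjoint_family_on_def)
  show "K : sets lborel" if "K : \<C>" for K using cell[OF that] by auto
 qed
 finally have "(SUM K:\<C>. LBINT x:K. g x) = (LBINT x:\<Union>\<C>. g x)" by simp
 also have "... = (LBINT x:Om. g x)"
 proof (rule set_integral_cong_set[symmetric])
  have "open (\<Union>\<C>)" using cell by auto
  thus "set_borel_measurable lborel (\<Union>\<C>) g"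
   using set_integrable_subset[OF assms, of "\<Union>\<C>"] cell
   by (auto simp: set_integrable_def set_borel_measurable_def Sup_le_iff dest: borel_measurable_integrable)
  show "set_borel_measurable lborel Om g" using assms by (auto simp: set_integrable_def set_borel_measurable_def)
  show "AE x in lborel. x : \<Union>\<C> <-> x : Om"
   using AE_covered by eventually_elim (use cell in auto)
 qed
 finally show ?thesis .
qed

lemma sum_cell_measure: "(SUM K:\<C>. measure lborel K) = measure lborel Om"
proof -
 have f: "S : sets borel ==> bounded S ==> (LBINT x:S. (1::real)) = measure lborel S" for S :: "(real^'d) set"
  using emeasure_bounded_finite[of S] by (subst set_integral_const) auto
 have "set_integrable lborel Om (%x. 1::real)"
  by (rule set_integrable_continuous) (use Om in auto)
 from sum_cell_integrals[OF this] show ?thesis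
  using Om cell cell_bounded by (simp add: f)
qed

end

section \<open>Geometry of a shape regular mesh\<close>

locale mesh_space =
 fixes Om :: "(real^'d::finite) set" and Tend sg :: real and M :: "'d st_mesh"
 assumes dim: "CARD('d) : {1, 2, 3}" and dom: "open Om" "bounded Om" "Om ~= {}" "0 < Tend"
  and mesh: "st_mesh Om Tend M" and sg: "0 < sg" and reg: "shape_regular sg M"
begin

abbreviation "h == mesh_size M"
abbreviation "steps == {0<..<slabs M}"
abbreviation "vol n K == measure lborel K * (tm M (Suc n) - tm M n)"
abbreviation "Q n K == K \<times> {tm M n..<tm M (Suc n)}"
abbreviation "icells n == cell_partition.inner_cells Om (cells M n)"
abbreviation "faces n == slab_cells.face_measure Om (cells M n) (tm M n) (tm M (Suc n))"

lemma part: "n < slabs M ==> slab_cells Om (cells M n) (tm M n) (tm M (Suc n))"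
 using mesh dim dom by (intro slab_cells.intro slab_cells_axioms.intro cell_partition.intro) (auto simp: st_mesh_def)

lemma part': "n < slabs M ==> cell_partition Om (cells M n)"
 using part by (simp add: slab_cells_def)

lemma tm_ends: "tm M 0 = 0" "tm M (slabs M) = Tend" "0 < slabs M"
 using mesh by (auto simp: st_mesh_def)

lemma tm_less: "n < slabs M ==> tm M n < tm M (Suc n)"
 using mesh by (auto simp: st_mesh_def)

lemma tm_mono: "m <= n ==> n <= slabs M ==> tm M m <= tm M n"
proof (induction rule: dec_induct)
 case (step n)
 thus ?case using tm_less[of n] by simp
qed simp

lemma tm_range: "n <= slabs M ==> 0 <= tm M n & tm M n <= Tend"
 using tm_mono[of 0 n] tm_mono[of n "slabs M"] tm_ends by simp

lemma cellD: "n < slabs M ==> K : cells M n ==> open K & convex K & K ~= {} & K <= Om & bounded K"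
 using cell_partition.cell[OF part'] cell_partition.cell_bounded[OF part'] by blast

lemma cells_finite: "n < slabs M ==> finite (cells M n)"
 using cell_partition.fin[OF part'] .

lemma cells_ne: "n < slabs M ==> cells M n ~= {}"
 using cell_partition.cover[OF part', of n] dom by auto

lemma cell_dist:
 assumes n: "n < slabs M" and K: "K : cells M n"
  and z: "z : closure K \<times> {tm M n..tm M (Suc n)}" "z' : closure K \<times> {tm M n..tm M (Suc n)}"
 shows "dist z z' <= h"
proof -
 have fin: "finite {diameter (K \<times> slab M n) | n K. n < slabs M & K : cells M n}"
 proof (rule finite_subset)
  show "{diameter (K \<times> slab M n) | n K. n < slabs M & K : cells M n}
   <= (\<Union>n<slabs M. (%K. diameter (K \<times> slab M n)) ` cells M n)" by auto
  show "finite (\<Union>n<slabs M. (%K. diameter (K \<times> slab M n)) ` cells M n)"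
   using cells_finite by auto
 qed
 have b: "bounded (K \<times> slab M n)" using cellD[OF n K] by (auto simp: slab_def intro: bounded_Times)
 have "closure (K \<times> slab M n) = closure K \<times> {tm M n..tm M (Suc n)}"
  using tm_less[OF n] by (simp add: closure_Times slab_def)
 hence "dist z z' <= diameter (closure (K \<times> slab M n))"
  using z b by (intro diameter_bounded_bound bounded_closure) auto
 also have "... = diameter (K \<times> slab M n)" using b by (rule diameter_closure)
 also have "... <= h" unfolding mesh_size_def
  using n K by (intro cSup_upper bdd_above_finite[OF fin]) auto
 finally show ?thesis .
qed

lemma slab_le: "n < slabs M ==> tm M (Suc n) - tm M n <= h"
proof -
 assume n: "n < slabs M"
 obtain K x where K: "K : cells M n" "x : K" using cells_ne[OF n] cellD[OF n] by blast
 have "dist (x, tm M (Suc n)) (x, tm M n) <= h"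
  using tm_less[OF n] K closure_subset[of K] by (intro cell_dist[OF n K(1)]) auto
 thus ?thesis by (simp add: dist_Pair_Pair dist_real_def)
qed

lemma h_pos: "0 < h" using slab_le[OF tm_ends(3)] tm_less[OF tm_ends(3)] by simp

text \<open>A radius of balls inside every space-time cell. Shape regularity bounds the supremum of
  the diameters \<open>2 * r\<close> below by \<open>h / sg\<close>; one factor 2 passes from
  diameter to radius, the other stays strictly below the supremum, so that an actual ball is
  obtained.\<close>

definition rho :: real where "rho = h / (4 * sg)"

lemma rho_pos: "0 < rho" using h_pos sg by (simp add: rho_def)

lemma inscribed_ball:
 assumes n: "n < slabs M" and K: "K : cells M n"
 shows "EX z. ball z rho <= Q n K"
proof -
 define S where "S = {2 * r | r z. 0 <= r & ball z r <= K \<times> slab M n}"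
 have "h <= sg * Sup S" using reg n K by (auto simp: shape_regular_def inner_diameter_def S_def)
 hence "h / (2 * sg) < Sup S" using h_pos sg by (simp add: field_simps)
 moreover have "S ~= {}" unfolding S_def by (auto intro!: exI[of _ "0::real"])
 ultimately obtain s where "s : S" "h / (2 * sg) < s" using less_cSupD by blast
 then obtain r z where r: "s = 2 * r" "ball z r <= K \<times> slab M n" by (auto simp: S_def)
 have "rho <= r" using `h / (2 * sg) < s` r(1) sg by (simp add: rho_def field_simps)
 hence "ball z rho <= ball z r" by (rule subset_ball)
 hence "ball z rho <= Q n K" using r(2) by (auto simp: slab_def)
 thus ?thesis by blast
qed

lemma inscribed_space:
 assumes n: "n < slabs M" and K: "K : cells M n"
 shows "EX z. ball z rho <= K" "2 * rho <= tm M (Suc n) - tm M n"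
  "unit_ball_vol (real (Suc CARD('d))) * rho ^ Suc CARD('d) <= vol n K"
proof -
 obtain z s where z: "ball (z, s) rho <= Q n K" using inscribed_ball[OF n K] by (metis surj_pair)
 have "ball z rho <= K"
 proof
  fix x assume "x : ball z rho"
  hence "(x, s) : ball (z, s) rho" by (simp add: dist_Pair_Pair)
  thus "x : K" using z by auto
 qed
 thus "EX z. ball z rho <= K" by blast
 show "2 * rho <= tm M (Suc n) - tm M n"
 proof (rule field_le_epsilon)
  fix e :: real assume e: "0 < e"
  define r where "r = max 0 (rho - e / 2)"
  have r: "0 <= r" "r < rho" "rho - e / 2 <= r" using e rho_pos by (auto simp: r_def)
  have "(z, s + r) : ball (z, s) rho" "(z, s - r) : ball (z, s) rho" using r by (auto simp: dist_Pair_Pair dist_real_def)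
  hence "s + r < tm M (Suc n)" "tm M n <= s - r" using z by auto
  thus "2 * rho <= tm M (Suc n) - tm M n + e" using r by simp
 qed
 have Kb: "open K" "bounded K" using cellD[OF n K] by auto
 have "measure lborel (ball (z, s) rho) <= measure lborel (Q n K)"
  using z Kb emeasure_bounded_finite[OF bounded_Times[OF Kb(2) bounded_Ico], of "tm M n" "tm M (Suc n)"]
  by (intro measure_mono_fmeasurable) (auto intro!: times_borel bounded_Times simp: fmeasurable_def)
 also have "measure lborel (Q n K) = vol n K"
 proof -
  have "emeasure lborel (Q n K) = emeasure lborel K * emeasure lborel {tm M n..<tm M (Suc n)}"
   using Kb unfolding lborel_prod[symmetric] by (intro lborel.emeasure_pair_measure_Times) auto
  thus ?thesis using tm_less[OF n] by (simp add: measure_def enn2real_mult)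
 qed
 finally show "unit_ball_vol (real (Suc CARD('d))) * rho ^ Suc CARD('d) <= vol n K"
  using rho_pos by (simp add: content_ball)
qed

lemma sum_slabs: "(\<Sum>n<slabs M. tm M (Suc n) - tm M n) = Tend"
 using tm_ends by (simp add: sum_lessThan_telescope)

text \<open>There are O(1/h) slabs and, by the following lemmas, \<open>O(h^-(d+1))\<close> cells
  and a total lateral area of O(1/h). These are the powers of \<open>h\<close> that the error
  estimates have to compensate.\<close>

lemma slab_count: "real (slabs M) * (2 * rho) <= Tend"
proof -
 have "real (slabs M) * (2 * rho) = (\<Sum>n<slabs M. 2 * rho)" by simp
 also have "... <= (\<Sum>n<slabs M. tm M (Suc n) - tm M n)"
  using cells_ne inscribed_space(2) by (intro sum_mono) blast
 finally show ?thesis by (simp add: sum_slabs)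
qed

lemma sum_cell_volume: "(\<Sum>n<slabs M. SUM K:cells M n. vol n K) = measure lborel Om * Tend"
 using cell_partition.sum_cell_measure[OF part'] sum_slabs
 by (simp add: sum_distrib_right[symmetric] sum_distrib_left[symmetric])

lemma cell_count:
 "(\<Sum>n<slabs M. real (card (cells M n))) * (unit_ball_vol (real (Suc CARD('d))) * rho ^ Suc CARD('d)) <= measure lborel Om * Tend"
proof -
 have "(\<Sum>n<slabs M. real (card (cells M n))) * (unit_ball_vol (real (Suc CARD('d))) * rho ^ Suc CARD('d))
  = (\<Sum>n<slabs M. SUM K:cells M n. unit_ball_vol (real (Suc CARD('d))) * rho ^ Suc CARD('d))"
  by (simp add: sum_distrib_right)
 also have "... <= (\<Sum>n<slabs M. SUM K:cells M n. vol n K)"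
  by (intro sum_mono inscribed_space(3)) auto
 finally show ?thesis by (simp only: sum_cell_volume)
qed

lemma face_count:
 "rho * (\<Sum>n<slabs M. SUM K:icells n. LINT z|faces n. side K z) <= real CARD('d) * (measure lborel Om * Tend)"
proof -
 have "rho * (\<Sum>n<slabs M. SUM K:icells n. LINT z|faces n. side K z)
   = (\<Sum>n<slabs M. SUM K:icells n. rho * (LINT z|faces n. side K z))"
  by (simp add: sum_distrib_left)
 also have "... <= (\<Sum>n<slabs M. SUM K:cells M n. (tm M (Suc n) - tm M n) * (real CARD('d) * measure lborel K))"
 proof (intro sum_mono)
  fix n assume n: "n : {..<slabs M}"
  interpret slab_cells Om "cells M n" "tm M n" "tm M (Suc n)" using part n by simp
  have "(SUM K:inner_cells. rho * (LINT z|face_measure. side K z))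
   <= (SUM K:inner_cells. (tm M (Suc n) - tm M n) * (real CARD('d) * measure lborel K))"
  proof (rule sum_mono)
   fix K assume K: "K : inner_cells"
   obtain z where "ball z rho <= K" using inscribed_space(1)[of n K] n inner_cells(1)[OF K] by auto
   thus "rho * (LINT z|face_measure. side K z) <= (tm M (Suc n) - tm M n) * (real CARD('d) * measure lborel K)"
    by (rule frontier_mass[OF K rho_pos])
  qed
  also have "... <= (SUM K:cells M n. (tm M (Suc n) - tm M n) * (real CARD('d) * measure lborel K))"
   using fin inner_cells ab by (intro sum_mono2) auto
  finally show "(SUM K:inner_cells. rho * (LINT z|face_measure. side K z))
   <= (SUM K:cells M n. (tm M (Suc n) - tm M n) * (real CARD('d) * measure lborel K))" .
 qed
 also have "... = real CARD('d) * (\<Sum>n<slabs M. SUM K:cells M n. vol n K)"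
  by (simp add: sum_distrib_left mult_ac)
 finally show ?thesis by (simp only: sum_cell_volume)
qed

end

section \<open>Integrals, derivatives and traces in the scheme\<close>

lemma set_integral_lebesgue_on:
 fixes g g' :: "'a::euclidean_space => 'b::{banach, second_countable_topology}"
 assumes S: "S : sets borel" and g': "g' : borel_measurable borel"
  and eq: "AE z in lborel. z : S --> g z = g' z"
 shows "(LINT z|lebesgue_on S. g z) = (LBINT z:S. g' z)"
proof -
 have m: "(%z. indicator S z *R g' z) : borel_measurable lborel" using S g' by measurable
 have m': "(%z. indicator S z *R g' z) : borel_measurable lebesgue" by (rule measurable_completion[OF m])
 have ae: "AE z in lebesgue. indicator S z *R g z = indicator S z *R g' z"
  using AE_completion[OF eq] by eventually_elim (auto split: split_indicator)
 have "(LINT z|lebesgue_on S. g z) = (LINT z|lebesgue. indicator S z *R g z)"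
  using S by (subst integral_restrict_space) auto
 also have "... = (LINT z|lebesgue. indicator S z *R g' z)"
  by (rule integral_cong_AE[OF completion.borel_measurable_AE_eq[OF m' ae] m' ae])
 also have "... = (LBINT z:S. g' z)"
  unfolding set_lebesgue_integral_def by (rule integral_completion[OF m])
 finally show ?thesis .
qed

text \<open>Agreement is asked on the open time interval only: at the first instant of a slab the
  time derivative also sees the previous slab.\<close>

lemma cell_int_eq:
 fixes g g' :: "(real^'d::finite) \<times> real => 'b::{banach, second_countable_topology}"
 assumes K: "K : sets borel" and g': "g' : borel_measurable borel"
  and eq: "!!z. z : K \<times> {tm M n<..<tm M (Suc n)} ==> g z = g' z"
 shows "cell_int M n K g = (LBINT z:K \<times> {tm M n..<tm M (Suc n)}. g' z)"
 unfolding cell_int_def slab_def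
proof (rule set_integral_lebesgue_on[OF _ g'])
 show "K \<times> {tm M n..<tm M (Suc n)} : sets borel" using K by (intro times_borel) auto
 show "AE z in lborel. z : K \<times> {tm M n..<tm M (Suc n)} --> g z = g' z"
  using AE_snd_neq[of "tm M n"] by eventually_elim (auto intro!: eq)
qed

lemma space_int_eq:
 assumes K: "K : sets borel" and g': "g' : borel_measurable borel"
  and eq: "AE x in lborel. x : K --> g x = g' x"
 shows "space_int K g = (LBINT x:K. g' x)"
 unfolding space_int_def by (rule set_integral_lebesgue_on[OF assms])

lemma dt_dx_eq:
 fixes w g :: "(real^'d::finite) \<times> real => 'b::euclidean_space"
 assumes S: "open S" "z : S" and eq: "!!y. y : S ==> w y = g y" and g: "has_C1 g g'"
 shows "dt w z = g' z (0, 1)" "dx k w z = g' z (axis k 1, 0)"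
proof -
 have d: "(w has_derivative g' z) (at z)"
  by (rule has_derivative_transform_within_open[OF has_C1D(1)[OF g] S]) (simp add: eq)
 have key: "vector_derivative (%s. w (p s)) (at a) = g' z e"
  if p: "(p has_derivative (%h. h *R e)) (at a)" "p a = z" for p e and a :: real
  using has_derivative_compose[OF p(1), of w "g' z"] d linear_cmul[OF has_C1D(3)[OF g], of z _ e]
  by (intro vector_derivative_at) (simp add: has_vector_derivative_def p(2))
 obtain x t where z: "z = (x, t)" by fastforce
 have "((%s. (x, s)) has_derivative (%h. h *R (0, 1))) (at t)"
  "((%s. (x + s *R axis k 1, t)) has_derivative (%h. h *R (axis k 1, 0))) (at 0)"
  by (auto intro!: derivative_eq_intros)
 thus "dt w z = g' z (0, 1)" "dx k w z = g' z (axis k 1, 0)" using key by (simp_all add: dt_def dx_def z)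
qed

lemma Lim_eq_isCont:
 fixes G :: "real => 'b::t2_space"
 assumes "F <= at a" "F ~= bot" "eventually (%e. G e = W e) F" "continuous_on UNIV G"
 shows "Lim F W = G a"
proof (rule tendsto_Lim[OF assms(2) Lim_transform_eventually[OF _ assms(3)]])
 have "isCont G a" using assms(4) by (simp add: continuous_on_eq_continuous_at)
 thus "(G ---> G a) F" unfolding isCont_def by (rule filterlim_mono[OF _ order_refl assms(1)])
qed

lemma slice_continuous: "continuous_on UNIV g ==> continuous_on UNIV (%t. g (x, t))"
 by (rule continuous_on_compose2) (auto intro!: continuous_intros)

lemma t_plus_eq:
 assumes "a < b" "!!t. t : {a<..<b} ==> w (x, t) = g (x, t)" "continuous_on UNIV g"
 shows "t_plus w a x = g (x, a)"
 unfolding t_plus_def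
proof (rule Lim_eq_isCont[OF _ _ _ slice_continuous[OF assms(3)]])
 show "eventually (%t. g (x, t) = w (x, t)) (at_right a)"
  using eventually_at_right_real[OF assms(1)] by eventually_elim (use assms(2) in auto)
qed (auto simp: at_le)

lemma t_minus_eq:
 assumes "a < b" "!!t. t : {a<..<b} ==> w (x, t) = g (x, t)" "continuous_on UNIV g"
 shows "t_minus w b x = g (x, b)"
 unfolding t_minus_def
proof (rule Lim_eq_isCont[OF _ _ _ slice_continuous[OF assms(3)]])
 show "eventually (%t. g (x, t) = w (x, t)) (at_left b)"
  using eventually_at_left_real[OF assms(1)] by eventually_elim (use assms(2) in auto)
qed (auto simp: at_le)

context cell_partition
begin

lemma Lim_normal_eq:
 fixes x n :: "'a::real_normed_vector"
 assumes r: "0 < r" "!!e. 0 < e ==> e < r ==> w (x + e *R n, t) = g (x + e *R n, t)" and g: "continuous_on UNIV g"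
 shows "Lim (at_right 0) (%e. w (x + e *R n, t)) = g (x, t)"
proof -
 have "continuous_on UNIV (%e. g (x + e *R n, t))" by (intro continuous_on_compose2[OF g] continuous_intros) auto
 moreover have "eventually (%e. g (x + e *R n, t) = w (x + e *R n, t)) (at_right 0)"
  using eventually_at_right_real[OF r(1)] by eventually_elim (use r(2) in auto)
 ultimately show ?thesis using Lim_eq_isCont[of "at_right 0" 0 "%e. g (x + e *R n, t)"] by (simp add: at_le)
qed

lemma K_minus_facing:
 assumes f: "facing K K' x" and w: "!!y. y : K ==> w (y, t) = g (y, t)" and g: "continuous_on UNIV g"
 shows "K_minus K w (x, t) = g (x, t)"
proof -
 obtain r where "0 < r" "!!e. 0 < e ==> e < r ==> x - e *R unit_normal K x : K" using facing_normal[OF f] by metis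
 with Lim_normal_eq[of r w x "- unit_normal K x" t g] w g show ?thesis by (simp add: K_minus_def)
qed

lemma K_plus_facing:
 assumes f: "facing K K' x" and w: "!!y. y : K' ==> w (y, t) = g (y, t)" and g: "continuous_on UNIV g"
 shows "K_plus K w (x, t) = g (x, t)"
proof -
 obtain r where "0 < r" "!!e. 0 < e ==> e < r ==> x + e *R unit_normal K x : K'" using facing_normal[OF f] by metis
 with Lim_normal_eq[of r w x "unit_normal K x" t g] w g show ?thesis by (simp add: K_plus_def)
qed

text \<open>Outside \<open>Om\<close> the normal may be meaningless, but there \<open>w\<close> vanishes in a neighbourhood.\<close>

lemma K_minus_zero:
 fixes w :: "(real^'d) \<times> real => real^'m"
 assumes K: "K : \<C>" and w: "!!y. y : K ==> w (y, t) = 0"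
  and Z: "closed Z" "Z <= Om" "!!y. y ~: Z ==> w (y, t) = 0"
 shows "AE x in surface_measure. x : frontier K --> K_minus K w (x, t) = 0"
 using AE_not_in[OF nodes_null]
proof eventually_elim
 case (elim x)
 show ?case
 proof
  assume x: "x : frontier K"
  show "K_minus K w (x, t) = 0"
  proof (cases "x : Om")
   case True
   then obtain K' where "facing K K' x" using facing_exists[OF K x] elim by blast
   from K_minus_facing[OF this, of w t "%_. 0"] w show ?thesis by simp
  next
   case False
   hence "x ~: Z" using Z(2) by auto
   then obtain r where r: "0 < r" "ball x r <= - Z" using Z(1) open_contains_ball[of "- Z"] by (auto simp: open_Compl)
   have "open ((%e. x - e *R unit_normal K x) -` ball x r)" by (intro continuous_open_vimage continuous_intros) auto
   moreover have "0 : (%e. x - e *R unit_normal K x) -` ball x r" using r(1) by simp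
   ultimately obtain d where d: "0 < d" "ball 0 d <= (%e. x - e *R unit_normal K x) -` ball x r" by (rule openE)
   have "w (x - e *R unit_normal K x, t) = 0" if "0 < e" "e < d" for e
   proof (rule Z(3))
    have "e : ball 0 d" using that by simp
    thus "x - e *R unit_normal K x ~: Z" using d(2) r(2) by blast
   qed
   with Lim_normal_eq[of d w x "- unit_normal K x" t "%_. 0"] d(1) show ?thesis by (simp add: K_minus_def)
  qed
 qed
qed

end

lemma finite_multi_indices: "finite (multi_indices q :: ('a::euclidean_space => nat) set)"
proof (rule finite_subset)
 show "(multi_indices q :: ('a => nat) set) <= {g. (ALL b. b ~: Basis --> g b = 0) & (ALL b:Basis. g b : {..q})}"
 proof
  fix g :: "'a => nat" assume g: "g : multi_indices q"
  have "g b <= q" if "b : Basis" for b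
  proof -
   have "g b <= (SUM b:Basis. g b)" using that by (intro member_le_sum) auto
   also have "... <= q" using g by (simp add: multi_indices_def)
   finally show ?thesis .
  qed
  thus "g : {g. (ALL b. b ~: Basis --> g b = 0) & (ALL b:Basis. g b : {..q})}" using g by (simp add: multi_indices_def)
 qed
 have "finite {g :: 'a => nat. ALL b. (b : Basis --> g b : {..q}) & (b ~: Basis --> g b = 0)}"
  by (rule finite_set_of_finite_funs) auto
 thus "finite {g :: 'a => nat. (ALL b. b ~: Basis --> g b = 0) & (ALL b:Basis. g b : {..q})}"
  by (rule rev_finite_subset) auto
qed

text \<open>On the line through \<open>z0\<close> and \<open>z\<close>, a component of
  \<open>p\<close> minus that of \<open>c\<close> is a polynomial in one variable with infinitely
  many zeros.\<close>

lemma polys_constant: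
 fixes p :: "'a::euclidean_space => 'b::euclidean_space"
 assumes p: "p : polys q" and S: "open S" "z0 : S" "!!z. z : S ==> p z = c"
 shows "p z = c"
proof (rule euclidean_eqI)
 fix i :: 'b assume "i : Basis"
 obtain C where C: "p = (%z. SUM al:multi_indices q. (PROD b:Basis. (z <.> b) ^ al b) *R C al)"
  using p by (auto simp: polys_def)
 define f where "f s = p (z0 + s *R (z - z0)) <.> i - c <.> i" for s
 have lin: "real_polynomial_function (%s::real. (z0 + s *R (z - z0)) <.> b)" for b
 proof -
  have "real_polynomial_function (%s::real. z0 <.> b + s * ((z - z0) <.> b))"
   by (intro real_polynomial_function.intros bounded_linear_ident)
  thus ?thesis by (simp add: inner_add_left)
 qed
 have "real_polynomial_function (%s. (SUM al:multi_indices q. (PROD b:Basis. ((z0 + s *R (z - z0)) <.> b) ^ al b) * (C al <.> i)) - c <.> i)"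
  by (intro real_polynomial_function_diff real_polynomial_function_sum finite_multi_indices real_polynomial_function.intros(2,4)
     real_polynomial_function_prod finite_Basis real_polynomial_function_power lin)
 hence "real_polynomial_function f"
  unfolding f_def C by (simp add: inner_sum_left)
 then obtain a N where a: "f = (%s. SUM j<=N. a j * s ^ j)" by (auto simp: real_polynomial_function_iff_sum)
 have "open ((%s. z0 + s *R (z - z0)) -` S)"
  by (intro continuous_open_vimage S(1) continuous_intros)
 moreover have "0 : (%s. z0 + s *R (z - z0)) -` S" using S(2) by simp
 ultimately obtain e where e: "0 < e" "ball 0 e <= (%s. z0 + s *R (z - z0)) -` S"
  by (rule openE)
 have "{0<..<e} <= {s. (SUM j<=N. a j * s ^ j) = 0}"
 proof
  fix s assume "s : {0<..<e}"
  hence "z0 + s *R (z - z0) : S" using e(2) by (auto simp: subset_iff)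
  hence "f s = 0" using S(3) by (simp add: f_def)
  thus "s : {s. (SUM j<=N. a j * s ^ j) = 0}" by (simp add: a)
 qed
 hence "infinite {s. (SUM j<=N. a j * s ^ j) = 0}"
  using infinite_Ioo[OF e(1)] finite_subset by blast
 hence "ALL j<=N. a j = 0" using polyfun_finite_roots[of a N] by blast
 hence "f 1 = 0" by (simp add: a)
 thus "p z <.> i = c <.> i" by (simp add: f_def)
qed

lemma polys_add_const:
 fixes p :: "'a::euclidean_space => 'b::euclidean_space"
 assumes "p : polys q"
 shows "(%z. p z + a) : polys q"
proof -
 obtain C where C: "!!z. p z = (SUM al:multi_indices q. (PROD b:Basis. (z <.> b) ^ al b) *R C al)"
  using assms by (auto simp: polys_def)
 have z: "(%_. 0) : (multi_indices q :: ('a => nat) set)" by (simp add: multi_indices_def)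
 have "p z + a = (SUM al:multi_indices q. (PROD b:Basis. (z <.> b) ^ al b) *R (C al + (if al = (%_. 0) then a else 0)))" for z
 proof -
  have "(SUM al:multi_indices q. (PROD b:Basis. (z <.> b) ^ al b) *R (if al = (%_. 0) then a else 0))
   = (SUM al:(multi_indices q :: ('a => nat) set). if al = (%_. 0) then a else 0)"
   by (rule sum.cong) auto
  also have "... = a" using z by (simp add: sum.delta[OF finite_multi_indices])
  finally show ?thesis by (simp add: C scaleR_add_right sum.distrib)
 qed
 thus ?thesis by (auto simp: polys_def intro!: exI[of _ "%al. C al + (if al = (%_. 0) then a else 0)"])
qed

lemma polys_const: "(%z. a) : (polys q :: ('a::euclidean_space => 'b::euclidean_space) set)"
proof -
 have "(%z. 0) : (polys q :: ('a => 'b) set)" by (auto simp: polys_def intro!: exI[of _ "%_. 0"])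
 from polys_add_const[OF this, of a] show ?thesis by simp
qed

section \<open>The discrete solution on cells and faces\<close>

text \<open>One set of constants for the ball of radius \<open>R\<close>, which will contain
  \<open>vstar\<close>, the values of the solution, their traces and the cell means. They depend on
  the entropy system and on \<open>R\<close>, not on the mesh.\<close>

locale entropy_bounds = entropy_system f U F
 for f :: "'d::finite => real^'m => real^'m" and U :: "real^'m => real" and F :: "'d => real^'m => real" +
 fixes R c1 L EB :: real
 assumes vstar_in: "vstar : cball 0 R" and c1: "0 < c1" and L: "0 < L"
  and u_v_low: "!!a w. a : cball 0 R ==> c1 * (w <.> w) <= w <.> (u_v U a *v w)"
  and u_v_up: "!!a w. a : cball 0 R ==> norm (u_v U a *v w) <= L * norm w"
  and v_u_low: "!!a w. a : cball 0 R ==> c1 * (w <.> w) <= w <.> (v_u U a *v w)"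
  and v_u_up: "!!a w. a : cball 0 R ==> norm (v_u U a *v w) <= L * norm w"
  and flux_up: "!!k a w. a : cball 0 R ==> norm (flux' k a w) <= L * norm w"
  and EB: "!!a. a : cball 0 R ==> \<bar>u a <.> (a - vstar) - potential0 a\<bar> <= EB"
begin

lemma u_Lipschitz: "a : cball 0 R ==> b : cball 0 R ==> norm (u a - u b) <= L * norm (a - b)"
 by (rule has_C1_Lipschitz[OF has_C1_u convex_cball[of 0 R]]) (use u_v_up in auto)

lemma flux_Lipschitz: "a : cball 0 R ==> b : cball 0 R ==> norm (fl k a - fl k b) <= L * norm (a - b)"
 by (rule has_C1_Lipschitz[OF has_C1_flux convex_cball[of 0 R]]) (use flux_up in auto)

end

lemma (in entropy_system) entropy_bounds_exist:
 assumes "vstar : cball 0 R"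
 shows "EX c1 L EB. entropy_bounds f U F R c1 L EB"
proof -
 obtain c1 L1 where 1: "0 < c1" "0 < L1" "!!a w. a : cball 0 R ==> c1 * (w <.> w) <= w <.> (u_v U a *v w)"
  "!!a w. a : cball 0 R ==> norm (u_v U a *v w) <= L1 * norm w"
  "!!a w. a : cball 0 R ==> c1 * (w <.> w) <= w <.> (v_u U a *v w)"
  using u_v_bounds[of R] by metis
 obtain L2 where 2: "0 < L2" "!!a w. a : cball 0 R ==> norm (hess (u a) w) <= L2 * norm w"
  using hess_bounds[of R] by metis
 have "EX B>=0. ALL a:cball 0 R. ALL w. norm (flux' k a w) <= B * norm w" for k
  by (rule has_C1_bound_compact[OF has_C1_flux compact_cball])
 then obtain B where 3: "!!k. 0 <= B k" "!!k a w. a : cball 0 R ==> norm (flux' k a w) <= B k * norm w" by metis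
 define L where "L = L1 + L2 + (SUM k:UNIV. B k)"
 have "B k <= (SUM k:UNIV. B k)" for k using 3(1) by (intro member_le_sum) auto
 hence Lge: "L1 <= L" "L2 <= L" "B k <= L" for k using 1(2) 2(1) sum_nonneg[of UNIV B] 3(1) by (auto simp: L_def add_increasing)
 have c: "continuous_on (cball 0 R) (%a. u a <.> (a - vstar) - potential0 a)"
  by (intro continuous_intros u_cont has_C1D(4)[OF has_C1_potential0])
 have "bounded ((%a. u a <.> (a - vstar) - potential0 a) ` cball 0 R)"
  by (rule compact_imp_bounded[OF compact_continuous_image[OF c compact_cball]])
 then obtain EB where EB: "!!a. a : cball 0 R ==> \<bar>u a <.> (a - vstar) - potential0 a\<bar> <= EB"
  unfolding bounded_iff real_norm_def by blast
 have "entropy_bounds f U F R c1 L EB"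
 proof unfold_locales
  show "norm (u_v U a *v w) <= L * norm w" if "a : cball 0 R" for a w
   using 1(4)[OF that, of w] mult_right_mono[OF Lge(1), of "norm w"] by simp
  show "norm (v_u U a *v w) <= L * norm w" if "a : cball 0 R" for a w
   using 2(2)[OF that, of w] mult_right_mono[OF Lge(2), of "norm w"] by (simp add: v_u_eq)
  show "norm (flux' k a w) <= L * norm w" if "a : cball 0 R" for k a w
   using 3(2)[OF that, of k w] mult_right_mono[OF Lge(3)[of k], of "norm w"] by simp
  show "0 < L" using Lge(1) 1(2) by simp
 qed (use assms 1 EB in auto)
 thus ?thesis by blast
qed

locale dg_scheme = mesh_space Om Tend sg M + entropy_bounds f U F R c1 L EB
 for Om :: "(real^'d::finite) set" and Tend sg M and f :: "'d => real^'m => real^'m" and U F R c1 L EB +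
 fixes D :: "real^'m => real^'m => real^'d => real^'m^'m" and c C C1 C2 al1 al2 th :: real and q :: nat
  and v0 :: "real^'d => real^'m" and v :: "(real^'d) \<times> real => real^'m" and Z :: "(real^'d) set"
 assumes flux: "admissible_flux f U D"
  and constants: "0 < c" "0 < C" "0 < C1" "0 < C2" "0 < al1" "0 < al2"
  and solution: "sc_dg_solution f U D C1 C2 al1 al2 th q M v0 v"
  and Z: "compact Z" "Z <= Om" "!!x t. x ~: Z ==> t : {0..Tend} ==> v (x, t) = vstar"
  and v_bound: "AE z in lebesgue_on (Om \<times> {0..Tend}). norm (v z) <= R"
  and D_bound: "!!n K t. [|n < slabs M; K : cells M n; t : {tm M n..<tm M (Suc n)}|] ==>
   AE x in surface_measure. x : frontier K -->
    (ALL w. c * (w <.> w) <= w <.> (D_at D K v (x, t) *v w) & w <.> (D_at D K v (x, t) *v w) <= C * (w <.> w))"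
begin

definition poly :: "nat => (real^'d) set => (real^'d) \<times> real => real^'m" where
 "poly n K = (SOME p. p : polys q & (ALL z:Q n K. v z = p z))"

lemma poly:
 assumes "n < slabs M" "K : cells M n"
 shows "poly n K : polys q" "z : Q n K ==> v z = poly n K z"
proof -
 have "EX p. p : polys q & (ALL z:Q n K. v z = p z)"
 proof -
  have "v : Vq q M" using solution by (simp add: sc_dg_solution_def)
  thus ?thesis using assms unfolding Vq_def slab_def by blast
 qed
 from someI_ex[OF this] show "poly n K : polys q" "z : Q n K ==> v z = poly n K z"
  unfolding poly_def by blast+
qed

definition dpoly :: "nat => (real^'d) set => (real^'d) \<times> real => (real^'d) \<times> real => real^'m" where
 "dpoly n K = (SOME p'. has_C1 (poly n K) p')"

lemma poly_C1:
 assumes "n < slabs M" "K : cells M n"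
 shows "has_C1 (poly n K) (dpoly n K)"
 unfolding dpoly_def using has_C1_polys[OF poly(1)[OF assms]] by (metis someI)

lemma poly_cont: "n < slabs M ==> K : cells M n ==> continuous_on S (poly n K)"
 using has_C1D(4)[OF poly_C1] .

lemma slab_sub: "n < slabs M ==> {tm M n..tm M (Suc n)} <= {0..Tend}"
 using tm_range[of n] tm_range[of "Suc n"] by auto

lemma closure_Q: "n < slabs M ==> closure K \<times> {tm M n..tm M (Suc n)} = closure (K \<times> {tm M n<..<tm M (Suc n)})"
 using tm_less[of n] by (simp add: closure_Times)

text \<open>A violation of the bound inside a cell would hold on a nonempty open set, which has
  positive measure, against the bound almost everywhere. Continuity carries the bound to the closed
  cell and hence to all traces.\<close>

lemma poly_bound:
 assumes n: "n < slabs M" "K : cells M n" and z: "z : closure K \<times> {tm M n..tm M (Suc n)}"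
 shows "poly n K z : cball 0 R"
proof -
 have "closure (K \<times> {tm M n<..<tm M (Suc n)}) <= {z. norm (poly n K z) <= R}"
 proof (rule closure_minimal)
  show "closed {z. norm (poly n K z) <= R}"
   by (intro closed_Collect_le continuous_intros poly_cont[OF n])
  show "K \<times> {tm M n<..<tm M (Suc n)} <= {z. norm (poly n K z) <= R}"
  proof (rule ccontr)
   assume "~ ?thesis"
   then obtain z0 where z0: "z0 : K \<times> {tm M n<..<tm M (Suc n)}" "R < norm (poly n K z0)" by force
   define W where "W = (K \<times> {tm M n<..<tm M (Suc n)}) Int {z. R < norm (poly n K z)}"
   have W: "open W" unfolding W_def
    by (intro open_Int open_Times open_Collect_less continuous_intros poly_cont[OF n]) (use cellD[OF n] in auto)
   have "Om \<times> {0..Tend} : sets borel" using dom by (intro times_borel) auto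
   hence "AE z in lebesgue. z : Om \<times> {0..Tend} --> norm (v z) <= R"
    using v_bound by (subst (asm) AE_restrict_space_iff) auto
   hence "AE z in lebesgue. z ~: W"
   proof eventually_elim
    case (elim z)
    show ?case
    proof
     assume "z : W"
     hence "z : Om \<times> {0..Tend}" "v z = poly n K z" "R < norm (poly n K z)"
      using cellD[OF n] slab_sub[OF n(1)] poly(2)[OF n, of z] by (auto simp: W_def)
     thus False using elim by simp
    qed
   qed
   hence "W : null_sets lebesgue"
    using W by (subst (asm) AE_iff_null_sets[symmetric]) auto
   hence "negligible W" by (simp add: negligible_iff_null_sets)
   thus False using open_not_negligible[OF W] z0 by (auto simp: W_def)
  qed
 qed
 thus ?thesis using z unfolding closure_Q[OF n(1)] by auto
qed

text \<open>A cell whose closure is not inside \<open>Om\<close> cannot be a subset of the compact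
  set \<open>Z\<close>. On the open set \<open>K - Z\<close> the polynomial equals
  \<open>vstar\<close>, hence it does so everywhere.\<close>

lemma poly_outer:
 assumes n: "n < slabs M" "K : cells M n" and K: "K ~: icells n"
 shows "poly n K z = vstar"
proof -
 have "~ closure K <= Om" using K n cell_partition.inner_cells_def[OF part'[OF n(1)]] by auto
 hence "~ K <= Z" using closure_minimal[of K Z] compact_imp_closed[OF Z(1)] Z(2) by blast
 then obtain x where x: "x : K" "x ~: Z" by blast
 show ?thesis
 proof (rule polys_constant[OF poly(1)[OF n]])
  show "open ((K - Z) \<times> {tm M n<..<tm M (Suc n)})"
   using cellD[OF n] compact_imp_closed[OF Z(1)] by (intro open_Times open_Diff) auto
  show "(x, (tm M n + tm M (Suc n)) / 2) : (K - Z) \<times> {tm M n<..<tm M (Suc n)}"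
   using x tm_less[OF n(1)] by auto
  show "poly n K z = vstar" if "z : (K - Z) \<times> {tm M n<..<tm M (Suc n)}" for z
  proof -
   have "v z = poly n K z" using that by (intro poly(2)[OF n]) auto
   moreover have "v (fst z, snd z) = vstar" using that slab_sub[OF n(1)] by (intro Z(3)) auto
   ultimately show ?thesis by simp
  qed
 qed
qed

text \<open>\<open>ctrace n s\<close> is the trace at time \<open>s\<close> of the approximate solution on slab \<open>n\<close>.\<close>

definition ctrace :: "nat => real => real^'d => real^'m" where
 "ctrace n s x = (SUM K:cells M n. indicator K x *R poly n K (x, s))"

lemma ctrace_cell:
 assumes n: "n < slabs M" "K : cells M n" and x: "x : K"
 shows "ctrace n s x = poly n K (x, s)"
proof -
 have "ctrace n s x = (SUM L:{K}. indicat_real L x *R poly n L (x, s))"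
  unfolding ctrace_def using n cells_finite[OF n(1)] cell_partition.disj[OF part'[OF n(1)]] x
  by (intro sum.mono_neutral_right) (auto simp: disjoint_def indicator_def)
 thus ?thesis using x by simp
qed

lemma ctrace_bound:
 assumes n: "n < slabs M" and s: "s : {tm M n..tm M (Suc n)}"
 shows "ctrace n s x : cball 0 R"
proof (cases "x : \<Union>(cells M n)")
 case True
 then obtain K where K: "K : cells M n" "x : K" by blast
 thus ?thesis using ctrace_cell[OF n K] poly_bound[OF n K(1), of "(x, s)"] s closure_subset[of K] by auto
next
 case False
 hence "ctrace n s x = 0" by (auto simp: ctrace_def)
 thus ?thesis using vstar_in by (auto intro: order_trans[OF norm_ge_zero])
qed

lemma ctrace_borel: "n < slabs M ==> ctrace n s : borel_measurable borel"
 unfolding ctrace_def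
proof (intro borel_measurable_sum borel_measurable_scaleR)
 fix K assume n: "n < slabs M" and K: "K : cells M n"
 show "indicat_real K : borel_measurable borel" using cellD[OF n K] by simp
 show "(%x. poly n K (x, s)) : borel_measurable borel"
  by (intro borel_measurable_continuous_onI continuous_on_compose2[OF poly_cont[OF n K, of UNIV]] continuous_intros) auto
qed

lemma past_trace_eq:
 assumes n: "n < slabs M" and x: "x : \<Union>(cells M n)"
 shows "past_trace M v0 v (Suc n) x = ctrace n (tm M (Suc n)) x"
proof -
 obtain K where K: "K : cells M n" "x : K" using x by blast
 have "t_minus v (tm M (Suc n)) x = poly n K (x, tm M (Suc n))"
  by (rule t_minus_eq[OF tm_less[OF n] _ poly_cont[OF n K(1)]]) (use poly(2)[OF n K(1)] K(2) in auto)
 thus ?thesis using ctrace_cell[OF n K] by (simp add: past_trace_def)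
qed

definition outer :: "nat => (real^'d) set => (real^'d) \<times> real => real^'m" where
 "outer n K z = cell_partition.across (cells M n) (%L. poly n L z) K (fst z)"

definition nml :: "nat => (real^'d) set => (real^'d) \<times> real => real^'d" where
 "nml n K z = cell_partition.normal (cells M n) K (fst z)"

definition jump :: "nat => (real^'d) set => (real^'d) \<times> real => real^'m" where
 "jump n K z = outer n K z - poly n K z"

abbreviation "diss n K z == D (poly n K z) (outer n K z) (nml n K z)"
abbreviation "nflux n K z == num_flux f U D (poly n K z) (outer n K z) (nml n K z)"
abbreviation "jumps n K == LINT z|faces n. side K z * (norm (jump n K z))^2"
abbreviation "hr == h powr (1 - al1 / 2)"
abbreviation "fn n K z == SUM k:UNIV. (nml n K z $ k) *R fl k (poly n K z)"
abbreviation "opposite n == cell_partition.facing (cells M n)"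

definition D_ok :: "real^'m^'m => bool" where
 "D_ok A <-> (ALL w. c * (w <.> w) <= w <.> (A *v w) & w <.> (A *v w) <= C * (w <.> w))"

lemma matrix_vector_continuous: "continuous_on UNIV (%z. fst z *v snd z :: real^'m)"
 unfolding matrix_vector_mult_def by (intro continuous_intros)

lemma D_ok_closed: "closed {A. D_ok A}"
proof -
 have "continuous_on UNIV (%A::real^'m^'m. A *v w)" for w
  unfolding matrix_vector_mult_def by (intro continuous_intros)
 thus ?thesis
  unfolding D_ok_def by (intro closed_Collect_all closed_Collect_conj closed_Collect_le continuous_intros)
qed

lemma fst_borel: "g : borel_measurable borel ==> (%z::(real^'d) \<times> real. g (fst z)) : borel_measurable borel"
proof -
 have "(fst :: (real^'d) \<times> real => real^'d) : measurable borel borel"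
  unfolding borel_prod[symmetric] by (rule measurable_fst)
 thus "g : borel_measurable borel ==> (%z::(real^'d) \<times> real. g (fst z)) : borel_measurable borel"
  by (rule measurable_compose)
qed

lemma face_borel:
 assumes n: "n < slabs M" "K : cells M n"
 shows "poly n K : borel_measurable borel" "outer n K : borel_measurable borel" "nml n K : borel_measurable borel"
  "diss n K : borel_measurable borel" "nflux n K : borel_measurable borel" "jump n K : borel_measurable borel"
proof -
 interpret slab_cells Om "cells M n" "tm M n" "tm M (Suc n)" using part n by simp
 have p: "poly n L : borel_measurable borel" if "L : cells M n" for L
  using poly_cont[OF n(1) that] by (rule borel_measurable_continuous_onI)
 show 1: "poly n K : borel_measurable borel" by (rule p[OF n(2)])
 show 2: "outer n K : borel_measurable borel"
  unfolding outer_def across_def using p by (intro borel_measurable_sum borel_measurable_scaleR fst_borel) auto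
 show 3: "nml n K : borel_measurable borel" unfolding nml_def by (intro fst_borel normal_borel)
 have t: "(%z. (poly n K z, outer n K z, nml n K z)) : borel_measurable borel"
  using 1 2 3 by (intro borel_measurable_Pair)
 have "(%(a, b, n). D a b n) : borel_measurable borel" using flux by (simp add: admissible_flux_def)
 from measurable_compose[OF t this] show 4: "diss n K : borel_measurable borel" by simp
 show 5: "jump n K : borel_measurable borel" unfolding jump_def using 1 2 by (rule borel_measurable_diff[rotated])
 have "(%z. (diss n K z, jump n K z)) : borel_measurable borel" using 4 5 by (rule borel_measurable_Pair)
 from measurable_compose[OF this borel_measurable_continuous_onI[OF matrix_vector_continuous]]
 have 6: "(%z. diss n K z *v jump n K z) : borel_measurable borel" by simp
 from measurable_compose[OF t borel_measurable_continuous_onI[OF f_star_continuous]]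
 have "(%z. f_star f U (poly n K z) (outer n K z) (nml n K z)) : borel_measurable borel" by simp
 with 6 show "nflux n K : borel_measurable borel"
  unfolding num_flux_def jump_def by (intro borel_measurable_diff borel_measurable_scaleR) auto
qed

lemma facing_values:
 assumes n: "n < slabs M" and f: "opposite n K K' (fst z)" and z: "snd z : {tm M n..<tm M (Suc n)}"
 shows "K : cells M n" "K' : cells M n" "outer n K z = poly n K' z" "outer n K' z = poly n K z" "nml n K' z = - nml n K z"
  "norm (nml n K z) = 1" "poly n K z : cball 0 R" "poly n K' z : cball 0 R"
  "K_minus K v z = poly n K z" "K_plus K v z = poly n K' z" "unit_normal K (fst z) = nml n K z"
proof -
 interpret slab_cells Om "cells M n" "tm M n" "tm M (Suc n)" using part n by simp
 note f' = facing_sym[OF f]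
 show K: "K : cells M n" "K' : cells M n" using f by (auto simp: facing_def)
 show "outer n K z = poly n K' z" "outer n K' z = poly n K z" unfolding outer_def by (rule across_facing[OF f], rule across_facing[OF f'])
 show un: "unit_normal K (fst z) = nml n K z" using normal_facing[OF f] by (simp add: nml_def)
 show "nml n K' z = - nml n K z" "norm (nml n K z) = 1"
  using facing_normal[OF f] un normal_facing[OF f'] by (metis nml_def)+
 have "z : closure K \<times> {tm M n..tm M (Suc n)}" "z : closure K' \<times> {tm M n..tm M (Suc n)}"
  using f z by (auto simp: facing_def frontier_def mem_Times_iff)
 thus "poly n K z : cball 0 R" "poly n K' z : cball 0 R" using poly_bound[OF n] K by blast+
 have "v (y, snd z) = poly n K (y, snd z)" if "y : K" for y using poly(2)[OF n K(1)] z that by auto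
 from K_minus_facing[OF f this poly_cont[OF n K(1)]] show "K_minus K v z = poly n K z" by simp
 have "v (y, snd z) = poly n K' (y, snd z)" if "y : K'" for y using poly(2)[OF n K(2)] z that by auto
 from K_plus_facing[OF f this poly_cont[OF n K(2)]] show "K_plus K v z = poly n K' z" by simp
qed

lemma face_AE:
 assumes n: "n < slabs M" "K : icells n"
 shows "AE z in faces n. fst z : frontier K -->
  snd z : {tm M n..<tm M (Suc n)} & (EX K'. opposite n K K' (fst z)) & D_ok (diss n K z)"
proof -
 interpret slab_cells Om "cells M n" "tm M n" "tm M (Suc n)" using part n by simp
 have KC: "K : cells M n" using n(2) by (rule inner_cells)
 have "AE z in face_measure. fst z : frontier K --> D_ok (diss n K z)"
 proof (rule AE_face)
  fix t assume t: "t : {tm M n..<tm M (Suc n)}"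
  show "AE x in surface_measure. x : skeleton --> fst (x, t) : frontier K --> D_ok (diss n K (x, t))"
   using D_bound[OF n(1) KC t] surface_facing[OF n(2)]
  proof eventually_elim
   case (elim x)
   show ?case
   proof (intro impI)
    assume x: "fst (x, t) : frontier K"
    then obtain K' where "opposite n K K' (fst (x, t))" using elim by auto
    from facing_values(3,9,10,11)[OF n(1) this] t elim x
    show "D_ok (diss n K (x, t))" by (simp add: D_ok_def D_at_def)
   qed
  qed
 next
  have "closed (frontier K \<times> (UNIV :: real set))" by (intro closed_Times) auto
  hence "- (frontier K \<times> (UNIV :: real set)) : sets borel" by (intro borel_comp borel_closed)
  moreover have "{z. fst z : frontier K --> D_ok (diss n K z)} = - (frontier K \<times> UNIV) Un diss n K -` {A. D_ok A}" by auto
  ultimately show "{z. fst z : frontier K --> D_ok (diss n K z)} : sets borel"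
   using measurable_sets[OF face_borel(4)[OF n(1) KC] borel_closed[OF D_ok_closed]] by (simp del: vimage_Collect_eq)
 qed
 with AE_face_facing show ?thesis
  by eventually_elim (use KC in auto)
qed

lemma flux_bounds:
 assumes n: "n < slabs M" and f: "opposite n K K' (fst z)" and z: "snd z : {tm M n..<tm M (Suc n)}" and D: "D_ok (diss n K z)"
 shows "norm (diss n K z *v jump n K z) <= C * norm (jump n K z)"
  "norm (f_star f U (poly n K z) (outer n K z) (nml n K z) - fn n K z)
   <= real CARD('d) * L * norm (jump n K z)"
  "norm (fn n K z - nflux n K z) <= (real CARD('d) * L + C) * norm (jump n K z)"
proof -
 note fv = facing_values[OF n f z]
 have spd: "spd (diss n K z)" using flux fv(6) by (simp add: admissible_flux_def)
 show 1: "norm (diss n K z *v jump n K z) <= C * norm (jump n K z)"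
  by (rule spd_norm_le[OF spd]) (use D constants in \<open>auto simp: D_ok_def\<close>)
 show 2: "norm (f_star f U (poly n K z) (outer n K z) (nml n K z) - fn n K z)
   <= real CARD('d) * L * norm (jump n K z)"
  unfolding jump_def fv(3) by (rule f_star_close[OF flux_Lipschitz _ fv(6-8)]) (use L in auto)
 define a b where "a = f_star f U (poly n K z) (outer n K z) (nml n K z)" and "b = fn n K z"
 have "b - nflux n K z = (1/2) *R (diss n K z *v jump n K z) - (a - b)"
  by (simp add: num_flux_def a_def jump_def)
 hence "norm (b - nflux n K z) <= norm ((1/2) *R (diss n K z *v jump n K z)) + norm (a - b)"
  using norm_triangle_ineq4 by metis
 also have "... <= (1/2) * (C * norm (jump n K z)) + real CARD('d) * L * norm (jump n K z)"
  using 1 2 by (intro add_mono) (auto simp: a_def b_def)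
 also have "... <= (real CARD('d) * L + C) * norm (jump n K z)"
  using constants by (simp add: algebra_simps)
 finally show "norm (fn n K z - nflux n K z) <= (real CARD('d) * L + C) * norm (jump n K z)"
  by (simp add: b_def)
qed

lemma flux_bounded: "EX B. ALL a:cball 0 R. ALL n. norm n = 1 --> norm (SUM k:UNIV. (n $ k) *R fl k a) <= B"
proof -
 have "bounded ((%z. SUM k:UNIV. (snd z $ k) *R fl k (fst z)) ` (cball 0 R \<times> sphere 0 1))"
  by (intro compact_imp_bounded compact_continuous_image compact_Times compact_cball compact_sphere
    continuous_intros continuous_on_compose2[OF has_C1D(4)[OF has_C1_flux, of UNIV]]) auto
 then obtain B where "!!z. z : cball 0 R \<times> sphere 0 1 ==> norm (SUM k:UNIV. (snd z $ k) *R fl k (fst z)) <= B"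
  unfolding bounded_iff by blast
 thus ?thesis by (intro exI[of _ B]) auto
qed

lemma nflux_integrable:
 assumes n: "n < slabs M" "K : icells n" and g: "continuous_on UNIV (g :: (real^'d) \<times> real => real^'m)"
 shows "integrable (faces n) (%z. side K z * (nflux n K z <.> g z))"
proof -
 interpret slab_cells Om "cells M n" "tm M n" "tm M (Suc n)" using part n by simp
 have KC: "K : cells M n" using n(2) by (rule inner_cells)
 obtain B where B: "!!a n. a : cball 0 R ==> norm n = 1 ==> norm (SUM k:UNIV. (n $ k) *R fl k a) <= B"
  using flux_bounded by blast
 have "bounded (g ` (closure K \<times> {tm M n..tm M (Suc n)}))"
  using cellD[OF n(1) KC] by (intro compact_imp_bounded compact_continuous_image continuous_on_subset[OF g] compact_Times) auto
 then obtain G where G: "!!z. z : closure K \<times> {tm M n..tm M (Suc n)} ==> norm (g z) <= G"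
  unfolding bounded_iff by blast
 define A where "A = B + (real CARD('d) * L + C) * (R + R)"
 show ?thesis
 proof (rule integrable_face[where B="A * G"])
  show "(%z. nflux n K z <.> g z) : borel_measurable borel"
   using face_borel(5)[OF n(1) KC] borel_measurable_continuous_onI[OF g] by (rule borel_measurable_inner)
  show "AE z in face_measure. fst z : frontier K --> \<bar>nflux n K z <.> g z\<bar> <= A * G"
   using face_AE[OF n]
  proof eventually_elim
   case (elim z)
   show ?case
   proof
    assume f: "fst z : frontier K"
    then obtain K' where z: "snd z : {tm M n..<tm M (Suc n)}" "facing K K' (fst z)" "D_ok (diss n K z)" using elim by blast
    note fv = facing_values[OF n(1) z(2,1)]
    have "norm (jump n K z) <= norm (outer n K z) + norm (poly n K z)" unfolding jump_def by (rule norm_triangle_ineq4)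
    also have "... <= R + R" using fv(3,7,8) by (intro add_mono) auto
    finally have j: "norm (jump n K z) <= R + R" .
    define b where "b = fn n K z"
    have "norm (nflux n K z) <= norm b + norm (b - nflux n K z)"
     using norm_triangle_ineq4[of b "b - nflux n K z"] by simp
    also have "... <= B + (real CARD('d) * L + C) * norm (jump n K z)"
     using B[OF fv(7,6)] flux_bounds(3)[OF n(1) z(2,1,3)] by (intro add_mono) (auto simp: b_def)
    also have "... <= A" unfolding A_def using j L constants by (intro add_left_mono mult_left_mono) auto
    finally have 1: "norm (nflux n K z) <= A" .
    have "norm (g z) <= G" using f z(1) by (intro G) (auto simp: frontier_def mem_Times_iff)
    hence "norm (nflux n K z) * norm (g z) <= A * G"
     using 1 by (intro mult_mono) (auto intro: order_trans[OF norm_ge_zero])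
    thus "\<bar>nflux n K z <.> g z\<bar> <= A * G" using Cauchy_Schwarz_ineq2[of "nflux n K z" "g z"] by linarith
   qed
  qed
 qed
qed

end

lemma set_integrable_bounded:
 fixes g :: "'a::euclidean_space => real"
 assumes g: "g : borel_measurable borel" and S: "S : sets borel" "bounded S" and B: "!!x. x : S ==> \<bar>g x\<bar> <= B"
 shows "set_integrable lborel S g"
 unfolding set_integrable_def
proof (rule Bochner_Integration.integrable_bound)
 show "integrable lborel (%x. indicator S x *R B)"
  using S emeasure_bounded_finite[OF S(2)] by simp
 show "(%x. indicator S x *R g x) : borel_measurable lborel" using g S by simp
 show "AE x in lborel. norm (indicator S x *R g x) <= norm (indicator S x *R B)"
  using B by (auto intro!: AE_I2 split: split_indicator intro: order_trans[OF _ abs_ge_self])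
qed

section \<open>The scheme on piecewise differentiable test functions\<close>

context dg_scheme
begin

definition vol_term :: "nat => (real^'d) set => ((real^'d) \<times> real => (real^'d) \<times> real => real^'m) => real" where
 "vol_term n K g' = (LBINT z:Q n K. u (poly n K z) <.> g' z (0, 1) + (SUM k:UNIV. fl k (poly n K z) <.> g' z (axis k 1, 0)))"

text \<open>The trace from the past is taken from slab \<open>n - 1\<close>, which is meaningful for
  positive \<open>n\<close>; on slab 0 the test functions vanish.\<close>

definition time_term :: "nat => (real^'d) set => ((real^'d) \<times> real => real^'m) => real" where
 "time_term n K g = (LBINT x:K. u (ctrace n (tm M (Suc n)) x) <.> g (x, tm M (Suc n)) - u (ctrace (n - 1) (tm M n) x) <.> g (x, tm M n))"

definition face_term :: "nat => (real^'d) set => ((real^'d) \<times> real => real^'m) => real" where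
 "face_term n K g = (LINT z|faces n. side K z * (nflux n K z <.> g z))"

lemma vol_continuous:
 assumes n: "n < slabs M" "K : cells M n" and g: "has_C1 (g :: (real^'d) \<times> real => real^'m) g'"
 shows "continuous_on UNIV (%z. u (poly n K z) <.> g' z (0, 1) + (SUM k:UNIV. fl k (poly n K z) <.> g' z (axis k 1, 0)))"
 by (intro continuous_intros has_C1D(2)[OF g] continuous_on_compose2[OF u_cont[of UNIV] poly_cont[OF n]]
   continuous_on_compose2[OF has_C1D(4)[OF has_C1_flux, of UNIV] poly_cont[OF n]]) auto

lemma interior_Q:
 assumes n: "n < slabs M" "K : cells M n"
 shows "open (K \<times> {tm M n<..<tm M (Suc n)})" "z : K \<times> {tm M n<..<tm M (Suc n)} ==> z : Q n K"
 using cellD[OF n] by (auto intro: open_Times)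

lemma vol_eq:
 assumes n: "n < slabs M" "K : cells M n" and w: "!!z. z : Q n K ==> w z = g z" and g: "has_C1 g g'"
 shows "cell_int M n K (%z. u (v z) <.> dt w z + (SUM k:UNIV. fl k (v z) <.> dx k w z)) = vol_term n K g'"
 unfolding vol_term_def
proof (rule cell_int_eq)
 show "K : sets borel" using cellD[OF n] by simp
 show "(%z. u (poly n K z) <.> g' z (0, 1) + (SUM k:UNIV. fl k (poly n K z) <.> g' z (axis k 1, 0))) : borel_measurable borel"
  by (rule borel_measurable_continuous_onI[OF vol_continuous[OF n g]])
 fix z assume z: "z : K \<times> {tm M n<..<tm M (Suc n)}"
 have "w y = g y" if "y : K \<times> {tm M n<..<tm M (Suc n)}" for y using w interior_Q(2)[OF n that] by blast
 from dt_dx_eq[OF interior_Q(1)[OF n] z this g] poly(2)[OF n interior_Q(2)[OF n z]]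
 show "u (v z) <.> dt w z + (SUM k:UNIV. fl k (v z) <.> dx k w z)
   = u (poly n K z) <.> g' z (0, 1) + (SUM k:UNIV. fl k (poly n K z) <.> g' z (axis k 1, 0))" by simp
qed

lemma time_eq:
 assumes n: "0 < n" "n < slabs M" "K : cells M n" and w: "!!z. z : Q n K ==> w z = g z" and g: "continuous_on UNIV g"
 shows "space_int K (%x. u (past_trace M v0 v (Suc n) x) <.> t_minus w (tm M (Suc n)) x - u (past_trace M v0 v n x) <.> t_plus w (tm M n) x)
   = time_term n K g"
 unfolding time_term_def
proof (rule space_int_eq)
 obtain m where m: "n = Suc m" "m < slabs M" using n by (cases n) auto
 show "K : sets borel" using cellD[OF n(2,3)] by simp
 have gx: "(%x. g (x, s)) : borel_measurable borel" for s
  by (intro borel_measurable_continuous_onI continuous_on_compose2[OF g] continuous_intros) auto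
 have ux: "(%x. u (ctrace i s x)) : borel_measurable borel" if "i < slabs M" for i s
  using measurable_compose[OF ctrace_borel[OF that] borel_measurable_continuous_onI[OF u_cont]] .
 show "(%x. u (ctrace n (tm M (Suc n)) x) <.> g (x, tm M (Suc n)) - u (ctrace (n - 1) (tm M n) x) <.> g (x, tm M n)) : borel_measurable borel"
  using n m by (intro borel_measurable_diff borel_measurable_inner gx ux) auto
 show "AE x in lborel. x : K --> u (past_trace M v0 v (Suc n) x) <.> t_minus w (tm M (Suc n)) x - u (past_trace M v0 v n x) <.> t_plus w (tm M n) x
   = u (ctrace n (tm M (Suc n)) x) <.> g (x, tm M (Suc n)) - u (ctrace (n - 1) (tm M n) x) <.> g (x, tm M n)"
  using cell_partition.AE_covered[OF part'[OF m(2)]]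
 proof eventually_elim
  case (elim x)
  show ?case
  proof
   assume x: "x : K"
   hence xm: "x : \<Union>(cells M m)" using elim cellD[OF n(2,3)] by blast
   have "t_minus w (tm M (Suc n)) x = g (x, tm M (Suc n))"
    by (rule t_minus_eq[OF tm_less[OF n(2)] _ g]) (use w x in auto)
   moreover have "t_plus w (tm M n) x = g (x, tm M n)"
    by (rule t_plus_eq[OF tm_less[OF n(2)] _ g]) (use w x in auto)
   moreover have "past_trace M v0 v (Suc n) x = ctrace n (tm M (Suc n)) x"
    by (rule past_trace_eq[OF n(2)]) (use x n in auto)
   moreover have "past_trace M v0 v n x = ctrace (n - 1) (tm M n) x"
    using past_trace_eq[OF m(2) xm] by (simp add: m(1))
   ultimately show "u (past_trace M v0 v (Suc n) x) <.> t_minus w (tm M (Suc n)) x - u (past_trace M v0 v n x) <.> t_plus w (tm M n) x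
    = u (ctrace n (tm M (Suc n)) x) <.> g (x, tm M (Suc n)) - u (ctrace (n - 1) (tm M n) x) <.> g (x, tm M n)" by simp
  qed
 qed
qed

lemma time_zero:
 assumes n: "n < slabs M" "K : cells M n" and w: "!!z. z : Q n K ==> w z = (0 :: real^'m)"
 shows "space_int K (%x. u (past_trace M v0 v (Suc n) x) <.> t_minus w (tm M (Suc n)) x - u (past_trace M v0 v n x) <.> t_plus w (tm M n) x) = 0"
proof -
 have 1: "t_minus w (tm M (Suc n)) x = 0" if "x : K" for x
  using t_minus_eq[OF tm_less[OF n(1)], of w x "%_. 0"] w that by auto
 have 2: "t_plus w (tm M n) x = 0" if "x : K" for x
  using t_plus_eq[OF tm_less[OF n(1)], of w x "%_. 0"] w that by auto
 have "space_int K (%x. u (past_trace M v0 v (Suc n) x) <.> t_minus w (tm M (Suc n)) x - u (past_trace M v0 v n x) <.> t_plus w (tm M n) x)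
  = (LBINT x:K. (0::real))"
  by (rule space_int_eq) (use cellD[OF n] 1 2 in auto)
 thus ?thesis by simp
qed

lemma face_eq:
 assumes n: "n < slabs M" "K : icells n" and w: "!!z. z : Q n K ==> w z = g z" and g: "continuous_on UNIV g"
 shows "face_int M n K (%z. num_flux_at f U D K v z <.> K_minus K w z) = face_term n K g"
proof -
 interpret slab_cells Om "cells M n" "tm M n" "tm M (Suc n)" using part n by simp
 have KC: "K : cells M n" using n(2) by (rule inner_cells)
 show ?thesis unfolding face_int_def slab_def face_term_def
 proof (rule face_integral_eq[OF n(2) _ nflux_integrable[OF n g]])
  show "(%z. nflux n K z <.> g z) : borel_measurable borel"
   using face_borel(5)[OF n(1) KC] borel_measurable_continuous_onI[OF g] by (rule borel_measurable_inner)
  fix t assume t: "t : {tm M n..<tm M (Suc n)}"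
  show "AE x in surface_measure. x : frontier K --> num_flux_at f U D K v (x, t) <.> K_minus K w (x, t) = nflux n K (x, t) <.> g (x, t)"
   using surface_facing[OF n(2)]
  proof eventually_elim
   case (elim x)
   show ?case
   proof
    assume "x : frontier K"
    then obtain K' where f: "facing K K' (fst (x, t))" using elim by auto
    have "K_minus K w (x, t) = g (x, t)"
     by (rule K_minus_facing[OF _ _ g, of K K']) (use f w t in auto)
    thus "num_flux_at f U D K v (x, t) <.> K_minus K w (x, t) = nflux n K (x, t) <.> g (x, t)"
     using facing_values(3,9,10,11)[OF n(1) f] t by (simp add: num_flux_at_def)
   qed
  qed
 qed
qed

text \<open>Serves the first slab and the cells that are not inner. The inner trace of
  \<open>w\<close> vanishes almost everywhere on the frontier, whatever value the flux has
  there.\<close>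

lemma face_zero:
 assumes n: "n < slabs M" "K : cells M n" and w: "!!z. z : Q n K ==> w z = (0 :: real^'m)"
  and S: "closed S" "S <= Om" "!!x t. x ~: S ==> t : {0..<Tend} ==> w (x, t) = 0"
 shows "face_int M n K (%z. num_flux_at f U D K v z <.> K_minus K w z) = 0"
proof -
 interpret slab_cells Om "cells M n" "tm M n" "tm M (Suc n)" using part n by simp
 have "(LINT x:frontier K|surface_measure. num_flux_at f U D K v (x, t) <.> K_minus K w (x, t)) = 0"
  if t: "t : {tm M n..<tm M (Suc n)}" for t
  unfolding set_lebesgue_integral_def
 proof (rule integral_eq_zero_AE)
  have "AE x in surface_measure. x : frontier K --> K_minus K w (x, t) = 0"
   by (rule K_minus_zero[OF n(2) _ S(1,2)]) (use w t S(3) tm_range[of n] tm_range[of "Suc n"] n in auto)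
  thus "AE x in surface_measure. indicator (frontier K) x *R (num_flux_at f U D K v (x, t) <.> K_minus K w (x, t)) = 0"
   by eventually_elim (auto split: split_indicator)
 qed
 hence "face_int M n K (%z. num_flux_at f U D K v z <.> K_minus K w z) = (LBINT t:{tm M n..<tm M (Suc n)}. (0::real))"
  unfolding face_int_def slab_def set_lebesgue_integral_def[of lborel]
  by (intro Bochner_Integration.integral_cong refl) (auto split: split_indicator)
 thus ?thesis by simp
qed

text \<open>For test functions vanishing on the first slab the initial data do not enter.\<close>

lemma B_DG_eval:
 assumes w: "!!n K z. 0 < n ==> n < slabs M ==> K : cells M n ==> z : Q n K ==> w z = g n K z"
  and w0: "!!K z. K : cells M 0 ==> z : Q 0 K ==> w z = 0"
  and C1: "!!n K. n < slabs M ==> K : cells M n ==> has_C1 (g n K) (g' n K)"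
  and outer0: "!!n K z. 0 < n ==> n < slabs M ==> K : cells M n ==> K ~: icells n ==> g n K z = 0"
  and S: "closed S" "S <= Om" "!!x t. x ~: S ==> t : {0..<Tend} ==> w (x, t) = 0"
 shows "B_DG f U D M v0 v w = (SUM n:steps.
   - (SUM K:cells M n. vol_term n K (g' n K)) + (SUM K:cells M n. time_term n K (g n K)) + (SUM K:icells n. face_term n K (g n K)))"
proof -
 have split: "(\<Sum>n<slabs M. a n) = (SUM n:steps. a n)" if "a 0 = 0" for a :: "nat => real"
  by (rule sum.mono_neutral_right) (use that in \<open>auto intro: gr0I\<close>)
 have N: "0 < slabs M" by (rule tm_ends)
 have "(\<Sum>n<slabs M. SUM K:cells M n. cell_int M n K (%z. u (v z) <.> dt w z + (SUM k:UNIV. fl k (v z) <.> dx k w z)))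
   = (SUM n:steps. SUM K:cells M n. vol_term n K (g' n K))"
 proof (subst split)
  have "cell_int M 0 K (%z. u (v z) <.> dt w z + (SUM k:UNIV. fl k (v z) <.> dx k w z)) = 0" if "K : cells M 0" for K
   using vol_eq[OF N that, of w "%_. 0" "%_ _. 0"] w0[OF that] has_C1_const[of "0::real^'m"] by (simp add: vol_term_def)
  thus "(SUM K:cells M 0. cell_int M 0 K (%z. u (v z) <.> dt w z + (SUM k:UNIV. fl k (v z) <.> dx k w z))) = 0" by simp
  show "(SUM n:steps. SUM K:cells M n. cell_int M n K (%z. u (v z) <.> dt w z + (SUM k:UNIV. fl k (v z) <.> dx k w z)))
   = (SUM n:steps. SUM K:cells M n. vol_term n K (g' n K))"
   by (intro sum.cong refl vol_eq[OF _ _ _ C1]) (use w in auto)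
 qed
 moreover have "(\<Sum>n<slabs M. SUM K:cells M n. space_int K (%x. u (past_trace M v0 v (Suc n) x) <.> t_minus w (tm M (Suc n)) x - u (past_trace M v0 v n x) <.> t_plus w (tm M n) x))
   = (SUM n:steps. SUM K:cells M n. time_term n K (g n K))"
 proof (subst split)
  show "(SUM K:cells M 0. space_int K (%x. u (past_trace M v0 v (Suc 0) x) <.> t_minus w (tm M (Suc 0)) x - u (past_trace M v0 v 0 x) <.> t_plus w (tm M 0) x)) = 0"
   using time_zero[OF N _ w0] by (intro sum.neutral) auto
  show "(SUM n:steps. SUM K:cells M n. space_int K (%x. u (past_trace M v0 v (Suc n) x) <.> t_minus w (tm M (Suc n)) x - u (past_trace M v0 v n x) <.> t_plus w (tm M n) x))
   = (SUM n:steps. SUM K:cells M n. time_term n K (g n K))"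
   by (intro sum.cong refl time_eq) (use w has_C1D(4)[OF C1] in auto)
 qed
 moreover have "(\<Sum>n<slabs M. SUM K:cells M n. face_int M n K (%z. num_flux_at f U D K v z <.> K_minus K w z))
   = (SUM n:steps. SUM K:icells n. face_term n K (g n K))"
 proof (subst split)
  show "(SUM K:cells M 0. face_int M 0 K (%z. num_flux_at f U D K v z <.> K_minus K w z)) = 0"
   by (intro sum.neutral ballI face_zero[OF N _ _ S(1,2)]) (use w0 S(3) in auto)
  show "(SUM n:steps. SUM K:cells M n. face_int M n K (%z. num_flux_at f U D K v z <.> K_minus K w z))
   = (SUM n:steps. SUM K:icells n. face_term n K (g n K))"
  proof (rule sum.cong[OF refl])
   fix n assume "n : steps"
   hence n: "0 < n" "n < slabs M" by auto
   note ic = cell_partition.inner_cells(1)[OF part'[OF n(2)]]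
   have "(SUM K:cells M n. face_int M n K (%z. num_flux_at f U D K v z <.> K_minus K w z))
    = (SUM K:icells n. face_int M n K (%z. num_flux_at f U D K v z <.> K_minus K w z))"
   proof (rule sum.mono_neutral_right[OF cells_finite[OF n(2)]])
    show "icells n <= cells M n" using ic by auto
    show "ALL K:cells M n - icells n. face_int M n K (%z. num_flux_at f U D K v z <.> K_minus K w z) = 0"
     by (intro ballI face_zero[OF n(2) _ _ S(1,2)]) (use w[OF n] outer0[OF n] S(3) in auto)
   qed
   also have "... = (SUM K:icells n. face_term n K (g n K))"
    by (intro sum.cong refl face_eq[OF n(2)]) (use w[OF n] ic has_C1D(4)[OF C1] n in auto)
   finally show "(SUM K:cells M n. face_int M n K (%z. num_flux_at f U D K v z <.> K_minus K w z)) = (SUM K:icells n. face_term n K (g n K))" .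
  qed
 qed
 ultimately show ?thesis
  unfolding B_DG_def by (simp add: sum.distrib sum_negf sum_subtractf)
qed

abbreviation "mean_uv n K == u_v_tilde U M n K v"

definition gform :: "nat => (real^'d) set => (real^'d) \<times> real => real" where
 "gform n K z = dpoly n K z (0, 1) <.> (mean_uv n K *v dpoly n K z (0, 1))
   + (SUM k:UNIV. dpoly n K z (axis k 1, 0) <.> (mean_uv n K *v dpoly n K z (axis k 1, 0)))"

lemma gform_continuous: "n < slabs M ==> K : cells M n ==> continuous_on UNIV (gform n K)"
 unfolding gform_def
 by (intro continuous_intros has_C1D(2)[OF poly_C1] bounded_linear.continuous_on[OF matrix_vector_mul_bounded_linear])

lemma dpoly_eq:
 assumes n: "n < slabs M" "K : cells M n" and z: "z : K \<times> {tm M n<..<tm M (Suc n)}"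
 shows "dt v z = dpoly n K z (0, 1)" "dx k v z = dpoly n K z (axis k 1, 0)"
proof -
 have "v y = poly n K y" if "y : K \<times> {tm M n<..<tm M (Suc n)}" for y using poly(2)[OF n] interior_Q(2)[OF n that] by blast
 from dt_dx_eq[OF interior_Q(1)[OF n] z this poly_C1[OF n]]
 show "dt v z = dpoly n K z (0, 1)" "dx k v z = dpoly n K z (axis k 1, 0)" by auto
qed

lemma quad_nonneg: "0 <= w <.> (u_v U a *v w)"
 using u_v_pos[of w a] by (cases "w = 0") (auto simp: less_imp_le)

lemma gform_nonneg: "0 <= gform n K z"
 unfolding gform_def u_v_tilde_def by (intro add_nonneg_nonneg sum_nonneg quad_nonneg)

lemma grad_bar_sq:
 assumes n: "n < slabs M" "K : cells M n"
 shows "(grad_bar U M n K v)^2 = (LBINT z:Q n K. gform n K z)" "0 <= grad_bar U M n K v"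
proof -
 have "cell_int M n K (grad_form (mean_uv n K) v v) = (LBINT z:Q n K. gform n K z)"
  using cellD[OF n] by (intro cell_int_eq borel_measurable_continuous_onI[OF gform_continuous[OF n]])
   (auto simp: grad_form_def gform_def dpoly_eq[OF n])
 moreover have "0 <= (LBINT z:Q n K. gform n K z)"
  unfolding set_lebesgue_integral_def using gform_nonneg by (intro Bochner_Integration.integral_nonneg) (auto split: split_indicator)
 ultimately show "(grad_bar U M n K v)^2 = (LBINT z:Q n K. gform n K z)" "0 <= grad_bar U M n K v"
  by (auto simp: grad_bar_def)
qed

abbreviation "visc n K == sc_viscosity f U D C1 C2 al1 al2 th M v0 n K v"
abbreviation "dissip n K == visc n K * (grad_bar U M n K v)^2"

text \<open>Applied with \<open>a = 1\<close> to the energy test function and with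
  \<open>a = 0\<close> to piecewise constants, whose derivatives vanish.\<close>

lemma B_SC_eval:
 assumes w: "!!n K z. 0 < n ==> n < slabs M ==> K : cells M n ==> z : Q n K ==> w z = g n K z"
  and w0: "!!K z. K : cells M 0 ==> z : Q 0 K ==> w z = 0"
  and C1: "!!n K. n < slabs M ==> K : cells M n ==> has_C1 (g n K) (%z h. a *R dpoly n K z h)"
 shows "B_SC f U D C1 C2 al1 al2 th M v0 v w = a * (SUM n:steps. SUM K:cells M n. dissip n K)"
proof -
 have split: "(\<Sum>n<slabs M. A n) = (SUM n:steps. A n)" if "A 0 = 0" for A :: "nat => real"
  by (rule sum.mono_neutral_right) (use that in \<open>auto intro: gr0I\<close>)
 have N: "0 < slabs M" by (rule tm_ends)
 show ?thesis unfolding B_SC_def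
 proof (subst split)
  show "(SUM K:cells M 0. cell_int M 0 K (%z. visc 0 K * grad_form (mean_uv 0 K) w v z)) = 0"
  proof (intro sum.neutral ballI)
   fix K assume K: "K : cells M 0"
   have "cell_int M 0 K (%z. visc 0 K * grad_form (mean_uv 0 K) w v z) = (LBINT z:Q 0 K. (0::real))"
   proof (rule cell_int_eq)
    show "K : sets borel" using cellD[OF N K] by simp
    fix z assume z: "z : K \<times> {tm M 0<..<tm M (Suc 0)}"
    have "w y = 0" if "y : K \<times> {tm M 0<..<tm M (Suc 0)}" for y using w0[OF K] interior_Q(2)[OF N K that] by blast
    from dt_dx_eq[OF interior_Q(1)[OF N K] z this has_C1_const]
    show "visc 0 K * grad_form (mean_uv 0 K) w v z = 0" by (simp add: grad_form_def)
   qed simp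
   thus "cell_int M 0 K (%z. visc 0 K * grad_form (mean_uv 0 K) w v z) = 0" by simp
  qed
  show "(SUM n:steps. SUM K:cells M n. cell_int M n K (%z. visc n K * grad_form (mean_uv n K) w v z))
   = a * (SUM n:steps. SUM K:cells M n. dissip n K)"
   unfolding sum_distrib_left
  proof (intro sum.cong refl)
   fix n K assume nK: "n : steps" "K : cells M n"
   hence n: "n < slabs M" "K : cells M n" "0 < n" by auto
   have "cell_int M n K (%z. visc n K * grad_form (mean_uv n K) w v z) = (LBINT z:Q n K. visc n K * (a * gform n K z))"
   proof (rule cell_int_eq)
    show "K : sets borel" using cellD[OF n(1,2)] by simp
    show "(%z. visc n K * (a * gform n K z)) : borel_measurable borel"
     using borel_measurable_continuous_onI[OF gform_continuous[OF n(1,2)]] by simp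
    fix z assume z: "z : K \<times> {tm M n<..<tm M (Suc n)}"
    have "w y = g n K y" if "y : K \<times> {tm M n<..<tm M (Suc n)}" for y using w[OF n(3,1,2)] interior_Q(2)[OF n(1,2) that] by blast
    from dt_dx_eq[OF interior_Q(1)[OF n(1,2)] z this C1[OF n(1,2)]]
    show "visc n K * grad_form (mean_uv n K) w v z = visc n K * (a * gform n K z)"
     by (simp add: grad_form_def gform_def dpoly_eq[OF n(1,2) z] distrib_left sum_distrib_left)
   qed
   thus "cell_int M n K (%z. visc n K * grad_form (mean_uv n K) w v z) = a * (dissip n K)"
    by (simp add: grad_bar_sq[OF n(1,2)])
  qed
 qed
qed

section \<open>Entropy dissipation\<close>

definition tjump :: "nat => real^'d => real^'m" where
 "tjump n x = ctrace n (tm M n) x - ctrace (n - 1) (tm M n) x"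

abbreviation "tjumps n == LBINT x:Om. (norm (tjump n x))^2"

text \<open>In terms of the state this is \<open>U (u a) - u a <.> vstar\<close>, which up to the
  constant \<open>U 0\<close> is the entropy relative to the state 0.\<close>

definition entropy_at :: "real^'m => real" where
 "entropy_at a = u a <.> (a - vstar) - potential0 a"

text \<open>The numerical fluxes seen from the two sides are opposite, so together they are tested
  with the jump. Its product with the entropy conservative part cancels the difference of the
  potentials, and half of the form of \<open>D\<close> at the jump remains.\<close>

lemma pair_dissipation:
 assumes n: "n < slabs M" and f: "opposite n K K' (fst z)" and z: "snd z : {tm M n..<tm M (Suc n)}"
  and D: "D_ok (diss n K z)"
 shows "c / 2 * (norm (jump n K z))^2 <=
  (nflux n K z <.> (poly n K z - vstar) - (SUM k:UNIV. nml n K z $ k * (potential k (poly n K z) - potential k vstar)))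
  + (nflux n K' z <.> (poly n K' z - vstar) - (SUM k:UNIV. nml n K' z $ k * (potential k (poly n K' z) - potential k vstar)))"
  "norm (jump n K' z) = norm (jump n K z)"
proof -
 note fv = facing_values[OF n f z]
 have "num_flux f U D (poly n K z) (poly n K' z) (nml n K z) = - num_flux f U D (poly n K' z) (poly n K z) (- nml n K z)"
  using flux fv(6) unfolding admissible_flux_def by blast
 hence "nflux n K' z = - nflux n K z" using fv(3-5) by (simp only: minus_minus)
 moreover have "jump n K z <.> f_star f U (poly n K z) (outer n K z) (nml n K z)
   = (SUM k:UNIV. nml n K z $ k * (potential k (poly n K' z) - potential k (poly n K z)))"
  using f_star_potential[of "poly n K z" "outer n K z" "nml n K z"] by (simp add: jump_def fv(3) inner_commute)
 moreover have "nflux n K z <.> jump n K z = f_star f U (poly n K z) (outer n K z) (nml n K z) <.> jump n K z - (diss n K z *v jump n K z) <.> jump n K z / 2"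
  by (simp add: num_flux_def jump_def inner_diff_left)
 moreover have "c * (jump n K z <.> jump n K z) <= (diss n K z *v jump n K z) <.> jump n K z"
  using D by (simp add: D_ok_def inner_commute)
 moreover have "nflux n K z <.> jump n K z = nflux n K z <.> (poly n K' z - vstar) - nflux n K z <.> (poly n K z - vstar)"
  by (simp add: jump_def fv(3) inner_diff_right)
 ultimately show "c / 2 * (norm (jump n K z))^2 <=
  (nflux n K z <.> (poly n K z - vstar) - (SUM k:UNIV. nml n K z $ k * (potential k (poly n K z) - potential k vstar)))
  + (nflux n K' z <.> (poly n K' z - vstar) - (SUM k:UNIV. nml n K' z $ k * (potential k (poly n K' z) - potential k vstar)))"
  by (simp add: fv(5) power2_norm_eq_inner inner_commute right_diff_distrib sum_subtractf sum_negf)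
 show "norm (jump n K' z) = norm (jump n K z)"
  using fv(3,4) by (simp add: jump_def norm_minus_commute)
qed

end

context dg_scheme
begin

lemma jump_integrable:
 assumes n: "n < slabs M" "K : icells n"
 shows "integrable (faces n) (%z. side K z * (norm (jump n K z))^2)"
  and "AE z in faces n. fst z : frontier K --> norm (jump n K z) <= 2 * R"
proof -
 interpret slab_cells Om "cells M n" "tm M n" "tm M (Suc n)" using part n by simp
 have KC: "K : cells M n" using n(2) by (rule inner_cells)
 show ae: "AE z in face_measure. fst z : frontier K --> norm (jump n K z) <= 2 * R"
  using face_AE[OF n]
 proof eventually_elim
  case (elim z)
  show ?case
  proof
   assume "fst z : frontier K"
   then obtain K' where z: "snd z : {tm M n..<tm M (Suc n)}" "facing K K' (fst z)" using elim by blast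
   note fv = facing_values[OF n(1) z(2,1)]
   have "norm (jump n K z) <= norm (outer n K z) + norm (poly n K z)" unfolding jump_def by (rule norm_triangle_ineq4)
   thus "norm (jump n K z) <= 2 * R" using fv(3,7,8) by simp
  qed
 qed
 show "integrable face_measure (%z. side K z * (norm (jump n K z))^2)"
 proof (rule integrable_face[where B="(2 * R)^2"])
  show "(%z. (norm (jump n K z))^2) : borel_measurable borel" using face_borel(6)[OF n(1) KC] by measurable
  show "AE z in face_measure. fst z : frontier K --> \<bar>(norm (jump n K z))^2\<bar> <= (2 * R)^2"
   using ae
  proof eventually_elim
   case (elim z)
   thus ?case using power_mono[of "norm (jump n K z)" "2 * R" 2] by auto
  qed
 qed
qed

text \<open>Flux of the potentials through a face. Subtracting their values at \<open>vstar\<close>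
  does not affect the divergence and makes the flux vanish on cells where the polynomial is the
  constant \<open>vstar\<close>.\<close>

definition side_potential :: "nat => (real^'d) set => (real^'d) \<times> real => real" where
 "side_potential n K z = (SUM k:UNIV. nml n K z $ k * (potential k (poly n K z) - potential k vstar))"

lemma vol_energy:
 assumes n: "n < slabs M" "K : cells M n"
 shows "vol_term n K (dpoly n K) = (LBINT x:K. potential0 (poly n K (x, tm M (Suc n))) - potential0 (poly n K (x, tm M n)))
   + (if K : icells n then LINT z|faces n. side K z * side_potential n K z else 0)"
  and "K : icells n ==> integrable (faces n) (%z. side K z * side_potential n K z)"
proof -
 interpret slab_cells Om "cells M n" "tm M n" "tm M (Suc n)" using part n by simp
 note p = poly_C1[OF n]
 have A: "has_C1 (%z. potential0 (poly n K z)) (%z h. u (poly n K z) <.> dpoly n K z h)"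
  by (rule has_C1_compose[OF has_C1_potential0 p])
 have B: "has_C1 (%z. potential k (poly n K z) - potential k vstar) (%z h. fl k (poly n K z) <.> dpoly n K z h - 0)" for k
  by (rule has_C1_diff[OF has_C1_compose[OF has_C1_potential p] has_C1_const])
 have eq: "side_potential n K z = (SUM k:UNIV. normal K (fst z) $ k * (potential k (poly n K z) - potential k vstar))" for z
  by (simp add: side_potential_def nml_def)
 show "K : icells n ==> integrable (faces n) (%z. side K z * side_potential n K z)"
  unfolding eq by (rule cell_divergence(2)[OF _ A B])
 show "vol_term n K (dpoly n K) = (LBINT x:K. potential0 (poly n K (x, tm M (Suc n))) - potential0 (poly n K (x, tm M n)))
   + (if K : icells n then LINT z|faces n. side K z * side_potential n K z else 0)"
 proof (cases "K : icells n")
  case True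
  show ?thesis unfolding vol_term_def eq using cell_divergence(1)[OF True A B] True by simp
 next
  case False
  have c: "poly n K = (%_. vstar)" using poly_outer[OF n False] by auto
  have "dpoly n K z h = 0" for z h
   using has_derivative_unique[OF has_C1D(1)[OF p, of z]] c has_derivative_const[of vstar] by metis
  thus ?thesis using False by (simp add: vol_term_def c)
 qed
qed

lemma face_energy:
 assumes n: "n < slabs M"
 shows "(SUM K:icells n. c / 4 * (jumps n K))
  <= (SUM K:icells n. face_term n K (%z. poly n K z - vstar) - (LINT z|faces n. side K z * side_potential n K z))"
proof -
 interpret slab_cells Om "cells M n" "tm M n" "tm M (Suc n)" using part n by simp
 \<comment> \<open>Each side of a face receives half of the dissipation \<open>c / 2\<close> of the
   pair. If the opposite cell is not inner, its terms vanish and the side keeps more than its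
   share.\<close>
 define G where "G K z = (nflux n K z <.> (poly n K z - vstar) - side_potential n K z) - c / 4 * (norm (jump n K z))^2" for K z
 have i1: "integrable face_measure (%z. side K z * (nflux n K z <.> (poly n K z - vstar)))" if "K : inner_cells" for K
  using inner_cells(1)[OF that] by (intro nflux_integrable[OF n that] continuous_intros poly_cont[OF n])
 have i2: "integrable face_measure (%z. side K z * side_potential n K z)" if "K : inner_cells" for K
  using vol_energy(2)[OF n inner_cells(1)] that by blast
 have i3: "integrable face_measure (%z. side K z * (norm (jump n K z))^2)" if "K : inner_cells" for K
  by (rule jump_integrable(1)[OF n that])
 have Geq: "side K z * G K z = (side K z * (nflux n K z <.> (poly n K z - vstar))
   - side K z * side_potential n K z) - c / 4 * (side K z * (norm (jump n K z))^2)" for K z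
  by (simp add: G_def algebra_simps)
 have iG: "integrable face_measure (%z. side K z * G K z)" if "K : inner_cells" for K
  unfolding Geq using i1[OF that] i2[OF that] i3[OF that] by (intro Bochner_Integration.integrable_diff integrable_mult_right) auto
 have LG: "(LINT z|face_measure. side K z * G K z) = face_term n K (%z. poly n K z - vstar)
   - (LINT z|face_measure. side K z * side_potential n K z)
   - c / 4 * (jumps n K)" if "K : inner_cells" for K
  unfolding Geq face_term_def using i1[OF that] i2[OF that] i3[OF that] by simp
 have all: "AE z in face_measure. ALL K:inner_cells. fst z : frontier K -->
   snd z : {tm M n..<tm M (Suc n)} & (EX K'. facing K K' (fst z)) & D_ok (diss n K z)"
  using inner_cells(4) face_AE[OF n] by (subst AE_finite_all) auto
 have "0 <= (SUM K:inner_cells. LINT z|face_measure. side K z * G K z)"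
 proof (rule pair_integral_nonneg[OF iG])
  show "AE z in face_measure. ALL K K'. facing K K' (fst z) --> K : inner_cells -->
   0 <= G K z + (if K' : inner_cells then G K' z else 0)"
   using all
  proof eventually_elim
   case (elim z)
   show ?case
   proof (intro allI impI)
    fix K K' assume f: "facing K K' (fst z)" and K: "K : inner_cells"
    have fr: "fst z : frontier K" using f by (simp add: facing_def)
    have z: "snd z : {tm M n..<tm M (Suc n)}" and D: "D_ok (diss n K z)" using elim K fr by auto
    note pd = pair_dissipation[OF n f z D, folded side_potential_def]
    show "0 <= G K z + (if K' : inner_cells then G K' z else 0)"
    proof (cases "K' : inner_cells")
     case True
     thus ?thesis using pd by (simp add: G_def)
    next
     case False
     have "poly n K' z = vstar" using False f by (intro poly_outer[OF n]) (auto simp: facing_def)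
     moreover have "0 <= c * (norm (jump n K z))^2" using constants by simp
     ultimately show ?thesis using pd(1) False by (simp add: G_def side_potential_def)
    qed
   qed
  qed
 qed
 also have "... = (SUM K:inner_cells. face_term n K (%z. poly n K z - vstar) - (LINT z|face_measure. side K z * side_potential n K z))
   - (SUM K:inner_cells. c / 4 * (jumps n K))"
  by (simp add: LG sum_subtractf)
 finally show ?thesis by simp
qed

lemma Omega_integrable:
 assumes "g : borel_measurable borel" "!!x. \<bar>g x\<bar> <= B"
 shows "set_integrable lborel Om (g :: real^'d => real)"
 by (rule set_integrable_bounded[OF assms(1) _ dom(2)]) (use dom assms in auto)

lemma continuous_trace:
 fixes g :: "(real^'m) \<times> (real^'m) => real"
 assumes g: "continuous_on UNIV g" and m: "m < slabs M" "s : {tm M m..tm M (Suc m)}" and n: "n < slabs M" "t : {tm M n..tm M (Suc n)}"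
 shows "set_integrable lborel Om (%x. g (ctrace m s x, ctrace n t x))"
proof -
 have "compact (cball (0::real^'m) R \<times> cball (0::real^'m) R)" by (intro compact_Times compact_cball)
 hence "bounded (g ` (cball 0 R \<times> cball 0 R))"
  by (intro compact_imp_bounded compact_continuous_image continuous_on_subset[OF g]) auto
 then obtain B where B: "!!y. y : cball 0 R \<times> cball 0 R ==> \<bar>g y\<bar> <= B" unfolding bounded_iff real_norm_def by blast
 show ?thesis
 proof (rule Omega_integrable)
  have "(%x. (ctrace m s x, ctrace n t x)) : borel_measurable borel"
   using ctrace_borel m n by (intro borel_measurable_Pair) auto
  from measurable_compose[OF this borel_measurable_continuous_onI[OF g]]
  show "(%x. g (ctrace m s x, ctrace n t x)) : borel_measurable borel" .
  show "\<bar>g (ctrace m s x, ctrace n t x)\<bar> <= B" for x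
   using ctrace_bound[OF m, of x] ctrace_bound[OF n, of x] by (intro B) (simp only: mem_Times_iff fst_conv snd_conv)
 qed
qed

lemma entropy_at_continuous: "continuous_on S entropy_at"
 unfolding entropy_at_def by (intro continuous_intros u_cont has_C1D(4)[OF has_C1_potential0])

lemma tjump_integrable:
 assumes n: "0 < n" "n < slabs M"
 shows "set_integrable lborel Om (%x. (norm (tjump n x))^2)"
proof -
 obtain m where m: "n = Suc m" "m < slabs M" using n by (cases n) auto
 have "set_integrable lborel Om (%x. (%y. (norm (fst y - snd y))^2) (ctrace n (tm M n) x, ctrace m (tm M n) x))"
  using tm_less[OF n(2)] tm_less[OF m(2)] m by (intro continuous_trace continuous_intros n m) auto
 thus ?thesis by (simp add: tjump_def m(1))
qed

text \<open>The time term minus the potentials at the two ends of the slab is the entropy at the end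
  minus a mixed expression at the start. The latter falls short of the entropy of the past trace by
  the Bregman distance of the two traces, which \<open>bregman\<close> bounds below by the squared
  jump.\<close>

lemma time_energy:
 assumes n: "0 < n" "n < slabs M"
 shows "(LBINT x:Om. entropy_at (ctrace n (tm M (Suc n)) x)) - (LBINT x:Om. entropy_at (ctrace (n - 1) (tm M n) x))
   + c1 / 2 * (tjumps n)
  <= (SUM K:cells M n. time_term n K (%z. poly n K z - vstar)
    - (LBINT x:K. potential0 (poly n K (x, tm M (Suc n))) - potential0 (poly n K (x, tm M n))))"
proof -
 obtain m where m: "n = Suc m" "m < slabs M" using n by (cases n) auto
 define a1 a0 am where "a1 = ctrace n (tm M (Suc n))" "a0 = ctrace n (tm M n)" "am = ctrace m (tm M n)"
 have s: "tm M (Suc n) : {tm M n..tm M (Suc n)}" "tm M n : {tm M n..tm M (Suc n)}" "tm M n : {tm M m..tm M (Suc m)}"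
  using tm_less[OF n(2)] tm_less[OF m(2)] m by auto
 have cb: "a1 x : cball 0 R" "a0 x : cball 0 R" "am x : cball 0 R" for x
  using ctrace_bound[OF n(2) s(1)] ctrace_bound[OF n(2) s(2)] ctrace_bound[OF m(2) s(3)] by (auto simp: a1_a0_am_def)
 have int1: "set_integrable lborel Om (%x. entropy_at (a1 x))"
  using continuous_trace[OF _ n(2) s(1) n(2) s(1), of "%y. entropy_at (fst y)"]
  by (simp add: a1_a0_am_def continuous_on_compose2[OF entropy_at_continuous[of UNIV]] continuous_on_fst)
 have intm: "set_integrable lborel Om (%x. entropy_at (am x))"
  using continuous_trace[OF _ m(2) s(3) m(2) s(3), of "%y. entropy_at (fst y)"]
  by (simp add: a1_a0_am_def continuous_on_compose2[OF entropy_at_continuous[of UNIV]] continuous_on_fst)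
 have int0: "set_integrable lborel Om (%x. u (am x) <.> (a0 x - vstar) - potential0 (a0 x))"
 proof -
  have "set_integrable lborel Om (%x. (%y. u (fst y) <.> (snd y - vstar) - potential0 (snd y)) (ctrace m (tm M n) x, ctrace n (tm M n) x))"
   by (intro continuous_trace continuous_intros continuous_on_compose2[OF u_cont[of UNIV]]
     continuous_on_compose2[OF has_C1D(4)[OF has_C1_potential0, of UNIV]] m n s) auto
  thus ?thesis by (simp add: a1_a0_am_def)
 qed
 have intj: "set_integrable lborel Om (%x. c1 / 2 * (norm (tjump n x))^2)"
  using tjump_integrable[OF n] by (rule set_integrable_mult_right)
 define H where "H x = entropy_at (a1 x) - (u (am x) <.> (a0 x - vstar) - potential0 (a0 x))" for x
 have intH: "set_integrable lborel Om H" unfolding H_def using int1 int0 by (rule set_integral_diff)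
 have "time_term n K (%z. poly n K z - vstar) - (LBINT x:K. potential0 (poly n K (x, tm M (Suc n))) - potential0 (poly n K (x, tm M n)))
   = (LBINT x:K. H x)" if K: "K : cells M n" for K
 proof -
  have Km: "K : sets borel" "K <= Om" using cellD[OF n(2) K] by auto
  have p: "poly n K (x, tm M (Suc n)) = a1 x" "poly n K (x, tm M n) = a0 x" if "x : K" for x
   using ctrace_cell[OF n(2) K that] by (simp_all add: a1_a0_am_def)
  have "time_term n K (%z. poly n K z - vstar) = (LBINT x:K. u (a1 x) <.> (a1 x - vstar) - u (am x) <.> (a0 x - vstar))"
   unfolding time_term_def by (rule set_lebesgue_integral_cong) (use Km p in \<open>auto simp: a1_a0_am_def m\<close>)
  moreover have "(LBINT x:K. potential0 (poly n K (x, tm M (Suc n))) - potential0 (poly n K (x, tm M n))) = (LBINT x:K. potential0 (a1 x) - potential0 (a0 x))"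
   by (rule set_lebesgue_integral_cong) (use Km p in auto)
  moreover have "(LBINT x:K. u (a1 x) <.> (a1 x - vstar) - u (am x) <.> (a0 x - vstar)) - (LBINT x:K. potential0 (a1 x) - potential0 (a0 x))
    = (LBINT x:K. H x)"
  proof (subst set_integral_diff(2)[symmetric])
   have "set_integrable lborel Om (%x. (%y. potential0 (fst y) - potential0 (snd y)) (ctrace n (tm M (Suc n)) x, ctrace n (tm M n) x))"
    by (intro continuous_trace continuous_intros continuous_on_compose2[OF has_C1D(4)[OF has_C1_potential0, of UNIV]] m n s) auto
   hence p: "set_integrable lborel Om (%x. potential0 (a1 x) - potential0 (a0 x))" by (simp add: a1_a0_am_def)
   thus "set_integrable lborel K (%x. potential0 (a1 x) - potential0 (a0 x))" by (rule set_integrable_subset) (use Km in auto)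
   have "set_integrable lborel Om (%x. H x + (potential0 (a1 x) - potential0 (a0 x)))" using intH p by (rule set_integral_add)
   hence "set_integrable lborel Om (%x. u (a1 x) <.> (a1 x - vstar) - u (am x) <.> (a0 x - vstar))"
    by (simp add: H_def entropy_at_def)
   thus "set_integrable lborel K (%x. u (a1 x) <.> (a1 x - vstar) - u (am x) <.> (a0 x - vstar))"
    by (rule set_integrable_subset) (use Km in auto)
   show "(LBINT x:K. u (a1 x) <.> (a1 x - vstar) - u (am x) <.> (a0 x - vstar) - (potential0 (a1 x) - potential0 (a0 x))) = (LBINT x:K. H x)"
    by (simp add: H_def entropy_at_def algebra_simps)
  qed
  ultimately show ?thesis by simp
 qed
 hence eq: "(SUM K:cells M n. time_term n K (%z. poly n K z - vstar)
    - (LBINT x:K. potential0 (poly n K (x, tm M (Suc n))) - potential0 (poly n K (x, tm M n)))) = (LBINT x:Om. H x)"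
  using cell_partition.sum_cell_integrals[OF part'[OF n(2)] intH] by simp
 have "(LBINT x:Om. entropy_at (a1 x)) - (LBINT x:Om. entropy_at (am x)) + c1 / 2 * (tjumps n)
  = (LBINT x:Om. entropy_at (a1 x) - entropy_at (am x) + c1 / 2 * (norm (tjump n x))^2)"
  using int1 intm intj by (simp add: set_integral_add set_integral_diff)
 also have "... <= (LBINT x:Om. H x)"
 proof (rule set_integral_mono[OF _ intH])
  show "set_integrable lborel Om (%x. entropy_at (a1 x) - entropy_at (am x) + c1 / 2 * (norm (tjump n x))^2)"
   by (intro set_integral_add set_integral_diff int1 intm intj)
  show "entropy_at (a1 x) - entropy_at (am x) + c1 / 2 * (norm (tjump n x))^2 <= H x" for x
   using bregman[OF u_v_low cb(3)[of x] cb(2)[of x]]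
   by (simp add: H_def entropy_at_def tjump_def a1_a0_am_def m inner_diff_right)
 qed
 finally show ?thesis unfolding eq by (simp add: a1_a0_am_def m)
qed

lemma sum_telescope:
 fixes E :: "nat => real"
 shows "(SUM n:{0<..<N}. E n - E (n - 1)) = E (N - 1) - (E 0)"
proof (cases N)
 case (Suc k)
 have "{0<..<Suc k} = {0<..k}" by auto
 moreover have "(SUM n:{0<..k}. E n - E (n - 1)) = E k - E 0"
 proof (induction k)
  case (Suc k)
  have "{0<..Suc k} = insert (Suc k) {0<..k}" by auto
  thus ?case using Suc by simp
 qed simp
 ultimately show ?thesis using Suc by simp
qed simp

text \<open>Telescoping leaves the entropies at the ends of the first and of the last slab, each of
  modulus at most \<open>EB * measure lborel Om\<close>.\<close>

definition total_energy :: real where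
 "total_energy = 2 * EB * measure lborel Om"

theorem energy:
 "(SUM n:steps. c1 / 2 * (tjumps n)
   + (SUM K:icells n. c / 4 * (jumps n K))
   + (SUM K:cells M n. dissip n K)) <= total_energy"
proof -
 \<comment> \<open>Subtracting \<open>vstar\<close> gives compact support in space. The cut-off at
   the end of the first slab keeps \<open>w\<close> in the trial space, as the slab interfaces are
   allowed discontinuities.\<close>
 define w where "w z = (if tm M 1 <= snd z then v z - vstar else 0)" for z
 have w: "w z = poly n K z - vstar" if n: "0 < n" "n < slabs M" "K : cells M n" and z: "z : Q n K" for n K z
  using tm_mono[of 1 n] n z poly(2)[OF n(2,3) z] by (auto simp: w_def)
 have w0: "w z = 0" if "K : cells M 0" "z : Q 0 K" for z K using that by (auto simp: w_def)
 have "w : Vq q M"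
  unfolding Vq_def mem_Collect_eq
 proof (intro allI impI ballI)
  fix n K assume n: "n < slabs M" "K : cells M n"
  show "EX p:polys q. ALL z:K \<times> slab M n. w z = p z"
  proof (cases "n = 0")
   case True
   thus ?thesis using w0 n by (intro bexI[of _ "%_. 0"]) (auto simp: slab_def polys_const)
  next
   case False
   thus ?thesis using w n polys_add_const[OF poly(1)[OF n], of "- vstar"]
    by (intro bexI[of _ "%z. poly n K z + - vstar"]) (auto simp: slab_def)
  qed
 qed
 hence "B_DG f U D M v0 v w + B_SC f U D C1 C2 al1 al2 th M v0 v w = 0"
  using solution by (simp add: sc_dg_solution_def)
 moreover have C1: "has_C1 (%z. poly n K z - vstar) (dpoly n K)" if "n < slabs M" "K : cells M n" for n K
  using has_C1_diff[OF poly_C1[OF that] has_C1_const] by simp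
 have "B_DG f U D M v0 v w = (SUM n:steps.
   - (SUM K:cells M n. vol_term n K (dpoly n K)) + (SUM K:cells M n. time_term n K (%z. poly n K z - vstar)) + (SUM K:icells n. face_term n K (%z. poly n K z - vstar)))"
 proof (rule B_DG_eval[where S=Z])
  show "has_C1 (%z. poly n K z - vstar) (dpoly n K)" if "n < slabs M" "K : cells M n" for n K by (rule C1[OF that])
  show "poly n K z - vstar = 0" if "n < slabs M" "K : cells M n" "K ~: icells n" for n K z
   using poly_outer[OF that] by simp
  show "closed Z" using Z(1) by (rule compact_imp_closed)
  show "w (x, t) = 0" if "x ~: Z" "t : {0..<Tend}" for x t using Z(3)[OF that(1), of t] that by (simp add: w_def)
 qed (use w w0 Z in auto)
 moreover have "B_SC f U D C1 C2 al1 al2 th M v0 v w = 1 * (SUM n:steps. SUM K:cells M n. dissip n K)"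
  by (rule B_SC_eval[of w "%n K z. poly n K z - vstar"]) (use w w0 C1 in auto)
 ultimately have zero: "(SUM n:steps. - (SUM K:cells M n. vol_term n K (dpoly n K)) + (SUM K:cells M n. time_term n K (%z. poly n K z - vstar)) + (SUM K:icells n. face_term n K (%z. poly n K z - vstar))
   + (SUM K:cells M n. dissip n K)) = 0"
  by (simp add: sum.distrib)
 define E where "E n = (LBINT x:Om. entropy_at (ctrace n (tm M (Suc n)) x))" for n
 have "(SUM n:steps. (E n - E (n - 1)) + (c1 / 2 * (tjumps n)
   + (SUM K:icells n. c / 4 * (jumps n K))
   + (SUM K:cells M n. dissip n K))) <= 0"
  unfolding zero[symmetric]
 proof (rule sum_mono)
  fix n assume "n : steps"
  hence n: "0 < n" "n < slabs M" by auto
  have ic: "icells n <= cells M n" using cell_partition.inner_cells(1)[OF part'[OF n(2)]] by auto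
  have "(SUM K:cells M n. vol_term n K (dpoly n K))
   = (SUM K:cells M n. LBINT x:K. potential0 (poly n K (x, tm M (Suc n))) - potential0 (poly n K (x, tm M n)))
    + (SUM K:icells n. LINT z|faces n. side K z * side_potential n K z)"
  proof -
   have "(SUM K:cells M n. if K : icells n then LINT z|faces n. side K z * side_potential n K z else 0)
    = (SUM K:icells n. LINT z|faces n. side K z * side_potential n K z)"
    using ic cells_finite[OF n(2)] by (subst sum.mono_neutral_right[of _ "icells n"]) auto
   thus ?thesis using vol_energy(1)[OF n(2)] by (simp add: sum.distrib)
  qed
  thus "E n - E (n - 1) + (c1 / 2 * (tjumps n)
   + (SUM K:icells n. c / 4 * (jumps n K))
   + (SUM K:cells M n. dissip n K))
   <= - (SUM K:cells M n. vol_term n K (dpoly n K)) + (SUM K:cells M n. time_term n K (%z. poly n K z - vstar)) + (SUM K:icells n. face_term n K (%z. poly n K z - vstar))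
   + (SUM K:cells M n. dissip n K)"
   using face_energy[OF n(2)] time_energy[OF n] n by (simp add: E_def sum_subtractf)
 qed
 hence final: "(SUM n:steps. c1 / 2 * (tjumps n)
   + (SUM K:icells n. c / 4 * (jumps n K))
   + (SUM K:cells M n. dissip n K)) <= E 0 - E (slabs M - 1)"
  using sum_telescope[of E "slabs M"] by (subst (asm) sum.distrib) linarith
 have "\<bar>E n\<bar> <= EB * measure lborel Om" if n: "n < slabs M" for n
 proof -
  have s: "tm M (Suc n) : {tm M n..tm M (Suc n)}" using tm_less[OF n] by simp
  have Om': "Om : sets lborel" "emeasure lborel Om ~= \<infinity>" using dom emeasure_bounded_finite[of Om] by auto
  have i: "set_integrable lborel Om (%x. entropy_at (ctrace n (tm M (Suc n)) x))"
   using continuous_trace[OF _ n s n s, of "%y. entropy_at (fst y)"]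
   by (simp add: continuous_on_compose2[OF entropy_at_continuous[of UNIV]] continuous_on_fst)
  have k: "set_integrable lborel Om (%x. b)" for b :: real by (rule Omega_integrable[of _ "\<bar>b\<bar>"]) auto
  have b: "\<bar>entropy_at (ctrace n (tm M (Suc n)) x)\<bar> <= EB" for x
   unfolding entropy_at_def by (rule EB[OF ctrace_bound[OF n s]])
  have b2: "- EB <= entropy_at (ctrace n (tm M (Suc n)) x)" for x using b[of x] by linarith
  have "E n <= (LBINT x:Om. EB)" unfolding E_def by (rule set_integral_mono[OF i k]) (use b in \<open>auto dest: abs_le_D1\<close>)
  moreover have "(LBINT x:Om. - EB) <= E n" unfolding E_def by (rule set_integral_mono[OF k i]) (rule b2)
  ultimately show ?thesis using set_integral_const[OF Om', of EB] set_integral_const[OF Om', of "- EB"] by (simp add: mult.commute)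
 qed
 from this[of 0] this[of "slabs M - 1"] have "E 0 - E (slabs M - 1) <= total_energy"
  using tm_ends(3) by (simp add: total_energy_def)
 with final show ?thesis by linarith
qed

end

section \<open>Residual bounds from the viscosity\<close>

lemma sum_sq_le: "finite I ==> (SUM i:I. x i)^2 <= real (card I) * (SUM i:I. (x i)^2)" for x :: "'i => real"
 using Cauchy_Schwarz_ineq_sum[of "%_. 1" x I] by simp

lemma set_integral_mono_continuous:
 fixes g g' :: "'a::euclidean_space => real"
 assumes "continuous_on UNIV g" "continuous_on UNIV g'" "S : sets borel" "bounded S" "!!x. x : S ==> g x <= g' x"
 shows "(LBINT x:S. g x) <= (LBINT x:S. g' x)"
 using set_integrable_continuous[OF assms(1) assms(4,3)] set_integrable_continuous[OF assms(2) assms(4,3)] assms(5)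
 by (rule set_integral_mono)

context dg_scheme
begin

definition rres :: "nat => (real^'d) set => (real^'d) \<times> real => real^'m" where
 "rres n K z = u_v U (poly n K z) *v dpoly n K z (0, 1) + (SUM k:UNIV. flux' k (poly n K z) (dpoly n K z (axis k 1, 0)))"

abbreviation "ress n K == LBINT z:Q n K. (norm (rres n K z))^2"

lemma rres_continuous: "n < slabs M ==> K : cells M n ==> continuous_on UNIV (rres n K)"
 unfolding rres_def
 by (intro continuous_intros has_C1_joint[OF has_C1_u] has_C1_joint[OF has_C1_flux] has_C1D(2)[OF poly_C1] poly_cont)

lemma rres_energy_continuous:
 "n < slabs M ==> K : cells M n ==> continuous_on UNIV (%z. rres n K z <.> (v_u U (poly n K z) *v rres n K z))"
 unfolding v_u_eq
 by (intro continuous_intros rres_continuous has_C1_joint[OF has_C1_entropy_var] continuous_on_compose2[OF u_cont[of UNIV] poly_cont]) auto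

lemma Res_eq:
 assumes n: "n < slabs M" "K : cells M n" and z: "z : K \<times> {tm M n<..<tm M (Suc n)}"
 shows "Res f U v z = rres n K z" "v z = poly n K z"
proof -
 note o = interior_Q(1)[OF n]
 have e: "v y = poly n K y" if "y : K \<times> {tm M n<..<tm M (Suc n)}" for y using poly(2)[OF n] interior_Q(2)[OF n that] by blast
 show "v z = poly n K z" using e[OF z] .
 have "dt (%y. u (v y)) z = u_v U (poly n K z) *v dpoly n K z (0, 1)"
  by (rule dt_dx_eq(1)[OF o z _ has_C1_compose[OF has_C1_u poly_C1[OF n]]]) (simp add: e)
 moreover have "dx k (%y. fl k (v y)) z = flux' k (poly n K z) (dpoly n K z (axis k 1, 0))" for k
  by (rule dt_dx_eq(2)[OF o z _ has_C1_compose[OF has_C1_flux poly_C1[OF n]]]) (simp add: e)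
 ultimately show "Res f U v z = rres n K z" by (simp add: Res_def rres_def)
qed

lemma Q_bounded: "n < slabs M ==> K : cells M n ==> bounded (Q n K) & Q n K : sets borel"
 using cellD[of n K] by (auto intro!: bounded_Times times_borel)

lemma Q_closure: "n < slabs M ==> z : Q n K ==> z : closure K \<times> {tm M n..tm M (Suc n)}"
 using closure_subset by fastforce

lemma poly_in: "n < slabs M ==> K : cells M n ==> z : Q n K ==> poly n K z : cball 0 R"
 using poly_bound Q_closure by blast

lemma Res_bar_sq:
 assumes n: "n < slabs M" "K : cells M n"
 shows "(Res_bar f U M n K v)^2 = (LBINT z:Q n K. rres n K z <.> (v_u U (poly n K z) *v rres n K z))" "0 <= Res_bar f U M n K v"
  "c1 * (ress n K) <= (Res_bar f U M n K v)^2"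
proof -
 have eq: "cell_int M n K (%z. Res f U v z <.> (v_u U (v z) *v Res f U v z)) = (LBINT z:Q n K. rres n K z <.> (v_u U (poly n K z) *v rres n K z))"
  using cellD[OF n] by (intro cell_int_eq borel_measurable_continuous_onI[OF rres_energy_continuous[OF n]]) (auto simp: Res_eq[OF n])
 have Q: "bounded (Q n K)" "Q n K : sets borel" using Q_bounded[OF n] by auto
 have le: "c1 * (ress n K) <= (LBINT z:Q n K. rres n K z <.> (v_u U (poly n K z) *v rres n K z))"
  unfolding set_integral_mult_right[symmetric]
  by (intro set_integral_mono_continuous rres_energy_continuous n Q continuous_intros rres_continuous)
    (use v_u_low[OF poly_in[OF n]] in \<open>simp add: power2_norm_eq_inner\<close>)
 have "0 <= (ress n K)"
  unfolding set_lebesgue_integral_def by (intro Bochner_Integration.integral_nonneg) auto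
 hence nn: "0 <= (LBINT z:Q n K. rres n K z <.> (v_u U (poly n K z) *v rres n K z))"
  using le c1 by (meson mult_nonneg_nonneg less_imp_le order_trans)
 thus "(Res_bar f U M n K v)^2 = (LBINT z:Q n K. rres n K z <.> (v_u U (poly n K z) *v rres n K z))" "0 <= Res_bar f U M n K v"
  unfolding Res_bar_def eq by auto
 thus "c1 * (ress n K) <= (Res_bar f U M n K v)^2" using le by simp
qed

text \<open>The viscosity matrix is frozen at the cell mean, so the bounds on the ball have to apply
  there.\<close>

lemma cell_mean_in:
 assumes n: "n < slabs M" "K : cells M n"
 shows "cell_mean M n K v : cball 0 R"
proof -
 have Q: "bounded (Q n K)" "Q n K : sets borel" using Q_bounded[OF n] by auto
 have fin: "emeasure lborel (Q n K) ~= \<infinity>" using emeasure_bounded_finite[OF Q(1)] by simp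
 have c: "cell_int M n K v = (LBINT z:Q n K. poly n K z)"
  using cellD[OF n] by (intro cell_int_eq borel_measurable_continuous_onI[OF poly_cont[OF n]]) (auto simp: Res_eq(2)[OF n])
 have "norm (LBINT z:Q n K. poly n K z) <= (LBINT z:Q n K. norm (poly n K z))"
  by (rule set_integral_norm_bound[OF set_integrable_continuous[OF poly_cont[OF n] Q]])
 also have "... <= (LBINT z:Q n K. R)"
  by (intro set_integral_mono_continuous continuous_intros poly_cont n Q) (use poly_in[OF n] in auto)
 also have "... = measure lborel (Q n K) * R" using Q fin by (subst set_integral_const) auto
 finally have le: "norm (cell_int M n K v) <= measure lborel (Q n K) * R" by (simp add: c)
 have "0 < measure lborel K * (tm M (Suc n) - tm M n)"
  using inscribed_space(3)[OF n] rho_pos unit_ball_vol_pos[of "real (Suc CARD('d))"] by (smt (verit) mult_pos_pos of_nat_0_le_iff zero_less_power)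
 moreover have "measure lborel (Q n K) = vol n K"
  using cellD[OF n] tm_less[OF n(1)] emeasure_bounded_finite[of K]
  unfolding measure_def lborel_prod[symmetric] by (subst lborel.emeasure_pair_measure_Times) (auto simp: enn2real_mult)
 ultimately have pos: "0 < measure lborel (Q n K)" by simp
 have m: "measure lebesgue (K \<times> slab M n) = measure lborel (Q n K)" using Q(2) by (simp add: slab_def)
 have "norm (cell_mean M n K v) = norm (cell_int M n K v) / measure lborel (Q n K)"
  unfolding cell_mean_def m using pos by simp
 also have "... <= R" using le pos by (simp add: pos_divide_le_eq mult.commute)
 finally show ?thesis by simp
qed

text \<open>One factor \<open>L\<close> bounds \<open>v_u\<close>, two more come from squaring the
  chain rule bound of the residual, the dimension plus one from Cauchy-Schwarz over the space-time
  directions, and \<open>1 / c1\<close> from the lower bound of the gradient form.\<close>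

definition res_const :: real where "res_const = L ^ 3 * (real CARD('d) + 1) / c1"

lemma res_const_pos: "0 < res_const" using L c1 by (simp add: res_const_def)

lemma Res_bar_le_grad:
 assumes n: "n < slabs M" "K : cells M n"
 shows "(Res_bar f U M n K v)^2 <= res_const * (grad_bar U M n K v)^2"
 unfolding Res_bar_sq(1)[OF n] grad_bar_sq(1)[OF n] set_integral_mult_right[symmetric]
proof (intro set_integral_mono_continuous rres_energy_continuous n continuous_intros gform_continuous)
 show "bounded (Q n K)" "Q n K : sets borel" using Q_bounded[OF n] by auto
 fix z assume z: "z : Q n K"
 note pin = poly_in[OF n z]
 define x where "x = dpoly n K z (0, 1)"
 define y where "y k = dpoly n K z (axis k 1, 0)" for k
 define s where "s = (norm x)^2 + (SUM k:UNIV. (norm (y k))^2)"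
 have "norm (rres n K z) <= norm (u_v U (poly n K z) *v x) + norm (SUM k:UNIV. flux' k (poly n K z) (y k))"
  unfolding rres_def x_def y_def by (rule norm_triangle_ineq)
 also have "... <= L * norm x + (SUM k:UNIV. L * norm (y k))"
  by (intro add_mono u_v_up[OF pin] sum_norm_le flux_up[OF pin])
 also have "... = L * (norm x + (SUM k:UNIV. norm (y k)))" by (simp add: distrib_left sum_distrib_left)
 finally have "(norm (rres n K z))^2 <= (L * (norm x + (SUM k:UNIV. norm (y k))))^2" by (intro power_mono) auto
 also have "... = L^2 * (norm x + (SUM k:UNIV. norm (y k)))^2" by (simp add: power_mult_distrib)
 \<comment> \<open>The type \<open>'d option\<close> indexes the space-time directions, with
   \<open>None\<close> for time.\<close>
 also have "(norm x + (SUM k:UNIV. norm (y k)))^2 = (SUM i:UNIV. case i of None => norm x | Some k => norm (y k))^2"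
  by (simp add: UNIV_option_conv sum.reindex)
 also have "... <= real (card (UNIV :: 'd option set)) * (SUM i:UNIV. (case i of None => norm x | Some k => norm (y k))^2)"
  by (rule sum_sq_le) simp
 also have "... = (real CARD('d) + 1) * s" by (simp add: s_def UNIV_option_conv sum.reindex card_image)
 finally have 1: "(norm (rres n K z))^2 <= L^2 * ((real CARD('d) + 1) * s)" using L by simp
 have 2: "c1 * s <= gform n K z"
  using u_v_low[OF cell_mean_in[OF n]]
  by (auto simp: gform_def s_def x_def y_def u_v_tilde_def distrib_left sum_distrib_left power2_norm_eq_inner intro!: add_mono sum_mono)
 have "rres n K z <.> (v_u U (poly n K z) *v rres n K z) <= norm (rres n K z) * norm (v_u U (poly n K z) *v rres n K z)"
  by (rule norm_cauchy_schwarz)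
 also have "... <= norm (rres n K z) * (L * norm (rres n K z))" by (intro mult_left_mono v_u_up[OF pin]) auto
 also have "... = L * (norm (rres n K z))^2" by (simp add: power2_eq_square)
 also have "... <= L * (L^2 * ((real CARD('d) + 1) * s))" using 1 L by (intro mult_left_mono) auto
 also have "... = res_const * (c1 * s)" using c1 by (simp add: res_const_def power2_eq_square power3_eq_cube)
 also have "... <= res_const * gform n K z" using 2 res_const_pos by (intro mult_left_mono) auto
 finally show "rres n K z <.> (v_u U (poly n K z) *v rres n K z) <= res_const * gform n K z" .
qed

lemma BRes_bar_nonneg: "0 <= BRes_bar f U D M v0 n K v"
 unfolding BRes_bar_def space_int_def face_int_def set_lebesgue_integral_def
 by (intro real_sqrt_ge_zero add_nonneg_nonneg Bochner_Integration.integral_nonneg mult_nonneg_nonneg scaleR_nonneg_nonneg)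
   (auto intro!: add_nonneg_nonneg Bochner_Integration.integral_nonneg)

lemma visc_lower:
 assumes n: "n < slabs M" "K : cells M n"
 shows "h powr al1 * C1 * (Res_bar f U M n K v / (grad_bar U M n K v + h powr th)) <= visc n K" "0 <= visc n K"
proof -
 have d: "0 < grad_bar U M n K v + h powr th" using grad_bar_sq(2)[OF n] h_pos by (simp add: add_nonneg_pos)
 show 1: "h powr al1 * C1 * (Res_bar f U M n K v / (grad_bar U M n K v + h powr th)) <= visc n K"
  unfolding sc_viscosity_def using d BRes_bar_nonneg constants by (simp add: divide_right_mono)
 have "0 <= h powr al1 * C1 * (Res_bar f U M n K v / (grad_bar U M n K v + h powr th))"
  using d constants Res_bar_sq(2)[OF n] by (intro mult_nonneg_nonneg divide_nonneg_pos) auto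
 thus "0 <= visc n K" using 1 by simp
qed

lemma energy_parts:
 "(SUM n:steps. tjumps n) <= 2 / c1 * total_energy"
 "(SUM n:steps. SUM K:icells n. jumps n K) <= 4 / c * total_energy"
 "(SUM n:steps. SUM K:cells M n. dissip n K) <= total_energy"
proof -
 define X where "X = (SUM n:steps. tjumps n)"
 define Y where "Y = (SUM n:steps. SUM K:icells n. jumps n K)"
 define W where "W = (SUM n:steps. SUM K:cells M n. dissip n K)"
 have e: "c1 / 2 * X + c / 4 * Y + W <= total_energy"
  using energy by (simp add: X_def Y_def W_def sum.distrib sum_distrib_left)
 have "0 <= X" unfolding X_def set_lebesgue_integral_def
  by (intro sum_nonneg Bochner_Integration.integral_nonneg) auto
 hence X: "0 <= c1 / 2 * X" using c1 by simp
 have "0 <= Y" unfolding Y_def by (intro sum_nonneg Bochner_Integration.integral_nonneg) auto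
 hence Y: "0 <= c / 4 * Y" using constants by simp
 have W: "0 <= W" unfolding W_def using visc_lower(2) by (intro sum_nonneg) auto
 have "c1 / 2 * X <= total_energy" using e Y W by linarith
 thus "X <= 2 / c1 * total_energy" using c1 by (simp add: field_simps)
 have "c / 4 * Y <= total_energy" using e X W by linarith
 thus "Y <= 4 / c * total_energy" using constants by (simp add: field_simps)
 show "W <= total_energy" using e X Y by linarith
qed

text \<open>The first alternative uses the viscous dissipation, the second that the gradient itself is
 below the regularisation \<open>h powr th\<close> of the viscosity.\<close>

lemma Res_bar_split:
 assumes n: "n < slabs M" "K : cells M n"
 shows "(Res_bar f U M n K v)^2 <= 2 * sqrt res_const / (h powr al1 * C1) * (dissip n K) + res_const * (h powr th)^2"
proof -
 define r g e where "r = Res_bar f U M n K v" and "g = grad_bar U M n K v" and "e = h powr th"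
 have p: "0 <= r" "0 <= g" "0 < e" using Res_bar_sq(2)[OF n] grad_bar_sq(2)[OF n] h_pos by (auto simp: r_def g_def e_def)
 have hc: "0 < h powr al1 * C1" using h_pos constants by simp
 have s: "0 <= sqrt res_const" using res_const_pos by simp
 have rg: "r^2 <= res_const * g^2" using Res_bar_le_grad[OF n] by (simp add: r_def g_def)
 have "(h powr al1 * C1) * (r / (g + e)) * g^2 <= visc n K * g^2"
  using visc_lower(1)[OF n] by (intro mult_right_mono) (auto simp: r_def g_def e_def)
 hence vis: "r / (g + e) * g^2 <= visc n K * g^2 / (h powr al1 * C1)"
  using hc by (simp add: pos_le_divide_eq mult_ac)
 have nn: "0 <= 2 * sqrt res_const * (visc n K * g^2 / (h powr al1 * C1))"
  using s hc visc_lower(2)[OF n] by (intro mult_nonneg_nonneg divide_nonneg_pos) auto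
 have "r^2 <= 2 * sqrt res_const * (visc n K * g^2 / (h powr al1 * C1)) + res_const * e^2"
 proof (cases "e <= g")
  case True
  have "r <= sqrt (res_const * g^2)" using rg by (rule real_le_rsqrt)
  also have "... = sqrt res_const * g" using p by (simp add: real_sqrt_mult)
  finally have "r * r <= (sqrt res_const * g) * r" using p by (intro mult_right_mono) auto
  \<comment> \<open>In this case the gradient dominates the regularisation, so
    \<open>g + e <= 2 * g\<close>.\<close>
  also have "g <= 2 * (g^2 / (g + e))"
  proof -
   have "g * (g + e) <= 2 * g^2" using True p by (simp add: power2_eq_square distrib_left mult_left_mono)
   thus ?thesis using p by (simp add: pos_le_divide_eq)
  qed
  hence "(sqrt res_const * g) * r <= (sqrt res_const * (2 * (g^2 / (g + e)))) * r"
   using s p by (intro mult_right_mono mult_left_mono) auto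
  also have "... = 2 * sqrt res_const * (r / (g + e) * g^2)" by simp
  also have "... <= 2 * sqrt res_const * (visc n K * g^2 / (h powr al1 * C1))" using vis s by (intro mult_left_mono) auto
  finally have "r^2 <= 2 * sqrt res_const * (visc n K * g^2 / (h powr al1 * C1))" by (simp add: power2_eq_square)
  moreover have "0 <= res_const * e^2" using res_const_pos by simp
  ultimately show ?thesis by linarith
 next
  case False
  hence "g^2 <= e^2" using p by (intro power_mono) auto
  hence "res_const * g^2 <= res_const * e^2" using res_const_pos by (intro mult_left_mono) auto
  thus ?thesis using rg nn by linarith
 qed
 thus ?thesis by (simp add: r_def g_def e_def)
qed

definition res_sum_const :: real where
 "res_sum_const = 2 * sqrt res_const / C1 * total_energy
   + res_const * (4 * sg) ^ Suc CARD('d) * (measure lborel Om * Tend) / unit_ball_vol (real (Suc CARD('d)))"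

text \<open>The viscous part is paid for by the energy. The regularised part contributes
  \<open>h powr (2 * th)\<close> on each of \<open>O(h^-(d+1))\<close> cells, and the condition on
  \<open>th\<close> makes the product at most of order \<open>h powr (- al1)\<close>.\<close>

lemma residual_sum:
 assumes h1: "h <= 1" and th: "(real CARD('d) + 1) / 2 - al1 / 2 <= th"
 shows "(SUM n:steps. SUM K:cells M n. (Res_bar f U M n K v)^2) <= res_sum_const * h powr (- al1)"
proof -
 define V where "V = unit_ball_vol (real (Suc CARD('d)))"
 have V: "0 < V" unfolding V_def by (rule unit_ball_vol_pos) simp
 have s: "0 <= 2 * sqrt res_const / (h powr al1 * C1)" using res_const_pos h_pos constants by simp
 have "(SUM n:steps. SUM K:cells M n. (Res_bar f U M n K v)^2)
  <= (SUM n:steps. SUM K:cells M n. 2 * sqrt res_const / (h powr al1 * C1) * (dissip n K) + res_const * (h powr th)^2)"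
  by (intro sum_mono Res_bar_split) auto
 also have "... = 2 * sqrt res_const / (h powr al1 * C1) * (SUM n:steps. SUM K:cells M n. dissip n K)
   + res_const * (h powr th)^2 * (SUM n:steps. real (card (cells M n)))"
  by (simp add: sum.distrib sum_distrib_left mult_ac)
 also have "... <= 2 * sqrt res_const / (h powr al1 * C1) * total_energy
   + res_const * (h powr th)^2 * ((measure lborel Om * Tend) / (V * rho ^ Suc CARD('d)))"
 proof (intro add_mono mult_left_mono energy_parts(3) s)
  have "(SUM n:steps. real (card (cells M n))) <= (\<Sum>n<slabs M. real (card (cells M n)))"
   by (rule sum_mono2) auto
  also have "... <= (measure lborel Om * Tend) / (V * rho ^ Suc CARD('d))"
   using cell_count V rho_pos by (subst pos_le_divide_eq) (auto simp: V_def)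
  finally show "(SUM n:steps. real (card (cells M n))) <= (measure lborel Om * Tend) / (V * rho ^ Suc CARD('d))" .
 qed (use res_const_pos in auto)
 also have "2 * sqrt res_const / (h powr al1 * C1) * total_energy = 2 * sqrt res_const / C1 * total_energy * h powr (- al1)"
  using h_pos by (simp add: powr_minus divide_inverse mult_ac)
 also have "res_const * (h powr th)^2 * ((measure lborel Om * Tend) / (V * rho ^ Suc CARD('d)))
  <= res_const * (4 * sg) ^ Suc CARD('d) * (measure lborel Om * Tend) / V * h powr (- al1)"
 proof -
  have hd: "h ^ Suc CARD('d) = h powr (real CARD('d) + 1)" using h_pos powr_realpow[of h "Suc CARD('d)"] by (simp add: add.commute)
  have "(h powr th)^2 / rho ^ Suc CARD('d) = (4 * sg) ^ Suc CARD('d) * (h powr (2 * th) / h powr (real CARD('d) + 1))"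
   using h_pos sg by (simp only: rho_def power_divide hd) (simp add: powr_power mult.commute)
  also have "h powr (2 * th) / h powr (real CARD('d) + 1) = h powr (2 * th - (real CARD('d) + 1))" by (simp add: powr_diff)
  also have "... <= h powr (- al1)" using h1 h_pos th by (intro powr_mono') (simp_all add: field_simps)
  finally have "(h powr th)^2 / rho ^ Suc CARD('d) <= (4 * sg) ^ Suc CARD('d) * h powr (- al1)"
   using sg by (simp add: mult_left_mono)
  hence "(res_const * (measure lborel Om * Tend) / V) * ((h powr th)^2 / rho ^ Suc CARD('d))
   <= (res_const * (measure lborel Om * Tend) / V) * ((4 * sg) ^ Suc CARD('d) * h powr (- al1))"
   using res_const_pos V dom by (intro mult_left_mono) auto
  thus ?thesis by (simp add: mult_ac)
 qed
 finally show ?thesis by (simp add: res_sum_const_def V_def distrib_right)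
qed

lemma rres_sum:
 assumes "h <= 1" "(real CARD('d) + 1) / 2 - al1 / 2 <= th"
 shows "(SUM n:steps. SUM K:cells M n. ress n K) <= res_sum_const / c1 * h powr (- al1)"
proof -
 have "c1 * (SUM n:steps. SUM K:cells M n. ress n K)
   <= (SUM n:steps. SUM K:cells M n. (Res_bar f U M n K v)^2)"
  unfolding sum_distrib_left by (intro sum_mono Res_bar_sq(3)) auto
 also have "... <= res_sum_const * h powr (- al1)" by (rule residual_sum[OF assms])
 finally show ?thesis using c1 by (simp add: field_simps)
qed

end

section \<open>Consistency for smooth test functions\<close>

lemma weighted_AMGM:
 fixes x :: real
 assumes "0 < eta"
 shows "2 * (a * x) <= eta * x^2 + a^2 / eta"
proof -
 have "0 <= (eta * x - a)^2 / eta" using assms by simp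
 thus ?thesis using assms by (simp add: power2_eq_square field_simps)
qed

context dg_scheme
begin

definition pt :: "nat => (real^'d) set => (real^'d) \<times> real" where
 "pt n K = (SOME z. z : Q n K)"

lemma pt: "n < slabs M ==> K : cells M n ==> pt n K : Q n K"
proof -
 assume n: "n < slabs M" "K : cells M n"
 then obtain x where "x : K" using cellD by blast
 hence "(x, tm M n) : Q n K" using tm_less[OF n(1)] by simp
 thus ?thesis unfolding pt_def by (rule someI)
qed

lemma Q_unique:
 assumes n: "n < slabs M" "K : cells M n" "z : Q n K" and m: "m < slabs M" "J : cells M m" "z : Q m J"
 shows "m = n & J = K"
proof -
 have "~ m < n" using tm_mono[of "Suc m" n] n m by auto
 moreover have "~ n < m" using tm_mono[of "Suc n" m] n m by auto
 ultimately have "m = n" by simp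
 moreover have "J = K" using cell_partition.disj[OF part'[OF n(1)]] n m `m = n` by (auto simp: disjoint_def)
 ultimately show ?thesis by simp
qed

definition rate_a :: real where
 "rate_a = res_sum_const / c1 + measure lborel Om * Tend"

definition rate_b :: real where
 "rate_b = L * (2 / c1 * total_energy + 2 * sg * Tend * measure lborel Om)
   + (real CARD('d) * L + C) * (4 / c * total_energy + 4 * sg * (real CARD('d) * (measure lborel Om * Tend)))"

text \<open>Weight for the residual in the inequality of arithmetic and geometric means. It makes
  \<open>eta * h powr (- al1)\<close>, from the bound on the residuals, and \<open>h^2 / eta\<close>
  the same power \<open>hr\<close> of \<open>h\<close>.\<close>

definition eta :: real where "eta = h powr (1 + al1 / 2)"

lemma weights:
 "2 * (h * x) <= eta * x^2 + hr" "2 * (h * x) <= sqrt h * x^2 + h * sqrt h"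
 "eta * h powr (- al1) = hr"
proof -
 have "h^2 = h powr 2" using h_pos by (simp add: powr_numeral)
 hence "h^2 / eta = hr" by (simp add: eta_def powr_diff[symmetric])
 thus "2 * (h * x) <= eta * x^2 + hr"
  using weighted_AMGM[of eta h x] h_pos by (simp add: eta_def)
 have "h^2 / sqrt h = h * sqrt h" using h_pos by (simp add: power2_eq_square field_simps)
 thus "2 * (h * x) <= sqrt h * x^2 + h * sqrt h" using weighted_AMGM[of "sqrt h" h x] h_pos by simp
 show "eta * h powr (- al1) = hr" by (simp add: eta_def powr_add[symmetric] field_simps)
qed

lemma Q_const:
 assumes n: "n < slabs M" "K : cells M n"
 shows "(LBINT z:Q n K. b) = vol n K * (b :: real)"
proof -
 have "(LBINT z:Q n K. b) = (LBINT x:K. LBINT t:{tm M n..<tm M (Suc n)}. b)"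
  by (rule set_integral_times(1)) (use cellD[OF n] in auto)
 thus ?thesis
  using tm_less[OF n(1)] cellD[OF n] emeasure_bounded_finite[of K] by (simp add: set_integral_const)
qed

text \<open>\<open>start\<close> and \<open>away\<close> hold for every test function once
  \<open>h\<close> is smaller than the distance of its support from the boundary of the space-time
  domain.\<close>

context
 fixes phi :: "(real^'d) \<times> real => real^'m" and phi' and l :: real
 assumes C1phi: "has_C1 phi phi'"
  and Lip: "0 <= l" "!!z z'. norm (phi z - phi z') <= l * dist z z'"
  and start: "!!z. snd z <= h ==> phi z = 0" and finish: "!!z. Tend <= snd z ==> phi z = 0"
  and away: "!!x t y. phi (x, t) ~= 0 ==> dist x y <= h ==> y : Om"
begin

abbreviation "phi0 n K == phi (pt n K)"
abbreviation "time0 n K == time_term n K (%_. phi0 n K)"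
abbreviation "face0 n K == face_term n K (%_. phi0 n K)"

lemma err_bound:
 assumes n: "n < slabs M" "K : cells M n" and z: "z : closure K \<times> {tm M n..tm M (Suc n)}"
 shows "norm (phi z - phi0 n K) <= l * h"
proof -
 have "dist z (pt n K) <= h" by (rule cell_dist[OF n z Q_closure[OF n(1) pt[OF n]]])
 thus ?thesis using Lip(2)[of z "pt n K"] mult_left_mono[OF _ Lip(1)] order_trans by blast
qed

text \<open>The closure of a cell has diameter at most \<open>h\<close>. If it contained a point
  where \<open>phi\<close> does not vanish, it would lie in \<open>Om\<close> by
  \<open>away\<close>, and the cell would be inner.\<close>

lemma test_outer:
 assumes n: "n < slabs M" "K : cells M n" "K ~: icells n" and x: "x : closure K"
 shows "phi (x, t) = 0"
proof (rule ccontr)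
 assume nz: "phi (x, t) ~= 0"
 have "y : Om" if "y : closure K" for y
 proof (rule away[OF nz])
  have "dist (x, tm M n) (y, tm M n) <= h" using x that tm_less[OF n(1)] by (intro cell_dist[OF n(1,2)]) auto
  thus "dist x y <= h" by (simp add: dist_Pair_Pair)
 qed
 thus False using n cell_partition.inner_cells_def[OF part'[OF n(1)]] by auto
qed

lemma test_first: "n = 0 ==> z : closure K \<times> {tm M n..tm M (Suc n)} ==> phi z = 0"
 using slab_le[OF tm_ends(3)] tm_ends(1) by (intro start) auto

lemma pt_outer: "n < slabs M ==> K : cells M n ==> K ~: icells n ==> phi0 n K = 0"
 using test_outer[of n K "fst (pt n K)" "snd (pt n K)"] pt[of n K] closure_subset[of K] by auto

lemma vol_zero:
 assumes n: "n < slabs M" "K : cells M n" and z: "!!z. z : Q n K ==> phi z = 0"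
 shows "vol_term n K phi' = 0"
proof -
 have "vol_term n K phi' = cell_int M n K (%z. u (v z) <.> dt phi z + (SUM k:UNIV. fl k (v z) <.> dx k phi z))"
  by (rule vol_eq[OF n _ C1phi, symmetric]) simp
 also have "... = vol_term n K (%z h. 0)"
  by (rule vol_eq[OF n, of _ "%_. 0"]) (use z has_C1_const[of "0::real^'m"] in auto)
 finally show ?thesis by (simp add: vol_term_def)
qed

definition wh :: "(real^'d) \<times> real => real^'m" where
 "wh z = (SUM n:steps. SUM K:cells M n. indicator (Q n K) z *R phi0 n K)"

lemma wh_cell:
 assumes n: "0 < n" "n < slabs M" "K : cells M n" and z: "z : Q n K"
 shows "wh z = phi0 n K"
proof -
 have "(SUM J:cells M m. indicator (Q m J) z *R phi (pt m J)) = (if m = n then phi0 n K else 0)" if m: "m < slabs M" for m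
 proof -
  have "(SUM J:cells M m. indicator (Q m J) z *R phi (pt m J)) = (SUM J:cells M m. if m = n & J = K then phi0 n K else 0)"
   using Q_unique[OF n(2,3) z m] z by (intro sum.cong refl) (auto simp: indicator_def)
  also have "... = (if m = n then phi0 n K else 0)" using n cells_finite[OF m] by (auto simp: sum.delta)
  finally show ?thesis .
 qed
 hence "wh z = (SUM m:steps. if m = n then phi0 n K else 0)" unfolding wh_def by (intro sum.cong refl) auto
 thus ?thesis using n by simp
qed

lemma wh_first:
 assumes "K : cells M 0" "z : Q 0 K"
 shows "wh z = 0"
 unfolding wh_def
proof (intro sum.neutral ballI)
 fix n J assume n: "n : steps" "J : cells M n"
 have "z ~: Q n J" using Q_unique[OF tm_ends(3) assms, of n J] n by auto
 thus "indicator (Q n J) z *R phi (pt n J) = 0" by simp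
qed

text \<open>A piecewise constant test function does not see the shock capturing term.\<close>

lemma scheme_equation:
 "(SUM n:steps. (SUM K:cells M n. time0 n K) + (SUM K:icells n. face0 n K)) = 0"
proof -
 have "wh : Vq q M" unfolding Vq_def mem_Collect_eq
 proof (intro allI impI ballI)
  fix n K assume n: "n < slabs M" "K : cells M n"
  show "EX p:polys q. ALL z:K \<times> slab M n. wh z = p z"
  proof (cases "n = 0")
   case True
   thus ?thesis using wh_first n by (intro bexI[of _ "%_. 0"]) (auto simp: slab_def polys_const)
  next
   case False
   thus ?thesis using wh_cell n by (intro bexI[of _ "%_. phi0 n K"]) (auto simp: slab_def polys_const)
  qed
 qed
 hence "B_DG f U D M v0 v wh + B_SC f U D C1 C2 al1 al2 th M v0 v wh = 0"
  using solution by (simp add: sc_dg_solution_def)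
 moreover have "B_DG f U D M v0 v wh = (SUM n:steps.
   - (SUM K:cells M n. vol_term n K (%_ _. 0)) + (SUM K:cells M n. time0 n K) + (SUM K:icells n. face0 n K))"
 proof (rule B_DG_eval[where S="UN n:steps. UN K:icells n. closure K"])
  have f: "finite (icells n)" "K : icells n ==> closure K <= Om" if "n : steps" for n K
   using cell_partition.inner_cells(2,4)[OF part', of n] that by auto
  show "closed (UN n:steps. UN K:icells n. closure K)"
   using f(1) by (intro closed_UN) auto
  show "(UN n:steps. UN K:icells n. closure K) <= Om" using f(2) by blast
  show "wh (x, t) = 0" if x: "x ~: (UN n:steps. UN K:icells n. closure K)" for x t
   unfolding wh_def
  proof (intro sum.neutral ballI)
   fix n K assume n: "n : steps" "K : cells M n"
   show "indicator (Q n K) (x, t) *R phi0 n K = 0"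
   proof (cases "K : icells n")
    case True
    hence "x ~: K" using x n closure_subset[of K] by blast
    thus ?thesis by simp
   next
    case False
    thus ?thesis using pt_outer n by simp
   qed
  qed
  show "has_C1 (%_. phi0 n K) (%_ _. 0)" for n K by (rule has_C1_const)
 qed (use wh_cell wh_first pt_outer in auto)
 moreover have "B_SC f U D C1 C2 al1 al2 th M v0 v wh = 0 * (SUM n:steps. SUM K:cells M n. dissip n K)"
  by (rule B_SC_eval[of wh "%n K _. phi0 n K"]) (use wh_cell wh_first has_C1_const in auto)
 ultimately show ?thesis by (simp add: vol_term_def)
qed

lemma err_C1: "has_C1 (%z. phi z - a) phi'"
 using has_C1_diff[OF C1phi has_C1_const[of a]] by simp

text \<open>Subtracting the constant \<open>phi0 n K\<close> leaves the derivative unchanged, so the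
  integration by parts is carried out with \<open>phi - phi0 n K\<close>. Every resulting term then
  contains a factor of size \<open>l * h\<close>.\<close>

lemma vol_inner:
 assumes n: "n < slabs M" "K : icells n"
 shows "vol_term n K phi' = - (LBINT z:Q n K. rres n K z <.> (phi z - phi0 n K))
  + (LBINT x:K. u (poly n K (x, tm M (Suc n))) <.> (phi (x, tm M (Suc n)) - phi0 n K) - u (poly n K (x, tm M n)) <.> (phi (x, tm M n) - phi0 n K))
  + (LINT z|faces n. side K z * (fn n K z <.> (phi z - phi0 n K)))"
  and "integrable (faces n) (%z. side K z * (fn n K z <.> (phi z - phi0 n K)))"
proof -
 interpret slab_cells Om "cells M n" "tm M n" "tm M (Suc n)" using part n by simp
 have KC: "K : cells M n" using n(2) by (rule inner_cells)
 note p = poly_C1[OF n(1) KC]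
 define e where "e z = phi z - phi0 n K" for z
 have e: "has_C1 e phi'" unfolding e_def by (rule err_C1)
 note A = has_C1_inner[OF has_C1_compose[OF has_C1_u p] e]
 note B = has_C1_inner[OF has_C1_compose[OF has_C1_flux p] e]
 have fneq: "fn n K z <.> e z = (SUM k:UNIV. normal K (fst z) $ k * (fl k (poly n K z) <.> e z))" for z
  by (simp add: nml_def inner_sum_left)
 show "integrable (faces n) (%z. side K z * (fn n K z <.> (phi z - phi0 n K)))"
  using cell_divergence(2)[OF n(2) A B] fneq by (simp add: e_def)
 have Q: "bounded (Q n K)" "Q n K : sets borel" using Q_bounded[OF n(1) KC] by auto
 have c1: "continuous_on UNIV (%z. rres n K z <.> e z)"
  by (intro continuous_intros rres_continuous n(1) KC has_C1D(4)[OF e])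
 have "(LBINT z:Q n K. (u (poly n K z) <.> phi' z (0, 1) + (u_v U (poly n K z) *v dpoly n K z (0, 1)) <.> e z)
   + (SUM k:UNIV. fl k (poly n K z) <.> phi' z (axis k 1, 0) + flux' k (poly n K z) (dpoly n K z (axis k 1, 0)) <.> e z))
  = (LBINT z:Q n K. (u (poly n K z) <.> phi' z (0, 1) + (SUM k:UNIV. fl k (poly n K z) <.> phi' z (axis k 1, 0))) + rres n K z <.> e z)"
  by (simp add: rres_def inner_add_left inner_sum_left sum.distrib add_ac)
 also have "... = vol_term n K phi' + (LBINT z:Q n K. rres n K z <.> e z)"
  unfolding vol_term_def
  by (rule set_integral_add(2)[OF set_integrable_continuous[OF vol_continuous[OF n(1) KC C1phi] Q] set_integrable_continuous[OF c1 Q]])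
 finally have "vol_term n K phi' + (LBINT z:Q n K. rres n K z <.> e z)
   = (LBINT x:K. u (poly n K (x, tm M (Suc n))) <.> e (x, tm M (Suc n)) - u (poly n K (x, tm M n)) <.> e (x, tm M n))
   + (LINT z|faces n. side K z * (fn n K z <.> e z))"
  using cell_divergence(1)[OF n(2) A B] by (simp only: fneq)
 thus "vol_term n K phi' = - (LBINT z:Q n K. rres n K z <.> (phi z - phi0 n K))
  + (LBINT x:K. u (poly n K (x, tm M (Suc n))) <.> (phi (x, tm M (Suc n)) - phi0 n K) - u (poly n K (x, tm M n)) <.> (phi (x, tm M n) - phi0 n K))
  + (LINT z|faces n. side K z * (fn n K z <.> (phi z - phi0 n K)))"
  by (simp add: e_def)
qed

text \<open>The numerical flux is conservative, hence tested with a continuous function it cancels.\<close>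

lemma flux_cancels:
 assumes n: "n < slabs M"
 shows "(SUM K:icells n. face_term n K phi) = 0"
proof -
 interpret slab_cells Om "cells M n" "tm M n" "tm M (Suc n)" using part n by simp
 have phic: "continuous_on UNIV phi" by (rule has_C1D(4)[OF C1phi])
 have i: "integrable face_measure (%z. side K z * (s * (nflux n K z <.> phi z)))" if "K : inner_cells" for K s
  using nflux_integrable[OF n that phic, THEN integrable_mult_right, of s] by (simp add: mult_ac)
 have pair: "AE z in face_measure. ALL K K'. facing K K' (fst z) --> K : inner_cells -->
   0 <= s * (nflux n K z <.> phi z) + (if K' : inner_cells then s * (nflux n K' z <.> phi z) else 0)" for s
  using AE_face_point
 proof eventually_elim
  case (elim z)
  show ?case
  proof (intro allI impI)
   fix K K' assume f: "facing K K' (fst z)"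
   have z: "snd z : {tm M n..<tm M (Suc n)}" using elim by simp
   note fv = facing_values[OF n f z]
   show "0 <= s * (nflux n K z <.> phi z) + (if K' : inner_cells then s * (nflux n K' z <.> phi z) else 0)"
   proof (cases "K' : inner_cells")
    case True
    have "num_flux f U D (poly n K z) (poly n K' z) (nml n K z) = - num_flux f U D (poly n K' z) (poly n K z) (- nml n K z)"
     using flux fv(6) unfolding admissible_flux_def by blast
    hence "nflux n K' z = - nflux n K z" using fv(3-5) by (simp only: minus_minus)
    thus ?thesis using True by simp
   next
    case False
    have "phi (fst z, snd z) = 0" using False fv(2) f by (intro test_outer[OF n, of K']) (auto simp: facing_def frontier_def)
    thus ?thesis by simp
   qed
  qed
 qed
 have eq: "(SUM K:inner_cells. LINT z|face_measure. side K z * (s * (nflux n K z <.> phi z))) = s * (SUM K:icells n. face_term n K phi)" for s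
  unfolding face_term_def sum_distrib_left
  by (intro sum.cong refl) (simp add: mult.left_commute)
 \<comment> \<open>Since the terms of a pair cancel, the nonnegativity lemma applies to both signs
   of the integrand, which forces the sum to vanish.\<close>
 have "0 <= s * (SUM K:icells n. face_term n K phi)" for s
  unfolding eq[symmetric] by (rule pair_integral_nonneg[OF i pair])
 from this[of 1] this[of "- 1"] show ?thesis by simp
qed

lemma u_trace_integrable:
 assumes m: "m < slabs M" "s : {tm M m..tm M (Suc m)}" and g: "continuous_on UNIV (g :: real^'d => real^'m)"
 shows "set_integrable lborel Om (%x. u (ctrace m s x) <.> g x)"
proof -
 have "bounded (u ` cball 0 R)" by (intro compact_imp_bounded compact_continuous_image u_cont compact_cball)
 then obtain A where A: "!!a. a : cball 0 R ==> norm (u a) <= A" unfolding bounded_iff by blast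
 have "bounded (g ` closure Om)"
  using dom by (intro compact_imp_bounded compact_continuous_image continuous_on_subset[OF g]) auto
 then obtain B where B: "!!x. x : closure Om ==> norm (g x) <= B" unfolding bounded_iff by blast
 show ?thesis
 proof (rule set_integrable_bounded)
  show "(%x. u (ctrace m s x) <.> g x) : borel_measurable borel"
   using measurable_compose[OF ctrace_borel[OF m(1)] borel_measurable_continuous_onI[OF u_cont]] borel_measurable_continuous_onI[OF g]
   by (rule borel_measurable_inner)
  fix x assume "x : Om"
  hence "norm (g x) <= B" using B closure_subset by blast
  moreover have "norm (u (ctrace m s x)) <= A" by (rule A[OF ctrace_bound[OF m]])
  ultimately have "norm (u (ctrace m s x)) * norm (g x) <= A * B" by (intro mult_mono) (auto intro: order_trans[OF norm_ge_zero])
  thus "\<bar>u (ctrace m s x) <.> g x\<bar> <= A * B" using Cauchy_Schwarz_ineq2 order_trans by blast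
 qed (use dom in auto)
qed

lemma test_slice: "continuous_on UNIV (%x. phi (x, s))"
 by (intro continuous_on_compose2[OF has_C1D(4)[OF C1phi, of UNIV]] continuous_intros) auto

definition moment :: "nat => real" where
 "moment n = (LBINT x:Om. u (ctrace n (tm M (Suc n)) x) <.> phi (x, tm M (Suc n)))"

definition bdry :: "nat => (real^'d) set => real" where
 "bdry n K = (LBINT x:K. u (poly n K (x, tm M (Suc n))) <.> (phi (x, tm M (Suc n)) - phi0 n K) - u (poly n K (x, tm M n)) <.> (phi (x, tm M n) - phi0 n K))"

text \<open>In the sum of \<open>bdry\<close> and \<open>time0\<close> the constant cancels at the
  end of the slab. At its start there remains, besides the moments, the jump of the state times
  \<open>phi - phi0 n K\<close>, a product of a controlled jump and an error of order
  \<open>h\<close>.\<close>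

lemma time_consistency:
 assumes n: "0 < n" "n < slabs M"
 shows "\<bar>(SUM K:cells M n. bdry n K + time0 n K) - (moment n - moment (n - 1))\<bar>
   <= (LBINT x:Om. L * l / 2 * (sqrt h * (norm (tjump n x))^2 + h * sqrt h))"
proof -
 define W where "W x = L * l / 2 * (sqrt h * (norm (tjump n x))^2 + h * sqrt h)" for x
 obtain m where m: "n = Suc m" "m < slabs M" using n by (cases n) auto
 define a1 a0 am where "a1 = ctrace n (tm M (Suc n))" "a0 = ctrace n (tm M n)" "am = ctrace m (tm M n)"
 have s: "tm M (Suc n) : {tm M n..tm M (Suc n)}" "tm M n : {tm M n..tm M (Suc n)}" "tm M n : {tm M m..tm M (Suc m)}"
  using tm_less[OF n(2)] tm_less[OF m(2)] m by auto
 have cb: "a0 x : cball 0 R" "am x : cball 0 R" for x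
  using ctrace_bound[OF n(2) s(2)] ctrace_bound[OF m(2) s(3)] by (auto simp: a1_a0_am_def)
 define G where "G x = u (a1 x) <.> phi (x, tm M (Suc n)) - u (am x) <.> phi (x, tm M n)" for x
 have i1: "set_integrable lborel Om (%x. u (a1 x) <.> g x)" if "continuous_on UNIV g" for g
  unfolding a1_a0_am_def by (rule u_trace_integrable[OF n(2) s(1) that])
 have i0: "set_integrable lborel Om (%x. u (a0 x) <.> g x)" if "continuous_on UNIV g" for g
  unfolding a1_a0_am_def by (rule u_trace_integrable[OF n(2) s(2) that])
 have im: "set_integrable lborel Om (%x. u (am x) <.> g x)" if "continuous_on UNIV g" for g
  unfolding a1_a0_am_def by (rule u_trace_integrable[OF m(2) s(3) that])
 have iG: "set_integrable lborel Om G" unfolding G_def by (intro set_integral_diff i1 im test_slice)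
 have ij: "set_integrable lborel Om W"
  unfolding W_def using tjump_integrable[OF n] Omega_integrable[of "%_. sqrt h" "\<bar>sqrt h\<bar>"]
  by (intro set_integrable_mult_right set_integral_add(1)) auto
 have cellwise: "\<bar>bdry n K + time0 n K - (LBINT x:K. G x)\<bar> <= (LBINT x:K. W x)"
  if K: "K : cells M n" for K
 proof -
  have Km: "K : sets borel" "K <= Om" using cellD[OF n(2) K] by auto
  have iK: "set_integrable lborel K g" if "set_integrable lborel Om g" for g :: "real^'d => real"
   using that by (rule set_integrable_subset) (use Km in auto)
  have p: "poly n K (x, tm M (Suc n)) = a1 x" "poly n K (x, tm M n) = a0 x" if "x : K" for x
   using ctrace_cell[OF n(2) K that] by (simp_all add: a1_a0_am_def)
  define E where "E x = (u (a0 x) - u (am x)) <.> (phi (x, tm M n) - phi0 n K)" for x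
  have ec: "continuous_on UNIV (%x. phi (x, t) - phi0 n K)" for t by (intro continuous_intros test_slice)
  have E_eq: "E = (%x. u (a0 x) <.> (phi (x, tm M n) - phi0 n K) - u (am x) <.> (phi (x, tm M n) - phi0 n K))"
   by (simp add: fun_eq_iff E_def inner_diff_left)
  have iE: "set_integrable lborel K E" unfolding E_eq
   using set_integral_diff(1)[OF iK[OF i0[OF ec]] iK[OF im[OF ec]], of "tm M n" "tm M n"] .
  have "bdry n K = (LBINT x:K. u (a1 x) <.> (phi (x, tm M (Suc n)) - phi0 n K) - u (a0 x) <.> (phi (x, tm M n) - phi0 n K))"
   unfolding bdry_def by (rule set_lebesgue_integral_cong) (use Km p in auto)
  moreover have "time0 n K = (LBINT x:K. u (a1 x) <.> phi0 n K - u (am x) <.> phi0 n K)"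
   by (simp add: time_term_def a1_a0_am_def m)
  ultimately have "bdry n K + time0 n K = (LBINT x:K. (u (a1 x) <.> (phi (x, tm M (Suc n)) - phi0 n K) - u (a0 x) <.> (phi (x, tm M n) - phi0 n K))
    + (u (a1 x) <.> phi0 n K - u (am x) <.> phi0 n K))"
   by (simp add: set_integral_add(2) set_integral_diff(1) iK i1 i0 im ec)
  also have "... = (LBINT x:K. G x - E x)"
   by (rule arg_cong[where f="set_lebesgue_integral lborel K"]) (auto simp: fun_eq_iff G_def E_def inner_diff_left inner_diff_right)
  also have "... = (LBINT x:K. G x) - (LBINT x:K. E x)" by (rule set_integral_diff(2)[OF iK[OF iG] iE])
  finally have "\<bar>bdry n K + time0 n K - (LBINT x:K. G x)\<bar> = norm (LBINT x:K. E x)" by simp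
  also have "... <= (LBINT x:K. norm (E x))" by (rule set_integral_norm_bound[OF iE])
  also have "... <= (LBINT x:K. W x)"
  proof (rule set_integral_mono[OF set_integrable_norm[OF iE] iK[OF ij]])
   fix x assume x: "x : K"
   have "norm (u (a0 x) - u (am x)) <= L * norm (tjump n x)"
    using u_Lipschitz[OF cb] by (simp add: tjump_def a1_a0_am_def m)
   moreover have "norm (phi (x, tm M n) - phi0 n K) <= l * h"
    using x closure_subset[of K] s by (intro err_bound[OF n(2) K]) auto
   ultimately have "norm (u (a0 x) - u (am x)) * norm (phi (x, tm M n) - phi0 n K) <= (L * norm (tjump n x)) * (l * h)"
    using L by (intro mult_mono) auto
   also have "... <= W x"
    unfolding W_def using mult_left_mono[OF weights(2), of "L * l / 2" "norm (tjump n x)"] L Lip(1) by (simp add: mult_ac)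
   finally show "norm (E x) <= W x"
    using Cauchy_Schwarz_ineq2[of "u (a0 x) - u (am x)" "phi (x, tm M n) - phi0 n K"] by (simp add: E_def)
  qed
  finally show ?thesis .
 qed
 have "moment n - moment (n - 1) = (LBINT x:Om. G x)"
  unfolding G_def moment_def using set_integral_diff(2)[OF i1[OF test_slice] im[OF test_slice], of "tm M (Suc n)" "tm M n"]
  by (simp add: a1_a0_am_def m)
 also have "... = (SUM K:cells M n. LBINT x:K. G x)"
  using cell_partition.sum_cell_integrals[OF part'[OF n(2)] iG] by simp
 finally have "\<bar>(SUM K:cells M n. bdry n K + time0 n K) - (moment n - moment (n - 1))\<bar>
  = \<bar>SUM K:cells M n. bdry n K + time0 n K - (LBINT x:K. G x)\<bar>"
  by (simp add: sum_subtractf)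
 also have "... <= (SUM K:cells M n. LBINT x:K. W x)"
  using cellwise by (intro order_trans[OF sum_abs] sum_mono) auto
 also have "... = (LBINT x:Om. W x)"
  by (rule cell_partition.sum_cell_integrals[OF part'[OF n(2)] ij])
 finally show ?thesis by (simp add: W_def)
qed

text \<open>The flux terms tested with \<open>phi\<close> sum to zero and may be subtracted. What
  remains is the difference of the inner flux and the numerical flux, bounded by the jump, times
  \<open>phi - phi0 n K\<close>.\<close>

lemma face_consistency:
 assumes n: "n < slabs M"
 shows "\<bar>SUM K:icells n. (LINT z|faces n. side K z * (fn n K z <.> (phi z - phi0 n K))) + face0 n K\<bar>
   <= (real CARD('d) * L + C) * l / 2 * (sqrt h * (SUM K:icells n. jumps n K)
    + h * sqrt h * (SUM K:icells n. LINT z|faces n. side K z))"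
proof -
 interpret slab_cells Om "cells M n" "tm M n" "tm M (Suc n)" using part n by simp
 have phic: "continuous_on UNIV phi" by (rule has_C1D(4)[OF C1phi])
 define B where "B = (real CARD('d) * L + C) * l / 2"
 define W where "W K z = B * (sqrt h * (side K z * (norm (jump n K z))^2) + h * sqrt h * side K z)" for K z
 have B: "0 <= B" using L constants Lip by (simp add: B_def)
 define X where "X K = (LINT z|face_measure. side K z * (fn n K z <.> (phi z - phi0 n K)))" for K
 have ij: "integrable face_measure (W K)" "(LINT z|face_measure. W K z) = B * (sqrt h * (jumps n K)
   + h * sqrt h * (LINT z|face_measure. side K z))" if K: "K : inner_cells" for K
  unfolding W_def using jump_integrable(1)[OF n K] integrable_face[of "%_. 1" K 1] by simp_all
 have "\<bar>X K + face0 n K - face_term n K phi\<bar> <= (LINT z|face_measure. W K z)" if K: "K : inner_cells" for K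
 proof -
  have KC: "K : cells M n" by (rule inner_cells(1)[OF K])
  note i1 = vol_inner(2)[OF n K]
  note i2 = nflux_integrable[OF n K continuous_on_const, of "phi0 n K"]
  note i3 = nflux_integrable[OF n K phic]
  define E where "E z = side K z * ((fn n K z - nflux n K z) <.> (phi z - phi0 n K))" for z
  have Eeq: "E = (%z. side K z * (fn n K z <.> (phi z - phi0 n K)) + side K z * (nflux n K z <.> phi0 n K)
    - side K z * (nflux n K z <.> phi z))"
   by (simp add: E_def fun_eq_iff inner_diff_left inner_diff_right algebra_simps)
  have "X K + face0 n K - face_term n K phi = (LINT z|face_measure. E z)"
   unfolding Eeq X_def face_term_def using i1 i2 i3 by simp
  also have "\<bar>...\<bar> <= (LINT z|face_measure. W K z)"
  proof (rule order_trans[OF integral_abs_bound integral_mono_AE])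
   show "integrable face_measure (%z. \<bar>E z\<bar>)" unfolding Eeq using i1 i2 i3 by (intro integrable_abs) auto
   show "integrable face_measure (W K)" by (rule ij(1)[OF K])
   show "AE z in face_measure. \<bar>E z\<bar> <= W K z"
    using face_AE[OF n K]
   proof eventually_elim
    case (elim z)
    have "\<bar>(fn n K z - nflux n K z) <.> (phi z - phi0 n K)\<bar> <= B * (sqrt h * (norm (jump n K z))^2 + h * sqrt h)" if f: "fst z : frontier K"
    proof -
     obtain K' where z: "snd z : {tm M n..<tm M (Suc n)}" "facing K K' (fst z)" "D_ok (diss n K z)" using elim f by blast
     have "norm (phi z - phi0 n K) <= l * h"
      using f z(1) by (intro err_bound[OF n KC]) (auto simp: frontier_def mem_Times_iff)
     hence "norm (fn n K z - nflux n K z) * norm (phi z - phi0 n K) <= ((real CARD('d) * L + C) * norm (jump n K z)) * (l * h)"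
      using flux_bounds(3)[OF n z(2,1,3)] L constants by (intro mult_mono) auto
     also have "... <= B * (sqrt h * (norm (jump n K z))^2 + h * sqrt h)"
      using mult_left_mono[OF weights(2) B, of "norm (jump n K z)"] by (simp add: B_def mult_ac)
     finally show ?thesis using Cauchy_Schwarz_ineq2[of "fn n K z - nflux n K z" "phi z - phi0 n K"] by linarith
    qed
    thus ?case by (auto simp: E_def W_def split: split_indicator)
   qed
  qed
  finally show ?thesis by simp
 qed
 hence "\<bar>SUM K:inner_cells. X K + face0 n K - face_term n K phi\<bar> <= (SUM K:inner_cells. LINT z|face_measure. W K z)"
  by (intro order_trans[OF sum_abs] sum_mono) auto
 also have "... = B * (sqrt h * (SUM K:inner_cells. jumps n K)
    + h * sqrt h * (SUM K:inner_cells. LINT z|face_measure. side K z))"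
  by (simp add: ij(2) sum.distrib sum_distrib_left distrib_left)
 finally show ?thesis using flux_cancels[OF n] by (simp add: sum_subtractf X_def B_def)
qed

lemma residual_consistency:
 assumes n: "n < slabs M" "K : cells M n"
 shows "\<bar>LBINT z:Q n K. rres n K z <.> (phi z - phi0 n K)\<bar>
  <= l / 2 * (eta * (ress n K) + hr * (vol n K))"
proof -
 have Q: "bounded (Q n K)" "Q n K : sets borel" using Q_bounded[OF n] by auto
 have c: "continuous_on UNIV (%z. rres n K z <.> (phi z - phi0 n K))"
  and c2: "continuous_on UNIV (%z. eta * (norm (rres n K z))^2)"
  by (intro continuous_intros rres_continuous n has_C1D(4)[OF C1phi])+
 have "norm (LBINT z:Q n K. rres n K z <.> (phi z - phi0 n K)) <= (LBINT z:Q n K. norm (rres n K z <.> (phi z - phi0 n K)))"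
  by (rule set_integral_norm_bound[OF set_integrable_continuous[OF c Q]])
 also have "... <= (LBINT z:Q n K. l / 2 * (eta * (norm (rres n K z))^2 + hr))"
 proof (intro set_integral_mono_continuous continuous_intros rres_continuous n has_C1D(4)[OF C1phi] Q)
  fix z assume z: "z : Q n K"
  have "norm (rres n K z) * norm (phi z - phi0 n K) <= norm (rres n K z) * (l * h)"
   by (intro mult_left_mono err_bound[OF n Q_closure[OF n(1) z]]) auto
  also have "... <= l / 2 * (eta * (norm (rres n K z))^2 + hr)"
   using mult_left_mono[OF weights(1), of "l / 2" "norm (rres n K z)"] Lip(1) by (simp add: mult_ac)
  finally show "norm (rres n K z <.> (phi z - phi0 n K)) <= l / 2 * (eta * (norm (rres n K z))^2 + hr)"
   using Cauchy_Schwarz_ineq2[of "rres n K z" "phi z - phi0 n K"] by simp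
 qed
 also have "... = l / 2 * (eta * (ress n K) + (LBINT z:Q n K. hr))"
  using set_integral_add(2)[OF set_integrable_continuous[OF c2 Q] set_integrable_continuous[OF continuous_on_const Q]] by simp
 finally show ?thesis using Q_const[OF n, of "hr"] by (simp add: mult_ac)
qed

definition err :: "nat => real" where
 "err n = (eta * (SUM K:cells M n. ress n K) + hr * (SUM K:cells M n. vol n K))
  + L * (sqrt h * (tjumps n) + h * sqrt h * measure lborel Om)
  + (real CARD('d) * L + C) * (sqrt h * (SUM K:icells n. jumps n K)
    + h * sqrt h * (SUM K:icells n. LINT z|faces n. side K z))"

lemma slab_consistency:
 assumes n: "0 < n" "n < slabs M"
 shows "\<bar>(SUM K:cells M n. vol_term n K phi') + ((SUM K:cells M n. time0 n K) + (SUM K:icells n. face0 n K))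
   - (moment n - moment (n - 1))\<bar> <= l / 2 * err n"
proof -
 have ic: "icells n <= cells M n" using cell_partition.inner_cells(1)[OF part'[OF n(2)]] by auto
 define X where "X K = (LBINT z:Q n K. rres n K z <.> (phi z - phi0 n K))" for K
 define Y where "Y K = (LINT z|faces n. side K z * (fn n K z <.> (phi z - phi0 n K)))" for K
 have restrict: "(SUM K:cells M n. g K) = (SUM K:icells n. g K)" if "!!K. K : cells M n ==> K ~: icells n ==> g K = 0" for g :: "_ => real"
  by (rule sum.mono_neutral_right[OF cells_finite[OF n(2)] ic]) (use that in auto)
 have "(SUM K:cells M n. vol_term n K phi') = (SUM K:icells n. vol_term n K phi')"
 proof (rule restrict)
  fix K assume K: "K : cells M n" "K ~: icells n"
  show "vol_term n K phi' = 0"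
   by (rule vol_zero[OF n(2) K(1)]) (use test_outer[OF n(2) K] closure_subset[of K] in auto)
 qed
 also have "... = (SUM K:icells n. - X K + bdry n K + Y K)"
  using vol_inner(1)[OF n(2)] by (simp add: X_def bdry_def Y_def)
 also have "... = - (SUM K:icells n. X K) + (SUM K:icells n. bdry n K) + (SUM K:icells n. Y K)"
  by (simp add: sum.distrib sum_negf sum_subtractf)
 also have "(SUM K:icells n. bdry n K) = (SUM K:cells M n. bdry n K)"
 proof (rule restrict[symmetric])
  fix K assume K: "K : cells M n" "K ~: icells n"
  have "bdry n K = (LBINT x:K. (0::real))"
   unfolding bdry_def
  proof (rule set_lebesgue_integral_cong)
   show "K : sets lborel" using cellD[OF n(2) K(1)] by simp
   show "ALL x. x : K --> u (poly n K (x, tm M (Suc n))) <.> (phi (x, tm M (Suc n)) - phi0 n K) - u (poly n K (x, tm M n)) <.> (phi (x, tm M n) - phi0 n K) = 0"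
    using test_outer[OF n(2) K] pt_outer[OF n(2) K] closure_subset[of K] by auto
  qed
  thus "bdry n K = 0" by simp
 qed
 finally have eq: "(SUM K:cells M n. vol_term n K phi') + ((SUM K:cells M n. time0 n K) + (SUM K:icells n. face0 n K)) - (moment n - moment (n - 1))
   = - (SUM K:icells n. X K) + ((SUM K:cells M n. bdry n K + time0 n K) - (moment n - moment (n - 1)))
    + (SUM K:icells n. Y K + face0 n K)"
  by (simp add: sum.distrib)
 have "\<bar>SUM K:icells n. X K\<bar> <= (SUM K:icells n. l / 2 * (eta * (ress n K) + hr * (vol n K)))"
  unfolding X_def using ic by (intro order_trans[OF sum_abs] sum_mono residual_consistency n(2)) auto
 also have "... <= (SUM K:cells M n. l / 2 * (eta * (ress n K) + hr * (vol n K)))"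
  using ic cells_finite[OF n(2)] Lip(1) tm_less[OF n(2)]
  by (intro sum_mono2 mult_nonneg_nonneg add_nonneg_nonneg) (auto simp: eta_def set_lebesgue_integral_def intro!: Bochner_Integration.integral_nonneg)
 also have "... = l / 2 * (eta * (SUM K:cells M n. ress n K) + hr * (SUM K:cells M n. vol n K))"
  by (simp only: sum_distrib_left sum.distrib distrib_left)
 finally have 1: "\<bar>SUM K:icells n. X K\<bar> <= l / 2 * (eta * (SUM K:cells M n. ress n K) + hr * (SUM K:cells M n. vol n K))" .
 have "Om : sets lborel" "emeasure lborel Om ~= \<infinity>" using dom emeasure_bounded_finite[of Om] by auto
 from set_integral_const[OF this, of "h * sqrt h"] set_integral_add(2)[OF set_integrable_mult_right[OF tjump_integrable[OF n]] Omega_integrable[of "%_. h * sqrt h" "\<bar>h * sqrt h\<bar>"], of "sqrt h"]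
 have 2: "(LBINT x:Om. L * l / 2 * (sqrt h * (norm (tjump n x))^2 + h * sqrt h)) = L * l / 2 * (sqrt h * (tjumps n) + h * sqrt h * measure lborel Om)"
  by (simp add: mult.commute)
 have "\<bar>- a + b + c\<bar> <= l / 2 * (A + L * B + (real CARD('d) * L + C) * D)"
  if "\<bar>a\<bar> <= l / 2 * A" "\<bar>b\<bar> <= L * l / 2 * B" "\<bar>c\<bar> <= (real CARD('d) * L + C) * l / 2 * D" for a b c A B D
 proof -
  have "l / 2 * (A + L * B + (real CARD('d) * L + C) * D) = l / 2 * A + L * l / 2 * B + (real CARD('d) * L + C) * l / 2 * D"
   by (simp add: algebra_simps)
  thus ?thesis using that by linarith
 qed
 from this[OF 1 time_consistency[OF n, unfolded 2] face_consistency[OF n(2), folded Y_def]]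
 show ?thesis unfolding eq err_def .
qed

lemma total_consistency:
 "\<bar>\<Sum>n<slabs M. SUM K:cells M n. vol_term n K phi'\<bar> <= l / 2 * (SUM n:steps. err n)"
proof -
 define S where "S n = (SUM K:cells M n. vol_term n K phi')" for n
 define T where "T n = (SUM K:cells M n. time0 n K) + (SUM K:icells n. face0 n K)" for n
 have "S 0 = 0"
  unfolding S_def
 proof (intro sum.neutral ballI)
  fix K assume K: "K : cells M 0"
  show "vol_term 0 K phi' = 0"
   by (rule vol_zero[OF tm_ends(3) K]) (use test_first[of 0] Q_closure[OF tm_ends(3)] in blast)
 qed
 hence "(\<Sum>n<slabs M. S n) = (SUM n:steps. S n)"
  by (intro sum.mono_neutral_right) (auto intro: gr0I)
 also have "... = (SUM n:steps. S n) + (SUM n:steps. T n) - (SUM n:steps. moment n - moment (n - 1))"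
 proof -
  \<comment> \<open>The moments telescope to the ends of the first and of the last slab. The former
    is at most \<open>h\<close> and the latter is \<open>Tend\<close>, where \<open>phi\<close>
    vanishes.\<close>
  have "moment 0 = 0" unfolding moment_def
   using start[of "(_, tm M (Suc 0))"] slab_le[OF tm_ends(3)] tm_ends(1) by simp
  moreover have "moment (slabs M - 1) = 0" unfolding moment_def
   using finish[of "(_, Tend)"] tm_ends by simp
  moreover have "(SUM n:steps. T n) = 0" unfolding T_def by (rule scheme_equation)
  ultimately show ?thesis by (simp only: sum_telescope)
 qed
 also have "... = (SUM n:steps. S n + T n - (moment n - moment (n - 1)))" by (simp add: sum.distrib sum_subtractf)
 also have "\<bar>...\<bar> <= (SUM n:steps. l / 2 * err n)"
  using slab_consistency by (intro order_trans[OF sum_abs] sum_mono) (auto simp: S_def T_def)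
 finally show ?thesis by (simp add: S_def sum_distrib_left)
qed

text \<open>The residual part gives the power \<open>hr\<close>. In the jump parts
  \<open>sqrt h\<close> multiplies quantities bounded by the energy, and \<open>h * sqrt h\<close>
  multiplies the number of slabs or the area of the faces, both O(1/h).\<close>

lemma total_error:
 assumes h1: "h <= 1" and th: "(real CARD('d) + 1) / 2 - al1 / 2 <= th"
 shows "(SUM n:steps. err n) <= rate_a * hr + rate_b * sqrt h"
proof -
 define V where "V = measure lborel Om * Tend"
 have sh: "0 <= sqrt h" and LC: "0 <= real CARD('d) * L + C" using h_pos L constants by auto
 have extend: "(SUM n:steps. g n) <= (\<Sum>n<slabs M. g n)" if "!!n. n < slabs M ==> 0 <= g n" for g :: "nat => real"
  by (rule sum_mono2) (use that in auto)
 have "(SUM n:steps. SUM K:cells M n. vol n K) <= V"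
  unfolding V_def sum_cell_volume[symmetric]
  by (intro extend sum_nonneg mult_nonneg_nonneg) (auto simp: less_imp_le[OF tm_less])
 hence 1: "hr * (SUM n:steps. SUM K:cells M n. vol n K) <= hr * V"
  by (rule mult_left_mono) simp
 have 2: "eta * (SUM n:steps. SUM K:cells M n. ress n K) <= res_sum_const / c1 * hr"
 proof -
  have "0 <= eta" by (simp add: eta_def)
  from mult_left_mono[OF rres_sum[OF assms] this] show ?thesis unfolding weights(3)[symmetric] by (simp add: mult_ac)
 qed
 have comb: "a * (sqrt h * x + y) <= a * (sqrt h * x' + y')" if "0 <= a" "x <= x'" "y <= y'" for a x x' y y' :: real
  using that sh by (intro mult_left_mono add_mono) auto
 have "h * real (card steps) <= h * real (slabs M)" using h_pos by (intro mult_left_mono) auto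
 also have "... <= 2 * sg * Tend" using slab_count sg by (simp add: rho_def field_simps)
 finally have "h * sqrt h * (real (card steps) * measure lborel Om) <= sqrt h * measure lborel Om * (2 * sg * Tend)"
  using mult_left_mono[of "h * real (card steps)" "2 * sg * Tend" "sqrt h * measure lborel Om"] sh by (simp add: mult_ac)
 note 3 = comb[OF less_imp_le[OF L] energy_parts(1) this]
 have "h * (SUM n:steps. SUM K:icells n. LINT z|faces n. side K z) <= h * (\<Sum>n<slabs M. SUM K:icells n. LINT z|faces n. side K z :: real)"
  using h_pos by (intro mult_left_mono extend) (auto intro!: sum_nonneg Bochner_Integration.integral_nonneg)
 also have "... <= 4 * sg * (real CARD('d) * V)" using face_count sg by (simp add: rho_def V_def field_simps)
 finally have "h * sqrt h * (SUM n:steps. SUM K:icells n. LINT z|faces n. side K z) <= sqrt h * (4 * sg * (real CARD('d) * V))"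
  using mult_left_mono[OF _ sh] by (fastforce simp: mult_ac)
 note 4 = comb[OF LC energy_parts(2) this]
 have "rate_a * hr + rate_b * sqrt h = (res_sum_const / c1 * hr + hr * V)
   + L * (sqrt h * (2 / c1 * total_energy) + sqrt h * measure lborel Om * (2 * sg * Tend))
   + (real CARD('d) * L + C) * (sqrt h * (4 / c * total_energy) + sqrt h * (4 * sg * (real CARD('d) * V)))"
  by (simp add: rate_a_def rate_b_def V_def algebra_simps)
 thus ?thesis
  using add_mono[OF add_mono[OF add_mono[OF 2 1] 3] 4]
  by (simp only: err_def sum.distrib sum_distrib_left[symmetric] sum_constant)
qed

theorem consistency:
 assumes "h <= 1" "(real CARD('d) + 1) / 2 - al1 / 2 <= th"
 shows "\<bar>\<Sum>n<slabs M. SUM K:cells M n. vol_term n K phi'\<bar> <= l / 2 * (rate_a * hr + rate_b * sqrt h)"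
 using order_trans[OF total_consistency mult_left_mono[OF total_error[OF assms], of "l / 2"]] Lip(1) by simp

end

end

section \<open>Weak form and passage to the limit\<close>

lemma borel_measurable_lebesgue_on_AE:
 fixes g g' :: "'a::euclidean_space => 'b::euclidean_space"
 assumes S: "S : sets borel" and g': "g' : borel_measurable borel" and eq: "AE z in lborel. z : S --> g z = g' z"
 shows "g : borel_measurable (lebesgue_on S)"
proof -
 have m: "(%z. indicator S z *R g' z) : borel_measurable lebesgue"
  using S g' by (intro measurable_completion) simp
 have "AE z in lebesgue. indicator S z *R g z = indicator S z *R g' z"
  using AE_completion[OF eq] by eventually_elim (auto split: split_indicator)
 from completion.borel_measurable_AE_eq[OF m this] show ?thesis
  using S by (subst borel_measurable_restrict_space_iff) auto
qed

text \<open>By completeness of Lebesgue measure, measurability passes from \<open>B\<close> to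
  \<open>A\<close>. This is applied to the barycentres of the Young measure, which are accessible
  through their components.\<close>

lemma integral_lebesgue_on_cong:
 fixes A B :: "'a::euclidean_space => real"
 assumes S: "S : sets borel" and B: "B : borel_measurable (lebesgue_on S)" and eq: "AE y in lebesgue_on S. A y = B y"
 shows "(LINT y|lebesgue_on S. A y) = (LINT y|lebesgue_on S. B y)"
proof -
 have S': "S Int space lebesgue : sets lebesgue" using S by simp
 have m: "(%y. indicator S y *R B y) : borel_measurable lebesgue"
  using B borel_measurable_restrict_space_iff[OF S', of B] by simp
 have "AE y in lebesgue. indicator S y *R A y = indicator S y *R B y"
  using eq S' by (subst (asm) AE_restrict_space_iff) (auto elim!: eventually_mono split: split_indicator)
 from completion.borel_measurable_AE_eq[OF m this] have "A : borel_measurable (lebesgue_on S)"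
  using borel_measurable_restrict_space_iff[OF S', of A] by simp
 from integral_cong_AE[OF this B eq] show ?thesis .
qed

lemma L_infinity_mult:
 assumes S: "S : sets borel" and g: "g : L_infinity S" and psi: "integrable (lebesgue_on S) psi"
 shows "integrable (lebesgue_on S) (%z. g z * psi z)"
proof -
 obtain B where B: "AE z in lebesgue_on S. \<bar>g z\<bar> <= B" and gm: "g : borel_measurable (lebesgue_on S)"
  using g by (auto simp: L_infinity_def)
 show ?thesis
 proof (rule Bochner_Integration.integrable_bound)
  show "integrable (lebesgue_on S) (%z. B * psi z)" using psi by simp
  show "(%z. g z * psi z) : borel_measurable (lebesgue_on S)" using gm psi by simp
  show "AE z in lebesgue_on S. norm (g z * psi z) <= norm (B * psi z)"
   using B by eventually_elim (auto simp: abs_mult intro!: mult_right_mono)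
 qed
qed

lemma integrable_lebesgue_on_continuous:
 fixes g :: "'a::euclidean_space => real"
 assumes "continuous_on UNIV g" "S : sets borel" "bounded S"
 shows "integrable (lebesgue_on S) g"
proof -
 have "integrable lborel (%z. indicator S z *R g z)"
  using set_integrable_continuous[OF assms(1,3,2)] by (simp add: set_integrable_def)
 hence "integrable lebesgue (%z. indicator S z *R g z)"
  by (subst integrable_completion) (auto dest: borel_measurable_integrable)
 thus ?thesis using assms(2) by (subst integrable_restrict_space) auto
qed

context dg_scheme
begin

abbreviation "S == Om \<times> {0<..<Tend}"

lemma S_borel: "S : sets borel" "bounded S"
 using dom by (auto intro!: times_borel bounded_Times)

lemma slab_exists: "0 <= t ==> t < Tend ==> EX n<slabs M. t : {tm M n..<tm M (Suc n)}"
proof -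
 assume t: "0 <= t" "t < Tend"
 define n where "n = (LEAST n. t < tm M n)"
 have N: "t < tm M (slabs M)" using t tm_ends by simp
 have n: "t < tm M n" unfolding n_def by (rule LeastI[of "%n. t < tm M n", OF N])
 have "n <= slabs M" unfolding n_def by (rule Least_le[of "%n. t < tm M n", OF N])
 moreover have "n ~= 0" using n t tm_ends by (metis not_less)
 ultimately obtain m where m: "n = Suc m" "m < slabs M" by (cases n) auto
 have "~ t < tm M m" using not_less_Least[of m "%n. t < tm M n"] m by (simp add: n_def[symmetric])
 thus ?thesis using n m by (intro exI[of _ m]) auto
qed

lemma AE_cells: "AE z in lborel. z : S --> (EX n<slabs M. EX K:cells M n. z : Q n K)"
proof -
 have "AE z in (lborel :: ((real^'d) \<times> real) measure). fst z : Om --> fst z : \<Union>(cells M n)" if n: "n < slabs M" for n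
  unfolding lborel_prod[symmetric]
 proof (rule lborel_pair.AE_pair_measure)
  have [measurable]: "Om : sets borel" "\<Union>(cells M n) : sets borel" using dom cellD[OF n] by (auto intro!: borel_open open_Union)
  show "{z : space (lborel \<Otimes>\<^sub>M lborel). fst z : Om --> fst z : \<Union>(cells M n)} : sets (lborel \<Otimes>\<^sub>M (lborel :: real measure))" by measurable
  show "AE x in lborel. AE t in (lborel :: real measure). fst (x, t) : Om --> fst (x, t) : \<Union>(cells M n)"
   using cell_partition.AE_covered[OF part'[OF n]] by eventually_elim simp
 qed
 hence "AE z in (lborel :: ((real^'d) \<times> real) measure). ALL n:{..<slabs M}. fst z : Om --> fst z : \<Union>(cells M n)"
  by (subst AE_finite_all) auto
 thus ?thesis
 proof eventually_elim
  case (elim z)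
  show ?case
  proof
   assume z: "z : S"
   then obtain n where n: "n < slabs M" "snd z : {tm M n..<tm M (Suc n)}" using slab_exists[of "snd z"] by auto
   then obtain K where "K : cells M n" "fst z : K" using elim z by (auto simp: mem_Times_iff)
   thus "EX n<slabs M. EX K:cells M n. z : Q n K" using n by (auto simp: mem_Times_iff)
  qed
 qed
qed

lemma cell_sum:
 assumes n: "n < slabs M" "K : cells M n" and z: "z : Q n K"
 shows "(\<Sum>m<slabs M. SUM J:cells M m. indicator (Q m J) z *R g m J) = (g n K :: 'b::real_vector)"
proof -
 have "(SUM J:cells M m. indicator (Q m J) z *R g m J) = (if m = n then g n K else 0)" if m: "m < slabs M" for m
 proof -
  have "(SUM J:cells M m. indicator (Q m J) z *R g m J) = (SUM J:cells M m. if m = n & J = K then g n K else 0)"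
   using Q_unique[OF n z m] z by (intro sum.cong refl) (auto simp: indicator_def)
  also have "... = (if m = n then g n K else 0)" using n cells_finite[OF m] by (auto simp: sum.delta)
  finally show ?thesis .
 qed
 hence "(\<Sum>m<slabs M. SUM J:cells M m. indicator (Q m J) z *R g m J) = (\<Sum>m<slabs M. if m = n then g n K else 0)"
  by (intro sum.cong refl) auto
 thus ?thesis using n by simp
qed

lemma v_measurable: "v : borel_measurable (lebesgue_on S)"
proof (rule borel_measurable_lebesgue_on_AE[OF S_borel(1)])
 show "(%z. \<Sum>m<slabs M. SUM J:cells M m. indicator (Q m J) z *R poly m J z) : borel_measurable borel"
  using Q_bounded poly_cont by (intro borel_measurable_sum borel_measurable_scaleR borel_measurable_indicator borel_measurable_continuous_onI) auto
 show "AE z in lborel. z : S --> v z = (\<Sum>m<slabs M. SUM J:cells M m. indicator (Q m J) z *R poly m J z)"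
  using AE_cells
 proof eventually_elim
  case (elim z)
  show ?case
  proof
   assume "z : S"
   then obtain n K where n: "n < slabs M" "K : cells M n" "z : Q n K" using elim by blast
   show "v z = (\<Sum>m<slabs M. SUM J:cells M m. indicator (Q m J) z *R poly m J z)"
    using poly(2)[OF n] cell_sum[OF n, of "%m J. poly m J z"] by simp
  qed
 qed
qed

lemma weak_form_cells:
 assumes phi: "has_C1 (phi :: (real^'d) \<times> real => real^'m) phi'"
 shows "(LINT z|lebesgue_on S. u (v z) <.> dt phi z + (SUM k:UNIV. fl k (v z) <.> dx k phi z)) = (\<Sum>n<slabs M. SUM K:cells M n. vol_term n K phi')"
proof -
 define G where "G n K z = u (poly n K z) <.> phi' z (0, 1) + (SUM k:UNIV. fl k (poly n K z) <.> phi' z (axis k 1, 0))" for n K z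
 have d: "dt phi z = phi' z (0, 1)" "dx k phi z = phi' z (axis k 1, 0)" for z k
  using dt_dx_eq[of UNIV z phi phi phi'] phi by auto
 have Gc: "continuous_on UNIV (G n K)" if "n < slabs M" "K : cells M n" for n K
  unfolding G_def by (rule vol_continuous[OF that phi])
 have int: "integrable lborel (%z. indicator (Q n K) z *R G n K z)" if "n < slabs M" "K : cells M n" for n K
  using set_integrable_continuous[OF Gc[OF that]] Q_bounded[OF that] by (simp add: set_integrable_def)
 define H where "H z = (\<Sum>n<slabs M. SUM K:cells M n. indicator (Q n K) z *R G n K z)" for z
 have Hint: "integrable lborel H" unfolding H_def using int by (intro Bochner_Integration.integrable_sum) auto
 have "(LINT z|lebesgue_on S. u (v z) <.> dt phi z + (SUM k:UNIV. fl k (v z) <.> dx k phi z)) = (LBINT z:S. H z)"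
 proof (rule set_integral_lebesgue_on[OF S_borel(1)])
  show "H : borel_measurable borel" using Hint by (auto dest: borel_measurable_integrable)
  show "AE z in lborel. z : S --> u (v z) <.> dt phi z + (SUM k:UNIV. fl k (v z) <.> dx k phi z) = H z"
   using AE_cells
  proof eventually_elim
   case (elim z)
   show ?case
   proof
    assume "z : S"
    then obtain n K where n: "n < slabs M" "K : cells M n" "z : Q n K" using elim by blast
    show "u (v z) <.> dt phi z + (SUM k:UNIV. fl k (v z) <.> dx k phi z) = H z"
     unfolding H_def cell_sum[OF n, of "%m J. G m J z"] by (simp add: G_def d poly(2)[OF n])
   qed
  qed
 qed
 also have "... = (LINT z|lborel. H z)"
  unfolding set_lebesgue_integral_def
 proof (rule integral_cong_AE)
  show "AE z in lborel. indicator S z *R H z = H z"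
   using AE_snd_neq[of 0]
  proof eventually_elim
   case (elim z)
   show ?case
   proof (cases "z : S")
    case False
    have "z ~: Q n K" if n: "n < slabs M" "K : cells M n" for n K
    proof
     assume "z : Q n K"
     hence "z : S" using elim cellD[OF n] tm_range[of n] tm_range[of "Suc n"] n by (auto simp: mem_Times_iff)
     thus False using False by simp
    qed
    hence "H z = 0" unfolding H_def by (intro sum.neutral ballI) auto
    thus ?thesis by simp
   qed simp
  qed
 qed (use S_borel Hint in \<open>auto dest: borel_measurable_integrable\<close>)
 also have "... = (\<Sum>n<slabs M. SUM K:cells M n. vol_term n K phi')"
  unfolding H_def using int by (simp add: Bochner_Integration.integral_sum vol_term_def G_def set_lebesgue_integral_def)
 finally show ?thesis .
qed

end

text \<open>\<open>dl\<close> is a width by which the compact support can be enlarged inside the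
  domain. Off the support the derivative vanishes, so its bound on the support is a global Lipschitz
  constant.\<close>

lemma test_function_facts:
 fixes phi :: "(real^'d::finite) \<times> real => real^'m"
 assumes phi: "test_function (Om \<times> {0<..<Tend}) phi" and Om: "open Om"
 obtains phi' l dl where "has_C1 phi phi'" "0 <= l" "!!z z'. norm (phi z - phi z') <= l * dist z z'" "0 < dl"
  "!!h z. h < dl ==> snd z <= h ==> phi z = 0" "!!z. Tend <= snd z ==> phi z = 0"
  "!!h x t y. h < dl ==> phi (x, t) ~= 0 ==> dist x y <= h ==> y : Om"
proof -
 define T where "T = closure {z. phi z ~= 0}"
 define phi' where "phi' = (%x. frechet_derivative phi (at x))"
 have T: "compact T" "T <= Om \<times> {0<..<Tend}" and sm: "smooth phi" using phi by (auto simp: test_function_def T_def)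
 have inT: "z : T" if "phi z ~= 0" for z using that closure_subset[of "{z. phi z ~= 0}"] by (auto simp: T_def)
 have C1: "has_C1 phi phi'" unfolding phi'_def by (rule smooth_has_C1[OF sm])
 obtain l where l: "0 <= l" "!!z h. z : T ==> norm (phi' z h) <= l * norm h"
  using has_C1_bound_compact[OF C1 T(1)] by metis
 have "norm (phi' z h) <= l * norm h" for z h
 proof (cases "z : T")
  case False
  have o: "open (- T)" using T(1) compact_imp_closed by auto
  have "(phi has_derivative (%h. 0)) (at z)"
  proof (rule has_derivative_transform_within_open[OF has_derivative_const o])
   show "z : - T" using False by simp
   show "0 = phi y" if "y : - T" for y using inT[of y] that by auto
  qed
  hence "phi' z = (%h. 0)" using has_derivative_unique[OF has_C1D(1)[OF C1]] by blast
  thus ?thesis using l by simp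
 qed (use l in blast)
 hence Lip: "norm (phi z - phi z') <= l * dist z z'" for z z'
  unfolding dist_norm by (intro has_C1_Lipschitz[OF C1 convex_UNIV]) auto
 have "open (Om \<times> {0<..<Tend})" using Om by (intro open_Times) auto
 then obtain dl where dl: "0 < dl" "(UN z:T. ball z dl) <= Om \<times> {0<..<Tend}"
  using compact_subset_open_imp_ball_epsilon_subset[OF T(1) _ T(2)] by metis
 show ?thesis
 proof (rule that[OF C1 l(1) Lip dl(1)])
  show "phi z = 0" if h: "h < dl" "snd z <= h" for h z
  proof (rule ccontr)
   assume nz: "phi z ~= 0"
   obtain x t where z: "z = (x, t)" by fastforce
   have "0 < t" using inT[OF nz] T(2) z by auto
   hence "(x, 0) : ball z dl" using h z by (simp add: dist_Pair_Pair dist_real_def)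
   thus False using dl(2) inT[OF nz] by fastforce
  qed
  show "phi z = 0" if "Tend <= snd z" for z using inT[of z] T(2) that by force
  show "y : Om" if "h < dl" "phi (x, t) ~= 0" "dist x y <= h" for h x t y
  proof -
   have "(y, t) : ball (x, t) dl" using that by (simp add: dist_Pair_Pair)
   thus ?thesis using dl(2) inT[OF that(2)] by fastforce
  qed
 qed
qed

no_notation inner (infix "<.>" 70)
no_notation scaleR (infixr "*R" 75)
no_notation tendsto (infixr "--->" 55)
no_notation LIMSEQ (infix "---->" 60)
no_notation iff (infixr "<->" 25)

theorem theorem5p2:
  fixes f :: "'d::finite \<Rightarrow> real^'m \<Rightarrow> real^'m"
    and U :: "real^'m \<Rightarrow> real"
    and F :: "'d \<Rightarrow> real^'m \<Rightarrow> real"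
    and D :: "real^'m \<Rightarrow> real^'m \<Rightarrow> real^'d \<Rightarrow> real^'m^'m"
    and u0 :: "real^'d \<Rightarrow> real^'m"
    and \<Omega> :: "(real^'d) set"
    and Tend c C \<sigma> C1 C2 \<alpha>1 \<alpha>2 \<theta> :: real
    and q :: nat
    and M :: "nat \<Rightarrow> 'd st_mesh"
    and P :: "nat \<Rightarrow> (real^'d \<Rightarrow> real^'m) \<Rightarrow> real^'d \<Rightarrow> real^'m"
    and v :: "nat \<Rightarrow> (real^'d) \<times> real \<Rightarrow> real^'m"
  assumes dim: "CARD('d) \<in> {1, 2, 3}"
    and domain: "open \<Omega>" "connected \<Omega>" "bounded \<Omega>" "\<Omega> \<noteq> {}" "0 < Tend"
    and fluxes: "\<And>k. smooth (f k)"
    and entropy: "entropy_pair f U F"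
    and initial: "\<exists>Z. compact Z \<and> Z \<subseteq> \<Omega> \<and> (\<forall>x. x \<notin> Z \<longrightarrow> u0 x = 0)"
      "(\<lambda>x. entropy_var U (u0 x)) \<in> L2_on \<Omega>"
    and mesh: "\<And>j. st_mesh \<Omega> Tend (M j)" "0 < \<sigma>" "\<And>j. shape_regular \<sigma> (M j)"
    and h_to_0: "(\<lambda>j. mesh_size (M j)) \<longlonglongrightarrow> 0"
    and flux: "admissible_flux f U D"
    and params: "0 < C1" "0 < C2" "0 < \<alpha>1" "\<alpha>1 < 2" "0 < \<alpha>2"
      "max ((real CARD('d) + 1) / 2 - \<alpha>1 / 2) ((real CARD('d) + 1) / 2 - \<alpha>2) \<le> \<theta>"
    and q: "1 \<le> q"
    and proj: "\<And>j. initial_projection \<Omega> q (M j) (P j)"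
    and scheme: "\<And>j. sc_dg_solution f U D C1 C2 \<alpha>1 \<alpha>2 \<theta> q (M j)
                       (P j (\<lambda>x. entropy_var U (u0 x))) (v j)"
    and support: "\<And>j. compactly_supported_in \<Omega> Tend U (v j)"
    and constants: "0 < c" "0 < C"
    and D_bounds: "\<And>j n K t. \<lbrakk>n < slabs (M j); K \<in> cells (M j) n; t \<in> slab (M j) n\<rbrakk> \<Longrightarrow>
      AE x in surface_measure. x \<in> frontier K \<longrightarrow>
        (\<forall>w. w \<noteq> 0 \<longrightarrow> 0 < c * (w \<bullet> w) \<and> c * (w \<bullet> w) \<le> w \<bullet> (D_at D K (v j) (x, t) *v w) \<and>
           w \<bullet> (D_at D K (v j) (x, t) *v w) \<le> C * (w \<bullet> w))"
    and uv_bounds: "\<And>j. AE z in lebesgue_on (\<Omega> \<times> {0..Tend}).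
        \<forall>w. w \<noteq> 0 \<longrightarrow> 0 < c * (w \<bullet> w) \<and> c * (w \<bullet> w) \<le> w \<bullet> (u_v U (v j z) *v w) \<and>
           w \<bullet> (u_v U (v j z) *v w) \<le> C * (w \<bullet> w)"
    and v_bounds: "\<And>j. AE z in lebesgue_on (\<Omega> \<times> {0..Tend}). norm (v j z) \<le> C"
  shows "\<exists>r \<mu>. strict_mono r \<and>
           generates_young_measure (\<Omega> \<times> {0<..<Tend}) (\<lambda>j. v (r j)) \<mu> \<and>
           measure_valued_solution f U (\<Omega> \<times> {0<..<Tend}) \<mu>"
proof -
 interpret entropy_system f U F using fluxes entropy by unfold_locales
 \<comment> \<open>The ball has to contain the exterior value \<open>vstar\<close> as well as the
   values of all solutions.\<close>
 define R where "R = max C (norm vstar)"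
 obtain c1 L EB where EBd: "entropy_bounds f U F R c1 L EB"
  using entropy_bounds_exist[of R] by (auto simp: R_def)
 have "EX Z. compact Z & Z <= \<Omega> & (ALL x t. x ~: Z --> t : {0..Tend} --> v j (x, t) = vstar)" for j
  using support[of j] unfolding compactly_supported_in_def by (metis u_inv(1))
 then obtain Z where Z: "!!j. compact (Z j)" "!!j. Z j <= \<Omega>" "!!j x t. x ~: Z j ==> t : {0..Tend} ==> v j (x, t) = vstar"
  by metis
 have dg: "dg_scheme \<Omega> Tend \<sigma> (M j) f U F R c1 L EB D c C C1 C2 \<alpha>1 \<alpha>2 \<theta> q (P j (%x. entropy_var U (u0 x))) (v j) (Z j)" for j
 proof (intro dg_scheme.intro mesh_space.intro EBd dg_scheme_axioms.intro)
  show "AE z in lebesgue_on (\<Omega> \<times> {0..Tend}). norm (v j z) <= R"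
   using v_bounds[of j] by eventually_elim (simp add: R_def)
  show "AE x in surface_measure. x : frontier K -->
    (ALL w. c * (w \<bullet> w) <= w \<bullet> (D_at D K (v j) (x, t) *v w) & w \<bullet> (D_at D K (v j) (x, t) *v w) <= C * (w \<bullet> w))"
   if "n < slabs (M j)" "K : cells (M j) n" "t : {tm (M j) n..<tm (M j) (Suc n)}" for n K t
  proof -
   have "AE x in surface_measure. x : frontier K -->
    (ALL w. w ~= 0 --> 0 < c * (w \<bullet> w) & c * (w \<bullet> w) <= w \<bullet> (D_at D K (v j) (x, t) *v w) &
      w \<bullet> (D_at D K (v j) (x, t) *v w) <= C * (w \<bullet> w))"
    by (rule D_bounds[OF that(1,2)]) (use that(3) in \<open>simp add: slab_def\<close>)
   thus ?thesis
    by (rule eventually_mono) (metis inner_zero_left mult_zero_right order_refl)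
  qed
 qed (use dim domain mesh flux params constants scheme Z in auto)
 define S where "S = \<Omega> \<times> {0<..<Tend}"
 have S: "S : sets borel" "bounded S"
  unfolding S_def using dg_scheme.S_borel[OF dg[of 0]] by auto
 have Sf: "emeasure lborel S < \<infinity>" by (rule emeasure_bounded_finite[OF S(2)])
 have vm: "v j : borel_measurable (lebesgue_on S)" for j
  unfolding S_def by (rule dg_scheme.v_measurable[OF dg])
 have vb: "AE z in lebesgue_on S. norm (v j z) <= C" for j
 proof -
  have "\<Omega> \<times> {0..Tend} : sets borel" using domain by (intro times_borel) auto
  hence "AE z in lebesgue. z : \<Omega> \<times> {0..Tend} --> norm (v j z) <= C"
   using v_bounds[of j] by (subst (asm) AE_restrict_space_iff) auto
  hence "AE z in lebesgue. z : S --> norm (v j z) <= C" by eventually_elim (auto simp: S_def)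
  thus ?thesis using S(1) by (subst AE_restrict_space_iff) auto
 qed
 obtain r :: "nat => nat" and \<mu> where r: "strict_mono r" and \<mu>: "generates_young_measure S (%j. v (r j)) \<mu>"
  by (rule young_measure_exists[OF S(1) Sf vm vb])
 have ym: "young_measure S \<mu>" using \<mu> by (simp add: generates_young_measure_def)
 have "measure_valued_solution f U S \<mu>"
  unfolding measure_valued_solution_def
 proof (intro conjI ym allI impI)
  fix \<phi> :: "(real^'d) \<times> real => real^'m" assume test: "test_function S \<phi>"
  obtain \<phi>' l \<delta> where \<phi>: "has_C1 \<phi> \<phi>'" "0 <= l" "!!z z'. norm (\<phi> z - \<phi> z') <= l * dist z z'" "0 < \<delta>"
   "!!h z. h < \<delta> ==> snd z <= h ==> \<phi> z = 0" "!!z. Tend <= snd z ==> \<phi> z = 0"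
   "!!h x t y. h < \<delta> ==> \<phi> (x, t) ~= 0 ==> dist x y <= h ==> y : \<Omega>"
   by (rule test_function_facts[OF test[unfolded S_def] domain(1)]) (assumption | blast)+
  define hh where "hh j = mesh_size (M (r j))" for j
  have hh0: "hh \<longlonglongrightarrow> 0" unfolding hh_def using LIMSEQ_subseq_LIMSEQ[OF h_to_0 r] by (simp add: o_def)
  have hpos: "0 < hh j" for j
   unfolding hh_def by (rule mesh_space.h_pos) (rule dg_scheme.axioms(1)[OF dg])
  define W where "W j = (LINT z|lebesgue_on S. u (v (r j) z) \<bullet> dt \<phi> z + (SUM k:UNIV. fl k (v (r j) z) \<bullet> dx k \<phi> z))" for j
  \<comment> \<open>The coefficients of the two rates involve the data and the constants of the
    ball, but not \<open>j\<close>, so the bound below tends to 0 with the mesh size.\<close>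
  define ra where "ra = dg_scheme.rate_a \<Omega> Tend \<sigma> c1 L EB C1"
  define rb where "rb = dg_scheme.rate_b \<Omega> Tend \<sigma> c1 L EB c C"
  have "W \<longlonglongrightarrow> 0"
  proof (rule Lim_null_comparison)
   have "eventually (%j. hh j < min 1 \<delta>) sequentially"
    using order_tendstoD(2)[OF hh0, of "min 1 \<delta>"] \<phi>(4) by simp
   thus "eventually (%j. norm (W j) <= l / 2 * (ra * hh j powr (1 - \<alpha>1 / 2) + rb * sqrt (hh j))) sequentially"
   proof eventually_elim
    case (elim j)
    have "W j = (\<Sum>n<slabs (M (r j)). SUM K:cells (M (r j)) n. dg_scheme.vol_term (M (r j)) f U q (v (r j)) n K \<phi>')"
     unfolding W_def S_def by (rule dg_scheme.weak_form_cells[OF dg \<phi>(1)])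
    moreover have "\<bar>...\<bar> <= l / 2 * (ra * hh j powr (1 - \<alpha>1 / 2) + rb * sqrt (hh j))"
     unfolding ra_def rb_def hh_def
    proof (rule dg_scheme.consistency[OF dg \<phi>(1-3)])
     show "\<phi> z = 0" if "snd z <= mesh_size (M (r j))" for z using \<phi>(5)[of "hh j" z] elim that by (simp add: hh_def)
     show "\<phi> z = 0" if "Tend <= snd z" for z by (rule \<phi>(6)[OF that])
     show "y : \<Omega>" if "\<phi> (x, t) ~= 0" "dist x y <= mesh_size (M (r j))" for x t y
      using \<phi>(7)[of "hh j" x t y] elim that by (simp add: hh_def)
    qed (use elim params in \<open>auto simp: hh_def\<close>)
    ultimately show ?case by simp
   qed
   \<comment> \<open>The exponent is positive because of \<open>\<alpha>1 < 2\<close>.\<close>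
   have "(%j. hh j powr (1 - \<alpha>1 / 2)) \<longlonglongrightarrow> 0"
    using tendsto_powr'[OF hh0 tendsto_const, of "1 - \<alpha>1 / 2"] hpos params by (simp add: less_imp_le)
   moreover have "(%j. sqrt (hh j)) \<longlonglongrightarrow> 0" using tendsto_real_sqrt[OF hh0] by simp
   ultimately have "(%j. l / 2 * (ra * hh j powr (1 - \<alpha>1 / 2) + rb * sqrt (hh j))) \<longlonglongrightarrow> l / 2 * (ra * 0 + rb * 0)"
    by (intro tendsto_intros)
   thus "(%j. l / 2 * (ra * hh j powr (1 - \<alpha>1 / 2) + rb * sqrt (hh j))) \<longlonglongrightarrow> 0" by simp
  qed
  define gg where "gg o' = (case o' of None => u | Some k => fl k)" for o'
  define pp where "pp o' = (case o' of None => dt \<phi> | Some k => dx k \<phi>)" for o'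
  \<comment> \<open>Generation of a Young measure concerns scalar functions of the state, so the
    weak form is written out in components; \<open>None\<close> stands for the time derivative with
    the state, \<open>Some k\<close> for the derivative in direction \<open>k\<close> with the
    flux.\<close>
  have split: "a None \<bullet> dt \<phi> y + (SUM k:UNIV. a (Some k) \<bullet> dx k \<phi> y) = (SUM o':UNIV. SUM i:UNIV. a o' $ i * pp o' y $ i)" for a y
   by (simp add: UNIV_option_conv sum.reindex pp_def inner_vec_def)
  have gc: "continuous_on UNIV (%s. gg o' s $ i)" for o' i
   unfolding gg_def by (cases o') (auto intro!: continuous_intros u_cont has_C1D(4)[OF has_C1_flux])
  have gn: "continuous_on UNIV (%s. norm (gg o' s))" for o'
   unfolding gg_def by (cases o') (auto intro!: continuous_intros u_cont has_C1D(4)[OF has_C1_flux])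
  have pi: "integrable (lebesgue_on S) (%y. pp o' y $ i)" for o' i
  proof -
   have d: "dt \<phi> z = \<phi>' z (0, 1)" "dx k \<phi> z = \<phi>' z (axis k 1, 0)" for z k
    using dt_dx_eq[of UNIV z \<phi> \<phi> \<phi>'] \<phi>(1) by auto
   have "continuous_on UNIV (%y. pp o' y $ i)"
    unfolding pp_def using has_C1D(2)[OF \<phi>(1)] by (cases o') (auto simp: d intro!: continuous_intros)
   thus ?thesis by (rule integrable_lebesgue_on_continuous[OF _ S])
  qed
  have ws: "weak_star_lim S (%j z. g (v (r j) z)) (%y. LINT s|\<mu> y. g s)" "AE y in lebesgue_on S. integrable (\<mu> y) g"
   if "continuous_on UNIV g" for g :: "real^'m => real"
   using \<mu> that by (auto simp: generates_young_measure_def)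
  note wsl = ws(1)[OF gc, unfolded weak_star_lim_def]
  have i1: "integrable (lebesgue_on S) (%y. gg o' (v (r j) y) $ i * pp o' y $ i)" for j o' i
   using wsl pi by (intro L_infinity_mult[OF S(1)]) auto
  have i2: "integrable (lebesgue_on S) (%y. (LINT s|\<mu> y. gg o' s $ i) * pp o' y $ i)" for o' i
   using wsl pi by (intro L_infinity_mult[OF S(1)]) auto
  have "W j = (SUM o':UNIV. SUM i:UNIV. LINT y|lebesgue_on S. gg o' (v (r j) y) $ i * pp o' y $ i)" for j
  proof -
   have "W j = (LINT y|lebesgue_on S. (SUM o':UNIV. SUM i:UNIV. gg o' (v (r j) y) $ i * pp o' y $ i))"
    unfolding W_def split[of "%o'. gg o' (v (r j) _)", symmetric] by (simp add: gg_def)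
   thus ?thesis using i1 by (simp add: Bochner_Integration.integral_sum)
  qed
  moreover have "(%j. SUM o':UNIV. SUM i:UNIV. LINT y|lebesgue_on S. gg o' (v (r j) y) $ i * pp o' y $ i)
   \<longlonglongrightarrow> (SUM o':UNIV. SUM i:UNIV. LINT y|lebesgue_on S. (LINT s|\<mu> y. gg o' s $ i) * pp o' y $ i)"
   using wsl pi by (intro tendsto_sum) auto
  ultimately have zero: "(SUM o':UNIV. SUM i:UNIV. LINT y|lebesgue_on S. (LINT s|\<mu> y. gg o' s $ i) * pp o' y $ i) = 0"
   using `W \<longlonglongrightarrow> 0` LIMSEQ_unique by (metis (no_types, lifting) ext)
  have prob: "sets (\<mu> y) = sets borel" if "y : space (lebesgue_on S)" for y
   using measurable_space[OF ym[unfolded young_measure_def] that] by (simp add: space_prob_algebra)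
  \<comment> \<open>The limit arises componentwise, whereas the definition of a solution integrates
    vectors against the measure. Integrability of the norms, obtained by testing with them as
    continuous functions, allows components to be taken inside the integral.\<close>
  have ae: "AE y in lebesgue_on S. ALL o':UNIV. integrable (\<mu> y) (%s. norm (gg o' s))"
   using ws(2)[OF gn] by (subst AE_finite_all) auto
  have comp: "AE y in lebesgue_on S. (SUM o':UNIV. SUM i:UNIV. (LINT s|\<mu> y. gg o' s) $ i * pp o' y $ i)
    = (SUM o':UNIV. SUM i:UNIV. (LINT s|\<mu> y. gg o' s $ i) * pp o' y $ i)"
   using ae AE_space
  proof eventually_elim
   case (elim y)
   have "(LINT s|\<mu> y. gg o' s) $ i = (LINT s|\<mu> y. gg o' s $ i)" for o' i
   proof -
    have "gg o' : borel_measurable borel"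
     unfolding gg_def by (cases o') (auto intro!: borel_measurable_continuous_onI u_cont has_C1D(4)[OF has_C1_flux])
    hence "gg o' : borel_measurable (\<mu> y)"
     using measurable_cong_sets[OF prob[OF elim(2)] refl] by blast
    hence "integrable (\<mu> y) (gg o')" using elim(1) by (subst integrable_norm_iff[symmetric]) auto
    hence "(LINT s|\<mu> y. gg o' s \<bullet> axis i 1) = (LINT s|\<mu> y. gg o' s) \<bullet> axis i 1"
     by (intro integral_inner_left)
    thus ?thesis by (simp add: inner_axis)
   qed
   thus ?case by simp
  qed
  have "(LINT y|lebesgue_on S. (LINT s|\<mu> y. u s) \<bullet> dt \<phi> y + (SUM k:UNIV. (LINT s|\<mu> y. fl k s) \<bullet> dx k \<phi> y))
   = (LINT y|lebesgue_on S. (SUM o':UNIV. SUM i:UNIV. (LINT s|\<mu> y. gg o' s) $ i * pp o' y $ i))"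
   unfolding split[of "%o'. LINT s|\<mu> _. gg o' s", symmetric] by (simp add: gg_def)
  also have "... = (LINT y|lebesgue_on S. (SUM o':UNIV. SUM i:UNIV. (LINT s|\<mu> y. gg o' s $ i) * pp o' y $ i))"
   using i2 by (intro integral_lebesgue_on_cong[OF S(1) _ comp] borel_measurable_integrable Bochner_Integration.integrable_sum) auto
  also have "... = 0" using i2 zero by (simp add: Bochner_Integration.integral_sum)
  finally show "(LINT y|lebesgue_on S. (LINT s|\<mu> y. u s) \<bullet> dt \<phi> y + (SUM k:UNIV. (LINT s|\<mu> y. fl k s) \<bullet> dx k \<phi> y)) = 0" .
 qed
 thus ?thesis using r \<mu> by (auto simp: S_def)
qed

end
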